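(* For all integers $m\geq d>1$ there is a relation in $K_0(\mathrm{Var}_{\mathbb C})$ \[ [\mathrm{Hilb}^d(\mathbb A^m)_0]=\sum_{\gamma=1}^{d-1}(-1)^{d+\gamma+1}[\mathrm{Hilb}^d(\mathbb A^\gamma)_0]\,[\mathrm{Gr}(m-d,m-\gamma-1)]\,[\mathrm{Gr}(\gamma,m)]\,\mathbb L^{\binom{d-\gamma}{2}} . \]
   Context: $K_0(\mathrm{Var}_{\mathbb C})$ is the Grothendieck ring of complex varieties, $\mathbb L=[\mathbb A^1]$; the class of a scheme is that of its reduction. $\mathrm{Hilb}^d(\mathbb A^n)_0$ is the punctual Hilbert scheme, parametrising length $d$ closed subschemes of $\mathbb A^n_{\mathbb C}$ entirely supported at the origin. $\mathrm{Gr}(k,n)$ is the Grassmannian of $k$-planes in $\mathbb C^n$. *)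

theory Defs
  imports "HOL-Analysis.Analysis" "HOL-Library.Poly_Mapping"
begin

section \<open>Complex varieties as spaces with functions\<close>

text \<open>A reduced separated scheme of finite type over the complex numbers is determined by its set
  of closed points with the Zariski topology and the sheaf of complex valued regular functions on
  it (Serre). We use this description. A regular function on an open set \<open>W\<close> is represented by any
  total function with the right values on \<open>W\<close>.\<close>

record 'a fspace =
  zar :: "'a topology"
  reg :: "'a set \<Rightarrow> ('a \<Rightarrow> complex) set"

abbreviation pts :: "('a, 'b) fspace_scheme \<Rightarrow> 'a set" where
  "pts X \<equiv> topspace (zar X)"

definition sheaf_of_functions :: "'a fspace \<Rightarrow> bool" where
  "sheaf_of_functions X \<longleftrightarrow> (\<forall>W. openin (zar X) W \<longrightarrow>
     (\<forall>c. (\<lambda>_. c) \<in> reg X W) \<and>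
     (\<forall>f\<in>reg X W. \<forall>g\<in>reg X W. (\<lambda>x. f x + g x) \<in> reg X W \<and> (\<lambda>x. f x * g x) \<in> reg X W) \<and>
     (\<forall>f\<in>reg X W. \<forall>U. openin (zar X) U \<and> U \<subseteq> W \<longrightarrow> f \<in> reg X U) \<and>
     (\<forall>f. (\<forall>x\<in>W. \<exists>U g. openin (zar X) U \<and> x \<in> U \<and> U \<subseteq> W \<and> g \<in> reg X U \<and> (\<forall>y\<in>U. f y = g y))
        \<longrightarrow> f \<in> reg X W))"

definition morphism :: "'a fspace \<Rightarrow> 'b fspace \<Rightarrow> ('a \<Rightarrow> 'b) \<Rightarrow> bool" where
  "morphism X Y \<phi> \<longleftrightarrow> continuous_map (zar X) (zar Y) \<phi> \<and>
     (\<forall>V h. openin (zar Y) V \<and> h \<in> reg Y V \<longrightarrow> h \<circ> \<phi> \<in> reg X (pts X \<inter> \<phi> -` V))"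

definition isomorphic :: "'a fspace \<Rightarrow> 'b fspace \<Rightarrow> bool" (infix "\<cong>\<^sub>V" 50) where
  "X \<cong>\<^sub>V Y \<longleftrightarrow> (\<exists>\<phi> \<psi>. morphism X Y \<phi> \<and> morphism Y X \<psi> \<and>
     (\<forall>x\<in>pts X. \<psi> (\<phi> x) = x) \<and> (\<forall>y\<in>pts Y. \<phi> (\<psi> y) = y))"

text \<open>For locally closed \<open>S\<close> this is the reduced induced structure.\<close>

definition induced :: "'a fspace \<Rightarrow> 'a set \<Rightarrow> 'a fspace" where
  "induced X S = \<lparr> zar = subtopology (zar X) S,
     reg = (\<lambda>W. {f. \<forall>x\<in>W. \<exists>U g. openin (zar X) U \<and> x \<in> U \<and> g \<in> reg X U \<and>
                       (\<forall>y\<in>U \<inter> W. f y = g y)}) \<rparr>"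

inductive_set subalgebra :: "('a \<Rightarrow> complex) set \<Rightarrow> ('a \<Rightarrow> complex) set"
  for C :: "('a \<Rightarrow> complex) set" where
  gen: "f \<in> C \<Longrightarrow> f \<in> subalgebra C"
| const: "(\<lambda>_. c) \<in> subalgebra C"
| add: "f \<in> subalgebra C \<Longrightarrow> g \<in> subalgebra C \<Longrightarrow> (\<lambda>x. f x + g x) \<in> subalgebra C"
| mult: "f \<in> subalgebra C \<Longrightarrow> g \<in> subalgebra C \<Longrightarrow> (\<lambda>x. f x * g x) \<in> subalgebra C"

text \<open>The space given by charts \<open>(U, C)\<close>, where \<open>C\<close> is a set of coordinate functions on the
  domain \<open>U\<close>. The open sets are generated by the principal ones, where a polynomial in
  coordinates of a chart is nonzero, and the regular functions are locally quotients of two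
  polynomials in the coordinates of a chart.\<close>

definition chart_space :: "('a set \<times> ('a \<Rightarrow> complex) set) set \<Rightarrow> 'a fspace" where
  "chart_space \<A> = \<lparr>
     zar = topology_generated_by {{x\<in>U. q x \<noteq> 0} |U C q. (U, C) \<in> \<A> \<and> q \<in> subalgebra C},
     reg = (\<lambda>W. {f. \<forall>x\<in>W. \<exists>(U, C)\<in>\<A>. \<exists>p\<in>subalgebra C. \<exists>q\<in>subalgebra C.
                       x \<in> U \<and> q x \<noteq> 0 \<and> (\<forall>y\<in>W \<inter> U. q y \<noteq> 0 \<longrightarrow> f y = p y / q y)}) \<rparr>"

definition affine_space :: "nat \<Rightarrow> (nat \<Rightarrow> complex) fspace" where
  "affine_space n = chart_space {({x. \<forall>i\<ge>n. x i = 0}, {\<lambda>x. x i |i. i < n})}"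

definition affine_variety :: "'a fspace \<Rightarrow> bool" where
  "affine_variety X \<longleftrightarrow>
     (\<exists>n S. closedin (zar (affine_space n)) S \<and> X \<cong>\<^sub>V induced (affine_space n) S)"

text \<open>The product: on \<open>U \<times> V\<close> the functions \<open>\<Sum>i. f\<^sub>i(x) g\<^sub>i(y)\<close> with \<open>f\<^sub>i\<close>, \<open>g\<^sub>i\<close> regular play the
  role of the polynomials.\<close>

definition product_space :: "'a fspace \<Rightarrow> 'b fspace \<Rightarrow> ('a \<times> 'b) fspace" (infixr "\<times>\<^sub>V" 80) where
  "X \<times>\<^sub>V Y = chart_space
     {(U \<times> V, {f \<circ> fst |f. f \<in> reg X U} \<union> {g \<circ> snd |g. g \<in> reg Y V}) |U V.
        openin (zar X) U \<and> openin (zar Y) V}"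

text \<open>Varieties need not be irreducible, connected or nonempty.\<close>

definition variety :: "'a fspace \<Rightarrow> bool" where
  "variety X \<longleftrightarrow> sheaf_of_functions X \<and>
     (\<exists>\<U>. finite \<U> \<and> \<Union>\<U> = pts X \<and>
        (\<forall>U\<in>\<U>. openin (zar X) U \<and> affine_variety (induced X U))) \<and>
     closedin (zar (X \<times>\<^sub>V X)) {(x, x) |x. x \<in> pts X}"


section \<open>The Grothendieck ring\<close>

text \<open>Every variety is isomorphic to one whose points lie in \<open>nat \<Rightarrow> complex\<close>: record the
  number of a chart of a finite affine cover and the coordinates in that chart. So this type
  contains all isomorphism classes.\<close>

typedef cvar = "{X :: (nat \<Rightarrow> complex) fspace. variety X}"
proof
  let ?X = "\<lparr> zar = discrete_topology {}, reg = (\<lambda>_. UNIV) \<rparr> :: (nat \<Rightarrow> complex) fspace"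
  have "sheaf_of_functions ?X"
    by (auto simp: sheaf_of_functions_def)
  moreover have "finite {}" "\<Union>{} = pts ?X"
    by auto
  moreover have "closedin (zar (?X \<times>\<^sub>V ?X)) {(x, x) |x. x \<in> pts ?X}"
    by simp
  ultimately show "?X \<in> {X. variety X}"
    unfolding variety_def by blast
qed

text \<open>\<open>K\<^sub>0(Var)\<close> is the commutative ring generated by the varieties, subject to the relations
  below. The free commutative ring on \<open>cvar\<close> is the ring of integer polynomials with variables in
  \<open>cvar\<close>. Since products of generators are generators modulo the relations, the underlying group
  is the free abelian group on isomorphism classes modulo the scissor relations.\<close>

type_synonym free_ring = "(cvar \<Rightarrow>\<^sub>0 nat) \<Rightarrow>\<^sub>0 int"

definition gen :: "cvar \<Rightarrow> free_ring" where
  "gen X = Poly_Mapping.single (Poly_Mapping.single X 1) 1"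

inductive_set relations :: "free_ring set" where
  iso: "Rep_cvar X \<cong>\<^sub>V Rep_cvar Y \<Longrightarrow> gen X - gen Y \<in> relations"
| scissor: "closedin (zar (Rep_cvar X)) S \<Longrightarrow>
    Rep_cvar Z \<cong>\<^sub>V induced (Rep_cvar X) S \<Longrightarrow>
    Rep_cvar U \<cong>\<^sub>V induced (Rep_cvar X) (pts (Rep_cvar X) - S) \<Longrightarrow>
    gen X - (gen Z + gen U) \<in> relations"
| product: "Rep_cvar P \<cong>\<^sub>V Rep_cvar X \<times>\<^sub>V Rep_cvar Y \<Longrightarrow> gen P - gen X * gen Y \<in> relations"
| point: "Rep_cvar P \<cong>\<^sub>V affine_space 0 \<Longrightarrow> gen P - 1 \<in> relations"

inductive_set relation_ideal :: "free_ring set" where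
  zero: "0 \<in> relation_ideal"
| rel: "p \<in> relations \<Longrightarrow> p \<in> relation_ideal"
| add: "p \<in> relation_ideal \<Longrightarrow> q \<in> relation_ideal \<Longrightarrow> p + q \<in> relation_ideal"
| mult: "q \<in> relation_ideal \<Longrightarrow> p * q \<in> relation_ideal"

lemma relation_ideal_uminus: "p \<in> relation_ideal \<Longrightarrow> - p \<in> relation_ideal"
  using relation_ideal.mult[of p "- 1"] by simp

quotient_type K0 = free_ring / "\<lambda>p q. p - q \<in> relation_ideal"
proof (rule equivpI)
  show "reflp (\<lambda>p q. p - q \<in> relation_ideal)"
    by (auto intro!: reflpI relation_ideal.zero)
  show "symp (\<lambda>p q. p - q \<in> relation_ideal)"
    by (rule sympI) (use relation_ideal_uminus in fastforce)
  show "transp (\<lambda>p q. p - q \<in> relation_ideal)"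
    by (rule transpI) (use relation_ideal.add in fastforce)
qed

text \<open>The class \<open>comm_ring_1\<close> is not used, because it includes \<open>0 \<noteq> 1\<close>.\<close>

instantiation K0 :: "{comm_ring, comm_monoid_mult}"
begin

lift_definition zero_K0 :: K0 is 0 .

lift_definition one_K0 :: K0 is 1 .

lift_definition plus_K0 :: "K0 \<Rightarrow> K0 \<Rightarrow> K0" is "(+)"
proof -
  fix p q r s :: free_ring
  assume "p - q \<in> relation_ideal" "r - s \<in> relation_ideal"
  then have "(p - q) + (r - s) \<in> relation_ideal"
    by (rule relation_ideal.add)
  then show "p + r - (q + s) \<in> relation_ideal"
    by (simp add: algebra_simps)
qed

lift_definition uminus_K0 :: "K0 \<Rightarrow> K0" is uminus
proof -
  fix p q :: free_ring
  assume "p - q \<in> relation_ideal"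
  from relation_ideal_uminus[OF this] show "- p - - q \<in> relation_ideal"
    by simp
qed

lift_definition minus_K0 :: "K0 \<Rightarrow> K0 \<Rightarrow> K0" is "(-)"
proof -
  fix p q r s :: free_ring
  assume "p - q \<in> relation_ideal" "r - s \<in> relation_ideal"
  then have "(p - q) + - (r - s) \<in> relation_ideal"
    by (intro relation_ideal.add relation_ideal_uminus)
  then show "p - r - (q - s) \<in> relation_ideal"
    by (simp add: algebra_simps)
qed

lift_definition times_K0 :: "K0 \<Rightarrow> K0 \<Rightarrow> K0" is "(*)"
proof -
  fix p q r s :: free_ring
  assume "p - q \<in> relation_ideal" "r - s \<in> relation_ideal"
  then have "r * (p - q) + q * (r - s) \<in> relation_ideal"
    by (intro relation_ideal.add relation_ideal.mult)
  then show "p * r - q * s \<in> relation_ideal"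
    by (simp add: algebra_simps)
qed

instance
  by standard (transfer; simp add: algebra_simps relation_ideal.zero)+

end

lift_definition gen_class :: "cvar \<Rightarrow> K0" is gen .

text \<open>The class of a variety with points in an arbitrary type.\<close>

definition cls :: "'a fspace \<Rightarrow> K0" where
  "cls X = gen_class (SOME Y. Rep_cvar Y \<cong>\<^sub>V X)"

abbreviation lefschetz :: K0  (\<open>\<bbbL>\<close>) where
  "\<bbbL> \<equiv> cls (affine_space 1)"


section \<open>Moduli of linear subspaces of finite codimension\<close>

text \<open>The vector space with basis \<open>E\<close> consists of the finitely supported functions on \<open>E\<close>.\<close>

definition scale :: "complex \<Rightarrow> ('i \<Rightarrow>\<^sub>0 complex) \<Rightarrow> ('i \<Rightarrow>\<^sub>0 complex)" where
  "scale c v = Poly_Mapping.map ((*) c) v"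

lemma lookup_scale [simp]: "Poly_Mapping.lookup (scale c v) i = c * Poly_Mapping.lookup v i"
  by (simp add: scale_def Poly_Mapping.map.rep_eq when_def)

interpretation free: vector_space "scale :: complex \<Rightarrow> ('i \<Rightarrow>\<^sub>0 complex) \<Rightarrow> ('i \<Rightarrow>\<^sub>0 complex)"
  by standard (auto intro!: poly_mapping_eqI simp: lookup_add algebra_simps)

definition free_space :: "'i set \<Rightarrow> ('i \<Rightarrow>\<^sub>0 complex) set" where
  "free_space E = {v. Poly_Mapping.keys v \<subseteq> E}"

text \<open>The standard charts of the Grassmannian of subspaces \<open>V\<close> of \<open>free_space E\<close> of finite
  codimension, restricted to a set \<open>\<V>\<close> of subspaces. For \<open>J \<subseteq> E\<close> the chart domain consists of
  the \<open>V\<close> such that the basis vectors \<open>e\<^sub>j\<close>, \<open>j \<in> J\<close>, form a basis of \<open>free_space E / V\<close>, and the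
  coordinates are the coefficients of the residue classes of the \<open>e\<^sub>i\<close>, \<open>i \<in> E\<close>, in this basis.\<close>

definition quotient_basis :: "'i set \<Rightarrow> 'i set \<Rightarrow> ('i \<Rightarrow>\<^sub>0 complex) set \<Rightarrow> bool" where
  "quotient_basis E J V \<longleftrightarrow> (\<forall>v\<in>free_space E. \<exists>!u. u \<in> free_space J \<and> v - u \<in> V)"

definition residue_coord :: "'i set \<Rightarrow> 'i \<Rightarrow> 'i \<Rightarrow> ('i \<Rightarrow>\<^sub>0 complex) set \<Rightarrow> complex" where
  "residue_coord J i j V =
     Poly_Mapping.lookup (THE u. u \<in> free_space J \<and> Poly_Mapping.single i 1 - u \<in> V) j"

definition subspace_moduli ::
  "'i set \<Rightarrow> ('i \<Rightarrow>\<^sub>0 complex) set set \<Rightarrow> ('i \<Rightarrow>\<^sub>0 complex) set fspace" where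
  "subspace_moduli E \<V> = chart_space
     {({V\<in>\<V>. quotient_basis E J V}, {residue_coord J i j |i j. i \<in> E \<and> j \<in> J}) |J. J \<subseteq> E}"

definition grassmannian :: "nat \<Rightarrow> nat \<Rightarrow> (nat \<Rightarrow>\<^sub>0 complex) set fspace" where
  "grassmannian k n = subspace_moduli {..<n}
     {V. V \<subseteq> free_space {..<n} \<and> free.subspace V \<and> free.dim V = k}"


section \<open>Punctual Hilbert schemes\<close>

text \<open>Polynomials are finitely supported functions on exponent vectors, and the variables are
  numbered by the natural numbers.\<close>

type_synonym mpoly = "(nat \<Rightarrow>\<^sub>0 nat) \<Rightarrow>\<^sub>0 complex"

definition monomials :: "nat \<Rightarrow> (nat \<Rightarrow>\<^sub>0 nat) set" where
  "monomials n = {a. Poly_Mapping.keys a \<subseteq> {..<n}}"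

definition poly_ring :: "nat \<Rightarrow> mpoly set" where
  "poly_ring n = free_space (monomials n)"

definition eval_mpoly :: "(nat \<Rightarrow> complex) \<Rightarrow> mpoly \<Rightarrow> complex" where
  "eval_mpoly x p = (\<Sum>a\<in>Poly_Mapping.keys p. Poly_Mapping.lookup p a *
     (\<Prod>i\<in>Poly_Mapping.keys a. x i ^ Poly_Mapping.lookup a i))"

definition poly_ideal :: "nat \<Rightarrow> mpoly set \<Rightarrow> bool" where
  "poly_ideal n I \<longleftrightarrow> I \<subseteq> poly_ring n \<and> 0 \<in> I \<and> (\<forall>p\<in>I. \<forall>q\<in>I. p + q \<in> I) \<and>
     (\<forall>p\<in>poly_ring n. \<forall>q\<in>I. p * q \<in> I)"

text \<open>The quotient by \<open>I\<close> has dimension \<open>d\<close>: \<open>I\<close> has a linear complement with a basis \<open>B\<close> of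
  \<open>d\<close> elements.\<close>

definition colength :: "nat \<Rightarrow> mpoly set \<Rightarrow> nat \<Rightarrow> bool" where
  "colength n I d \<longleftrightarrow> (\<exists>B. B \<subseteq> poly_ring n \<and> finite B \<and> card B = d \<and> free.independent B \<and>
     free.span B \<inter> I = {0} \<and> (\<forall>p\<in>poly_ring n. \<exists>u\<in>free.span B. p - u \<in> I))"

definition zero_locus :: "nat \<Rightarrow> mpoly set \<Rightarrow> (nat \<Rightarrow> complex) set" where
  "zero_locus n I = {x \<in> pts (affine_space n). \<forall>p\<in>I. eval_mpoly x p = 0}"

text \<open>The reduction of \<open>Hilb\<^sup>d(\<bbbA>\<^sup>n)\<close>. A closed subscheme of length \<open>d\<close> is its ideal. The charts are
  the usual ones: the ideals for which a given set of \<open>d\<close> monomials is a basis of the quotient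
  ring, with the coefficients of the residue classes of all monomials as coordinates.\<close>

definition hilb :: "nat \<Rightarrow> nat \<Rightarrow> mpoly set fspace" where
  "hilb d n = subspace_moduli (monomials n) {I. poly_ideal n I \<and> colength n I d}"

definition punctual_hilb :: "nat \<Rightarrow> nat \<Rightarrow> mpoly set fspace" where
  "punctual_hilb d n = induced (hilb d n) {I. zero_locus n I \<subseteq> {\<lambda>_. 0}}"

end

theory Submission
  imports Defs "HOL-Computational_Algebra.Fundamental_Theorem_Algebra"
begin

text \<open>Let \<open>I\<close> be a punctual ideal of colength \<open>d\<close> in \<open>n\<close> variables with cotangent space of
  dimension \<open>g\<close>. Choose greedily a set \<open>A\<close> of \<open>g\<close> variables that is a basis of the cotangent space,
  and let \<open>J\<close> be the first set of \<open>d - 1 - g\<close> monomials in these variables that is a basis of the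
  square of the maximal ideal of the quotient ring. If the other variables are congruent to \<open>h\<close> modulo \<open>I\<close>,
  where \<open>h\<close> is a combination of \<open>A\<close> and \<open>J\<close>, then \<open>I\<close> is determined by \<open>h\<close> and by its contraction to
  the ring in the variables \<open>A\<close>, and both are arbitrary apart from the shape of \<open>h\<close> imposed by the greedy
  choice. So the strata are trivial affine bundles of rank \<open>inv A + (n - g) (d - 1 - g)\<close>, where
  \<open>inv A\<close> is the dimension of the Schubert cell of \<open>A\<close>, and
  \<open>[Hilb\<^sup>d(n)] = \<Sum>g. [n choose g] \<bbbL>\<^bsup>(n - g)(d - 1 - g)\<^esup> P\<^sub>g\<close> with Gaussian binomials at \<open>q = \<bbbL>\<close>
  and classes \<open>P\<^sub>g\<close> independent of \<open>n\<close>. The relation follows from this by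
  Lagrange interpolation at powers of \<open>\<bbbL>\<close>, in a form that avoids divisions in the Grothendieck ring,
  because the Gaussian binomials are the classes of Grassmannians by the Schubert cell decomposition.\<close>

section \<open>Morphisms\<close>

text \<open>The exponents count free coefficients. A variable outside \<open>A\<close> is congruent
  to a combination of \<open>J\<close> and of the variables of \<open>A\<close> that precede it.
  \<open>J\<close> has \<open>d - 1 - g\<close> elements because the basis of the quotient ring also
  contains 1 and the \<open>g\<close> variables, and the pairs with an earlier variable of
  \<open>A\<close> are the inversions, whose generating function over all \<open>A\<close> of size
  \<open>g\<close> is the Gaussian binomial. In K_0 a space may be cut only along closed subsets.
  Each stratum is therefore placed in an affine chart of its own, and the strata are ordered so that
  such a chart meets, besides its own stratum, only earlier ones; then charts can be split off one
  by one. For fixed \<open>g\<close>, apart from the binomial, the dependence on \<open>n\<close> is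
  the monomial \<open>x ^ (d - 1 - g)\<close> at \<open>x = \<bbbL> ^ (n - g)\<close>. The values
  \<open>n = g, \<dots>, d - 1\<close> are exactly as many as determine a polynomial of that degree,
  and they all occur as \<open>\<gamma>\<close> in the relation. The identities of Gaussian
  binomials are derived from Pascal rules alone, in an arbitrary commutative ring.\<close>

lemma morphism_maps: "morphism X Y \<phi> \<Longrightarrow> x \<in> pts X \<Longrightarrow> \<phi> x \<in> pts Y"
  unfolding morphism_def continuous_map_def by auto

lemma morphism_openin:
  "morphism X Y \<phi> \<Longrightarrow> openin (zar Y) V \<Longrightarrow> openin (zar X) (pts X \<inter> \<phi> -` V)"
  unfolding morphism_def continuous_map_def by (simp add: Int_def vimage_def)

lemma morphism_reg:
  "morphism X Y \<phi> \<Longrightarrow> openin (zar Y) V \<Longrightarrow> h \<in> reg Y V \<Longrightarrow> h \<circ> \<phi> \<in> reg X (pts X \<inter> \<phi> -` V)"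
  unfolding morphism_def by auto

lemma morphismI:
  assumes "\<And>x. x \<in> pts X \<Longrightarrow> \<phi> x \<in> pts Y"
    and "\<And>V. openin (zar Y) V \<Longrightarrow> openin (zar X) (pts X \<inter> \<phi> -` V)"
    and "\<And>V h. openin (zar Y) V \<Longrightarrow> h \<in> reg Y V \<Longrightarrow> h \<circ> \<phi> \<in> reg X (pts X \<inter> \<phi> -` V)"
  shows "morphism X Y \<phi>"
  unfolding morphism_def continuous_map_def
  using assms by (auto simp: Int_def vimage_def)

lemma morphism_comp:
  assumes "morphism X Y \<phi>" "morphism Y Z \<psi>"
  shows "morphism X Z (\<psi> \<circ> \<phi>)"
proof (rule morphismI)
  have eq: "pts X \<inter> (\<psi> \<circ> \<phi>) -` V = pts X \<inter> \<phi> -` (pts Y \<inter> \<psi> -` V)" for V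
    using morphism_maps[OF assms(1)] by auto
  show "(\<psi> \<circ> \<phi>) x \<in> pts Z" if "x \<in> pts X" for x
    using that morphism_maps[OF assms(1)] morphism_maps[OF assms(2)] by simp
  show "openin (zar X) (pts X \<inter> (\<psi> \<circ> \<phi>) -` V)" if "openin (zar Z) V" for V
    unfolding eq by (intro morphism_openin[OF assms(1)] morphism_openin[OF assms(2)] that)
  show "h \<circ> (\<psi> \<circ> \<phi>) \<in> reg X (pts X \<inter> (\<psi> \<circ> \<phi>) -` V)" if "openin (zar Z) V" "h \<in> reg Z V" for V h
    unfolding eq using morphism_reg[OF assms(1) morphism_openin[OF assms(2) that(1)]
        morphism_reg[OF assms(2) that]] by (simp add: comp_assoc)
qed

lemma isomorphicI:
  assumes "morphism X Y \<phi>" "morphism Y X \<psi>"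
    and "\<And>x. x \<in> pts X \<Longrightarrow> \<psi> (\<phi> x) = x" "\<And>y. y \<in> pts Y \<Longrightarrow> \<phi> (\<psi> y) = y"
  shows "X \<cong>\<^sub>V Y"
  using assms unfolding isomorphic_def by blast

lemma isomorphic_sym: "X \<cong>\<^sub>V Y \<Longrightarrow> Y \<cong>\<^sub>V X"
  unfolding isomorphic_def by blast

lemma isomorphic_trans [trans]:
  assumes "X \<cong>\<^sub>V Y" "Y \<cong>\<^sub>V Z" shows "X \<cong>\<^sub>V Z"
proof -
  obtain \<phi> \<psi> where 1: "morphism X Y \<phi>" "morphism Y X \<psi>"
    "\<And>x. x \<in> pts X \<Longrightarrow> \<psi> (\<phi> x) = x" "\<And>x. x \<in> pts Y \<Longrightarrow> \<phi> (\<psi> x) = x"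
    using assms(1) unfolding isomorphic_def by blast
  obtain \<phi>' \<psi>' where 2: "morphism Y Z \<phi>'" "morphism Z Y \<psi>'"
    "\<And>x. x \<in> pts Y \<Longrightarrow> \<psi>' (\<phi>' x) = x" "\<And>x. x \<in> pts Z \<Longrightarrow> \<phi>' (\<psi>' x) = x"
    using assms(2) unfolding isomorphic_def by blast
  show ?thesis
    by (rule isomorphicI[OF morphism_comp[OF 1(1) 2(1)] morphism_comp[OF 2(2) 1(2)]])
       (use 1 2 morphism_maps in fastforce)+
qed

lemma pts_induced: "pts (induced X S) = pts X \<inter> S"
  by (simp add: induced_def)

lemma morphism_induced:
  assumes "morphism X Y \<phi>" "\<And>x. x \<in> pts X \<Longrightarrow> x \<in> S \<Longrightarrow> \<phi> x \<in> T"
  shows "morphism (induced X S) (induced Y T) \<phi>"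
proof (rule morphismI)
  show "\<phi> x \<in> pts (induced Y T)" if "x \<in> pts (induced X S)" for x
    using that assms morphism_maps[OF assms(1)] by (auto simp: pts_induced)
  show "openin (zar (induced X S)) (pts (induced X S) \<inter> \<phi> -` V)"
    if V: "openin (zar (induced Y T)) V" for V
  proof -
    obtain V' where V': "openin (zar Y) V'" "V = V' \<inter> T"
      using V by (auto simp: induced_def openin_subtopology)
    have "pts (induced X S) \<inter> \<phi> -` V = (pts X \<inter> \<phi> -` V') \<inter> S"
      using assms(2) V' by (auto simp: pts_induced)
    then show ?thesis
      using morphism_openin[OF assms(1) V'(1)] by (auto simp: induced_def openin_subtopology)
  qed
  show "h \<circ> \<phi> \<in> reg (induced X S) (pts (induced X S) \<inter> \<phi> -` V)"
    if V: "openin (zar (induced Y T)) V" and h: "h \<in> reg (induced Y T) V" for V h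
  proof -
    have "\<exists>U g. openin (zar X) U \<and> x \<in> U \<and> g \<in> reg X U \<and>
       (\<forall>y\<in>U \<inter> (pts (induced X S) \<inter> \<phi> -` V). (h \<circ> \<phi>) y = g y)"
      if x: "x \<in> pts (induced X S) \<inter> \<phi> -` V" for x
    proof -
      have "\<phi> x \<in> V" using x by auto
      then obtain U g where U: "openin (zar Y) U" "\<phi> x \<in> U" "g \<in> reg Y U" "\<forall>y\<in>U \<inter> V. h y = g y"
        using h by (auto simp: induced_def)
      show ?thesis
        by (rule exI[of _ "pts X \<inter> \<phi> -` U"], rule exI[of _ "g \<circ> \<phi>"])
           (use U x morphism_openin[OF assms(1) U(1)] morphism_reg[OF assms(1) U(1,3)] in
             \<open>auto simp: pts_induced\<close>)
    qed
    then show ?thesis by (auto simp: induced_def)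
  qed
qed

lemma isomorphic_induced:
  assumes "morphism X Y \<phi>" "morphism Y X \<psi>"
    and "\<And>x. x \<in> pts X \<Longrightarrow> \<psi> (\<phi> x) = x" "\<And>y. y \<in> pts Y \<Longrightarrow> \<phi> (\<psi> y) = y"
  shows "induced X (pts X \<inter> \<phi> -` S) \<cong>\<^sub>V induced Y S"
  by (rule isomorphicI[OF morphism_induced[OF assms(1)] morphism_induced[OF assms(2)]])
     (use assms morphism_maps[OF assms(2)] in \<open>auto simp: pts_induced\<close>)


section \<open>Principal neighbourhoods and local fractions\<close>

lemma subalgebra_uminus: "f \<in> subalgebra C \<Longrightarrow> (\<lambda>x. - f x) \<in> subalgebra C"
  using subalgebra.mult[OF subalgebra.const[of "-1"], of f C] by simp

lemma subalgebra_diff: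
  "f \<in> subalgebra C \<Longrightarrow> g \<in> subalgebra C \<Longrightarrow> (\<lambda>x. f x - g x) \<in> subalgebra C"
  using subalgebra.add[OF _ subalgebra_uminus, of f C g] by simp

lemma subalgebra_sum:
  "(\<And>i. i \<in> I \<Longrightarrow> f i \<in> subalgebra C) \<Longrightarrow> (\<lambda>x. \<Sum>i\<in>I. f i x) \<in> subalgebra C"
  by (induction I rule: infinite_finite_induct) (auto intro: subalgebra.intros)

lemmas subalgebra_intros = subalgebra.const subalgebra.add subalgebra.mult subalgebra_uminus
  subalgebra_diff subalgebra_sum

lemma subalgebra_pullback:
  assumes "f \<in> subalgebra D" "\<And>g. g \<in> D \<Longrightarrow> \<exists>p\<in>subalgebra C. \<forall>y\<in>S. g (\<phi> y) = p y"
  shows "\<exists>p\<in>subalgebra C. \<forall>y\<in>S. f (\<phi> y) = p y"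
  using assms(1)
proof induction
  case (gen f) then show ?case using assms(2) by blast
next
  case (const c) show ?case by (rule bexI[of _ "\<lambda>_. c"]) (auto intro: subalgebra.const)
next
  case (add f g)
  then obtain p q where "p \<in> subalgebra C" "q \<in> subalgebra C"
    "\<forall>y\<in>S. f (\<phi> y) = p y" "\<forall>y\<in>S. g (\<phi> y) = q y" by blast
  then show ?case by (intro bexI[of _ "\<lambda>x. p x + q x"]) (auto intro: subalgebra.intros)
next
  case (mult f g)
  then obtain p q where "p \<in> subalgebra C" "q \<in> subalgebra C"
    "\<forall>y\<in>S. f (\<phi> y) = p y" "\<forall>y\<in>S. g (\<phi> y) = q y" by blast
  then show ?case by (intro bexI[of _ "\<lambda>x. p x * q x"]) (auto intro: subalgebra.intros)
qed

lemma subalgebra_closed: "C \<subseteq> subalgebra D \<Longrightarrow> f \<in> subalgebra C \<Longrightarrow> f \<in> subalgebra D"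
  by (erule subalgebra.induct) (auto intro: subalgebra.intros)

lemma subalgebra_comp:
  "f \<in> subalgebra D \<Longrightarrow> (\<And>g. g \<in> D \<Longrightarrow> (\<lambda>y. g (\<phi> y)) \<in> subalgebra C) \<Longrightarrow> (\<lambda>y. f (\<phi> y)) \<in> subalgebra C"
  by (induction rule: subalgebra.induct) (auto intro: subalgebra.intros)

text \<open>Germs in one chart: products in the subalgebra intersect principal open sets, so
  \<open>near\<close> behaves like "in a neighbourhood". For compatible atlases the topology and the
  regular functions of \<open>chart_space\<close> are expressed entirely by \<open>near\<close> and
  \<open>frac_at\<close>.\<close>

definition near :: "'a set \<Rightarrow> ('a \<Rightarrow> complex) set \<Rightarrow> 'a \<Rightarrow> ('a \<Rightarrow> bool) \<Rightarrow> bool" where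
  "near U C x P \<longleftrightarrow> (\<exists>s\<in>subalgebra C. s x \<noteq> 0 \<and> (\<forall>y\<in>U. s y \<noteq> 0 \<longrightarrow> P y))"

definition frac_at :: "'a set \<Rightarrow> ('a \<Rightarrow> complex) set \<Rightarrow> 'a \<Rightarrow> ('a \<Rightarrow> complex) \<Rightarrow> bool" where
  "frac_at U C x f \<longleftrightarrow>
     (\<exists>p\<in>subalgebra C. \<exists>s\<in>subalgebra C. s x \<noteq> 0 \<and> (\<forall>y\<in>U. s y \<noteq> 0 \<longrightarrow> f y = p y / s y))"

lemma near_mono: "near U C x P \<Longrightarrow> (\<And>y. y \<in> U \<Longrightarrow> P y \<Longrightarrow> Q y) \<Longrightarrow> near U C x Q"
  unfolding near_def by blast

lemma near_conj: 
  assumes "near U C x P" "near U C x Q" shows "near U C x (\<lambda>y. P y \<and> Q y)"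
proof -
  from assms obtain s t where "s \<in> subalgebra C" "s x \<noteq> 0" "\<forall>y\<in>U. s y \<noteq> 0 \<longrightarrow> P y"
    "t \<in> subalgebra C" "t x \<noteq> 0" "\<forall>y\<in>U. t y \<noteq> 0 \<longrightarrow> Q y" unfolding near_def by blast
  then show ?thesis unfolding near_def
    by (intro bexI[of _ "\<lambda>y. s y * t y"]) (auto intro: subalgebra.intros)
qed

lemma near_always: "(\<And>y. y \<in> U \<Longrightarrow> P y) \<Longrightarrow> near U C x P"
  unfolding near_def by (intro bexI[of _ "\<lambda>_. 1"]) (auto intro: subalgebra.intros)

lemma near_nonzero: "s \<in> subalgebra C \<Longrightarrow> s x \<noteq> 0 \<Longrightarrow> near U C x (\<lambda>y. s y \<noteq> 0)"
  unfolding near_def by blast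

text \<open>In \<open>frac_at\<close> the denominator also cuts out the neighbourhood. A smaller
  neighbourhood \<open>t \<noteq> 0\<close> is absorbed by multiplying numerator and denominator by
  \<open>t\<close>.\<close>

lemma frac_at_iff_near:
  "frac_at U C x f \<longleftrightarrow>
     (\<exists>p\<in>subalgebra C. \<exists>s\<in>subalgebra C. s x \<noteq> 0 \<and> near U C x (\<lambda>y. s y \<noteq> 0 \<and> f y = p y / s y))"
proof
  assume "frac_at U C x f"
  then show "\<exists>p\<in>subalgebra C. \<exists>s\<in>subalgebra C. s x \<noteq> 0 \<and> near U C x (\<lambda>y. s y \<noteq> 0 \<and> f y = p y / s y)"
    unfolding frac_at_def near_def by blast
next
  assume "\<exists>p\<in>subalgebra C. \<exists>s\<in>subalgebra C. s x \<noteq> 0 \<and> near U C x (\<lambda>y. s y \<noteq> 0 \<and> f y = p y / s y)"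
  then obtain p s t where *: "p \<in> subalgebra C" "s \<in> subalgebra C" "t \<in> subalgebra C"
    "s x \<noteq> 0" "t x \<noteq> 0" "\<forall>y\<in>U. t y \<noteq> 0 \<longrightarrow> s y \<noteq> 0 \<and> f y = p y / s y"
    unfolding near_def by blast
  show "frac_at U C x f" unfolding frac_at_def
    by (rule bexI[of _ "\<lambda>y. p y * t y"], rule bexI[of _ "\<lambda>y. s y * t y"])
       (use * in \<open>auto intro: subalgebra.intros\<close>)
qed

lemma frac_at_cong:
  assumes "frac_at U C x f" "near U C x (\<lambda>y. f y = g y)"
  shows "frac_at U C x g"
proof -
  obtain p s where ps: "p \<in> subalgebra C" "s \<in> subalgebra C" "s x \<noteq> 0"
     "near U C x (\<lambda>y. s y \<noteq> 0 \<and> f y = p y / s y)"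
    using assms(1) unfolding frac_at_iff_near by blast
  have "near U C x (\<lambda>y. s y \<noteq> 0 \<and> g y = p y / s y)"
    using near_conj[OF ps(4) assms(2)] by (rule near_mono) auto
  then show ?thesis unfolding frac_at_iff_near using ps by blast
qed

lemma frac_at_subalgebra: "f \<in> subalgebra C \<Longrightarrow> frac_at U C x f"
  unfolding frac_at_def
  by (rule bexI[of _ f], rule bexI[of _ "\<lambda>_. 1"]) (auto intro: subalgebra.intros)

lemma frac_at_add:
  assumes "frac_at U C x f" "frac_at U C x g" shows "frac_at U C x (\<lambda>y. f y + g y)"
proof -
  obtain p s where 1: "p \<in> subalgebra C" "s \<in> subalgebra C" "s x \<noteq> 0" "\<forall>y\<in>U. s y \<noteq> 0 \<longrightarrow> f y = p y / s y"
    using assms(1) unfolding frac_at_def by blast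
  obtain q t where 2: "q \<in> subalgebra C" "t \<in> subalgebra C" "t x \<noteq> 0" "\<forall>y\<in>U. t y \<noteq> 0 \<longrightarrow> g y = q y / t y"
    using assms(2) unfolding frac_at_def by blast
  show ?thesis unfolding frac_at_def
    by (rule bexI[of _ "\<lambda>y. p y * t y + q y * s y"], rule bexI[of _ "\<lambda>y. s y * t y"])
       (use 1 2 in \<open>auto intro!: subalgebra.add subalgebra.mult simp: field_simps\<close>)
qed

lemma frac_at_mult:
  assumes "frac_at U C x f" "frac_at U C x g" shows "frac_at U C x (\<lambda>y. f y * g y)"
proof -
  obtain p s where 1: "p \<in> subalgebra C" "s \<in> subalgebra C" "s x \<noteq> 0" "\<forall>y\<in>U. s y \<noteq> 0 \<longrightarrow> f y = p y / s y"
    using assms(1) unfolding frac_at_def by blast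
  obtain q t where 2: "q \<in> subalgebra C" "t \<in> subalgebra C" "t x \<noteq> 0" "\<forall>y\<in>U. t y \<noteq> 0 \<longrightarrow> g y = q y / t y"
    using assms(2) unfolding frac_at_def by blast
  show ?thesis unfolding frac_at_def
    by (rule bexI[of _ "\<lambda>y. p y * q y"], rule bexI[of _ "\<lambda>y. s y * t y"])
       (use 1 2 in \<open>auto intro!: subalgebra.add subalgebra.mult simp: field_simps\<close>)
qed

text \<open>If \<open>f = p / s\<close>, then \<open>1 / f = (s * s) / (s * p)\<close>. The
  denominator \<open>s * p\<close> keeps the inverse inside the set where \<open>f\<close> is given
  by its fraction.\<close>

lemma frac_at_inverse:
  assumes "frac_at U C x f" "f x \<noteq> 0" "x \<in> U"
  shows "frac_at U C x (\<lambda>y. 1 / f y)" "near U C x (\<lambda>y. f y \<noteq> 0)"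
proof -
  obtain p s where 1: "p \<in> subalgebra C" "s \<in> subalgebra C" "s x \<noteq> 0" "\<forall>y\<in>U. s y \<noteq> 0 \<longrightarrow> f y = p y / s y"
    using assms(1) unfolding frac_at_def by blast
  have px: "p x \<noteq> 0" using 1 assms by auto
  show "frac_at U C x (\<lambda>y. 1 / f y)" unfolding frac_at_def
    by (rule bexI[of _ "\<lambda>y. s y * s y"], rule bexI[of _ "\<lambda>y. s y * p y"])
       (use 1 px in \<open>auto intro!: subalgebra.mult\<close>)
  show "near U C x (\<lambda>y. f y \<noteq> 0)" unfolding near_def
    by (rule bexI[of _ "\<lambda>y. s y * p y"]) (use 1 px in \<open>auto intro!: subalgebra.mult\<close>)
qed

lemma frac_at_divide:
  assumes "frac_at U C x f" "frac_at U C x g" "g x \<noteq> 0" "x \<in> U"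
  shows "frac_at U C x (\<lambda>y. f y / g y)"
  using frac_at_mult[OF assms(1) frac_at_inverse(1)[OF assms(2-4)]] by simp

lemma frac_at_pullback:
  assumes "f \<in> subalgebra D" "\<And>g. g \<in> D \<Longrightarrow> frac_at U C x (\<lambda>y. g (\<phi> y))"
  shows "frac_at U C x (\<lambda>y. f (\<phi> y))"
  using assms(1)
  by induction (auto intro: assms(2) frac_at_add frac_at_mult frac_at_subalgebra subalgebra.const)

text \<open>The pullback of the function that cuts out the neighbourhood is a fraction nonzero at
  \<open>x\<close>, hence nonzero on a principal neighbourhood of \<open>x\<close>.\<close>

lemma near_pullback:
  assumes "near V D (\<phi> x) P" "near U C x (\<lambda>y. \<phi> y \<in> V)"
    and "\<And>g. g \<in> D \<Longrightarrow> frac_at U C x (\<lambda>y. g (\<phi> y))" "x \<in> U"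
  shows "near U C x (\<lambda>y. P (\<phi> y))"
proof -
  obtain s where s: "s \<in> subalgebra D" "s (\<phi> x) \<noteq> 0" "\<forall>y\<in>V. s y \<noteq> 0 \<longrightarrow> P y"
    using assms(1) unfolding near_def by blast
  have "near U C x (\<lambda>y. s (\<phi> y) \<noteq> 0)"
    using frac_at_inverse(2)[OF frac_at_pullback[OF s(1) assms(3)]] s(2) assms(4) by simp
  from near_conj[OF this assms(2)] show ?thesis
    by (rule near_mono) (use s in auto)
qed

lemma frac_at_pullback_frac:
  assumes "frac_at V D (\<phi> x) f" "near U C x (\<lambda>y. \<phi> y \<in> V)"
    and "\<And>g. g \<in> D \<Longrightarrow> frac_at U C x (\<lambda>y. g (\<phi> y))" "x \<in> U"
  shows "frac_at U C x (\<lambda>y. f (\<phi> y))"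
proof -
  obtain p s where ps: "p \<in> subalgebra D" "s \<in> subalgebra D" "s (\<phi> x) \<noteq> 0"
     "near V D (\<phi> x) (\<lambda>y. s y \<noteq> 0 \<and> f y = p y / s y)"
    using assms(1) unfolding frac_at_iff_near by blast
  have 1: "frac_at U C x (\<lambda>y. p (\<phi> y) / s (\<phi> y))"
    using frac_at_divide[OF frac_at_pullback[OF ps(1) assms(3)] frac_at_pullback[OF ps(2) assms(3)]] ps(3) assms(4)
    by simp
  show ?thesis
    by (rule frac_at_cong[OF 1]) (rule near_mono[OF near_pullback[OF ps(4) assms(2-4)]], auto)
qed


section \<open>Compatible atlases\<close>

text \<open>This makes local questions independent of the chart: openness and regularity in
  \<open>chart_space\<close>, which are defined through some chart, can then be tested in every
  chart through the point (\<open>openin_near\<close>, \<open>reg_frac_at\<close>).\<close>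

definition compatible :: "('a set \<times> ('a \<Rightarrow> complex) set) set \<Rightarrow> bool" where
  "compatible \<A> \<longleftrightarrow> (\<forall>(U, C)\<in>\<A>. \<forall>(V, D)\<in>\<A>. \<forall>x\<in>U \<inter> V.
     near U C x (\<lambda>y. y \<in> V) \<and> (\<forall>f\<in>D. frac_at U C x f))"

lemma compatibleD:
  assumes "compatible \<A>" "(U, C) \<in> \<A>" "(V, D) \<in> \<A>" "x \<in> U" "x \<in> V"
  shows "near U C x (\<lambda>y. y \<in> V)" "f \<in> D \<Longrightarrow> frac_at U C x f"
  using assms unfolding compatible_def by blast+

lemma compatible_single: "compatible {(U, C)}"
  unfolding compatible_def
  by (auto intro: near_always frac_at_subalgebra subalgebra.gen)

lemma openin_principal:
  "(U, C) \<in> \<A> \<Longrightarrow> s \<in> subalgebra C \<Longrightarrow> openin (zar (chart_space \<A>)) {x\<in>U. s x \<noteq> 0}"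
  unfolding chart_space_def by (auto intro!: topology_generated_by_Basis)

lemma openin_chart: "(U, C) \<in> \<A> \<Longrightarrow> openin (zar (chart_space \<A>)) U"
  using openin_principal[of U C \<A> "\<lambda>_. 1"] by (auto intro: subalgebra.const)

lemma pts_chart_space: "pts (chart_space \<A>) = \<Union>(fst ` \<A>)"
proof
  show "pts (chart_space \<A>) \<subseteq> \<Union>(fst ` \<A>)"
    unfolding chart_space_def by force
  show "\<Union>(fst ` \<A>) \<subseteq> pts (chart_space \<A>)"
  proof
    fix x assume "x \<in> \<Union>(fst ` \<A>)"
    then obtain U C where "(U, C) \<in> \<A>" "x \<in> U" by auto
    then show "x \<in> pts (chart_space \<A>)" using openin_subset[OF openin_chart] by blast
  qed
qed

text \<open>Induction over the generation of the topology. A principal set of another chart is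
  pulled back along the identity, whose coordinates are fractions by compatibility.\<close>

lemma openin_near:
  assumes "compatible \<A>" "openin (zar (chart_space \<A>)) W" "x \<in> W" "(U, C) \<in> \<A>" "x \<in> U"
  shows "near U C x (\<lambda>y. y \<in> W)"
proof -
  have "generate_topology_on {{x\<in>U. q x \<noteq> 0} |U C q. (U, C) \<in> \<A> \<and> q \<in> subalgebra C} W"
    using assms(2) by (simp add: chart_space_def openin_topology_generated_by_iff)
  then show ?thesis using assms(3)
  proof induction
    case Empty then show ?case by simp
  next
    case (Int a b) then show ?case using near_conj[of U C x "\<lambda>y. y \<in> a" "\<lambda>y. y \<in> b"] by simp
  next
    case (UN K)
    then obtain k where k: "k \<in> K" "x \<in> k" by blast
    with UN.IH have "near U C x (\<lambda>y. y \<in> k)" by blast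
    then show ?case by (rule near_mono) (use k in blast)
  next
    case (Basis W)
    then obtain V D q where W: "W = {x\<in>V. q x \<noteq> 0}" "(V, D) \<in> \<A>" "q \<in> subalgebra D" by blast
    have "near V D x (\<lambda>y. y \<in> W)" using W Basis unfolding near_def by blast
    then show ?case
      using near_pullback[where \<phi>="\<lambda>x. x" and V=V and D=D and P="\<lambda>y. y \<in> W"]
        compatibleD[OF assms(1,4) W(2) assms(5)] W(1) Basis assms(5) by auto
  qed
qed

lemma openin_near_iff:
  assumes "compatible \<A>"
  shows "openin (zar (chart_space \<A>)) W \<longleftrightarrow>
    (\<forall>x\<in>W. \<exists>(U, C)\<in>\<A>. x \<in> U \<and> near U C x (\<lambda>y. y \<in> W))"
proof
  assume W: "openin (zar (chart_space \<A>)) W"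
  show "\<forall>x\<in>W. \<exists>(U, C)\<in>\<A>. x \<in> U \<and> near U C x (\<lambda>y. y \<in> W)"
  proof
    fix x assume x: "x \<in> W"
    then have "x \<in> pts (chart_space \<A>)" using W openin_subset by blast
    then obtain U C where "(U, C) \<in> \<A>" "x \<in> U" unfolding pts_chart_space by force
    with openin_near[OF assms W x] show "\<exists>(U, C)\<in>\<A>. x \<in> U \<and> near U C x (\<lambda>y. y \<in> W)" by auto
  qed
next
  assume r: "\<forall>x\<in>W. \<exists>(U, C)\<in>\<A>. x \<in> U \<and> near U C x (\<lambda>y. y \<in> W)"
  show "openin (zar (chart_space \<A>)) W"
  proof (subst openin_subopen, intro ballI)
    fix x assume "x \<in> W"
    with r obtain U C s where "(U, C) \<in> \<A>" "x \<in> U" "s \<in> subalgebra C" "s x \<noteq> 0" "\<forall>y\<in>U. s y \<noteq> 0 \<longrightarrow> y \<in> W"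
      unfolding near_def by fastforce
    then show "\<exists>T. openin (zar (chart_space \<A>)) T \<and> x \<in> T \<and> T \<subseteq> W"
      by (intro exI[of _ "{x\<in>U. s x \<noteq> 0}"]) (auto intro: openin_principal)
  qed
qed

lemma frac_at_change:
  assumes "compatible \<A>" "(U, C) \<in> \<A>" "(V, D) \<in> \<A>" "x \<in> U" "x \<in> V" "frac_at V D x f"
  shows "frac_at U C x f"
  using frac_at_pullback_frac[where \<phi>="\<lambda>x. x", OF assms(6)] compatibleD[OF assms(1-5)] assms(4) by blast

lemma reg_frac_at:
  assumes "compatible \<A>" "openin (zar (chart_space \<A>)) W" "f \<in> reg (chart_space \<A>) W"
    "x \<in> W" "(U, C) \<in> \<A>" "x \<in> U"
  shows "frac_at U C x f"
proof -
  obtain V D p q where *: "(V, D) \<in> \<A>" "p \<in> subalgebra D" "q \<in> subalgebra D" "x \<in> V" "q x \<noteq> 0"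
    "\<forall>y\<in>W \<inter> V. q y \<noteq> 0 \<longrightarrow> f y = p y / q y"
    using assms(3,4) unfolding chart_space_def by fastforce
  \<comment> \<open>The quotient describes \<open>f\<close> only on \<open>W \<inter> V\<close>, so
    the neighbourhood is shrunk into the open set \<open>W\<close> before the denominator is
    fixed.\<close>
  have "near V D x (\<lambda>y. q y \<noteq> 0 \<and> y \<in> W)"
    by (rule near_conj[OF near_nonzero[OF *(3,5)] openin_near[OF assms(1,2,4) *(1,4)]])
  then have "near V D x (\<lambda>y. q y \<noteq> 0 \<and> f y = p y / q y)"
    by (rule near_mono) (use * in auto)
  then have "frac_at V D x f" unfolding frac_at_iff_near using * by blast
  then show ?thesis by (rule frac_at_change[OF assms(1,5) *(1) assms(6) *(4)])
qed

lemma regI: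
  assumes "\<And>x. x \<in> W \<Longrightarrow> \<exists>(U, C)\<in>\<A>. x \<in> U \<and> frac_at U C x f"
  shows "f \<in> reg (chart_space \<A>) W"
proof -
  have "\<exists>(U, C)\<in>\<A>. \<exists>p\<in>subalgebra C. \<exists>q\<in>subalgebra C.
      x \<in> U \<and> q x \<noteq> 0 \<and> (\<forall>y\<in>W \<inter> U. q y \<noteq> 0 \<longrightarrow> f y = p y / q y)" if x: "x \<in> W" for x
  proof -
    obtain U C p s where "(U, C) \<in> \<A>" "x \<in> U" "p \<in> subalgebra C" "s \<in> subalgebra C" "s x \<noteq> 0"
      "\<forall>y\<in>U. s y \<noteq> 0 \<longrightarrow> f y = p y / s y"
      using assms[OF x] unfolding frac_at_def by blast
    then show ?thesis by blast
  qed
  then show ?thesis unfolding chart_space_def by simp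
qed

lemma sheaf_chart_space:
  assumes "compatible \<A>" shows "sheaf_of_functions (chart_space \<A>)"
proof -
  let ?X = "chart_space \<A>"
  have ch: "\<exists>U C. (U, C) \<in> \<A> \<and> x \<in> U" if "openin (zar ?X) W" "x \<in> W" for x W
    using openin_subset[OF that(1)] that(2) unfolding pts_chart_space by force
  show ?thesis unfolding sheaf_of_functions_def
  proof (intro allI impI conjI ballI)
    fix W assume W: "openin (zar ?X) W"
    have op: "h \<in> reg ?X W" if "\<And>x U C. x \<in> W \<Longrightarrow> (U, C) \<in> \<A> \<Longrightarrow> x \<in> U \<Longrightarrow> frac_at U C x h" for h
    proof (rule regI)
      fix x assume x: "x \<in> W"
      then obtain U C where "(U, C) \<in> \<A>" "x \<in> U" using ch[OF W] by blast
      with that[OF x this] show "\<exists>(U, C)\<in>\<A>. x \<in> U \<and> frac_at U C x h" by blast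
    qed
    show "(\<lambda>_. c) \<in> reg ?X W" for c
      by (rule op, rule frac_at_subalgebra, rule subalgebra.const)
    fix f assume f: "f \<in> reg ?X W"
    show "f \<in> reg ?X U" if sub: "openin (zar ?X) U \<and> U \<subseteq> W" for U
    proof (rule regI)
      fix x assume "x \<in> U"
      then obtain V D where "(V, D) \<in> \<A>" "x \<in> V" using ch[OF W, of x] sub by blast
      then show "\<exists>(V, D)\<in>\<A>. x \<in> V \<and> frac_at V D x f"
        using reg_frac_at[OF assms W f] \<open>x \<in> U\<close> sub by blast
    qed
    fix g assume g: "g \<in> reg ?X W"
    show "(\<lambda>x. f x + g x) \<in> reg ?X W" "(\<lambda>x. f x * g x) \<in> reg ?X W"
      by (rule op, intro frac_at_add frac_at_mult reg_frac_at[OF assms W f] reg_frac_at[OF assms W g]; simp)+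
  next
    fix W f assume W: "openin (zar ?X) W"
      and l: "\<forall>x\<in>W. \<exists>U g. openin (zar ?X) U \<and> x \<in> U \<and> U \<subseteq> W \<and> g \<in> reg ?X U \<and> (\<forall>y\<in>U. f y = g y)"
    show "f \<in> reg ?X W"
    proof (rule regI)
      fix x assume x: "x \<in> W"
      then obtain U g where U: "openin (zar ?X) U" "x \<in> U" "g \<in> reg ?X U" "\<forall>y\<in>U. f y = g y"
        using l by blast
      obtain V D where V: "(V, D) \<in> \<A>" "x \<in> V" using ch[OF W x] by blast
      have "frac_at V D x f"
        by (rule frac_at_cong[OF reg_frac_at[OF assms U(1,3,2) V]])
           (rule near_mono[OF openin_near[OF assms U(1,2) V]], use U in auto)
      then show "\<exists>(V, D)\<in>\<A>. x \<in> V \<and> frac_at V D x f" using V by blast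
    qed
  qed
qed

text \<open>Continuity and pullback of regular functions are local, so one pair of charts at each
  point suffices. There only the coordinates have to be tested; fractions in them follow by the
  pullback rules.\<close>

lemma morphism_chart_space:
  assumes "compatible \<A>" "compatible \<B>"
    and "\<And>x. x \<in> pts (chart_space \<A>) \<Longrightarrow> \<exists>U C V D. (U, C) \<in> \<A> \<and> (V, D) \<in> \<B> \<and> x \<in> U \<and> \<phi> x \<in> V \<and>
        near U C x (\<lambda>y. \<phi> y \<in> V) \<and> (\<forall>g\<in>D. frac_at U C x (\<lambda>y. g (\<phi> y)))"
  shows "morphism (chart_space \<A>) (chart_space \<B>) \<phi>"
proof (rule morphismI)
  let ?X = "chart_space \<A>" and ?Y = "chart_space \<B>"
  show "\<phi> x \<in> pts ?Y" if "x \<in> pts ?X" for x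
    using assms(3)[OF that] unfolding pts_chart_space by force
  fix W assume W: "openin (zar ?Y) W"
  show "openin (zar ?X) (pts ?X \<inter> \<phi> -` W)"
    unfolding openin_near_iff[OF assms(1)]
  proof
    fix x assume x: "x \<in> pts ?X \<inter> \<phi> -` W"
    then obtain U C V D where *: "(U, C) \<in> \<A>" "(V, D) \<in> \<B>" "x \<in> U" "\<phi> x \<in> V"
        "near U C x (\<lambda>y. \<phi> y \<in> V)" "\<And>g. g \<in> D \<Longrightarrow> frac_at U C x (\<lambda>y. g (\<phi> y))"
      using assms(3)[of x] by blast
    have "near V D (\<phi> x) (\<lambda>y. y \<in> W)" using openin_near[OF assms(2) W _ *(2,4)] x by auto
    from near_pullback[OF this *(5,6,3)] have "near U C x (\<lambda>y. \<phi> y \<in> W)" by blast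
    then have "near U C x (\<lambda>y. y \<in> pts ?X \<inter> \<phi> -` W)"
      by (rule near_mono) (use *(1) in \<open>force simp: pts_chart_space\<close>)
    then show "\<exists>(U, C)\<in>\<A>. x \<in> U \<and> near U C x (\<lambda>y. y \<in> pts ?X \<inter> \<phi> -` W)" using * by blast
  qed
  fix h assume h: "h \<in> reg ?Y W"
  show "h \<circ> \<phi> \<in> reg ?X (pts ?X \<inter> \<phi> -` W)"
  proof (rule regI)
    fix x assume x: "x \<in> pts ?X \<inter> \<phi> -` W"
    then obtain U C V D where *: "(U, C) \<in> \<A>" "(V, D) \<in> \<B>" "x \<in> U" "\<phi> x \<in> V"
        "near U C x (\<lambda>y. \<phi> y \<in> V)" "\<And>g. g \<in> D \<Longrightarrow> frac_at U C x (\<lambda>y. g (\<phi> y))"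
      using assms(3)[of x] by blast
    have "frac_at V D (\<phi> x) h" using reg_frac_at[OF assms(2) W h _ *(2,4)] x by auto
    from frac_at_pullback_frac[OF this *(5,6,3)] have "frac_at U C x (h \<circ> \<phi>)" by (simp add: comp_def)
    then show "\<exists>(U, C)\<in>\<A>. x \<in> U \<and> frac_at U C x (h \<circ> \<phi>)" using * by blast
  qed
qed

section \<open>Induced structures on subsets\<close>

definition restrict_atlas ::
  "('a set \<times> ('a \<Rightarrow> complex) set) set \<Rightarrow> 'a set \<Rightarrow> ('a set \<times> ('a \<Rightarrow> complex) set) set" where
  "restrict_atlas \<A> S = (\<lambda>(U, C). (U \<inter> S, C)) ` \<A>"

lemma pts_restrict: "pts (chart_space (restrict_atlas \<A> S)) = pts (chart_space \<A>) \<inter> S"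
  unfolding pts_chart_space restrict_atlas_def by force

lemma near_subset: "near U C x P \<Longrightarrow> V \<subseteq> U \<Longrightarrow> near V C x P"
  unfolding near_def by blast

lemma frac_at_subset: "frac_at U C x f \<Longrightarrow> V \<subseteq> U \<Longrightarrow> frac_at V C x f"
  unfolding frac_at_def by blast

lemma compatible_restrict:
  assumes "compatible \<A>" shows "compatible (restrict_atlas \<A> S)"
  unfolding compatible_def
proof clarify
  fix U C V D x assume "(U, C) \<in> restrict_atlas \<A> S" "(V, D) \<in> restrict_atlas \<A> S" and x: "x \<in> U" "x \<in> V"
  then obtain U' V' where *: "(U', C) \<in> \<A>" "(V', D) \<in> \<A>" "U = U' \<inter> S" "V = V' \<inter> S"
    unfolding restrict_atlas_def by auto
  have "near U' C x (\<lambda>y. y \<in> V')" "\<forall>f\<in>D. frac_at U' C x f"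
    using compatibleD[OF assms *(1,2)] x * by auto
  moreover from this(1) have "near U C x (\<lambda>y. y \<in> V')" by (rule near_subset) (use * in auto)
  then have "near U C x (\<lambda>y. y \<in> V)" by (rule near_mono) (use * in auto)
  ultimately show "near U C x (\<lambda>y. y \<in> V) \<and> (\<forall>f\<in>D. frac_at U C x f)"
    using frac_at_subset[of U' C x _ U] *(3) by auto
qed

lemma openin_induced_chart_space:
  assumes "compatible \<A>"
  shows "openin (zar (induced (chart_space \<A>) S)) W \<longleftrightarrow> openin (zar (chart_space (restrict_atlas \<A> S))) W"
proof
  assume "openin (zar (induced (chart_space \<A>) S)) W"
  then obtain T where T: "openin (zar (chart_space \<A>)) T" "W = T \<inter> S"
    by (auto simp: induced_def openin_subtopology)
  show "openin (zar (chart_space (restrict_atlas \<A> S))) W"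
    unfolding openin_near_iff[OF compatible_restrict[OF assms]]
  proof
    fix x assume x: "x \<in> W"
    then obtain U C where *: "(U, C) \<in> \<A>" "x \<in> U" "near U C x (\<lambda>y. y \<in> T)"
      using T(1) T(2) unfolding openin_near_iff[OF assms] by fastforce
    have "near (U \<inter> S) C x (\<lambda>y. y \<in> W)"
      by (rule near_mono[OF near_subset[OF *(3)]]) (use T in auto)
    moreover have "(U \<inter> S, C) \<in> restrict_atlas \<A> S" using * unfolding restrict_atlas_def by force
    ultimately show "\<exists>(U, C)\<in>restrict_atlas \<A> S. x \<in> U \<and> near U C x (\<lambda>y. y \<in> W)"
      using x T *(2) by blast
  qed
next
  assume W: "openin (zar (chart_space (restrict_atlas \<A> S))) W"
  show "openin (zar (induced (chart_space \<A>) S)) W"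
  proof (subst openin_subopen, intro ballI)
    fix x assume "x \<in> W"
    then obtain U C where *: "(U, C) \<in> \<A>" "x \<in> U \<inter> S" "near (U \<inter> S) C x (\<lambda>y. y \<in> W)"
      using W unfolding openin_near_iff[OF compatible_restrict[OF assms]] 
      by (fastforce simp: restrict_atlas_def)
    then obtain s where s: "s \<in> subalgebra C" "s x \<noteq> 0" "\<forall>y\<in>U \<inter> S. s y \<noteq> 0 \<longrightarrow> y \<in> W"
      unfolding near_def by blast
    then show "\<exists>T. openin (zar (induced (chart_space \<A>) S)) T \<and> x \<in> T \<and> T \<subseteq> W"
      by (intro exI[of _ "{x\<in>U. s x \<noteq> 0} \<inter> S"])
         (use openin_principal[OF *(1) s(1)] * in \<open>auto simp: induced_def openin_subtopology\<close>)
  qed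
qed

text \<open>A local fraction on \<open>U \<inter> S\<close> is given by polynomials that are defined
  on all of \<open>U\<close>, so the same formula extends it to a principal open set of the big
  space. This matches the regular functions of \<open>induced\<close>, which are local
  restrictions.\<close>

lemma induced_chart_space:
  assumes "compatible \<A>"
  shows "induced (chart_space \<A>) S \<cong>\<^sub>V chart_space (restrict_atlas \<A> S)"
proof (rule isomorphicI)
  let ?X = "induced (chart_space \<A>) S" and ?Y = "chart_space (restrict_atlas \<A> S)"
  note cr = compatible_restrict[OF assms, of S]
  note eq = openin_induced_chart_space[OF assms, of S]
  have pts: "pts ?X = pts ?Y" by (simp add: pts_induced pts_restrict)
  show "morphism ?X ?Y (\<lambda>x. x)"
  proof (rule morphismI)
    fix V assume V: "openin (zar ?Y) V"
    have V': "pts ?X \<inter> (\<lambda>x. x) -` V = V" using openin_subset[OF V] pts by auto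
    show "openin (zar ?X) (pts ?X \<inter> (\<lambda>x. x) -` V)" unfolding V' using eq V by simp
    fix h assume h: "h \<in> reg ?Y V"
    have "\<exists>T g. openin (zar (chart_space \<A>)) T \<and> x \<in> T \<and> g \<in> reg (chart_space \<A>) T \<and> (\<forall>y\<in>T \<inter> V. h y = g y)"
      if x: "x \<in> V" for x
    proof -
      obtain U C where UC: "(U, C) \<in> \<A>" "x \<in> U" "x \<in> S"
        using x openin_subset[OF V] unfolding pts_restrict unfolding pts_chart_space by force
      then have "(U \<inter> S, C) \<in> restrict_atlas \<A> S" unfolding restrict_atlas_def by force
      then have "frac_at (U \<inter> S) C x h" using reg_frac_at[OF cr V h x] UC by blast
      then obtain p s where ps: "p \<in> subalgebra C" "s \<in> subalgebra C" "s x \<noteq> 0"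
         "\<forall>y\<in>U \<inter> S. s y \<noteq> 0 \<longrightarrow> h y = p y / s y" unfolding frac_at_def by blast
      have "(\<lambda>y. p y / s y) \<in> reg (chart_space \<A>) {x\<in>U. s x \<noteq> 0}"
      proof (rule regI)
        fix z assume "z \<in> {x\<in>U. s x \<noteq> 0}"
        then show "\<exists>(U, C)\<in>\<A>. z \<in> U \<and> frac_at U C z (\<lambda>y. p y / s y)"
          using UC ps frac_at_divide[OF frac_at_subalgebra[OF ps(1)] frac_at_subalgebra[OF ps(2)]] by blast
      qed
      then show ?thesis
        using ps UC openin_principal[OF UC(1) ps(2)] openin_subset[OF V]
        by (intro exI[of _ "{x\<in>U. s x \<noteq> 0}"] exI[of _ "\<lambda>y. p y / s y"]) (auto simp: pts_restrict)
    qed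
    then show "h \<circ> (\<lambda>x. x) \<in> reg ?X (pts ?X \<inter> (\<lambda>x. x) -` V)"
      unfolding V' by (auto simp: induced_def comp_def)
  qed (use pts in auto)
  show "morphism ?Y ?X (\<lambda>x. x)"
  proof (rule morphismI)
    fix V assume V: "openin (zar ?X) V"
    have V': "pts ?Y \<inter> (\<lambda>x. x) -` V = V" using openin_subset[OF V] pts by auto
    show "openin (zar ?Y) (pts ?Y \<inter> (\<lambda>x. x) -` V)" unfolding V' using eq V by simp
    fix h assume h: "h \<in> reg ?X V"
    have "h \<in> reg ?Y V"
    proof (rule regI)
      fix x assume x: "x \<in> V"
      then obtain T g where T: "openin (zar (chart_space \<A>)) T" "x \<in> T" "g \<in> reg (chart_space \<A>) T"
        "\<forall>y\<in>T \<inter> V. h y = g y" using h by (auto simp: induced_def)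
      obtain U C where UC: "(U, C) \<in> \<A>" "x \<in> U" "x \<in> S"
        using x openin_subset[OF V] unfolding pts_induced unfolding pts_chart_space by force
      then have UC': "(U \<inter> S, C) \<in> restrict_atlas \<A> S" unfolding restrict_atlas_def by force
      have "near (U \<inter> S) C x (\<lambda>y. y \<in> T)"
        using near_subset[OF openin_near[OF assms T(1,2) UC(1,2)]] by blast
      moreover have "near (U \<inter> S) C x (\<lambda>y. y \<in> V)"
        using openin_near[OF cr _ x UC'] eq V UC by blast
      ultimately have "near (U \<inter> S) C x (\<lambda>y. y \<in> T \<and> y \<in> V)" by (rule near_conj)
      then have n: "near (U \<inter> S) C x (\<lambda>y. g y = h y)" by (rule near_mono) (use T in auto)
      have "frac_at (U \<inter> S) C x g"
        using frac_at_subset[OF reg_frac_at[OF assms T(1,3,2) UC(1,2)]] by blast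
      from frac_at_cong[OF this n] show "\<exists>(U, C)\<in>restrict_atlas \<A> S. x \<in> U \<and> frac_at U C x h"
        using UC' UC by blast
    qed
    then show "h \<circ> (\<lambda>x. x) \<in> reg ?Y (pts ?Y \<inter> (\<lambda>x. x) -` V)"
      unfolding V' by (simp add: comp_def)
  qed (use pts in auto)
qed auto

text \<open>Compatibility lets the coordinates of the chart that contains \<open>S\<close> govern
  all others, so a stratum can be handled by one coordinate system.\<close>

lemma chart_space_single_in_chart:
  assumes "compatible \<A>" "(U, C) \<in> \<A>" "S \<subseteq> U"
  shows "induced (chart_space \<A>) S \<cong>\<^sub>V chart_space {(S, C)}"
proof -
  note cr = compatible_restrict[OF assms(1), of S]
  have US: "U \<inter> S = S" using assms(3) by auto
  have UC': "(S, C) \<in> restrict_atlas \<A> S"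
    using image_eqI[OF _ assms(2), of "(S, C)" "\<lambda>(U, C). (U \<inter> S, C)"] US
    unfolding restrict_atlas_def by simp
  have "chart_space (restrict_atlas \<A> S) \<cong>\<^sub>V chart_space {(S, C)}"
  proof (rule isomorphicI[where \<phi>="\<lambda>x. x" and \<psi>="\<lambda>x. x"])
    show "morphism (chart_space (restrict_atlas \<A> S)) (chart_space {(S, C)}) (\<lambda>x. x)"
    proof (rule morphism_chart_space[OF cr compatible_single])
      fix x assume "x \<in> pts (chart_space (restrict_atlas \<A> S))"
      then have "x \<in> S" by (simp add: pts_restrict)
      then show "\<exists>U' C' V D. (U', C') \<in> restrict_atlas \<A> S \<and> (V, D) \<in> {(S, C)} \<and> x \<in> U' \<and> x \<in> V \<and>
          near U' C' x (\<lambda>y. y \<in> V) \<and> (\<forall>g\<in>D. frac_at U' C' x g)"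
        by (intro exI[of _ S] exI[of _ C]) (use UC' in \<open>auto intro: near_always frac_at_subalgebra subalgebra.gen\<close>)
    qed
    show "morphism (chart_space {(S, C)}) (chart_space (restrict_atlas \<A> S)) (\<lambda>x. x)"
    proof (rule morphism_chart_space[OF compatible_single cr])
      fix x assume "x \<in> pts (chart_space {(S, C)})"
      then have "x \<in> S" by (simp add: pts_chart_space)
      then show "\<exists>U' C' V D. (U', C') \<in> {(S, C)} \<and> (V, D) \<in> restrict_atlas \<A> S \<and> x \<in> U' \<and> x \<in> V \<and>
          near U' C' x (\<lambda>y. y \<in> V) \<and> (\<forall>g\<in>D. frac_at U' C' x g)"
        by (intro exI[of _ S] exI[of _ C]) (use UC' in \<open>auto intro: near_always frac_at_subalgebra subalgebra.gen\<close>)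
    qed
  qed auto
  then show ?thesis using induced_chart_space[OF assms(1)] isomorphic_trans by blast
qed

section \<open>Affine charts\<close>

text \<open>The image of \<open>S\<close> under the finitely many coordinates \<open>F\<close> is Zariski closed: a tuple
  satisfying all polynomial relations that hold on \<open>S\<close> comes from a point of \<open>S\<close>.\<close>

definition affine_coords :: "'a set \<Rightarrow> ('a \<Rightarrow> complex) set \<Rightarrow> ('a \<Rightarrow> complex) set \<Rightarrow> bool" where
  "affine_coords S C F \<longleftrightarrow> finite F \<and>
     (\<forall>f\<in>F. \<exists>p\<in>subalgebra C. \<forall>x\<in>S. f x = p x) \<and>
     (\<forall>c\<in>C. \<exists>p\<in>subalgebra F. \<forall>x\<in>S. c x = p x) \<and>
     (\<forall>x\<in>S. \<forall>y\<in>S. (\<forall>f\<in>F. f x = f y) \<longrightarrow> x = y) \<and>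
     (\<forall>z. (\<forall>P\<in>subalgebra ((\<lambda>f z. z f) ` F). (\<forall>x\<in>S. P (\<lambda>f. f x) = 0) \<longrightarrow> P z = 0) \<longrightarrow>
        (\<exists>x\<in>S. \<forall>f\<in>F. f x = z f))"

definition affine_chart :: "'a set \<Rightarrow> ('a \<Rightarrow> complex) set \<Rightarrow> bool" where
  "affine_chart S C \<longleftrightarrow> (\<exists>F. affine_coords S C F)"

lemma affine_coordsD:
  assumes "affine_coords S C F"
  shows "finite F"
    "\<forall>f\<in>F. \<exists>p\<in>subalgebra C. \<forall>x\<in>S. f x = p x"
    "\<forall>c\<in>C. \<exists>p\<in>subalgebra F. \<forall>x\<in>S. c x = p x"
    "\<forall>x\<in>S. \<forall>y\<in>S. (\<forall>f\<in>F. f x = f y) \<longrightarrow> x = y"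
    "\<And>z. (\<forall>P\<in>subalgebra ((\<lambda>f z. z f) ` F). (\<forall>x\<in>S. P (\<lambda>f. f x) = 0) \<longrightarrow> P z = 0) \<Longrightarrow>
        (\<exists>x\<in>S. \<forall>f\<in>F. f x = z f)"
  using assms unfolding affine_coords_def by simp_all

lemma subalgebra_as_polynomial:
  assumes "p \<in> subalgebra (F ` K)"
  shows "\<exists>P\<in>subalgebra ((\<lambda>k z. z k) ` K). \<forall>x. p x = P (\<lambda>k. F k x)"
  using assms
proof induction
  case (gen f)
  then obtain k where "k \<in> K" "f = F k" by blast
  then show ?case by (intro bexI[of _ "\<lambda>z. z k"] subalgebra.gen) auto
next
  case (const c) show ?case by (rule bexI[of _ "\<lambda>_. c"]) (auto intro: subalgebra.const)
next
  case (add f g)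
  then obtain p q where "p \<in> subalgebra ((\<lambda>k z. z k) ` K)" "q \<in> subalgebra ((\<lambda>k z. z k) ` K)"
    "\<forall>x. f x = p (\<lambda>k. F k x)" "\<forall>x. g x = q (\<lambda>k. F k x)" by blast
  then show ?case by (intro bexI[of _ "\<lambda>x. p x + q x"]) (auto intro: subalgebra.intros)
next
  case (mult f g)
  then obtain p q where "p \<in> subalgebra ((\<lambda>k z. z k) ` K)" "q \<in> subalgebra ((\<lambda>k z. z k) ` K)"
    "\<forall>x. f x = p (\<lambda>k. F k x)" "\<forall>x. g x = q (\<lambda>k. F k x)" by blast
  then show ?case by (intro bexI[of _ "\<lambda>x. p x * q x"]) (auto intro: subalgebra.intros)
qed

text \<open>The coordinates are indexed by \<open>K\<close> instead of being collected in a set,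
  which suits matrices of coefficients and allows different indices to give the same
  function.\<close>

lemma affine_chartI:
  fixes F :: "'k \<Rightarrow> 'a \<Rightarrow> complex"
  assumes "finite K"
    and "\<And>k. k \<in> K \<Longrightarrow> \<exists>p\<in>subalgebra C. \<forall>x\<in>S. F k x = p x"
    and "\<And>c. c \<in> C \<Longrightarrow> \<exists>p\<in>subalgebra (F ` K). \<forall>x\<in>S. c x = p x"
    and "\<And>x y. x \<in> S \<Longrightarrow> y \<in> S \<Longrightarrow> (\<And>k. k \<in> K \<Longrightarrow> F k x = F k y) \<Longrightarrow> x = y"
    and real: "\<And>z. (\<And>P. P \<in> subalgebra ((\<lambda>k z. z k) ` K) \<Longrightarrow> (\<And>x. x \<in> S \<Longrightarrow> P (\<lambda>k. F k x) = 0) \<Longrightarrow> P z = 0) \<Longrightarrow>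
        (\<exists>x\<in>S. \<forall>k\<in>K. F k x = z k)"
  shows "affine_chart S C"
  unfolding affine_chart_def affine_coords_def
proof (intro exI[of _ "F ` K"] conjI allI impI)
  fix z assume z: "\<forall>P\<in>subalgebra ((\<lambda>f z. z f) ` F ` K). (\<forall>x\<in>S. P (\<lambda>f. f x) = 0) \<longrightarrow> P z = 0"
  have "\<exists>x\<in>S. \<forall>k\<in>K. F k x = z (F k)"
  proof (rule real)
    fix P assume P: "P \<in> subalgebra ((\<lambda>k z. z k) ` K)" and v: "\<And>x. x \<in> S \<Longrightarrow> P (\<lambda>k. F k x) = 0"
    have "(\<lambda>z. P (\<lambda>k. z (F k))) \<in> subalgebra ((\<lambda>f z. z f) ` F ` K)"
      by (rule subalgebra_comp[OF P]) (auto intro: subalgebra.gen)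
    then show "P (\<lambda>k. z (F k)) = 0" using z v by fastforce
  qed
  then show "\<exists>x\<in>S. \<forall>f\<in>F ` K. f x = z f" by auto
qed (use assms(1-4) in auto)

text \<open>Coordinates correspond by polynomials valid on the whole domain, not only by local
  fractions; this is what transports affineness.\<close>

definition poly_iso ::
  "'a set \<Rightarrow> ('a \<Rightarrow> complex) set \<Rightarrow> 'b set \<Rightarrow> ('b \<Rightarrow> complex) set \<Rightarrow> ('a \<Rightarrow> 'b) \<Rightarrow> bool" where
  "poly_iso S C T D \<phi> \<longleftrightarrow> bij_betw \<phi> S T \<and>
     (\<forall>d\<in>D. \<exists>p\<in>subalgebra C. \<forall>x\<in>S. d (\<phi> x) = p x) \<and>
     (\<forall>c\<in>C. \<exists>p\<in>subalgebra D. \<forall>x\<in>S. c x = p (\<phi> x))"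

lemma affine_chart_poly_iso:
  assumes "poly_iso S C T D \<phi>" "affine_chart T D" shows "affine_chart S C"
proof -
  obtain F where "affine_coords T D F" using assms(2) unfolding affine_chart_def by blast
  note F = affine_coordsD[OF this]
  have bij: "bij_betw \<phi> S T" 
    and DC: "\<And>d. d \<in> D \<Longrightarrow> \<exists>p\<in>subalgebra C. \<forall>x\<in>S. d (\<phi> x) = p x"
    and CD: "\<And>c. c \<in> C \<Longrightarrow> \<exists>p\<in>subalgebra D. \<forall>x\<in>S. c x = p (\<phi> x)"
    using assms(1) unfolding poly_iso_def by auto
  have im: "\<phi> ` S = T" and inj: "inj_on \<phi> S" using bij unfolding bij_betw_def by auto
  show ?thesis
  proof (rule affine_chartI[OF F(1), where F="\<lambda>f x. f (\<phi> x)"])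
    fix f assume "f \<in> F"
    then obtain p where p: "p \<in> subalgebra D" "\<forall>x\<in>T. f x = p x" using F by blast
    from subalgebra_pullback[OF p(1), where \<phi>=\<phi> and C=C and S=S] DC obtain q where "q \<in> subalgebra C" "\<forall>x\<in>S. p (\<phi> x) = q x" by blast
    then show "\<exists>p\<in>subalgebra C. \<forall>x\<in>S. f (\<phi> x) = p x" using p im by force
  next
    fix c assume "c \<in> C"
    then obtain p where p: "p \<in> subalgebra D" "\<forall>x\<in>S. c x = p (\<phi> x)" using CD by blast
    from subalgebra_pullback[OF p(1), where \<phi>="\<lambda>x. x" and C=F and S=T] F(3) obtain q
      where q: "q \<in> subalgebra F" "\<forall>x\<in>T. p x = q x" by blast
    have "(\<lambda>x. q (\<phi> x)) \<in> subalgebra ((\<lambda>f x. f (\<phi> x)) ` F)"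
      by (rule subalgebra_comp[OF q(1)]) (auto intro: subalgebra.gen)
    then show "\<exists>p\<in>subalgebra ((\<lambda>f x. f (\<phi> x)) ` F). \<forall>x\<in>S. c x = p x" using p q im by force
  next
    fix x y assume "x \<in> S" "y \<in> S" "\<And>f. f \<in> F \<Longrightarrow> f (\<phi> x) = f (\<phi> y)"
    then show "x = y" using F(4) im inj by (metis image_eqI inj_onD)
  next
    fix z assume z: "\<And>P. P \<in> subalgebra ((\<lambda>k z. z k) ` F) \<Longrightarrow> (\<And>x. x \<in> S \<Longrightarrow> P (\<lambda>k. k (\<phi> x)) = 0) \<Longrightarrow> P z = 0"
    have "\<exists>x\<in>T. \<forall>f\<in>F. f x = z f"
      by (rule F(5)) (use z im in blast)
    then show "\<exists>x\<in>S. \<forall>k\<in>F. k (\<phi> x) = z k" using im by blast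
  qed
qed

lemma chart_space_poly_iso:
  assumes "poly_iso S C T D \<phi>" shows "chart_space {(S, C)} \<cong>\<^sub>V chart_space {(T, D)}"
proof (rule isomorphicI[where \<phi>=\<phi> and \<psi>="inv_into S \<phi>"])
  have bij: "bij_betw \<phi> S T" 
    and DC: "\<And>d. d \<in> D \<Longrightarrow> \<exists>p\<in>subalgebra C. \<forall>x\<in>S. d (\<phi> x) = p x"
    and CD: "\<And>c. c \<in> C \<Longrightarrow> \<exists>p\<in>subalgebra D. \<forall>x\<in>S. c x = p (\<phi> x)"
    using assms(1) unfolding poly_iso_def by auto
  have im: "\<phi> ` S = T" and inj: "inj_on \<phi> S" using bij unfolding bij_betw_def by auto
  show "morphism (chart_space {(S, C)}) (chart_space {(T, D)}) \<phi>"
  proof (rule morphism_chart_space[OF compatible_single compatible_single])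
    fix x assume "x \<in> pts (chart_space {(S, C)})"
    then have x: "x \<in> S" by (simp add: pts_chart_space)
    have "frac_at S C x (\<lambda>y. d (\<phi> y))" if d: "d \<in> D" for d
    proof -
      obtain p where p: "p \<in> subalgebra C" "\<forall>x\<in>S. d (\<phi> x) = p x" using DC[OF d] by blast
      show ?thesis by (rule frac_at_cong[OF frac_at_subalgebra[OF p(1)]]) (rule near_always, use p in auto)
    qed
    then show "\<exists>U C' V D'. (U, C') \<in> {(S, C)} \<and> (V, D') \<in> {(T, D)} \<and> x \<in> U \<and> \<phi> x \<in> V \<and>
        near U C' x (\<lambda>y. \<phi> y \<in> V) \<and> (\<forall>g\<in>D'. frac_at U C' x (\<lambda>y. g (\<phi> y)))"
      using x im by (auto intro!: near_always)
  qed
  show "morphism (chart_space {(T, D)}) (chart_space {(S, C)}) (inv_into S \<phi>)"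
  proof (rule morphism_chart_space[OF compatible_single compatible_single])
    fix x assume "x \<in> pts (chart_space {(T, D)})"
    then have x: "x \<in> T" by (simp add: pts_chart_space)
    have "frac_at T D x (\<lambda>y. c (inv_into S \<phi> y))" if c: "c \<in> C" for c
    proof -
      obtain p where p: "p \<in> subalgebra D" "\<forall>x\<in>S. c x = p (\<phi> x)" using CD[OF c] by blast
      have "\<forall>y\<in>T. p y = c (inv_into S \<phi> y)" using p(2) im by (metis f_inv_into_f inv_into_into)
      then show ?thesis by (intro frac_at_cong[OF frac_at_subalgebra[OF p(1)]] near_always) auto
    qed
    moreover have "inv_into S \<phi> y \<in> S" if "y \<in> T" for y using that im inv_into_into by metis
    ultimately show "\<exists>U C' V D'. (U, C') \<in> {(T, D)} \<and> (V, D') \<in> {(S, C)} \<and> x \<in> U \<and> inv_into S \<phi> x \<in> V \<and>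
        near U C' x (\<lambda>y. inv_into S \<phi> y \<in> V) \<and> (\<forall>g\<in>D'. frac_at U C' x (\<lambda>y. g (inv_into S \<phi> y)))"
      using x im by (auto intro!: near_always)
  qed
  show "inv_into S \<phi> (\<phi> x) = x" if "x \<in> pts (chart_space {(S, C)})" for x
    using that inj by (simp add: pts_chart_space)
  show "\<phi> (inv_into S \<phi> y) = y" if "y \<in> pts (chart_space {(T, D)})" for y
    using that im by (simp add: pts_chart_space f_inv_into_f)
qed

text \<open>A tuple satisfying the relations of \<open>U \<inter> S\<close> comes from a point
  \<open>x\<close> of \<open>U\<close>. If \<open>x\<close> were outside \<open>S\<close>, a
  function nonzero at \<open>x\<close> and zero on \<open>U \<inter> S\<close> would be a relation
  that the tuple violates.\<close>

lemma affine_chart_closed_subset: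
  assumes "affine_chart U C" "\<And>x. x \<in> U \<Longrightarrow> x \<notin> S \<Longrightarrow> near U C x (\<lambda>y. y \<notin> S)"
  shows "affine_chart (U \<inter> S) C"
proof -
  obtain F where "affine_coords U C F" using assms(1) unfolding affine_chart_def by blast
  note F = affine_coordsD[OF this]
  show ?thesis
  proof (rule affine_chartI[OF F(1), where F="\<lambda>f. f"])
    fix z :: "('a \<Rightarrow> complex) \<Rightarrow> complex"
    assume z: "\<And>P. P \<in> subalgebra ((\<lambda>k z. z k) ` F) \<Longrightarrow> (\<And>x. x \<in> U \<inter> S \<Longrightarrow> P (\<lambda>k. k x) = 0) \<Longrightarrow> P z = 0"
    have "\<exists>x\<in>U. \<forall>f\<in>F. f x = z f"
      by (rule F(5)) (use z in blast)
    then obtain x where x: "x \<in> U" "\<forall>f\<in>F. f x = z f" by blast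
    have "x \<in> S"
    proof (rule ccontr)
      assume "x \<notin> S"
      then obtain s where s: "s \<in> subalgebra C" "s x \<noteq> 0" "\<forall>y\<in>U. s y \<noteq> 0 \<longrightarrow> y \<notin> S"
        using assms(2)[OF x(1)] unfolding near_def by blast
      from subalgebra_pullback[OF s(1), where \<phi>="\<lambda>x. x" and C=F and S=U] F(3) obtain q
        where q: "q \<in> subalgebra ((\<lambda>f. f) ` F)" "\<forall>x\<in>U. s x = q x" by auto
      from subalgebra_as_polynomial[OF q(1)] obtain P
        where P: "P \<in> subalgebra ((\<lambda>k z. z k) ` F)" "\<forall>x. q x = P (\<lambda>k. k x)" by blast
      have "P z = 0" by (rule z[OF P(1)]) (use P q s in auto)
      moreover have "P z' = P z''" if "\<forall>f\<in>F. z' f = z'' f" for z' z''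
        using P(1) by induction (use that in auto)
      ultimately show False using x P q s by (metis (no_types, lifting))
    qed
    then show "\<exists>x\<in>U \<inter> S. \<forall>k\<in>F. k x = z k" using x by blast
  next
    fix c assume "c \<in> C"
    then obtain p where "p \<in> subalgebra F" "\<forall>x\<in>U. c x = p x" using F(3) by blast
    then show "\<exists>p\<in>subalgebra ((\<lambda>f. f) ` F). \<forall>x\<in>U \<inter> S. c x = p x" unfolding image_ident by blast
  qed (use F(2,4) in blast)+
qed

lemma affine_chart_points:
  assumes "affine_chart S C" "x \<in> S" "y \<in> S" "x \<noteq> y"
  obtains p where "p \<in> subalgebra C" "p x \<noteq> p y"
proof -
  obtain F where "affine_coords S C F" using assms(1) unfolding affine_chart_def by blast
  note F = affine_coordsD[OF this]
  obtain f where "f \<in> F" "f x \<noteq> f y" using F(4) assms by blast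
  then show ?thesis using F(2) assms that by metis
qed

lemma compatible_affine_space:
  "affine_space n = chart_space {({x. \<forall>i\<ge>n. x i = 0}, (\<lambda>i x. x i) ` {..<n})}"
  unfolding affine_space_def by (rule arg_cong[where f=chart_space]) auto

lemma affine_chart_affine_space:
  "affine_chart {x::nat \<Rightarrow> complex. \<forall>i\<ge>n. x i = 0} ((\<lambda>i x. x i) ` {..<n})"
proof (rule affine_chartI[where K="{..<n}" and F="\<lambda>i x. x i"])
  fix x y :: "nat \<Rightarrow> complex" assume *: "x \<in> {x. \<forall>i\<ge>n. x i = 0}" "y \<in> {x. \<forall>i\<ge>n. x i = 0}"
    "\<And>k. k \<in> {..<n} \<Longrightarrow> x k = y k"
  show "x = y"
  proof
    show "x i = y i" for i using * by (cases "i < n") auto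
  qed
next
  fix z :: "nat \<Rightarrow> complex"
  show "\<exists>x\<in>{x. \<forall>i\<ge>n. x i = 0}. \<forall>k\<in>{..<n}. x k = z k"
    by (rule bexI[of _ "\<lambda>i. if i < n then z i else 0"]) auto
next
  show "\<exists>p\<in>subalgebra ((\<lambda>i x. x i) ` {..<n}). \<forall>x\<in>{x. \<forall>i\<ge>n. x i = 0}. x k = p x" if "k \<in> {..<n}" for k
    by (rule bexI[of _ "\<lambda>x. x k"]) (use that in \<open>auto intro: subalgebra.gen\<close>)
  show "\<exists>p\<in>subalgebra ((\<lambda>i x. x i) ` {..<n}). \<forall>x\<in>{x. \<forall>i\<ge>n. x i = 0}. c x = p x"
    if "c \<in> (\<lambda>i x. x i) ` {..<n}" for c
    by (rule bexI[of _ c]) (use that in \<open>auto intro: subalgebra.gen\<close>)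
qed simp

lemma affine_variety_chart_space:
  assumes "affine_chart S C"
  obtains n Z \<phi> where "poly_iso S C Z ((\<lambda>i x. x i) ` {..<n}) \<phi>"
    "closedin (zar (affine_space n)) Z" "chart_space {(S, C)} \<cong>\<^sub>V induced (affine_space n) Z"
proof -
  obtain F where "affine_coords S C F" using assms(1) unfolding affine_chart_def by blast
  note F = affine_coordsD[OF this]
  obtain e where e: "bij_betw e {..<card F} F"
    using ex_bij_betw_nat_finite[OF F(1)] unfolding atLeast0LessThan by blast
  define n where "n = card F"
  define \<phi> where "\<phi> x = (\<lambda>i. if i < n then e i x else 0)" for x
  define e' where "e' = inv_into {..<n} e"
  have e: "\<And>i. i < n \<Longrightarrow> e i \<in> F" "\<And>f. f \<in> F \<Longrightarrow> e' f < n" "\<And>f. f \<in> F \<Longrightarrow> e (e' f) = f"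
    "\<And>i. i < n \<Longrightarrow> e' (e i) = i"
    using e unfolding n_def e'_def by (auto simp: bij_betw_def inv_into_into f_inv_into_f)
      (metis inv_into_into lessThan_iff)
  let ?Z = "\<phi> ` S" and ?A = "{x::nat \<Rightarrow> complex. \<forall>i\<ge>n. x i = 0}" and ?D = "(\<lambda>i x. x i) ` {..<n} :: ((nat \<Rightarrow> complex) \<Rightarrow> complex) set"
  have inj: "inj_on \<phi> S"
  proof (rule inj_onI)
    fix x y assume xy: "x \<in> S" "y \<in> S" "\<phi> x = \<phi> y"
    have "f x = f y" if "f \<in> F" for f
      using fun_cong[OF xy(3), of "e' f"] e(2,3)[OF that] by (simp add: \<phi>_def)
    then show "x = y" using F(4) xy by blast
  qed
  have Z: "?Z \<subseteq> ?A" by (auto simp: \<phi>_def)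
  have iso: "poly_iso S C ?Z ?D \<phi>"
    unfolding poly_iso_def
  proof (intro conjI ballI)
    show "bij_betw \<phi> S ?Z" using inj by (simp add: bij_betw_def)
    fix d assume "d \<in> ?D"
    then obtain i where i: "i < n" "d = (\<lambda>x. x i)" by auto
    then obtain p where "p \<in> subalgebra C" "\<forall>x\<in>S. e i x = p x" using F(2) e(1) by blast
    then show "\<exists>p\<in>subalgebra C. \<forall>x\<in>S. d (\<phi> x) = p x" using i by (auto simp: \<phi>_def)
  next
    fix c assume "c \<in> C"
    then obtain p where p: "p \<in> subalgebra F" "\<forall>x\<in>S. c x = p x" using F(3) by blast
    have "\<exists>q\<in>subalgebra ?D. \<forall>x\<in>UNIV. p x = q (\<phi> x)"
      using p(1)
    proof induction
      case (gen f)
      then show ?case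
        by (intro bexI[of _ "\<lambda>x. x (e' f)"] subalgebra.gen) (use e in \<open>auto simp: \<phi>_def\<close>)
    next
      case (const c) show ?case by (rule bexI[of _ "\<lambda>_. c"]) (auto intro: subalgebra.const)
    next
      case (add f g)
      then obtain p q where "p \<in> subalgebra ?D" "q \<in> subalgebra ?D"
        "\<forall>x\<in>UNIV. f x = p (\<phi> x)" "\<forall>x\<in>UNIV. g x = q (\<phi> x)" by blast
      then show ?case by (intro bexI[of _ "\<lambda>x. p x + q x"]) (auto intro: subalgebra.intros)
    next
      case (mult f g)
      then obtain p q where "p \<in> subalgebra ?D" "q \<in> subalgebra ?D"
        "\<forall>x\<in>UNIV. f x = p (\<phi> x)" "\<forall>x\<in>UNIV. g x = q (\<phi> x)" by blast
      then show ?case by (intro bexI[of _ "\<lambda>x. p x * q x"]) (auto intro: subalgebra.intros)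
    qed
    then show "\<exists>p\<in>subalgebra ?D. \<forall>x\<in>S. c x = p (\<phi> x)" using p by auto
  qed
  have cl: "closedin (zar (affine_space n)) ?Z"
    unfolding closedin_def compatible_affine_space
  proof
    show "?Z \<subseteq> pts (chart_space {(?A, ?D)})" using Z by (simp add: pts_chart_space)
    show "openin (zar (chart_space {(?A, ?D)})) (pts (chart_space {(?A, ?D)}) - ?Z)"
      unfolding openin_near_iff[OF compatible_single]
    proof
      fix z assume "z \<in> pts (chart_space {(?A, ?D)}) - ?Z"
      then have z: "z \<in> ?A" "z \<notin> ?Z" by (auto simp: pts_chart_space)
      \<comment> \<open>Closedness of the image: a point of affine space outside it is not the tuple
        of any point of \<open>S\<close>, so it violates a polynomial relation \<open>P\<close>, and
        \<open>P \<noteq> 0\<close> is a principal neighbourhood missing the image.\<close>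
      have "\<not> (\<exists>x\<in>S. \<forall>f\<in>F. f x = z (e' f))"
      proof
        assume "\<exists>x\<in>S. \<forall>f\<in>F. f x = z (e' f)"
        then obtain x where x: "x \<in> S" "\<forall>f\<in>F. f x = z (e' f)" by blast
        have "\<phi> x = z"
        proof
          show "\<phi> x i = z i" for i using bspec[OF x(2) e(1)[of i]] e(4) z(1) by (cases "i < n") (auto simp: \<phi>_def)
        qed
        then show False using x z by blast
      qed
      then obtain P where P: "P \<in> subalgebra ((\<lambda>f z. z f) ` F)" "\<forall>x\<in>S. P (\<lambda>f. f x) = 0"
        "P (\<lambda>f. z (e' f)) \<noteq> 0" using F(5)[of "\<lambda>f. z (e' f)"] by blast
      let ?s = "\<lambda>z. P (\<lambda>f. z (e' f))"
      have s: "?s \<in> subalgebra ?D"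
        by (rule subalgebra_comp[OF P(1)]) (use e in \<open>auto intro!: subalgebra.gen\<close>)
      have cong: "P z' = P z''" if "\<forall>f\<in>F. z' f = z'' f" for z' z''
        using P(1) by induction (use that in auto)
      have "?s y = 0" if "y \<in> ?Z" for y
      proof -
        obtain x where x: "x \<in> S" "y = \<phi> x" using \<open>y \<in> ?Z\<close> by blast
        have "P (\<lambda>f. y (e' f)) = P (\<lambda>f. f x)"
          by (rule cong) (use x e in \<open>auto simp: \<phi>_def\<close>)
        then show ?thesis using P(2) x by simp
      qed
      then have "near ?A ?D z (\<lambda>y. y \<in> ?A - ?Z)" unfolding near_def
        by (intro bexI[of _ ?s] s) (use P in auto)
      then show "\<exists>(U, C)\<in>{(?A, ?D)}. z \<in> U \<and> near U C z (\<lambda>y. y \<in> pts (chart_space {(?A, ?D)}) - ?Z)"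
        using z by (simp add: pts_chart_space)
    qed
  qed
  have "induced (affine_space n) ?Z \<cong>\<^sub>V chart_space {(?Z, ?D)}"
    unfolding compatible_affine_space
    by (rule chart_space_single_in_chart[OF compatible_single]) (use Z in auto)
  then have "chart_space {(S, C)} \<cong>\<^sub>V induced (affine_space n) ?Z"
    using chart_space_poly_iso[OF iso] isomorphic_sym isomorphic_trans by blast
  with that[OF iso cl] show ?thesis by blast
qed


section \<open>Varieties given by atlases\<close>

text \<open>The set \<open>h \<noteq> 0\<close> in the product of the two charts is a principal
  neighbourhood of \<open>(x, y)\<close> that misses the diagonal.\<close>

definition separated :: "('a set \<times> ('a \<Rightarrow> complex) set) set \<Rightarrow> bool" where
  "separated \<A> \<longleftrightarrow> (\<forall>x\<in>pts (chart_space \<A>). \<forall>y\<in>pts (chart_space \<A>). x \<noteq> y \<longrightarrow>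
     (\<exists>U C V D h. (U, C) \<in> \<A> \<and> (V, D) \<in> \<A> \<and> x \<in> U \<and> y \<in> V \<and>
        h \<in> subalgebra ((\<lambda>c. c \<circ> fst) ` C \<union> (\<lambda>d. d \<circ> snd) ` D) \<and> h (x, y) \<noteq> 0 \<and>
        (\<forall>z\<in>U \<inter> V. h (z, z) = 0)))"

text \<open>Affineness and finiteness are asked of a covering subfamily only, since the moduli
  atlases contain a chart for every set \<open>J\<close> of basis vectors, and the monomials have
  infinitely many subsets in general.\<close>

definition variety_atlas :: "('a set \<times> ('a \<Rightarrow> complex) set) set \<Rightarrow> bool" where
  "variety_atlas \<A> \<longleftrightarrow> compatible \<A> \<and> separated \<A> \<and>
     (\<exists>\<B>\<subseteq>\<A>. finite \<B> \<and> \<Union>(fst ` \<B>) = \<Union>(fst ` \<A>) \<and> (\<forall>(U, C)\<in>\<B>. affine_chart U C))"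

lemma variety_atlasE:
  assumes "variety_atlas \<A>"
  obtains \<B> where "compatible \<A>" "separated \<A>" "\<B> \<subseteq> \<A>" "finite \<B>" "\<Union>(fst ` \<B>) = \<Union>(fst ` \<A>)"
    "\<And>U C. (U, C) \<in> \<B> \<Longrightarrow> affine_chart U C"
proof -
  from assms have *: "compatible \<A>" "separated \<A>"
    "\<exists>\<B>\<subseteq>\<A>. finite \<B> \<and> \<Union>(fst ` \<B>) = \<Union>(fst ` \<A>) \<and> (\<forall>(U, C)\<in>\<B>. affine_chart U C)"
    unfolding variety_atlas_def by simp_all
  from *(3) obtain \<B> where \<B>: "\<B> \<subseteq> \<A>"
    "finite \<B> \<and> \<Union>(fst ` \<B>) = \<Union>(fst ` \<A>) \<and> (\<forall>(U, C)\<in>\<B>. affine_chart U C)"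
    by (elim exE conjE) (rule that; (intro conjI)?; assumption)
  show ?thesis by (rule that[OF *(1,2) \<B>(1)]) (use \<B>(2) in auto)
qed

lemma pts_product_space: "pts (X \<times>\<^sub>V Y) = pts X \<times> pts Y"
proof
  show "pts X \<times> pts Y \<subseteq> pts (X \<times>\<^sub>V Y)"
  proof -
    have "(pts X \<times> pts Y, {f \<circ> fst |f. f \<in> reg X (pts X)} \<union> {g \<circ> snd |g. g \<in> reg Y (pts Y)}) \<in>
      {(U \<times> V, {f \<circ> fst |f. f \<in> reg X U} \<union> {g \<circ> snd |g. g \<in> reg Y V}) |U V.
        openin (zar X) U \<and> openin (zar Y) V}"
      by auto
    from imageI[OF this, of fst] show ?thesis
      unfolding product_space_def pts_chart_space fst_conv by (rule Union_upper)
  qed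
  show "pts (X \<times>\<^sub>V Y) \<subseteq> pts X \<times> pts Y"
    unfolding product_space_def pts_chart_space by (auto dest!: openin_subset)
qed

lemma variety_chart_space:
  assumes "variety_atlas \<A>" shows "variety (chart_space \<A>)"
proof -
  let ?X = "chart_space \<A>"
  obtain \<B> where comp: "compatible \<A>" and sep: "separated \<A>"
    and \<B>: "\<B> \<subseteq> \<A>" "finite \<B>" "\<Union>(fst ` \<B>) = \<Union>(fst ` \<A>)" "\<And>U C. (U, C) \<in> \<B> \<Longrightarrow> affine_chart U C"
    using variety_atlasE[of \<A>] assms by metis
  have diag: "closedin (zar (?X \<times>\<^sub>V ?X)) {(x, x) |x. x \<in> pts ?X}"
    unfolding closedin_def
  proof
    show "{(x, x) |x. x \<in> pts ?X} \<subseteq> pts (?X \<times>\<^sub>V ?X)" by (auto simp: pts_product_space)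
    show "openin (zar (?X \<times>\<^sub>V ?X)) (pts (?X \<times>\<^sub>V ?X) - {(x, x) |x. x \<in> pts ?X})"
    proof (subst openin_subopen, intro ballI)
      fix z assume "z \<in> pts (?X \<times>\<^sub>V ?X) - {(x, x) |x. x \<in> pts ?X}"
      then obtain x y where z: "z = (x, y)" "x \<in> pts ?X" "y \<in> pts ?X" "x \<noteq> y"
        by (auto simp: pts_product_space)
      then obtain U C V D h where *: "(U, C) \<in> \<A>" "(V, D) \<in> \<A>" "x \<in> U" "y \<in> V"
        "h \<in> subalgebra ((\<lambda>c. c \<circ> fst) ` C \<union> (\<lambda>d. d \<circ> snd) ` D)" "h (x, y) \<noteq> 0"
        "\<forall>z\<in>U \<inter> V. h (z, z) = 0" using sep unfolding separated_def by meson
      have reg: "c \<in> reg ?X U" if "(U, C) \<in> \<A>" "c \<in> C" for c U C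
      proof (rule regI)
        fix z assume "z \<in> U"
        then show "\<exists>(U, C)\<in>\<A>. z \<in> U \<and> frac_at U C z c"
          using that(1) frac_at_subalgebra[OF subalgebra.gen[OF that(2)]] by blast
      qed
      let ?G = "{f \<circ> fst |f. f \<in> reg ?X U} \<union> {g \<circ> snd |g. g \<in> reg ?X V}"
      have h: "h \<in> subalgebra ?G"
        by (rule subalgebra_closed[OF _ *(5)]) (use reg *(1,2) in \<open>auto intro!: subalgebra.gen\<close>)
      have "openin (zar (?X \<times>\<^sub>V ?X)) {z\<in>U \<times> V. h z \<noteq> 0}"
        unfolding product_space_def
        by (rule openin_principal[OF _ h]) (use openin_chart[OF *(1)] openin_chart[OF *(2)] in blast)
      moreover from openin_subset[OF this] have "{z\<in>U \<times> V. h z \<noteq> 0} \<subseteq> pts (?X \<times>\<^sub>V ?X) - {(x, x) |x. x \<in> pts ?X}"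
        using *(7) by auto
      ultimately show "\<exists>T. openin (zar (?X \<times>\<^sub>V ?X)) T \<and> z \<in> T \<and> T \<subseteq> pts (?X \<times>\<^sub>V ?X) - {(x, x) |x. x \<in> pts ?X}"
        using * z by blast
    qed
  qed
  have aff: "openin (zar ?X) U \<and> affine_variety (induced ?X U)" if U: "U \<in> fst ` \<B>" for U
  proof -
    obtain C where C: "(U, C) \<in> \<B>" using U by auto
    then have "induced ?X U \<cong>\<^sub>V chart_space {(U, C)}"
      using chart_space_single_in_chart[OF comp, of U C U] \<B>(1) by blast
    moreover obtain n Z where "closedin (zar (affine_space n)) Z" "chart_space {(U, C)} \<cong>\<^sub>V induced (affine_space n) Z"
      using affine_variety_chart_space[OF \<B>(4)[OF C]] by blast
    ultimately have "affine_variety (induced ?X U)"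
      unfolding affine_variety_def using isomorphic_trans by blast
    then show ?thesis using openin_chart C \<B>(1) by blast
  qed
  show ?thesis unfolding variety_def
    by (intro conjI sheaf_chart_space[OF comp] diag exI[of _ "fst ` \<B>"])
       (use \<B>(2,3) aff in \<open>auto simp: pts_chart_space\<close>)
qed

lemma variety_atlas_single:
  assumes "affine_chart S C" shows "variety_atlas {(S, C)}"
  unfolding variety_atlas_def
proof (intro conjI exI[of _ "{(S, C)}"])
  show "separated {(S, C)}" unfolding separated_def
  proof (intro ballI impI)
    fix x y assume "x \<in> pts (chart_space {(S, C)})" "y \<in> pts (chart_space {(S, C)})" "x \<noteq> y"
    then have xy: "x \<in> S" "y \<in> S" "x \<noteq> y" by (auto simp: pts_chart_space)
    then obtain p where p: "p \<in> subalgebra C" "p x \<noteq> p y" using affine_chart_points[OF assms] by blast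
    let ?G = "(\<lambda>c. c \<circ> fst) ` C \<union> (\<lambda>d. d \<circ> snd) ` C"
    have "(\<lambda>z. p (fst z)) \<in> subalgebra ?G" "(\<lambda>z. p (snd z)) \<in> subalgebra ?G"
      by (rule subalgebra_comp[OF p(1)]; force intro: subalgebra.gen simp: comp_def)+
    then have "(\<lambda>z. p (fst z) - p (snd z)) \<in> subalgebra ?G" by (rule subalgebra_diff)
    then show "\<exists>U C' V D h. (U, C') \<in> {(S, C)} \<and> (V, D) \<in> {(S, C)} \<and> x \<in> U \<and> y \<in> V \<and>
        h \<in> subalgebra ((\<lambda>c. c \<circ> fst) ` C' \<union> (\<lambda>d. d \<circ> snd) ` D) \<and> h (x, y) \<noteq> 0 \<and>
        (\<forall>z\<in>U \<inter> V. h (z, z) = 0)"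
      using xy p by (intro exI[of _ S] exI[of _ C] exI[of _ "\<lambda>z. p (fst z) - p (snd z)"]) auto
  qed
qed (use assms in \<open>auto intro: compatible_single\<close>)

lemma variety_atlas_restrict:
  assumes "variety_atlas \<A>" "openin (zar (chart_space \<A>)) (pts (chart_space \<A>) - S)"
  shows "variety_atlas (restrict_atlas \<A> S)"
proof -
  obtain \<B> where comp: "compatible \<A>" and sep: "separated \<A>"
    and \<B>: "\<B> \<subseteq> \<A>" "finite \<B>" "\<Union>(fst ` \<B>) = \<Union>(fst ` \<A>)" "\<And>U C. (U, C) \<in> \<B> \<Longrightarrow> affine_chart U C"
    using variety_atlasE[of \<A>] assms by metis
  show ?thesis unfolding variety_atlas_def
  proof (intro conjI compatible_restrict[OF comp] exI[of _ "restrict_atlas \<B> S"])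
    show "separated (restrict_atlas \<A> S)" unfolding separated_def
    proof (intro ballI impI)
      fix x y assume "x \<in> pts (chart_space (restrict_atlas \<A> S))" "y \<in> pts (chart_space (restrict_atlas \<A> S))" "x \<noteq> y"
      then have xy: "x \<in> S" "y \<in> S" "x \<noteq> y" "x \<in> pts (chart_space \<A>)" "y \<in> pts (chart_space \<A>)" by (auto simp: pts_restrict)
      then obtain U C V D h where *: "(U, C) \<in> \<A>" "(V, D) \<in> \<A>" "x \<in> U" "y \<in> V"
        "h \<in> subalgebra ((\<lambda>c. c \<circ> fst) ` C \<union> (\<lambda>d. d \<circ> snd) ` D)" "h (x, y) \<noteq> 0"
        "\<forall>z\<in>U \<inter> V. h (z, z) = 0" using sep unfolding separated_def by blast
      have r: "(U \<inter> S, C) \<in> restrict_atlas \<A> S" "(V \<inter> S, D) \<in> restrict_atlas \<A> S"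
        using image_eqI[OF _ *(1), of "(U \<inter> S, C)" "\<lambda>(U, C). (U \<inter> S, C)"]
          image_eqI[OF _ *(2), of "(V \<inter> S, D)" "\<lambda>(U, C). (U \<inter> S, C)"] 
        unfolding restrict_atlas_def by simp_all
      show "\<exists>U C V D h. (U, C) \<in> restrict_atlas \<A> S \<and> (V, D) \<in> restrict_atlas \<A> S \<and> x \<in> U \<and> y \<in> V \<and>
        h \<in> subalgebra ((\<lambda>c. c \<circ> fst) ` C \<union> (\<lambda>d. d \<circ> snd) ` D) \<and> h (x, y) \<noteq> 0 \<and>
        (\<forall>z\<in>U \<inter> V. h (z, z) = 0)"
        by (intro exI[of _ "U \<inter> S"] exI[of _ C] exI[of _ "V \<inter> S"] exI[of _ D] exI[of _ h])
           (use r * xy in auto)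
    qed
    show "restrict_atlas \<B> S \<subseteq> restrict_atlas \<A> S" "finite (restrict_atlas \<B> S)"
      using \<B> by (auto simp: restrict_atlas_def)
    show "\<Union>(fst ` restrict_atlas \<B> S) = \<Union>(fst ` restrict_atlas \<A> S)"
      using pts_restrict[of \<A> S] pts_restrict[of \<B> S] \<B>(3) by (simp add: pts_chart_space)
    have "affine_chart (U \<inter> S) C" if UC: "(U, C) \<in> \<B>" for U C
    proof (rule affine_chart_closed_subset[OF \<B>(4)[OF UC]])
      fix x assume "x \<in> U" "x \<notin> S"
      moreover have "(U, C) \<in> \<A>" using UC \<B>(1) by blast
      moreover from this have "U \<subseteq> pts (chart_space \<A>)" by (auto simp: pts_chart_space)
      ultimately have "near U C x (\<lambda>y. y \<in> pts (chart_space \<A>) - S)"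
        by (intro openin_near[OF comp assms(2)]) auto
      then show "near U C x (\<lambda>y. y \<notin> S)" by (rule near_mono) auto
    qed
    then show "\<forall>(U, C)\<in>restrict_atlas \<B> S. affine_chart U C" by (auto simp: restrict_atlas_def)
  qed
qed

section \<open>Classes in the Grothendieck ring\<close>

text \<open>Transport of structure along an injection. It serves to reach \<open>cvar\<close>, which
  admits only spaces with points in \<open>nat \<Rightarrow> complex\<close>, from spaces whose
  points are sets of vectors or polynomials.\<close>

definition push_atlas :: "('a \<Rightarrow> 'b) \<Rightarrow> ('a set \<times> ('a \<Rightarrow> complex) set) set \<Rightarrow> ('b set \<times> ('b \<Rightarrow> complex) set) set" where
  "push_atlas f \<A> = (\<lambda>(U, C). (f ` U, (\<lambda>c y. c (inv_into (\<Union>(fst ` \<A>)) f y)) ` C)) ` \<A>"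

lemma push_atlasI:
  "(U, C) \<in> \<A> \<Longrightarrow> (f ` U, (\<lambda>c y. c (inv_into (\<Union>(fst ` \<A>)) f y)) ` C) \<in> push_atlas f \<A>"
  unfolding push_atlas_def by force

lemma push_atlas:
  fixes f :: "'a \<Rightarrow> 'b"
  assumes "variety_atlas \<A>" "inj_on f (pts (chart_space \<A>))"
  shows "variety_atlas (push_atlas f \<A>)" "chart_space (push_atlas f \<A>) \<cong>\<^sub>V chart_space \<A>"
proof -
  obtain \<B> where comp: "compatible \<A>" and sep: "separated \<A>"
    and \<B>: "\<B> \<subseteq> \<A>" "finite \<B>" "\<Union>(fst ` \<B>) = \<Union>(fst ` \<A>)" "\<And>U C. (U, C) \<in> \<B> \<Longrightarrow> affine_chart U C"
    using variety_atlasE[of \<A>] assms by metis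
  define g where "g = inv_into (\<Union>(fst ` \<A>)) f"
  have inj: "inj_on f (\<Union>(fst ` \<A>))" using assms(2) by (simp add: pts_chart_space)
  have gf: "g (f x) = x" if "(U, C) \<in> \<A>" "x \<in> U" for x U C
    unfolding g_def by (rule inv_into_f_f[OF inj]) (use that in force)
  have inU: "f x \<in> f ` U \<longleftrightarrow> x \<in> U" if "(U, C) \<in> \<A>" "(V, D) \<in> \<A>" "x \<in> V" for x U C V D
    using gf that by (metis imageE imageI)
  have pushI: "(f ` U, (\<lambda>c y. c (g y)) ` C) \<in> push_atlas f \<A>" if "(U, C) \<in> \<A>" for U C
    using push_atlasI[OF that] unfolding g_def .
  have pushE: "\<exists>U C. (U, C) \<in> \<A> \<and> U' = f ` U \<and> C' = (\<lambda>c y. c (g y)) ` C"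
    if "(U', C') \<in> push_atlas f \<A>" for U' C'
    using that unfolding push_atlas_def g_def by auto
  have pts: "pts (chart_space (push_atlas f \<A>)) = f ` pts (chart_space \<A>)"
    unfolding push_atlas_def pts_chart_space by force
  have sub: "(\<lambda>y. s (g y)) \<in> subalgebra ((\<lambda>c y. c (g y)) ` C)" if "s \<in> subalgebra C" for s C
    by (rule subalgebra_comp[OF that]) (auto intro: subalgebra.gen)
  have near: "near (f ` U) ((\<lambda>c y. c (g y)) ` C) (f x) (\<lambda>y. P (g y))"
    if U: "(U, C) \<in> \<A>" "x \<in> U" and n: "near U C x P" for U C x P
  proof -
    obtain s where "s \<in> subalgebra C" "s x \<noteq> 0" "\<forall>y\<in>U. s y \<noteq> 0 \<longrightarrow> P y" using n unfolding near_def by blast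
    then show ?thesis unfolding near_def
      by (intro bexI[OF _ sub[of s]]) (use gf[OF U(1)] U(2) in auto)
  qed
  have frac: "frac_at (f ` U) ((\<lambda>c y. c (g y)) ` C) (f x) (\<lambda>y. h (g y))"
    if U: "(U, C) \<in> \<A>" "x \<in> U" and n: "frac_at U C x h" for U C x h
  proof -
    obtain p s where ps: "p \<in> subalgebra C" "s \<in> subalgebra C" "s x \<noteq> 0" "\<forall>y\<in>U. s y \<noteq> 0 \<longrightarrow> h y = p y / s y"
      using n unfolding frac_at_def by blast
    show ?thesis unfolding frac_at_def
      by (rule bexI[OF _ sub[OF ps(1)]], rule bexI[OF _ sub[OF ps(2)]])
         (use ps gf[OF U(1)] U(2) in auto)
  qed
  have comp': "compatible (push_atlas f \<A>)"
    unfolding compatible_def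
  proof clarify
    fix U' C' V' D' y assume "(U', C') \<in> push_atlas f \<A>" "(V', D') \<in> push_atlas f \<A>" and y: "y \<in> U'" "y \<in> V'"
    then obtain U C V D where *: "(U, C) \<in> \<A>" "U' = f ` U" "C' = (\<lambda>c y. c (g y)) ` C"
      "(V, D) \<in> \<A>" "V' = f ` V" "D' = (\<lambda>c y. c (g y)) ` D" using pushE by metis
    then obtain x where x: "x \<in> U" "y = f x" using y by blast
    then have xV: "x \<in> V" using inU[OF *(4,1) x(1)] y * by blast
    have 1: "near U' C' y (\<lambda>y. g y \<in> V)"
      using near[OF *(1) x(1) compatibleD(1)[OF comp *(1,4) x(1) xV]] * x by simp
    have "near U' C' y (\<lambda>y. y \<in> V')"
      by (rule near_mono[OF 1]) (use gf[OF *(1)] * in auto)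
    moreover have "frac_at U' C' y h" if "h \<in> D'" for h
      using frac[OF *(1) x(1) compatibleD(2)[OF comp *(1,4) x(1) xV]] * x that by auto
    ultimately show "near U' C' y (\<lambda>y. y \<in> V') \<and> (\<forall>f\<in>D'. frac_at U' C' y f)" by blast
  qed
  have aff: "affine_chart (f ` U) ((\<lambda>c y. c (g y)) ` C)" if UC: "(U, C) \<in> \<B>" for U C
  proof (rule affine_chart_poly_iso[OF _ \<B>(4)[OF UC]])
    have UA: "(U, C) \<in> \<A>" using UC \<B> by blast
    show "poly_iso (f ` U) ((\<lambda>c y. c (g y)) ` C) U C g"
      unfolding poly_iso_def
    proof (intro conjI ballI)
      show "bij_betw g (f ` U) U"
        by (rule bij_betwI[where g=f]) (use gf[OF UA] in auto)
      show "\<exists>p\<in>subalgebra ((\<lambda>c y. c (g y)) ` C). \<forall>x\<in>f ` U. d (g x) = p x" if "d \<in> C" for d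
        using that by (intro bexI[of _ "\<lambda>y. d (g y)"]) (auto intro: subalgebra.gen)
      show "\<exists>p\<in>subalgebra C. \<forall>x\<in>f ` U. c x = p (g x)" if "c \<in> (\<lambda>c y. c (g y)) ` C" for c
        using that by (auto intro: subalgebra.gen)
    qed
  qed
  show "variety_atlas (push_atlas f \<A>)"
    unfolding variety_atlas_def
  proof (intro conjI comp' exI[of _ "(\<lambda>(U, C). (f ` U, (\<lambda>c y. c (g y)) ` C)) ` \<B>"])
    show "separated (push_atlas f \<A>)" unfolding separated_def
    proof (intro ballI impI)
      fix x' y' assume "x' \<in> pts (chart_space (push_atlas f \<A>))" "y' \<in> pts (chart_space (push_atlas f \<A>))" "x' \<noteq> y'"
      then obtain x y where xy: "x \<in> pts (chart_space \<A>)" "y \<in> pts (chart_space \<A>)" "x' = f x" "y' = f y" "x \<noteq> y"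
        unfolding pts by blast
      then obtain U C V D h where *: "(U, C) \<in> \<A>" "(V, D) \<in> \<A>" "x \<in> U" "y \<in> V"
        "h \<in> subalgebra ((\<lambda>c. c \<circ> fst) ` C \<union> (\<lambda>d. d \<circ> snd) ` D)" "h (x, y) \<noteq> 0"
        "\<forall>z\<in>U \<inter> V. h (z, z) = 0" using sep unfolding separated_def by meson
      let ?C = "(\<lambda>c y. c (g y)) ` C" and ?D = "(\<lambda>c y. c (g y)) ` D" and ?h = "\<lambda>z. h (map_prod g g z)"
      have h: "?h \<in> subalgebra ((\<lambda>c. c \<circ> fst) ` ?C \<union> (\<lambda>d. d \<circ> snd) ` ?D)"
        by (rule subalgebra_comp[OF *(5)]) (force intro!: subalgebra.gen simp: comp_def)
      have "?h (z, z) = 0" if z: "z \<in> f ` U \<inter> f ` V" for z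
      proof -
        obtain w where "w \<in> U" "z = f w" using z by blast
        moreover from this have "w \<in> V" using inU[OF *(2,1)] z by blast
        ultimately show ?thesis using *(7) gf[OF *(1)] by simp
      qed
      then show "\<exists>U C V D h. (U, C) \<in> push_atlas f \<A> \<and> (V, D) \<in> push_atlas f \<A> \<and> x' \<in> U \<and> y' \<in> V \<and>
        h \<in> subalgebra ((\<lambda>c. c \<circ> fst) ` C \<union> (\<lambda>d. d \<circ> snd) ` D) \<and> h (x', y') \<noteq> 0 \<and>
        (\<forall>z\<in>U \<inter> V. h (z, z) = 0)"
        using h pushI[OF *(1)] pushI[OF *(2)] xy *(3,4,6) gf[OF *(1,3)] gf[OF *(2,4)]
        by (intro exI[of _ "f ` U"] exI[of _ ?C] exI[of _ "f ` V"] exI[of _ ?D] exI[of _ ?h]) simp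
    qed
    show "(\<lambda>(U, C). (f ` U, (\<lambda>c y. c (g y)) ` C)) ` \<B> \<subseteq> push_atlas f \<A>"
      using pushI \<B>(1) by auto
    show "finite ((\<lambda>(U, C). (f ` U, (\<lambda>c y. c (g y)) ` C)) ` \<B>)" using \<B> by simp
    have "\<Union>(fst ` (\<lambda>(U, C). (f ` U, (\<lambda>c y. c (g y)) ` C)) ` \<B>) = f ` \<Union>(fst ` \<B>)" by force
    then show "\<Union>(fst ` (\<lambda>(U, C). (f ` U, (\<lambda>c y. c (g y)) ` C)) ` \<B>) = \<Union>(fst ` push_atlas f \<A>)"
      using pts \<B>(3) by (simp add: pts_chart_space)
    show "\<forall>(U, C)\<in>(\<lambda>(U, C). (f ` U, (\<lambda>c y. c (g y)) ` C)) ` \<B>. affine_chart U C"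
      using aff by auto
  qed
  show "chart_space (push_atlas f \<A>) \<cong>\<^sub>V chart_space \<A>"
  proof (rule isomorphicI[where \<phi>=g and \<psi>=f])
    show "morphism (chart_space (push_atlas f \<A>)) (chart_space \<A>) g"
    proof (rule morphism_chart_space[OF comp' comp])
      fix y assume "y \<in> pts (chart_space (push_atlas f \<A>))"
      then have "y \<in> f ` pts (chart_space \<A>)" by (simp only: pts)
      then obtain x where x0: "y = f x" "x \<in> pts (chart_space \<A>)" by (elim imageE)
      from x0(2) have "x \<in> \<Union>(fst ` \<A>)" unfolding pts_chart_space .
      with x0(1) obtain U C where x: "y = f x" "(U, C) \<in> \<A>" "x \<in> U" by auto
      let ?C = "(\<lambda>c y. c (g y)) ` C"
      have "near (f ` U) ?C y (\<lambda>y. g y \<in> U)" by (rule near_always) (use gf[OF x(2)] in auto)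
      moreover have "\<forall>h\<in>C. frac_at (f ` U) ?C y (\<lambda>y. h (g y))" by (auto intro!: frac_at_subalgebra subalgebra.gen)
      ultimately show "\<exists>U C V D. (U, C) \<in> push_atlas f \<A> \<and> (V, D) \<in> \<A> \<and> y \<in> U \<and> g y \<in> V \<and>
        near U C y (\<lambda>y. g y \<in> V) \<and> (\<forall>h\<in>D. frac_at U C y (\<lambda>y. h (g y)))"
        using x gf[OF x(2,3)] pushI[OF x(2)] by (intro exI[of _ "f ` U"] exI[of _ ?C] exI[of _ U] exI[of _ C]) simp
    qed
    show "morphism (chart_space \<A>) (chart_space (push_atlas f \<A>)) f"
    proof (rule morphism_chart_space[OF comp comp'])
      fix x assume "x \<in> pts (chart_space \<A>)"
      then obtain U C where x: "(U, C) \<in> \<A>" "x \<in> U" unfolding pts_chart_space by force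
      let ?C = "(\<lambda>c y. c (g y)) ` C"
      have "near U C x (\<lambda>y. f y \<in> f ` U)" by (rule near_always) auto
      moreover have "frac_at U C x (\<lambda>y. h (f y))" if h: "h \<in> ?C" for h
      proof -
        obtain c where c: "c \<in> C" "h = (\<lambda>y. c (g y))" using h by blast
        show ?thesis
          by (rule frac_at_cong[OF frac_at_subalgebra[OF subalgebra.gen[OF c(1)]]])
             (rule near_always, use c gf[OF x(1)] in simp)
      qed
      ultimately show "\<exists>U C V D. (U, C) \<in> \<A> \<and> (V, D) \<in> push_atlas f \<A> \<and> x \<in> U \<and> f x \<in> V \<and>
        near U C x (\<lambda>y. f y \<in> V) \<and> (\<forall>h\<in>D. frac_at U C x (\<lambda>y. h (f y)))"
        using x pushI[OF x(1)] by (intro exI[of _ U] exI[of _ C] exI[of _ "f ` U"] exI[of _ ?C]) simp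
    qed
    show gf': "g (f x) = x" if "x \<in> pts (chart_space \<A>)" for x
      using that inv_into_f_f[OF inj] unfolding pts_chart_space g_def by blast
    show "f (g y) = y" if "y \<in> pts (chart_space (push_atlas f \<A>))" for y
      using that gf' unfolding pts by auto
  qed
qed

text \<open>\<open>cls\<close> chooses a representative with \<open>SOME\<close>, and only for
  representable spaces is the choice known to be isomorphic to the space. The scissor, product and
  point relations are therefore applied to such spaces.\<close>

definition representable :: "'a fspace \<Rightarrow> bool" where
  "representable X \<longleftrightarrow> (\<exists>Y. Rep_cvar Y \<cong>\<^sub>V X)"

lemma representable_iso: "representable X \<Longrightarrow> X \<cong>\<^sub>V Y \<Longrightarrow> representable Y"
  unfolding representable_def using isomorphic_trans by blast

lemma representable_chart_space:
  assumes "variety_atlas \<A>" shows "representable (chart_space \<A>)"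
proof -
  obtain \<B> where \<B>: "\<B> \<subseteq> \<A>" "finite \<B>" "\<Union>(fst ` \<B>) = \<Union>(fst ` \<A>)" "\<And>U C. (U, C) \<in> \<B> \<Longrightarrow> affine_chart U C"
    using variety_atlasE[of \<A>] assms by metis
  have "\<forall>b\<in>\<B>. \<exists>h :: 'a \<Rightarrow> nat \<Rightarrow> complex. inj_on h (fst b)"
  proof
    fix b assume "b \<in> \<B>"
    then have "affine_chart (fst b) (snd b)" using \<B>(4)[of "fst b" "snd b"] by simp
    then obtain n :: nat and Z \<phi> where "poly_iso (fst b) (snd b) Z ((\<lambda>i x. x i) ` {..<n}) \<phi>"
      by (rule affine_variety_chart_space) (rule that)
    then show "\<exists>h :: 'a \<Rightarrow> nat \<Rightarrow> complex. inj_on h (fst b)"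
      unfolding poly_iso_def bij_betw_def by blast
  qed
  then obtain h :: "'a set \<times> ('a \<Rightarrow> complex) set \<Rightarrow> 'a \<Rightarrow> nat \<Rightarrow> complex" where h: "\<And>b. b \<in> \<B> \<Longrightarrow> inj_on (h b) (fst b)" by metis
  obtain e :: "'a set \<times> ('a \<Rightarrow> complex) set \<Rightarrow> nat" where e: "inj_on e \<B>"
    using finite_imp_inj_to_nat_seg[OF \<B>(2)] by blast
  have "\<forall>x\<in>pts (chart_space \<A>). \<exists>b\<in>\<B>. x \<in> fst b"
    unfolding pts_chart_space \<B>(3)[symmetric] by blast
  then obtain b where b: "\<And>x. x \<in> pts (chart_space \<A>) \<Longrightarrow> b x \<in> \<B> \<and> x \<in> fst (b x)" by metis
  \<comment> \<open>Entry 0 records the number of a chart containing \<open>x\<close>, and the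
    remaining entries, shifted by one, the coordinates of \<open>x\<close> there. Equal values force
    the same chart and hence the same point.\<close>
  define f :: "'a \<Rightarrow> nat \<Rightarrow> complex" where "f x = (\<lambda>k. if k = 0 then of_nat (e (b x)) else h (b x) x (k - 1))" for x
  have inj: "inj_on f (pts (chart_space \<A>))"
  proof (rule inj_onI)
    fix x y assume x: "x \<in> pts (chart_space \<A>)" and y: "y \<in> pts (chart_space \<A>)" and eq: "f x = f y"
    have "e (b x) = e (b y)" using fun_cong[OF eq, of 0] by (simp add: f_def)
    then have bxy: "b x = b y" using b[OF x] b[OF y] e by (meson inj_onD)
    have "h (b x) x = h (b x) y"
    proof
      show "h (b x) x k = h (b x) y k" for k using fun_cong[OF eq, of "Suc k"] bxy by (simp add: f_def)
    qed
    then show "x = y" using h b x y bxy by (metis inj_onD)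
  qed
  let ?X = "chart_space (push_atlas f \<A>)"
  have "variety ?X" by (rule variety_chart_space[OF push_atlas(1)[OF assms inj]])
  then have "Rep_cvar (Abs_cvar ?X) = ?X" by (intro Abs_cvar_inverse) simp
  then show ?thesis unfolding representable_def using push_atlas(2)[OF assms inj] by metis
qed

section \<open>The relations of the Grothendieck ring for \<open>cls\<close>\<close>

lemma gen_class_iso: "Rep_cvar X \<cong>\<^sub>V Rep_cvar Y \<Longrightarrow> gen_class X = gen_class Y"
  by transfer (rule relation_ideal.rel, rule relations.iso)

lemma cls_eq_gen_class:
  assumes "Rep_cvar Y \<cong>\<^sub>V X" shows "cls X = gen_class Y"
proof -
  have "Rep_cvar (SOME Y. Rep_cvar Y \<cong>\<^sub>V X) \<cong>\<^sub>V X" using assms by (rule someI)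
  then show ?thesis unfolding cls_def
    using gen_class_iso isomorphic_trans[OF _ isomorphic_sym[OF assms]] by blast
qed

lemma cls_iso:
  assumes "X \<cong>\<^sub>V Y" shows "cls X = cls Y"
proof -
  have "Rep_cvar Z \<cong>\<^sub>V X \<longleftrightarrow> Rep_cvar Z \<cong>\<^sub>V Y" for Z
    using isomorphic_trans[OF _ assms] isomorphic_trans[OF _ isomorphic_sym[OF assms]] by blast
  then show ?thesis unfolding cls_def by simp
qed

text \<open>The scissor relation speaks about representatives, so the closed set is moved through an
  isomorphism to the representative of \<open>X\<close>.\<close>

lemma cls_scissor:
  assumes X: "representable X" and S: "closedin (zar X) S"
    and Z: "representable (induced X S)" and U: "representable (induced X (pts X - S))"
  shows "cls X = cls (induced X S) + cls (induced X (pts X - S))"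
proof -
  obtain X' Z' U' where r: "Rep_cvar X' \<cong>\<^sub>V X" "Rep_cvar Z' \<cong>\<^sub>V induced X S"
     "Rep_cvar U' \<cong>\<^sub>V induced X (pts X - S)"
    using assms unfolding representable_def by blast
  obtain \<phi> \<psi> where iso: "morphism (Rep_cvar X') X \<phi>" "morphism X (Rep_cvar X') \<psi>"
    "\<And>x. x \<in> pts (Rep_cvar X') \<Longrightarrow> \<psi> (\<phi> x) = x" "\<And>x. x \<in> pts X \<Longrightarrow> \<phi> (\<psi> x) = x"
    using r(1) unfolding isomorphic_def by blast
  let ?S = "pts (Rep_cvar X') \<inter> \<phi> -` S"
  have eq: "pts (Rep_cvar X') - ?S = pts (Rep_cvar X') \<inter> \<phi> -` (pts X - S)"
    using morphism_maps[OF iso(1)] by auto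
  have "closedin (zar (Rep_cvar X')) ?S"
    unfolding closedin_def eq using morphism_openin[OF iso(1)] S unfolding closedin_def by blast
  moreover have "Rep_cvar Z' \<cong>\<^sub>V induced (Rep_cvar X') ?S"
    using isomorphic_trans[OF r(2) isomorphic_sym[OF isomorphic_induced[where \<phi>=\<phi> and \<psi>=\<psi>, OF iso]]] .
  moreover have "Rep_cvar U' \<cong>\<^sub>V induced (Rep_cvar X') (pts (Rep_cvar X') - ?S)"
    unfolding eq using isomorphic_trans[OF r(3) isomorphic_sym[OF isomorphic_induced[where \<phi>=\<phi> and \<psi>=\<psi>, OF iso]]] .
  ultimately have "gen X' - (gen Z' + gen U') \<in> relation_ideal"
    by (intro relation_ideal.rel relations.scissor)
  then have "gen_class X' = gen_class Z' + gen_class U'" by transfer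
  then show ?thesis using r cls_eq_gen_class by metis
qed

text \<open>Cutting the empty space along the empty closed set gives
  \<open>[X] = [X] + [X]\<close>.\<close>

lemma cls_empty:
  assumes "\<And>U C. (U, C) \<in> \<A> \<Longrightarrow> U = {}" shows "cls (chart_space \<A>) = 0"
proof -
  have comp: "compatible \<A>" using assms unfolding compatible_def by blast
  have pts: "pts (chart_space \<A>) = {}" using assms unfolding pts_chart_space by force
  have "variety_atlas \<A>" unfolding variety_atlas_def
    using comp pts by (auto simp: separated_def pts_chart_space intro!: exI[of _ "{}"])
  then have rep: "representable (chart_space \<A>)" by (rule representable_chart_space)
  have pts': "pts (induced (chart_space \<A>) {}) = {}" by (simp add: pts_induced)
  have iso: "induced (chart_space \<A>) {} \<cong>\<^sub>V chart_space \<A>"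
  proof (rule isomorphic_trans[OF induced_chart_space[OF comp]])
    show "chart_space (restrict_atlas \<A> {}) \<cong>\<^sub>V chart_space \<A>"
      by (rule isomorphicI[where \<phi>="\<lambda>x. x" and \<psi>="\<lambda>x. x"]; (rule morphism_chart_space)?)
         (use comp compatible_restrict[OF comp] pts in \<open>auto simp: pts_restrict\<close>)
  qed
  have "cls (chart_space \<A>) = cls (induced (chart_space \<A>) {}) + cls (induced (chart_space \<A>) (pts (chart_space \<A>) - {}))"
    using cls_scissor[OF rep, of "{}"] representable_iso[OF rep isomorphic_sym[OF iso]] pts by simp
  then show ?thesis using cls_iso[OF iso] pts by simp
qed

text \<open>Charts are removed one after another, each time one that meets no other stratum.\<close>

theorem cls_stratification:
  assumes "finite I" "variety_atlas \<A>"
    and chart: "\<And>i. i \<in> I \<Longrightarrow> (U i, C i) \<in> \<A>" "\<And>i. i \<in> I \<Longrightarrow> affine_chart (U i) (C i)"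
    and T: "\<And>i. i \<in> I \<Longrightarrow> T i \<subseteq> U i" "pts (chart_space \<A>) = (\<Union>i\<in>I. T i)"
    and disj: "\<And>i j. i \<in> I \<Longrightarrow> j \<in> I \<Longrightarrow> i \<noteq> j \<Longrightarrow> T i \<inter> T j = {}"
    and ord: "wf R" "\<And>i j x. i \<in> I \<Longrightarrow> j \<in> I \<Longrightarrow> i \<noteq> j \<Longrightarrow> x \<in> T i \<Longrightarrow> x \<in> U j \<Longrightarrow> (i, j) \<in> R"
  shows "cls (chart_space \<A>) = (\<Sum>i\<in>I. cls (chart_space {(T i, C i)}))"
  using assms
proof (induction "card I" arbitrary: I \<A> U)
  case 0
  then have I: "I = {}" by simp
  have "cls (chart_space \<A>) = 0"
    by (rule cls_empty) (use 0 I in \<open>auto simp: pts_chart_space\<close>)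
  then show ?case using I by simp
next
  case (Suc n)
  let ?X = "chart_space \<A>"
  have comp: "compatible \<A>" using Suc.prems(2) unfolding variety_atlas_def by blast
  have "I \<noteq> {}" using Suc.hyps(2) by auto
  then obtain i where i: "i \<in> I" "\<And>j. (j, i) \<in> R \<Longrightarrow> j \<notin> I"
    using wfE_min[OF Suc.prems(8)] by (metis ex_in_conv)
  note UA = Suc.prems(3)[OF i(1)]
  have "U i \<subseteq> pts ?X" using UA by (auto simp: pts_chart_space)
  \<comment> \<open>By minimality of \<open>i\<close> no other stratum meets the chart
    \<open>U i\<close>, so the stratum fills its chart, which is open. The rest is closed and
    contains all other strata.\<close>
  then have Ti: "T i = U i" using Suc.prems(5)[OF i(1)] Suc.prems(6,9) i by blast
  let ?S = "pts ?X - U i" and ?\<B> = "restrict_atlas \<A> (pts ?X - U i)"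
  have compl: "pts ?X - ?S = U i" using \<open>U i \<subseteq> pts ?X\<close> by blast
  have op: "openin (zar ?X) (pts ?X - ?S)" unfolding compl by (rule openin_chart[OF UA])
  have vB: "variety_atlas ?\<B>" by (rule variety_atlas_restrict[OF Suc.prems(2) op])
  have isoZ: "induced ?X ?S \<cong>\<^sub>V chart_space ?\<B>" by (rule induced_chart_space[OF comp])
  have isoU: "induced ?X (pts ?X - ?S) \<cong>\<^sub>V chart_space {(U i, C i)}"
    unfolding compl by (rule chart_space_single_in_chart[OF comp UA]) simp
  have "cls ?X = cls (induced ?X ?S) + cls (induced ?X (pts ?X - ?S))"
  proof (rule cls_scissor)
    show "representable ?X" by (rule representable_chart_space[OF Suc.prems(2)])
    show "closedin (zar ?X) ?S" using openin_chart[OF UA] by blast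
    show "representable (induced ?X ?S)"
      by (rule representable_iso[OF representable_chart_space[OF vB] isomorphic_sym[OF isoZ]])
    show "representable (induced ?X (pts ?X - ?S))"
      by (rule representable_iso[OF representable_chart_space[OF variety_atlas_single[OF Suc.prems(4)[OF i(1)]]]
            isomorphic_sym[OF isoU]])
  qed
  also have "\<dots> = cls (chart_space ?\<B>) + cls (chart_space {(T i, C i)})"
    using cls_iso[OF isoZ] cls_iso[OF isoU] Ti by simp
  also have "cls (chart_space ?\<B>) = (\<Sum>j\<in>I - {i}. cls (chart_space {(T j, C j)}))"
  \<comment> \<open>The remaining strata keep their coordinates. Their charts shrink to the closed
    complement of \<open>U i\<close> and stay affine, since closed subsets of affine charts are
    affine.\<close>
  proof (rule Suc.hyps(1)[where U="\<lambda>j. U j \<inter> ?S"])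
    show "n = card (I - {i})" "finite (I - {i})" using Suc.hyps(2) Suc.prems(1) i by auto
    show "variety_atlas ?\<B>" by fact
    show "wf R" by fact
    show "pts (chart_space ?\<B>) = (\<Union>j\<in>I - {i}. T j)"
      using Suc.prems(6,7) i(1) Ti unfolding pts_restrict by blast
    fix j assume j: "j \<in> I - {i}"
    show "(U j \<inter> ?S, C j) \<in> ?\<B>"
      using image_eqI[OF _ Suc.prems(3)[of j], of "(U j \<inter> ?S, C j)" "\<lambda>(U, C). (U \<inter> ?S, C)"] j
      unfolding restrict_atlas_def by simp
    show "affine_chart (U j \<inter> ?S) (C j)"
    proof (rule affine_chart_closed_subset[OF Suc.prems(4)])
      show "j \<in> I" using j by blast
      fix x assume x: "x \<in> U j" "x \<notin> ?S"
      have jA: "(U j, C j) \<in> \<A>" using Suc.prems(3) j by blast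
      then have "x \<in> U i" using x by (auto simp: pts_chart_space)
      from near_mono[OF compatibleD(1)[OF comp jA UA x(1) this]]
      show "near (U j) (C j) x (\<lambda>y. y \<notin> ?S)" by auto
    qed
    have "T j \<inter> T i = {}" using Suc.prems(7) i j by blast
    moreover have "T j \<subseteq> pts ?X" using Suc.prems(6) j by blast
    ultimately show "T j \<subseteq> U j \<inter> ?S" using Suc.prems(5)[of j] j Ti by blast
    fix k assume k: "k \<in> I - {i}" "j \<noteq> k"
    show "T j \<inter> T k = {}" using Suc.prems(7) j k by blast
    show "(j, k) \<in> R" if "x \<in> T j" "x \<in> U k \<inter> ?S" for x
      using Suc.prems(9) j k that by blast
  qed
  finally show ?case
    using sum.remove[OF Suc.prems(1) i(1), of "\<lambda>j. cls (chart_space {(T j, C j)})"] by (simp add: add.commute)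
qed

section \<open>Products\<close>

text \<open>For arbitrary factors nothing ensures that the product atlas is compatible, so
  continuity is checked on the generating sets and regularity on the defining quotients. Both reduce
  to pulling back the coordinates factor by factor.\<close>

lemma morphism_product_space:
  assumes "morphism X X' \<phi>" "morphism Y Y' \<psi>"
  shows "morphism (X \<times>\<^sub>V Y) (X' \<times>\<^sub>V Y') (map_prod \<phi> \<psi>)"
proof -
  let ?\<Phi> = "map_prod \<phi> \<psi>"
  define G' where "G' = (\<lambda>U V. {f \<circ> fst |f. f \<in> reg X' U} \<union> {g \<circ> snd |g. g \<in> reg Y' V})"
  define G where "G = (\<lambda>U V. {f \<circ> fst |f. f \<in> reg X U} \<union> {g \<circ> snd |g. g \<in> reg Y V})"
  define A where "A = {(U \<times> V, G U V) |U V. openin (zar X) U \<and> openin (zar Y) V}"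
  define A' where "A' = {(U \<times> V, G' U V) |U V. openin (zar X') U \<and> openin (zar Y') V}"
  have XY: "X \<times>\<^sub>V Y = chart_space A" "X' \<times>\<^sub>V Y' = chart_space A'"
    unfolding product_space_def A_def A'_def G_def G'_def by auto
  let ?pU = "\<lambda>U. pts X \<inter> \<phi> -` U" and ?pV = "\<lambda>V. pts Y \<inter> \<psi> -` V"
  have chart: "(?pU U \<times> ?pV V, G (?pU U) (?pV V)) \<in> A" if "openin (zar X') U" "openin (zar Y') V" for U V
    unfolding A_def using morphism_openin[OF assms(1) that(1)] morphism_openin[OF assms(2) that(2)] by blast
  have alg: "(\<lambda>z. q (?\<Phi> z)) \<in> subalgebra (G (?pU U) (?pV V))"
    if UV: "openin (zar X') U" "openin (zar Y') V" and q: "q \<in> subalgebra (G' U V)" for U V q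
  proof (rule subalgebra_comp[OF q])
    fix g assume "g \<in> G' U V"
    then consider f where "f \<in> reg X' U" "g = f \<circ> fst" | f where "f \<in> reg Y' V" "g = f \<circ> snd"
      unfolding G'_def by blast
    then show "(\<lambda>z. g (?\<Phi> z)) \<in> subalgebra (G (?pU U) (?pV V))"
    proof cases
      case 1
      have "(f \<circ> \<phi>) \<circ> fst \<in> G (?pU U) (?pV V)"
        unfolding G_def using morphism_reg[OF assms(1) UV(1) 1(1)] by blast
      moreover have "(\<lambda>z. g (?\<Phi> z)) = (f \<circ> \<phi>) \<circ> fst" using 1 by auto
      ultimately show ?thesis by (simp only: subalgebra.gen)
    next
      case 2
      have "(f \<circ> \<psi>) \<circ> snd \<in> G (?pU U) (?pV V)"
        unfolding G_def using morphism_reg[OF assms(2) UV(2) 2(1)] by blast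
      moreover have "(\<lambda>z. g (?\<Phi> z)) = (f \<circ> \<psi>) \<circ> snd" using 2 by auto
      ultimately show ?thesis by (simp only: subalgebra.gen)
    qed
  qed
  have maps: "?\<Phi> z \<in> pts (X' \<times>\<^sub>V Y')" if "z \<in> pts (X \<times>\<^sub>V Y)" for z
    using that morphism_maps[OF assms(1)] morphism_maps[OF assms(2)] by (auto simp: pts_product_space)
  have "continuous_map (zar (X \<times>\<^sub>V Y)) (zar (X' \<times>\<^sub>V Y')) ?\<Phi>"
    unfolding XY(2) chart_space_def fspace.simps
  proof (rule continuous_on_generated_topo)
    fix W assume "W \<in> {{x \<in> U. q x \<noteq> 0} |U C q. (U, C) \<in> A' \<and> q \<in> subalgebra C}"
    then obtain U V q where *: "W = {x \<in> U \<times> V. q x \<noteq> 0}" "openin (zar X') U" "openin (zar Y') V" "q \<in> subalgebra (G' U V)"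
      unfolding A'_def by blast
    have "?\<Phi> -` W \<inter> pts (X \<times>\<^sub>V Y) = {z \<in> ?pU U \<times> ?pV V. q (?\<Phi> z) \<noteq> 0}"
      using * by (auto simp: pts_product_space)
    then show "openin (zar (X \<times>\<^sub>V Y)) (?\<Phi> -` W \<inter> pts (X \<times>\<^sub>V Y))"
      using openin_principal[OF chart[OF *(2,3)] alg[OF *(2-4)]] unfolding XY by simp
  next
    have "pts (X' \<times>\<^sub>V Y') \<subseteq> \<Union> {{x \<in> U. q x \<noteq> 0} |U C q. (U, C) \<in> A' \<and> q \<in> subalgebra C}"
      unfolding XY chart_space_def by simp
    then show "?\<Phi> ` pts (X \<times>\<^sub>V Y) \<subseteq> \<Union> {{x \<in> U. q x \<noteq> 0} |U C q. (U, C) \<in> A' \<and> q \<in> subalgebra C}"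
      by (intro image_subsetI, elim subsetD, intro maps)
  qed
  moreover have "h \<circ> ?\<Phi> \<in> reg (X \<times>\<^sub>V Y) (pts (X \<times>\<^sub>V Y) \<inter> ?\<Phi> -` W)" if h: "h \<in> reg (X' \<times>\<^sub>V Y') W" for h W
  proof -
    have "\<exists>(U, C)\<in>A. \<exists>p\<in>subalgebra C. \<exists>q\<in>subalgebra C. z \<in> U \<and> q z \<noteq> 0 \<and>
        (\<forall>y\<in>(pts (X \<times>\<^sub>V Y) \<inter> ?\<Phi> -` W) \<inter> U. q y \<noteq> 0 \<longrightarrow> (h \<circ> ?\<Phi>) y = p y / q y)"
      if z: "z \<in> pts (X \<times>\<^sub>V Y) \<inter> ?\<Phi> -` W" for z
    proof -
      have "?\<Phi> z \<in> W" using z by simp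
      with h have "\<exists>(U, C)\<in>A'. \<exists>p\<in>subalgebra C. \<exists>q\<in>subalgebra C. ?\<Phi> z \<in> U \<and> q (?\<Phi> z) \<noteq> 0 \<and>
        (\<forall>y\<in>W \<inter> U. q y \<noteq> 0 \<longrightarrow> h y = p y / q y)" unfolding XY chart_space_def by simp
      then obtain Q C p q where Q: "(Q, C) \<in> A'" "p \<in> subalgebra C" "q \<in> subalgebra C"
        "?\<Phi> z \<in> Q" "q (?\<Phi> z) \<noteq> 0" "\<forall>y\<in>W \<inter> Q. q y \<noteq> 0 \<longrightarrow> h y = p y / q y" by blast
      from Q(1) obtain U V where "openin (zar X') U" "openin (zar Y') V" "Q = U \<times> V" "C = G' U V"
        unfolding A'_def by blast
      with Q have *: "openin (zar X') U" "openin (zar Y') V" "p \<in> subalgebra (G' U V)"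
        "q \<in> subalgebra (G' U V)" "?\<Phi> z \<in> U \<times> V" "q (?\<Phi> z) \<noteq> 0"
        "\<forall>y\<in>W \<inter> U \<times> V. q y \<noteq> 0 \<longrightarrow> h y = p y / q y"
        by simp_all
      show ?thesis
        by (rule bexI[OF _ chart[OF *(1,2)]], rule case_prodI,
            rule bexI[OF _ alg[OF *(1-3)]], rule bexI[OF _ alg[OF *(1,2,4)]])
           (use * z in \<open>auto simp: pts_product_space\<close>)
    qed
    then show ?thesis unfolding XY chart_space_def by simp
  qed
  ultimately show ?thesis unfolding morphism_def by blast
qed

lemma product_space_iso:
  assumes "X \<cong>\<^sub>V X'" "Y \<cong>\<^sub>V Y'" shows "X \<times>\<^sub>V Y \<cong>\<^sub>V X' \<times>\<^sub>V Y'"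
proof -
  obtain \<phi> \<phi>' where 1: "morphism X X' \<phi>" "morphism X' X \<phi>'"
    "\<And>x. x \<in> pts X \<Longrightarrow> \<phi>' (\<phi> x) = x" "\<And>x. x \<in> pts X' \<Longrightarrow> \<phi> (\<phi>' x) = x"
    using assms(1) unfolding isomorphic_def by blast
  obtain \<psi> \<psi>' where 2: "morphism Y Y' \<psi>" "morphism Y' Y \<psi>'"
    "\<And>x. x \<in> pts Y \<Longrightarrow> \<psi>' (\<psi> x) = x" "\<And>x. x \<in> pts Y' \<Longrightarrow> \<psi> (\<psi>' x) = x"
    using assms(2) unfolding isomorphic_def by blast
  show ?thesis
    by (rule isomorphicI[OF morphism_product_space[OF 1(1) 2(1)] morphism_product_space[OF 1(2) 2(2)]])
       (use 1 2 in \<open>auto simp: pts_product_space\<close>)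
qed

text \<open>The product carries one chart for each pair of open sets, with all regular functions as
  coordinates. These are local fractions in the coordinates of the factors, so that atlas is
  compatible and describes the same space as the single chart on
  \<open>S \<times> T\<close>.\<close>

lemma product_space_single:
  fixes S :: "'a set" and T :: "'b set"
  shows "chart_space {(S, C)} \<times>\<^sub>V chart_space {(T, D)} \<cong>\<^sub>V
     chart_space {(S \<times> T, (\<lambda>c. c \<circ> fst) ` C \<union> (\<lambda>d. d \<circ> snd) ` D)}"
proof -
  let ?X = "chart_space {(S, C)}" and ?Y = "chart_space {(T, D)}"
  define G where "G = (\<lambda>U V. {f \<circ> fst |f. f \<in> reg ?X U} \<union> {g \<circ> snd |g. g \<in> reg ?Y V})"
  define A where "A = {(U \<times> V, G U V) |U V. openin (zar ?X) U \<and> openin (zar ?Y) V}"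
  define E where "E = (\<lambda>c. c \<circ> fst) ` C \<union> (\<lambda>d. d \<circ> snd) ` D"
  have pts: "pts ?X = S" "pts ?Y = T" by (simp_all add: pts_chart_space)
  have op: "openin (zar ?X) S" "openin (zar ?Y) T" using openin_chart[of S C "{(S, C)}"] openin_chart[of T D "{(T, D)}"] by auto
  have regX: "s \<in> reg ?X U" if "s \<in> subalgebra C" "U \<subseteq> S" for s U
    by (rule regI) (use that frac_at_subalgebra[OF that(1)] in auto)
  have regY: "s \<in> reg ?Y U" if "s \<in> subalgebra D" "U \<subseteq> T" for s U
    by (rule regI) (use that frac_at_subalgebra[OF that(1)] in auto)
  have E_G: "subalgebra E \<subseteq> subalgebra (G U V)" if "U \<subseteq> S" "V \<subseteq> T" for U V
  proof
    fix f assume f: "f \<in> subalgebra E"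
    have "E \<subseteq> G U V"
      unfolding E_def G_def using regX[OF subalgebra.gen that(1)] regY[OF subalgebra.gen that(2)] by blast
    then show "f \<in> subalgebra (G U V)" using subalgebra_closed[OF _ f] subalgebra.gen by blast
  qed
  have CE: "(\<lambda>z. s (fst z)) \<in> subalgebra E" if "s \<in> subalgebra C" for s
    by (rule subalgebra_comp[OF that]) (auto intro!: subalgebra.gen simp: E_def comp_def)
  have DE: "(\<lambda>z. s (snd z)) \<in> subalgebra E" if "s \<in> subalgebra D" for s
    by (rule subalgebra_comp[OF that]) (auto intro!: subalgebra.gen simp: E_def comp_def)
  have nearE: "near (S \<times> T) E (x, y) (\<lambda>z. z \<in> U \<times> V)"
    if "openin (zar ?X) U" "openin (zar ?Y) V" "x \<in> U" "y \<in> V" for x y U V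
  proof -
    have "x \<in> S" "y \<in> T" using that openin_subset pts by blast+
    then have "near S C x (\<lambda>x. x \<in> U)" "near T D y (\<lambda>y. y \<in> V)"
      using openin_near[OF compatible_single that(1,3)] openin_near[OF compatible_single that(2,4)] by auto
    then obtain s t where s: "s \<in> subalgebra C" "s x \<noteq> 0" "\<forall>y\<in>S. s y \<noteq> 0 \<longrightarrow> y \<in> U"
      and t: "t \<in> subalgebra D" "t y \<noteq> 0" "\<forall>y\<in>T. t y \<noteq> 0 \<longrightarrow> y \<in> V" unfolding near_def by blast
    show ?thesis unfolding near_def
      by (rule bexI[OF _ subalgebra.mult[OF CE[OF s(1)] DE[OF t(1)]]]) (use s t in auto)
  qed
  have fracE: "frac_at (S \<times> T) E (x, y) g"
    if UV: "openin (zar ?X) U" "openin (zar ?Y) V" "x \<in> U" "y \<in> V" and g: "g \<in> G U V" for x y U V g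
  proof -
    have xy: "x \<in> S" "y \<in> T" using UV openin_subset pts by blast+
    consider f where "f \<in> reg ?X U" "g = f \<circ> fst" | f where "f \<in> reg ?Y V" "g = f \<circ> snd"
      using g unfolding G_def by blast
    then show ?thesis
    proof cases
      case 1
      have "frac_at S C x f" using reg_frac_at[OF compatible_single UV(1) 1(1) UV(3)] xy by blast
      then obtain p s where "p \<in> subalgebra C" "s \<in> subalgebra C" "s x \<noteq> 0" "\<forall>y\<in>S. s y \<noteq> 0 \<longrightarrow> f y = p y / s y"
        unfolding frac_at_def by blast
      then show ?thesis unfolding frac_at_def
        by (intro bexI[OF _ CE[of p]] bexI[OF _ CE[of s]]) (use 1 in auto)
    next
      case 2
      have "frac_at T D y f" using reg_frac_at[OF compatible_single UV(2) 2(1) UV(4)] xy by blast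
      then obtain p s where "p \<in> subalgebra D" "s \<in> subalgebra D" "s y \<noteq> 0" "\<forall>y\<in>T. s y \<noteq> 0 \<longrightarrow> f y = p y / s y"
        unfolding frac_at_def by blast
      then show ?thesis unfolding frac_at_def
        by (intro bexI[OF _ DE[of p]] bexI[OF _ DE[of s]]) (use 2 in auto)
    qed
  qed
  have sub: "subalgebra E \<subseteq> subalgebra (G U V)" "U \<times> V \<subseteq> S \<times> T" if "openin (zar ?X) U" "openin (zar ?Y) V" for U V
    using E_G[of U V] openin_subset[OF that(1)] openin_subset[OF that(2)] pts by auto
  have nearG: "near (U \<times> V) (G U V) z P" if "openin (zar ?X) U" "openin (zar ?Y) V" "near (S \<times> T) E z P" for U V z P
    using that(3) sub[OF that(1,2)] unfolding near_def by blast
  have fracG: "frac_at (U \<times> V) (G U V) z P" if "openin (zar ?X) U" "openin (zar ?Y) V" "frac_at (S \<times> T) E z P" for U V z P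
    using that(3) sub[OF that(1,2)] unfolding frac_at_def by blast
  have compA: "compatible A"
    unfolding compatible_def
  proof clarify
    fix W C1 W' C2 x y assume W: "(W, C1) \<in> A" "(W', C2) \<in> A" "(x, y) \<in> W" "(x, y) \<in> W'"
    from W(1,3) obtain U V where 1: "openin (zar ?X) U" "openin (zar ?Y) V" "W = U \<times> V" "C1 = G U V"
      unfolding A_def by blast
    from W(2,4) obtain U' V' where 2: "openin (zar ?X) U'" "openin (zar ?Y) V'" "W' = U' \<times> V'" "C2 = G U' V'"
      unfolding A_def by blast
    show "near W C1 (x, y) (\<lambda>z. z \<in> W') \<and> (\<forall>f\<in>C2. frac_at W C1 (x, y) f)"
      using nearG[OF 1(1,2) nearE[OF 2(1,2)]] fracG[OF 1(1,2) fracE[OF 2(1,2)]] 1 2 W(3,4) by blast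
  qed
  have "chart_space A \<cong>\<^sub>V chart_space {(S \<times> T, E)}"
  proof (rule isomorphicI[where \<phi>="\<lambda>x. x" and \<psi>="\<lambda>x. x"])
    have STA: "(S \<times> T, G S T) \<in> A" unfolding A_def using op by blast
    show "morphism (chart_space A) (chart_space {(S \<times> T, E)}) (\<lambda>x. x)"
    proof (rule morphism_chart_space[OF compA compatible_single])
      fix z assume "z \<in> pts (chart_space A)"
      then obtain U V where UV: "openin (zar ?X) U" "openin (zar ?Y) V" "z \<in> U \<times> V"
        unfolding pts_chart_space A_def by auto
      have "z \<in> S \<times> T" using UV sub(2)[OF UV(1,2)] by blast
      moreover have "\<forall>g\<in>E. frac_at (S \<times> T) (G S T) z g"
        using sub(1)[OF op] subalgebra.gen by (blast intro: frac_at_subalgebra)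
      ultimately show "\<exists>U C V D. (U, C) \<in> A \<and> (V, D) \<in> {(S \<times> T, E)} \<and> z \<in> U \<and> z \<in> V \<and>
          near U C z (\<lambda>y. y \<in> V) \<and> (\<forall>g\<in>D. frac_at U C z g)"
        using STA near_always[of "S \<times> T" "\<lambda>y. y \<in> S \<times> T" "G S T" z]
        by (intro exI[of _ "S \<times> T"] exI[of _ "G S T"] exI[of _ E]) simp
    qed
    show "morphism (chart_space {(S \<times> T, E)}) (chart_space A) (\<lambda>x. x)"
    proof (rule morphism_chart_space[OF compatible_single compA])
      fix z assume "z \<in> pts (chart_space {(S \<times> T, E)})"
      then obtain x y where z: "z = (x, y)" "x \<in> S" "y \<in> T" by (auto simp: pts_chart_space)
      have "\<forall>g\<in>G S T. frac_at (S \<times> T) E z g" using fracE[OF op z(2,3)] z(1) by simp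
      then show "\<exists>U C V D. (U, C) \<in> {(S \<times> T, E)} \<and> (V, D) \<in> A \<and> z \<in> U \<and> z \<in> V \<and>
          near U C z (\<lambda>y. y \<in> V) \<and> (\<forall>g\<in>D. frac_at U C z g)"
        using STA z near_always[of "S \<times> T" "\<lambda>y. y \<in> S \<times> T" E z]
        by (intro exI[of _ "S \<times> T"] exI[of _ "G S T"] exI[of _ E]) simp
    qed
  qed auto
  moreover have "?X \<times>\<^sub>V ?Y = chart_space A" unfolding product_space_def A_def G_def ..
  ultimately show ?thesis unfolding E_def by simp
qed

text \<open>A relation between the coordinates of one factor is a relation on the product. A tuple
  satisfying the relations of the product therefore splits into two tuples, each realised in its
  factor.\<close>

lemma affine_chart_product:
  fixes S :: "'a set" and T :: "'b set"
  assumes "affine_chart S C" "affine_chart T D"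
  shows "affine_chart (S \<times> T) ((\<lambda>c. c \<circ> fst) ` C \<union> (\<lambda>d. d \<circ> snd) ` D)" (is "affine_chart _ ?E")
proof -
  obtain F where "affine_coords S C F" using assms(1) unfolding affine_chart_def by blast
  note F = affine_coordsD[OF this]
  obtain G where "affine_coords T D G" using assms(2) unfolding affine_chart_def by blast
  note G = affine_coordsD[OF this]
  define H :: "('a \<Rightarrow> complex) + ('b \<Rightarrow> complex) \<Rightarrow> 'a \<times> 'b \<Rightarrow> complex"
    where "H k z = (case k of Inl f \<Rightarrow> f (fst z) | Inr g \<Rightarrow> g (snd z))" for k z
  let ?K = "F <+> G"
  have CE: "(\<lambda>z. s (fst z)) \<in> subalgebra ?E" if "s \<in> subalgebra C" for s
    by (rule subalgebra_comp[OF that]) (auto intro!: subalgebra.gen simp: comp_def)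
  have DE: "(\<lambda>z. s (snd z)) \<in> subalgebra ?E" if "s \<in> subalgebra D" for s
    by (rule subalgebra_comp[OF that]) (auto intro!: subalgebra.gen simp: comp_def)
  have HI: "H (Inl f) = (\<lambda>z. f (fst z))" "H (Inr g) = (\<lambda>z. g (snd z))" for f g by (auto simp: H_def)
  have FH: "(\<lambda>z. s (fst z)) \<in> subalgebra (H ` ?K)" if "s \<in> subalgebra F" for s
    by (rule subalgebra_comp[OF that]) (auto intro!: subalgebra.gen simp: HI[symmetric])
  have GH: "(\<lambda>z. s (snd z)) \<in> subalgebra (H ` ?K)" if "s \<in> subalgebra G" for s
    by (rule subalgebra_comp[OF that]) (auto intro!: subalgebra.gen simp: HI[symmetric])
  show ?thesis
  proof (cases "S \<times> T = {}")
    case True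
    show ?thesis unfolding True
    proof (rule affine_chartI[where K="{} :: nat set" and F="\<lambda>_ _. 0"])
      fix z :: "nat \<Rightarrow> complex"
      assume "\<And>P. P \<in> subalgebra ((\<lambda>k z. z k) ` ({} :: nat set)) \<Longrightarrow> (\<And>x. x \<in> ({} :: ('a \<times> 'b) set) \<Longrightarrow> P (\<lambda>k. 0) = 0) \<Longrightarrow> P z = 0"
      from this[of "\<lambda>_. 1"] show "\<exists>x\<in>{} :: ('a \<times> 'b) set. \<forall>k\<in>{}. 0 = z k" by (simp add: subalgebra.const)
    qed (auto intro: subalgebra.const)
  next
    case False
    then obtain x0 y0 where x0: "x0 \<in> S" "y0 \<in> T" by blast
    show ?thesis
    proof (rule affine_chartI[where K="?K" and F=H])
      show "finite ?K" using F(1) G(1) by simp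
      fix k assume "k \<in> ?K"
      then consider f where "k = Inl f" "f \<in> F" | g where "k = Inr g" "g \<in> G" by blast
      then show "\<exists>p\<in>subalgebra ?E. \<forall>z\<in>S \<times> T. H k z = p z"
      proof cases
        case 1
        then obtain p where "p \<in> subalgebra C" "\<forall>x\<in>S. f x = p x" using F(2) by blast
        then show ?thesis using 1 by (intro bexI[OF _ CE[of p]]) (auto simp: H_def)
      next
        case 2
        then obtain p where "p \<in> subalgebra D" "\<forall>x\<in>T. g x = p x" using G(2) by blast
        then show ?thesis using 2 by (intro bexI[OF _ DE[of p]]) (auto simp: H_def)
      qed
    next
      fix e assume "e \<in> ?E"
      then consider c where "c \<in> C" "e = c \<circ> fst" | d where "d \<in> D" "e = d \<circ> snd" by blast
      then show "\<exists>p\<in>subalgebra (H ` ?K). \<forall>z\<in>S \<times> T. e z = p z"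
      proof cases
        case 1
        then obtain p where "p \<in> subalgebra F" "\<forall>x\<in>S. c x = p x" using F(3) by blast
        then show ?thesis using 1 by (intro bexI[OF _ FH[of p]]) auto
      next
        case 2
        then obtain p where "p \<in> subalgebra G" "\<forall>x\<in>T. d x = p x" using G(3) by blast
        then show ?thesis using 2 by (intro bexI[OF _ GH[of p]]) auto
      qed
    next
      fix z w assume zw: "z \<in> S \<times> T" "w \<in> S \<times> T" and eq: "\<And>k. k \<in> ?K \<Longrightarrow> H k z = H k w"
      have "f (fst z) = f (fst w)" if "f \<in> F" for f using eq[OF InlI[OF that]] by (simp add: H_def)
      moreover have "g (snd z) = g (snd w)" if "g \<in> G" for g using eq[OF InrI[OF that]] by (simp add: H_def)
      ultimately show "z = w" using F(4) G(4) zw by (auto simp: prod_eq_iff)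
    next
      fix z assume z: "\<And>P. P \<in> subalgebra ((\<lambda>k z. z k) ` ?K) \<Longrightarrow> (\<And>x. x \<in> S \<times> T \<Longrightarrow> P (\<lambda>k. H k x) = 0) \<Longrightarrow> P z = 0"
      have "\<exists>x\<in>S. \<forall>f\<in>F. f x = z (Inl f)"
      proof (rule F(5), intro ballI impI)
        fix P assume P: "P \<in> subalgebra ((\<lambda>f z. z f) ` F)" and v: "\<forall>x\<in>S. P (\<lambda>f. f x) = 0"
        have "(\<lambda>z. P (\<lambda>f. z (Inl f))) \<in> subalgebra ((\<lambda>k z. z k) ` ?K)"
          by (rule subalgebra_comp[OF P]) (auto intro!: subalgebra.gen)
        from z[OF this] show "P (\<lambda>f. z (Inl f)) = 0" using v by (auto simp: H_def)
      qed
      moreover have "\<exists>x\<in>T. \<forall>g\<in>G. g x = z (Inr g)"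
      proof (rule G(5), intro ballI impI)
        fix P assume P: "P \<in> subalgebra ((\<lambda>f z. z f) ` G)" and v: "\<forall>x\<in>T. P (\<lambda>f. f x) = 0"
        have "(\<lambda>z. P (\<lambda>f. z (Inr f))) \<in> subalgebra ((\<lambda>k z. z k) ` ?K)"
          by (rule subalgebra_comp[OF P]) (auto intro!: subalgebra.gen)
        from z[OF this] show "P (\<lambda>f. z (Inr f)) = 0" using v by (auto simp: H_def)
      qed
      ultimately obtain x y where "x \<in> S" "y \<in> T" "\<forall>f\<in>F. f x = z (Inl f)" "\<forall>g\<in>G. g y = z (Inr g)" by blast
      then show "\<exists>x\<in>S \<times> T. \<forall>k\<in>?K. H k x = z k" by (intro bexI[of _ "(x, y)"]) (auto simp: H_def)
    qed
  qed
qed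

lemma cls_product:
  assumes "affine_chart S C" "affine_chart T D"
  shows "cls (chart_space {(S \<times> T, (\<lambda>c. c \<circ> fst) ` C \<union> (\<lambda>d. d \<circ> snd) ` D)}) =
    cls (chart_space {(S, C)}) * cls (chart_space {(T, D)})"
proof -
  let ?E = "(\<lambda>c. c \<circ> fst) ` C \<union> (\<lambda>d. d \<circ> snd) ` D"
  obtain P X Y where r: "Rep_cvar P \<cong>\<^sub>V chart_space {(S \<times> T, ?E)}"
      "Rep_cvar X \<cong>\<^sub>V chart_space {(S, C)}" "Rep_cvar Y \<cong>\<^sub>V chart_space {(T, D)}"
    using representable_chart_space[OF variety_atlas_single[OF affine_chart_product[OF assms]]]
      representable_chart_space[OF variety_atlas_single[OF assms(1)]]
      representable_chart_space[OF variety_atlas_single[OF assms(2)]]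
    unfolding representable_def by blast
  have "Rep_cvar P \<cong>\<^sub>V chart_space {(S, C)} \<times>\<^sub>V chart_space {(T, D)}"
    by (rule isomorphic_trans[OF r(1) isomorphic_sym[OF product_space_single]])
  also have "\<dots> \<cong>\<^sub>V Rep_cvar X \<times>\<^sub>V Rep_cvar Y"
    by (rule product_space_iso[OF isomorphic_sym[OF r(2)] isomorphic_sym[OF r(3)]])
  finally have "gen P - gen X * gen Y \<in> relation_ideal"
    by (intro relation_ideal.rel relations.product)
  then have "gen_class P = gen_class X * gen_class Y" by transfer
  then show ?thesis using r cls_eq_gen_class by metis
qed

section \<open>Points, affine spaces and trivial bundles\<close>

lemma cls_point: "cls (chart_space {({x}, {})}) = 1"
proof -
  have "cls (affine_space 0) = 1"
  proof -
    have "representable (affine_space 0)"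
      using representable_chart_space[OF variety_atlas_single[OF affine_chart_affine_space[of 0]]]
      unfolding compatible_affine_space .
    then obtain P where P: "Rep_cvar P \<cong>\<^sub>V affine_space 0" unfolding representable_def by blast
    have "gen P - 1 \<in> relation_ideal" by (intro relation_ideal.rel relations.point P)
    then have "gen_class P = 1" by transfer
    then show ?thesis using P cls_eq_gen_class by metis
  qed
  moreover have "chart_space {({x}, {})} \<cong>\<^sub>V affine_space 0"
    unfolding compatible_affine_space
    by (rule chart_space_poly_iso[where \<phi>="\<lambda>_ _. 0"]) (auto simp: poly_iso_def bij_betw_def)
  ultimately show ?thesis using cls_iso by metis
qed

lemma affine_chart_point: "affine_chart {x} {}"
  by (rule affine_chartI[where K="{} :: nat set"]) auto

text \<open>Functions supported on \<open>K\<close> model affine space without an ordering of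
  \<open>K\<close>. The two claims are proved together because the product rule for the next
  coordinate asks for affineness of the previous bundle.\<close>

lemma lefschetz_power_bundle:
  fixes S :: "'a set" and K :: "'k set"
  assumes "affine_chart S C" "finite K"
  shows "affine_chart (S \<times> {u. \<forall>k. k \<notin> K \<longrightarrow> u k = 0}) ((\<lambda>c. c \<circ> fst) ` C \<union> (\<lambda>k z. snd z k) ` K) \<and>
    cls (chart_space {(S \<times> {u. \<forall>k. k \<notin> K \<longrightarrow> u k = 0}, (\<lambda>c. c \<circ> fst) ` C \<union> (\<lambda>k z. snd z k) ` K)}) =
      cls (chart_space {(S, C)}) * \<bbbL> ^ card K"
  using assms(2)
proof induction
  case empty
  have iso: "poly_iso (S \<times> {u :: 'k \<Rightarrow> complex. \<forall>k. k \<notin> {} \<longrightarrow> u k = 0}) ((\<lambda>c. c \<circ> fst) ` C \<union> (\<lambda>k z. snd z k) ` {}) S C fst"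
    unfolding poly_iso_def
  proof (intro conjI ballI)
    show "bij_betw fst (S \<times> {u :: 'k \<Rightarrow> complex. \<forall>k. k \<notin> {} \<longrightarrow> u k = 0}) S"
      by (rule bij_betwI[where g="\<lambda>x. (x, \<lambda>_. 0)"]) auto
    show "\<exists>p\<in>subalgebra ((\<lambda>c. c \<circ> fst) ` C \<union> (\<lambda>(k::'k) z. snd z k) ` {}).
        \<forall>x\<in>S \<times> {u. \<forall>k. k \<notin> {} \<longrightarrow> u k = 0}. d (fst x) = p x" if "d \<in> C" for d
      using that by (intro bexI[of _ "d \<circ> fst"] subalgebra.gen) auto
    show "\<exists>p\<in>subalgebra C. \<forall>x\<in>S \<times> {u. \<forall>k. k \<notin> {} \<longrightarrow> u k = 0}. c x = p (fst x)"
      if "c \<in> (\<lambda>c. c \<circ> fst) ` C \<union> (\<lambda>(k::'k) z. snd z k) ` {}" for c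
      using that by (auto intro: subalgebra.gen)
  qed
  show ?case using affine_chart_poly_iso[OF iso assms(1)] cls_iso[OF chart_space_poly_iso[OF iso]] by (simp add: comp_def)
next
  case (insert k K)
  let ?T = "\<lambda>K. S \<times> {u :: 'k \<Rightarrow> complex. \<forall>k. k \<notin> K \<longrightarrow> u k = 0}" and ?D = "\<lambda>K. (\<lambda>c. c \<circ> fst) ` C \<union> (\<lambda>(k::'k) z. snd z k) ` K"
  let ?A = "{x::nat \<Rightarrow> complex. \<forall>i\<ge>1. x i = 0}" and ?B = "(\<lambda>i x. x i) ` {..<1} :: ((nat \<Rightarrow> complex) \<Rightarrow> complex) set"
  let ?E = "(\<lambda>c. c \<circ> fst) ` ?D K \<union> (\<lambda>d. d \<circ> snd) ` ?B"
  let ?\<phi> = "\<lambda>(x, u). ((x, u(k := 0)), \<lambda>i::nat. if i = 0 then u k else 0)"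
  have iso: "poly_iso (?T (insert k K)) (?D (insert k K)) (?T K \<times> ?A) ?E ?\<phi>"
    unfolding poly_iso_def
  proof (intro conjI ballI)
    show "bij_betw ?\<phi> (?T (insert k K)) (?T K \<times> ?A)"
      by (rule bij_betwI[where g="\<lambda>((x, u), w). (x, u(k := w 0))"]) (use insert.hyps in \<open>auto simp: fun_eq_iff\<close>)
    fix d assume "d \<in> ?E"
    then consider c where "c \<in> C" "d = (\<lambda>z. c (fst (fst z)))" | l where "l \<in> K" "d = (\<lambda>z. snd (fst z) l)" | "d = (\<lambda>z. snd z 0)"
      by (auto simp: comp_def)
    then show "\<exists>p\<in>subalgebra (?D (insert k K)). \<forall>z\<in>?T (insert k K). d (?\<phi> z) = p z"
    proof cases
      case 1 then show ?thesis by (intro bexI[of _ "c \<circ> fst"] subalgebra.gen) auto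
    next
      case 2 then show ?thesis by (intro bexI[of _ "\<lambda>z. snd z l"] subalgebra.gen) (use insert.hyps in auto)
    next
      case 3 then show ?thesis by (intro bexI[of _ "\<lambda>z. snd z k"] subalgebra.gen) auto
    qed
  next
    fix c assume "c \<in> ?D (insert k K)"
    then consider c' where "c' \<in> C" "c = c' \<circ> fst" | l where "l \<in> K" "c = (\<lambda>z. snd z l)" | "c = (\<lambda>z. snd z k)"
      by auto
    then show "\<exists>p\<in>subalgebra ?E. \<forall>z\<in>?T (insert k K). c z = p (?\<phi> z)"
    proof cases
      case 1 then show ?thesis by (intro bexI[of _ "(c' \<circ> fst) \<circ> fst"] subalgebra.gen) auto
    next
      case 2 then show ?thesis by (intro bexI[of _ "(\<lambda>z. snd z l) \<circ> fst"] subalgebra.gen) (use insert.hyps in auto)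
    next
      case 3 then show ?thesis by (intro bexI[of _ "(\<lambda>w. w 0) \<circ> snd"] subalgebra.gen) auto
    qed
  qed
  have IH: "affine_chart (?T K) (?D K)" "cls (chart_space {(?T K, ?D K)}) = cls (chart_space {(S, C)}) * \<bbbL> ^ card K"
    using conjunct1[OF insert.IH] conjunct2[OF insert.IH] .
  note A1 = affine_chart_affine_space[of 1]
  have "affine_chart (?T (insert k K)) (?D (insert k K))"
    by (rule affine_chart_poly_iso[OF iso affine_chart_product[OF IH(1) A1]])
  moreover have "cls (chart_space {(?T (insert k K), ?D (insert k K))}) = cls (chart_space {(?T K, ?D K)}) * \<bbbL>"
    using cls_iso[OF chart_space_poly_iso[OF iso]] cls_product[OF IH(1) A1]
    unfolding compatible_affine_space by simp
  moreover have "cls (chart_space {(?T K, ?D K)}) * \<bbbL> = cls (chart_space {(S, C)}) * \<bbbL> ^ card (insert k K)"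
    unfolding IH(2) using insert.hyps by (simp add: ac_simps)
  ultimately show ?case by (intro conjI) (assumption, rule trans)
qed

text \<open>The interface for all strata: \<open>\<pi>\<close> is the projection and
  \<open>u\<close> gives fibre coordinates. As the coordinates above and below are polynomials in
  each other, \<open>t \<mapsto> (\<pi> t, u t)\<close> is an isomorphism onto the product of
  \<open>S\<close> with an affine space.\<close>

theorem cls_trivial_bundle:
  fixes S :: "'a set" and T :: "'b set" and K :: "'k set"
  assumes S: "affine_chart S C" and K: "finite K"
    and \<pi>: "\<And>t. t \<in> T \<Longrightarrow> \<pi> t \<in> S"
    and inj: "\<And>t t'. t \<in> T \<Longrightarrow> t' \<in> T \<Longrightarrow> \<pi> t = \<pi> t' \<Longrightarrow> (\<And>k. k \<in> K \<Longrightarrow> u k t = u k t') \<Longrightarrow> t = t'"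
    and surj: "\<And>s w. s \<in> S \<Longrightarrow> \<exists>t\<in>T. \<pi> t = s \<and> (\<forall>k\<in>K. u k t = w k)"
    and C: "\<And>c. c \<in> C \<Longrightarrow> \<exists>p\<in>subalgebra D. \<forall>t\<in>T. c (\<pi> t) = p t"
    and u: "\<And>k. k \<in> K \<Longrightarrow> \<exists>p\<in>subalgebra D. \<forall>t\<in>T. u k t = p t"
    and D: "\<And>d. d \<in> D \<Longrightarrow> \<exists>p\<in>subalgebra ((\<lambda>c. c \<circ> \<pi>) ` C \<union> u ` K). \<forall>t\<in>T. d t = p t"
  shows "cls (chart_space {(T, D)}) = cls (chart_space {(S, C)}) * \<bbbL> ^ card K"
proof -
  let ?T = "S \<times> {u :: 'k \<Rightarrow> complex. \<forall>k. k \<notin> K \<longrightarrow> u k = 0}" and ?D = "(\<lambda>c. c \<circ> fst) ` C \<union> (\<lambda>(k::'k) z. snd z k) ` K"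
  let ?\<phi> = "\<lambda>t. (\<pi> t, \<lambda>k. if k \<in> K then u k t else 0)"
  have "poly_iso T D ?T ?D ?\<phi>"
    unfolding poly_iso_def
  proof (intro conjI ballI)
    show "bij_betw ?\<phi> T ?T" unfolding bij_betw_def
    proof
      show "inj_on ?\<phi> T"
      proof (rule inj_onI)
        fix t t' assume t: "t \<in> T" "t' \<in> T" and eq: "?\<phi> t = ?\<phi> t'"
        have "u k t = u k t'" if "k \<in> K" for k
          using fun_cong[OF conjunct2[OF eq[unfolded prod.inject]], of k] that by simp
        then show "t = t'" using inj[OF t] eq by blast
      qed
      show "?\<phi> ` T = ?T"
      proof
        show "?\<phi> ` T \<subseteq> ?T" using \<pi> by auto
        show "?T \<subseteq> ?\<phi> ` T"
        proof
          fix z assume "z \<in> ?T"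
          then obtain s w where z: "z = (s, w)" "s \<in> S" "\<forall>k. k \<notin> K \<longrightarrow> w k = 0" by blast
          then obtain t where t: "t \<in> T" "\<pi> t = s" "\<forall>k\<in>K. u k t = w k" using surj by meson
          then have "?\<phi> t = z" using z by (auto simp: fun_eq_iff)
          then show "z \<in> ?\<phi> ` T" using t by blast
        qed
      qed
    qed
    fix d assume "d \<in> ?D"
    then consider c where "c \<in> C" "d = c \<circ> fst" | k where "k \<in> K" "d = (\<lambda>z. snd z k)" by blast
    then show "\<exists>p\<in>subalgebra D. \<forall>t\<in>T. d (?\<phi> t) = p t" using C u by cases auto
  next
    fix d assume "d \<in> D"
    then obtain p where p: "p \<in> subalgebra ((\<lambda>c. c \<circ> \<pi>) ` C \<union> u ` K)" "\<forall>t\<in>T. d t = p t" using D by blast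
    have "\<exists>q\<in>subalgebra ?D. \<forall>t\<in>T. p t = q (?\<phi> t)"
      using p(1)
    proof induction
      case (gen f)
      then consider c where "c \<in> C" "f = c \<circ> \<pi>" | k where "k \<in> K" "f = u k" by blast
      then show ?case
      proof cases
        case 1
        have "c \<circ> fst \<in> ?D" using 1 by blast
        from subalgebra.gen[OF this] show ?thesis by (rule bexI[rotated]) (simp add: 1)
      next
        case 2 then show ?thesis by (intro bexI[of _ "\<lambda>z. snd z k"] subalgebra.gen) auto
      qed
    next
      case (const c) show ?case by (rule bexI[of _ "\<lambda>_. c"]) (auto intro: subalgebra.const)
    next
      case (add f g)
      then obtain p q where pq: "p \<in> subalgebra ?D" "q \<in> subalgebra ?D"
        "\<forall>x\<in>T. f x = p (?\<phi> x)" "\<forall>x\<in>T. g x = q (?\<phi> x)" by blast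
      show ?case by (rule bexI[OF _ subalgebra.add[OF pq(1,2)]]) (use pq(3,4) in simp)
    next
      case (mult f g)
      then obtain p q where pq: "p \<in> subalgebra ?D" "q \<in> subalgebra ?D"
        "\<forall>x\<in>T. f x = p (?\<phi> x)" "\<forall>x\<in>T. g x = q (?\<phi> x)" by blast
      show ?case by (rule bexI[OF _ subalgebra.mult[OF pq(1,2)]]) (use pq(3,4) in simp)
    qed
    then show "\<exists>p\<in>subalgebra ?D. \<forall>t\<in>T. d t = p (?\<phi> t)" using p by auto
  qed
  from cls_iso[OF chart_space_poly_iso[OF this]] conjunct2[OF lefschetz_power_bundle[OF S K]]
  show ?thesis by (rule trans)
qed

section \<open>Linear algebra of finitely supported functions\<close>

abbreviation bvec :: "'i \<Rightarrow> 'i \<Rightarrow>\<^sub>0 complex" where "bvec i \<equiv> Poly_Mapping.single i 1"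

abbreviation coord :: "('i \<Rightarrow>\<^sub>0 complex) \<Rightarrow> 'i \<Rightarrow> complex" where "coord \<equiv> Poly_Mapping.lookup"

lemma free_space_iff: "v \<in> free_space E \<longleftrightarrow> (\<forall>i. i \<notin> E \<longrightarrow> coord v i = 0)"
  unfolding free_space_def by (auto simp: in_keys_iff)

lemma free_space_mono: "J \<subseteq> E \<Longrightarrow> free_space J \<subseteq> free_space E"
  unfolding free_space_def by auto

lemma subspace_free_space: "free.subspace (free_space E)"
  by (rule free.subspaceI) (auto simp: free_space_iff lookup_add)

lemma bvec_free_space [simp]: "bvec i \<in> free_space E \<longleftrightarrow> i \<in> E"
  by (auto simp: free_space_iff lookup_single when_def)

text \<open>The linear functional with prescribed values on the basis vectors.\<close>

definition lin :: "('i \<Rightarrow> complex) \<Rightarrow> ('i \<Rightarrow>\<^sub>0 complex) \<Rightarrow> complex" where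
  "lin g v = (\<Sum>i\<in>Poly_Mapping.keys v. coord v i * g i)"

lemma lin_superset: "finite A \<Longrightarrow> Poly_Mapping.keys v \<subseteq> A \<Longrightarrow> lin g v = (\<Sum>i\<in>A. coord v i * g i)"
  unfolding lin_def by (rule sum.mono_neutral_left) (auto simp: in_keys_iff)

lemma lin_add: "lin g (v + w) = lin g v + lin g w"
proof -
  let ?A = "Poly_Mapping.keys v \<union> Poly_Mapping.keys w"
  have "lin g (v + w) = (\<Sum>i\<in>?A. coord (v + w) i * g i)"
    by (rule lin_superset) (auto simp: keys_add)
  also have "\<dots> = (\<Sum>i\<in>?A. coord v i * g i) + (\<Sum>i\<in>?A. coord w i * g i)"
    by (simp add: lookup_add algebra_simps sum.distrib)
  finally show ?thesis using lin_superset[of ?A v g] lin_superset[of ?A w g] by simp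
qed

lemma keys_scale: "Poly_Mapping.keys (scale c v) \<subseteq> Poly_Mapping.keys v"
  by (auto simp: in_keys_iff)

lemma lin_scale: "lin g (scale c v) = c * lin g v"
  using lin_superset[OF _ keys_scale, of v g c] by (simp add: lin_def sum_distrib_left mult.assoc)

lemma lin_zero [simp]: "lin g 0 = 0"
  by (simp add: lin_def)

lemma uminus_scale: "- v = scale (- 1) v"
  by (rule poly_mapping_eqI) simp

lemma lin_uminus: "lin g (- v) = - lin g v"
  unfolding uminus_scale lin_scale by simp

lemma lin_diff: "lin g (v - w) = lin g v - lin g w"
  using lin_add[of g v "- w"] by (simp add: lin_uminus)

lemma lin_bvec [simp]: "lin g (bvec i) = g i"
  by (simp add: lin_def)

lemma coord_sum: "coord (\<Sum>i\<in>A. f i) k = (\<Sum>i\<in>A. coord (f i) k)"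
  by (induction A rule: infinite_finite_induct) (auto simp: lookup_add)

text \<open>The linear map with prescribed values on the basis vectors; substitution of polynomials
  will be of this form.\<close>

definition ext :: "('i \<Rightarrow> 'k \<Rightarrow>\<^sub>0 complex) \<Rightarrow> ('i \<Rightarrow>\<^sub>0 complex) \<Rightarrow> ('k \<Rightarrow>\<^sub>0 complex)" where
  "ext \<phi> v = (\<Sum>i\<in>Poly_Mapping.keys v. scale (coord v i) (\<phi> i))"

lemma coord_ext: "coord (ext \<phi> v) k = lin (\<lambda>i. coord (\<phi> i) k) v"
  by (simp add: ext_def lin_def coord_sum)

lemma ext_add: "ext \<phi> (v + w) = ext \<phi> v + ext \<phi> w"
  by (rule poly_mapping_eqI) (simp add: coord_ext lin_add lookup_add)

lemma ext_scale: "ext \<phi> (scale c v) = scale c (ext \<phi> v)"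
  by (rule poly_mapping_eqI) (simp add: coord_ext lin_scale)

lemma ext_diff: "ext \<phi> (v - w) = ext \<phi> v - ext \<phi> w"
  by (rule poly_mapping_eqI) (simp add: coord_ext lin_diff lookup_minus)

lemma ext_bvec [simp]: "ext \<phi> (bvec i) = \<phi> i"
  by (rule poly_mapping_eqI) (simp add: coord_ext)

lemma ext_zero [simp]: "ext \<phi> 0 = 0"
  by (simp add: ext_def)

lemma ext_cong: "(\<And>i. i \<in> Poly_Mapping.keys v \<Longrightarrow> \<phi> i = \<psi> i) \<Longrightarrow> ext \<phi> v = ext \<psi> v"
  by (simp add: ext_def)

lemma ext_id: "ext bvec v = v"
proof (rule poly_mapping_eqI)
  fix k
  have "(\<Sum>i\<in>Poly_Mapping.keys v. coord v i * coord (bvec i) k) =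
      (\<Sum>i\<in>Poly_Mapping.keys v. if i = k then coord v i else 0)"
    by (rule sum.cong) (auto simp: lookup_single when_def)
  then show "coord (ext bvec v) k = coord v k"
    unfolding coord_ext lin_def by (simp add: in_keys_iff)
qed

lemma ext_mem:
  assumes "free.subspace W" "\<And>i. i \<in> Poly_Mapping.keys v \<Longrightarrow> \<phi> i \<in> W"
  shows "ext \<phi> v \<in> W"
  unfolding ext_def
  by (rule free.subspace_sum[OF assms(1)]) (use assms in \<open>auto intro: free.subspace_scale\<close>)

lemma keys_free_space: "v \<in> free_space E \<Longrightarrow> i \<in> Poly_Mapping.keys v \<Longrightarrow> i \<in> E"
  unfolding free_space_def by auto

lemma linear_eq_ext:
  assumes "\<And>v w. v \<in> free_space E \<Longrightarrow> w \<in> free_space E \<Longrightarrow> f (v + w) = f v + f w"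
    "\<And>c v. v \<in> free_space E \<Longrightarrow> f (scale c v) = scale c (f v)" "v \<in> free_space E"
  shows "f v = ext (\<lambda>i. f (bvec i)) v"
proof -
  have f0: "f 0 = 0" using assms(2)[of 0 0] by (simp add: free_space_iff)
  have sub: "free.subspace (free_space E)" by (rule subspace_free_space)
  have "f (\<Sum>i\<in>A. scale (coord v i) (bvec i)) = (\<Sum>i\<in>A. scale (coord v i) (f (bvec i)))" if "finite A" "A \<subseteq> E" for A
    using that
  proof (induction A)
    case (insert i A)
    have "(\<Sum>i\<in>A. scale (coord v i) (bvec i)) \<in> free_space E"
      by (rule free.subspace_sum[OF sub]) (use insert in \<open>auto intro!: free.subspace_scale[OF sub]\<close>)
    moreover have "scale (coord v i) (bvec i) \<in> free_space E" "bvec i \<in> free_space E"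
      using insert by (auto intro!: free.subspace_scale[OF sub])
    ultimately show ?case using insert assms(1,2) by simp
  qed (use f0 in simp)
  from this[OF finite_keys] have "Poly_Mapping.keys v \<subseteq> E \<Longrightarrow> f (ext bvec v) = ext (\<lambda>i. f (bvec i)) v"
    unfolding ext_def .
  moreover have "Poly_Mapping.keys v \<subseteq> E" using assms(3) unfolding free_space_def by simp
  ultimately show ?thesis by (simp only: ext_id)
qed


section \<open>Bases of quotient spaces\<close>

text \<open>The normal form modulo \<open>V\<close> with respect to the basis \<open>J\<close> of
  the quotient.\<close>

definition res :: "'i set \<Rightarrow> ('i \<Rightarrow>\<^sub>0 complex) set \<Rightarrow> ('i \<Rightarrow>\<^sub>0 complex) \<Rightarrow> ('i \<Rightarrow>\<^sub>0 complex)" where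
  "res J V v = (THE u. u \<in> free_space J \<and> v - u \<in> V)"

lemma residue_coord_res: "residue_coord J i j V = coord (res J V (bvec i)) j"
  unfolding residue_coord_def res_def ..

lemma quotient_basisI:
  assumes "free.subspace V" "\<And>v. v \<in> free_space E \<Longrightarrow> \<exists>u\<in>free_space J. v - u \<in> V"
    "\<And>u. u \<in> free_space J \<Longrightarrow> u \<in> V \<Longrightarrow> u = 0"
  shows "quotient_basis E J V"
  unfolding quotient_basis_def
proof
  fix v assume "v \<in> free_space E"
  then obtain u where u: "u \<in> free_space J" "v - u \<in> V" using assms(2) by blast
  have "w = u" if "w \<in> free_space J" "v - w \<in> V" for w
  proof -
    have "w - u = (v - u) - (v - w)" by simp
    also have "\<dots> \<in> V" by (rule free.subspace_diff[OF assms(1) u(2) that(2)])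
    finally have "w - u \<in> V" .
    moreover have "w - u \<in> free_space J" by (rule free.subspace_diff[OF subspace_free_space that(1) u(1)])
    ultimately show ?thesis using assms(3) by fastforce
  qed
  then show "\<exists>!u. u \<in> free_space J \<and> v - u \<in> V" using u by blast
qed

locale qbasis =
  fixes E J :: "'i set" and V :: "('i \<Rightarrow>\<^sub>0 complex) set"
  assumes sub: "free.subspace V" and JE: "J \<subseteq> E" and qb: "quotient_basis E J V"
begin

lemma res_ex1: "v \<in> free_space E \<Longrightarrow> \<exists>!u. u \<in> free_space J \<and> v - u \<in> V"
  using qb unfolding quotient_basis_def by blast

lemma res_mem: "v \<in> free_space E \<Longrightarrow> res J V v \<in> free_space J"
  and res_diff: "v \<in> free_space E \<Longrightarrow> v - res J V v \<in> V"
  using theI'[OF res_ex1] unfolding res_def by auto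

lemma res_eqI: "v \<in> free_space E \<Longrightarrow> u \<in> free_space J \<Longrightarrow> v - u \<in> V \<Longrightarrow> res J V v = u"
  using res_ex1 res_mem res_diff by blast

lemma free_JE: "u \<in> free_space J \<Longrightarrow> u \<in> free_space E"
  using free_space_mono[OF JE] by blast

lemma res_free: "u \<in> free_space J \<Longrightarrow> res J V u = u"
  by (rule res_eqI) (auto intro: free_JE free.subspace_0[OF sub])

lemma res_add:
  assumes "v \<in> free_space E" "w \<in> free_space E"
  shows "res J V (v + w) = res J V v + res J V w"
proof (rule res_eqI)
  show "v + w \<in> free_space E" by (rule free.subspace_add[OF subspace_free_space assms])
  show "res J V v + res J V w \<in> free_space J"
    by (rule free.subspace_add[OF subspace_free_space res_mem[OF assms(1)] res_mem[OF assms(2)]])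
  have "(v - res J V v) + (w - res J V w) \<in> V"
    by (rule free.subspace_add[OF sub res_diff[OF assms(1)] res_diff[OF assms(2)]])
  then show "v + w - (res J V v + res J V w) \<in> V" by (simp add: algebra_simps)
qed

lemma res_scale:
  assumes "v \<in> free_space E" shows "res J V (scale c v) = scale c (res J V v)"
proof (rule res_eqI)
  show "scale c v \<in> free_space E" by (rule free.subspace_scale[OF subspace_free_space assms])
  show "scale c (res J V v) \<in> free_space J"
    by (rule free.subspace_scale[OF subspace_free_space res_mem[OF assms]])
  have "scale c (v - res J V v) \<in> V" by (rule free.subspace_scale[OF sub res_diff[OF assms]])
  then show "scale c v - scale c (res J V v) \<in> V" by (simp add: free.scale_right_diff_distrib)
qed

lemma res_ext: "v \<in> free_space E \<Longrightarrow> res J V v = ext (\<lambda>i. res J V (bvec i)) v"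
  by (rule linear_eq_ext[where E=E]) (auto intro: res_add res_scale)

lemma coord_res: "v \<in> free_space E \<Longrightarrow> coord (res J V v) j = lin (\<lambda>i. residue_coord J i j V) v"
  by (subst res_ext) (simp_all add: coord_ext residue_coord_res)

lemma res_eq_0_iff: "v \<in> free_space E \<Longrightarrow> res J V v = 0 \<longleftrightarrow> v \<in> V"
  using res_diff[of v] res_eqI[of v 0] by (auto simp: free.subspace_0[OF subspace_free_space])

lemma res_diff_distrib:
  assumes "v \<in> free_space E" "w \<in> free_space E"
  shows "res J V (v - w) = res J V v - res J V w"
  using res_add[OF assms(1) free.subspace_neg[OF subspace_free_space assms(2)]] res_scale[OF assms(2), of "- 1"]
  by (simp add: uminus_scale[symmetric])

lemma residue_coord_basis: "i \<in> J \<Longrightarrow> residue_coord J i j V = (if i = j then 1 else 0)"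
  unfolding residue_coord_res by (subst res_free) (auto simp: lookup_single when_def)

lemma residue_coord_outside: "i \<in> E \<Longrightarrow> j \<notin> J \<Longrightarrow> residue_coord J i j V = 0"
  unfolding residue_coord_res using res_mem[of "bvec i"] bvec_free_space[of i E]
  by (simp add: free_space_iff[of "res J V (bvec i)"])

text \<open>Change of basis in the quotient. Read with different subspaces in the two places, the
  same expression becomes the function that detects distance from the diagonal in
  \<open>separated_moduli\<close>.\<close>

lemma residue_coord_change:
  assumes "qbasis E K V" "finite J" "i \<in> E"
  shows "residue_coord K i k V = (\<Sum>j\<in>J. residue_coord J i j V * residue_coord K j k V)"
proof -
  interpret K: qbasis E K V by fact
  have e: "bvec i \<in> free_space E" using assms(3) by simp
  note rE = free_JE[OF res_mem[OF e]]
  have "res K V (bvec i) = res K V (res J V (bvec i))"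
    using K.res_diff_distrib[OF e rE] K.res_eq_0_iff[OF free.subspace_diff[OF subspace_free_space e rE]] res_diff[OF e]
    by simp
  then have "residue_coord K i k V = lin (\<lambda>j. residue_coord K j k V) (res J V (bvec i))"
    unfolding residue_coord_res[of K i] by (simp add: K.coord_res[OF rE])
  also have "\<dots> = (\<Sum>j\<in>J. residue_coord J i j V * residue_coord K j k V)"
    unfolding residue_coord_res[of J i]
    by (rule lin_superset[OF assms(2)]) (use res_mem[OF e] in \<open>simp add: free_space_def\<close>)
  finally show ?thesis .
qed

text \<open>The Steinitz exchange step with its explicit effect on coordinates. The only denominator
  is the pivot, so neighbouring charts have regular transition functions where the pivot does not
  vanish.\<close>

lemma exchange:
  assumes k: "k \<in> E" "k \<notin> J" and j: "j \<in> J" and nz: "residue_coord J k j V \<noteq> 0"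
  defines "J' \<equiv> insert k (J - {j})"
  shows "quotient_basis E J' V"
    "i \<in> E \<Longrightarrow> residue_coord J' i l V = residue_coord J i l V +
      residue_coord J i j V / residue_coord J k j V * ((if l = k then 1 else 0) - residue_coord J k l V)"
proof -
  let ?w = "bvec k - res J V (bvec k)"
  \<comment> \<open>\<open>?w\<close> lies in \<open>V\<close> and has coefficient
    \<open>- residue_coord J k j V\<close> at \<open>j\<close>, so this multiple of it removes the
    component of the normal form along \<open>j\<close> at the price of one along
    \<open>k\<close>.\<close>
  define r' where "r' v = res J V v + scale (coord (res J V v) j / residue_coord J k j V) ?w" for v
  have kE: "bvec k \<in> free_space E" using k by simp
  have w: "?w \<in> V" by (rule res_diff[OF kE])
  have r'J: "r' v \<in> free_space J'" if v: "v \<in> free_space E" for v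
    unfolding free_space_iff
  proof (intro allI impI)
    fix i assume "i \<notin> J'"
    then have "i \<noteq> k" "i \<notin> J \<or> i = j" unfolding J'_def by auto
    then show "coord (r' v) i = 0"
      using res_mem[OF v] res_mem[OF kE] nz
      by (auto simp: r'_def free_space_iff lookup_add lookup_minus lookup_single residue_coord_res)
  qed
  have r'V: "v - r' v \<in> V" if v: "v \<in> free_space E" for v
    using free.subspace_diff[OF sub res_diff[OF v] free.subspace_scale[OF sub w]]
    unfolding r'_def by (simp add: diff_diff_eq)
  show qb': "quotient_basis E J' V"
  proof (rule quotient_basisI[OF sub])
    show "\<exists>u\<in>free_space J'. v - u \<in> V" if "v \<in> free_space E" for v using r'J[OF that] r'V[OF that] by blast
    fix u assume u: "u \<in> free_space J'" "u \<in> V"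
    have uE: "u \<in> free_space E" using u(1) free_space_mono[of J' E] JE k unfolding J'_def by blast
    let ?u = "u - scale (coord u k) (bvec k)"
    have uJ: "?u \<in> free_space J"
      using u(1) by (auto simp: free_space_iff lookup_minus lookup_single when_def J'_def)
    have "coord ?u j = 0"
      using u(1) k j by (auto simp: free_space_iff lookup_minus lookup_single when_def J'_def)
    moreover have "res J V u = res J V ?u + scale (coord u k) (res J V (bvec k))"
      using res_add[OF free_JE[OF uJ] free.subspace_scale[OF subspace_free_space kE], of "coord u k"] res_scale[OF kE]
      by simp
    then have "coord (res J V u) j = coord ?u j + coord u k * residue_coord J k j V"
      by (simp add: res_free[OF uJ] lookup_add residue_coord_res)
    moreover have "res J V u = 0" using res_eq_0_iff[OF uE] u by simp
    ultimately have "coord u k = 0" using nz by simp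
    then have "u \<in> free_space J" using uJ by (simp add: free_space_iff lookup_minus)
    then show "u = 0" using res_free \<open>res J V u = 0\<close> by simp
  qed
  interpret J': qbasis E J' V by standard (use sub qb' JE k in \<open>auto simp: J'_def\<close>)
  show "residue_coord J' i l V = residue_coord J i l V +
      residue_coord J i j V / residue_coord J k j V * ((if l = k then 1 else 0) - residue_coord J k l V)"
    if "i \<in> E"
  proof -
    have e: "bvec i \<in> free_space E" using that by simp
    have "res J' V (bvec i) = r' (bvec i)" by (rule J'.res_eqI[OF e r'J[OF e] r'V[OF e]])
    then show ?thesis
      by (simp add: residue_coord_res r'_def lookup_add lookup_minus lookup_single when_def eq_commute)
  qed
qed

end

text \<open>If the pivots of some \<open>k\<close> in \<open>K - J\<close> vanished for all
  \<open>j\<close> in \<open>J - K\<close>, then \<open>bvec k\<close> minus its normal form would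
  be supported on \<open>K\<close> and lie in \<open>V\<close>, contradicting that \<open>K\<close>
  is a basis.\<close>

lemma (in qbasis) exchange_exists:
  assumes "qbasis E K V" "finite K" "K \<noteq> J"
  obtains k j where "k \<in> K - J" "j \<in> J - K" "residue_coord J k j V \<noteq> 0"
proof -
  interpret K: qbasis E K V by fact
  have "\<not> K \<subseteq> J"
  proof
    assume KJ: "K \<subseteq> J"
    then obtain j where j: "j \<in> J" "j \<notin> K" using assms(3) by blast
    have e: "bvec j \<in> free_space E" using j JE by auto
    have "res J V (bvec j) = res K V (bvec j)"
      by (rule res_eqI[OF e]) (use K.res_mem[OF e] K.res_diff[OF e] free_space_mono[OF KJ] in auto)
    then have "bvec j \<in> free_space K" using res_free[of "bvec j"] j K.res_mem[OF e] by simp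
    then show False using j by simp
  qed
  then obtain k where k: "k \<in> K" "k \<notin> J" by blast
  have e: "bvec k \<in> free_space E" using k K.JE by auto
  have "\<exists>j\<in>J - K. residue_coord J k j V \<noteq> 0"
  proof (rule ccontr)
    assume "\<not> ?thesis"
    then have "res J V (bvec k) \<in> free_space K"
      using res_mem[OF e] by (auto simp: free_space_iff residue_coord_res)
    then have "bvec k - res J V (bvec k) \<in> free_space K"
      using k by (auto simp: free_space_iff lookup_minus lookup_single when_def)
    then have "bvec k - res J V (bvec k) = 0"
      using K.res_free K.res_eq_0_iff[OF K.free_JE] res_diff[OF e] by metis
    then have "bvec k \<in> free_space J" using res_mem[OF e] by simp
    then show False using k by simp
  qed
  then show ?thesis using that k by blast
qed

text \<open>The kernel of the linear map with matrix \<open>z\<close>. If \<open>z\<close> is the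
  identity on \<open>J\<close>, this is the subspace whose residue coordinates are \<open>z\<close>,
  so it realises prescribed coordinates in a chart.\<close>

definition kernel :: "'i set \<Rightarrow> 'i set \<Rightarrow> ('i \<Rightarrow> 'i \<Rightarrow> complex) \<Rightarrow> ('i \<Rightarrow>\<^sub>0 complex) set" where
  "kernel E J z = {v\<in>free_space E. \<forall>j\<in>J. lin (\<lambda>i. z i j) v = 0}"

lemma kernel:
  assumes "finite J" "J \<subseteq> E" "\<And>i j. i \<in> J \<Longrightarrow> j \<in> J \<Longrightarrow> z i j = (if i = j then 1 else 0)"
  shows "free.subspace (kernel E J z)" "kernel E J z \<subseteq> free_space E" "qbasis E J (kernel E J z)"
    "\<And>i j. i \<in> E \<Longrightarrow> j \<in> J \<Longrightarrow> residue_coord J i j (kernel E J z) = z i j"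
proof -
  show sub: "free.subspace (kernel E J z)"
    by (rule free.subspaceI)
       (auto simp: kernel_def lin_add lin_scale intro: free.subspace_add[OF subspace_free_space]
          free.subspace_scale[OF subspace_free_space] free.subspace_0[OF subspace_free_space])
  show "kernel E J z \<subseteq> free_space E" by (auto simp: kernel_def)
  define r where "r v = (\<Sum>j\<in>J. scale (lin (\<lambda>i. z i j) v) (bvec j))" for v
  have coord_r: "coord (r v) j = (if j \<in> J then lin (\<lambda>i. z i j) v else 0)" for v j
    using assms(1) by (simp add: r_def coord_sum lookup_single when_def if_distrib cong: if_cong)
  have rJ: "r v \<in> free_space J" for v by (simp add: free_space_iff coord_r)
  have lin_J: "lin (\<lambda>i. z i j) u = coord u j" if "u \<in> free_space J" "j \<in> J" for u j
  proof -
    have "lin (\<lambda>i. z i j) u = (\<Sum>i\<in>J. coord u i * z i j)"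
      using that by (intro lin_superset[OF assms(1)]) (simp add: free_space_def)
    also have "\<dots> = (\<Sum>i\<in>J. if i = j then coord u i else 0)"
      by (rule sum.cong) (auto simp: assms(3) that)
    finally show ?thesis using assms(1) that by simp
  qed
  have rV: "v - r v \<in> kernel E J z" if "v \<in> free_space E" for v
    using free.subspace_diff[OF subspace_free_space that] rJ[of v] free_space_mono[OF assms(2)]
    by (auto simp: kernel_def lin_diff lin_J[OF rJ] coord_r)
  have "quotient_basis E J (kernel E J z)"
  proof (rule quotient_basisI[OF sub])
    show "\<exists>u\<in>free_space J. v - u \<in> kernel E J z" if "v \<in> free_space E" for v using rJ rV[OF that] by blast
    show "u = 0" if "u \<in> free_space J" "u \<in> kernel E J z" for u
    proof (rule poly_mapping_eqI)
      show "coord u k = coord 0 k" for k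
        using that lin_J[OF that(1)] by (cases "k \<in> J") (auto simp: kernel_def free_space_iff)
    qed
  qed
  then show qb: "qbasis E J (kernel E J z)" using sub assms(2) unfolding qbasis_def by blast
  fix i j assume ij: "i \<in> E" "j \<in> J"
  have "res J (kernel E J z) (bvec i) = r (bvec i)"
    by (rule qbasis.res_eqI[OF qb _ rJ rV]) (use ij in auto)
  then show "residue_coord J i j (kernel E J z) = z i j"
    using ij by (simp add: residue_coord_res coord_r)
qed


section \<open>Moduli of subspaces as varieties\<close>

definition moduli_atlas :: "'i set \<Rightarrow> ('i \<Rightarrow>\<^sub>0 complex) set set \<Rightarrow>
    (('i \<Rightarrow>\<^sub>0 complex) set set \<times> (('i \<Rightarrow>\<^sub>0 complex) set \<Rightarrow> complex) set) set" where
  "moduli_atlas E \<V> = {({V\<in>\<V>. quotient_basis E J V}, {residue_coord J i j |i j. i \<in> E \<and> j \<in> J}) |J. J \<subseteq> E}"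

lemma subspace_moduli_atlas: "subspace_moduli E \<V> = chart_space (moduli_atlas E \<V>)"
  unfolding subspace_moduli_def moduli_atlas_def ..

locale moduli =
  fixes E :: "'i set" and \<V> :: "('i \<Rightarrow>\<^sub>0 complex) set set"
  assumes subV: "V \<in> \<V> \<Longrightarrow> free.subspace V" and inV: "V \<in> \<V> \<Longrightarrow> V \<subseteq> free_space E"
    and finV: "V \<in> \<V> \<Longrightarrow> J \<subseteq> E \<Longrightarrow> quotient_basis E J V \<Longrightarrow> finite J"
begin

definition dom :: "'i set \<Rightarrow> ('i \<Rightarrow>\<^sub>0 complex) set set" where
  "dom J = {V\<in>\<V>. quotient_basis E J V}"

definition crd :: "'i set \<Rightarrow> (('i \<Rightarrow>\<^sub>0 complex) set \<Rightarrow> complex) set" where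
  "crd J = {residue_coord J i j |i j. i \<in> E \<and> j \<in> J}"

lemma atlas: "moduli_atlas E \<V> = {(dom J, crd J) |J. J \<subseteq> E}"
  unfolding moduli_atlas_def dom_def crd_def ..

lemma atlasI: "J \<subseteq> E \<Longrightarrow> (dom J, crd J) \<in> moduli_atlas E \<V>"
  unfolding atlas by blast

lemma qbasis_dom: "V \<in> dom J \<Longrightarrow> J \<subseteq> E \<Longrightarrow> qbasis E J V"
  unfolding dom_def qbasis_def using subV by blast

lemma crd_gen: "i \<in> E \<Longrightarrow> j \<in> J \<Longrightarrow> residue_coord J i j \<in> subalgebra (crd J)"
  unfolding crd_def by (rule subalgebra.gen) blast

lemma frac_at_residue_coord:
  assumes "J \<subseteq> E" "i \<in> E" shows "frac_at (dom J) (crd J) V (residue_coord J i j)"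
proof (cases "j \<in> J")
  case True then show ?thesis using frac_at_subalgebra[OF crd_gen] assms by blast
next
  case False
  have z: "residue_coord J i j W = 0" if "W \<in> dom J" for W
    using qbasis.residue_coord_outside[OF qbasis_dom[OF that assms(1)] assms(2) False] .
  show ?thesis
    by (rule frac_at_cong[OF frac_at_subalgebra[OF subalgebra.const[of 0]]])
       (rule near_always, simp add: z)
qed

text \<open>Compatibility of two charts at a single point. At a fixed point it is transitive, so it
  can be reached through a chain of exchanges.\<close>

definition adjacent :: "('i \<Rightarrow>\<^sub>0 complex) set \<Rightarrow> 'i set \<Rightarrow> 'i set \<Rightarrow> bool" where
  "adjacent V J K \<longleftrightarrow> near (dom J) (crd J) V (\<lambda>W. W \<in> dom K) \<and> (\<forall>f\<in>crd K. frac_at (dom J) (crd J) V f)"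

lemma adjacent_trans:
  assumes "adjacent V J K" "adjacent V K L" "V \<in> dom J"
  shows "adjacent V J L"
proof -
  have JK: "near (dom J) (crd J) V (\<lambda>W. W \<in> dom K)" "\<And>f. f \<in> crd K \<Longrightarrow> frac_at (dom J) (crd J) V f"
    and KL: "near (dom K) (crd K) V (\<lambda>W. W \<in> dom L)" "\<And>f. f \<in> crd L \<Longrightarrow> frac_at (dom K) (crd K) V f"
    using assms unfolding adjacent_def by auto
  show ?thesis unfolding adjacent_def
    using near_pullback[where \<phi>="\<lambda>W. W", OF KL(1) JK(1) _ assms(3)] JK(2)
      frac_at_pullback_frac[where \<phi>="\<lambda>W. W", OF KL(2) JK(1) _ assms(3)] by blast
qed

lemma adjacent_exchange:
  assumes V: "V \<in> dom J" and J: "J \<subseteq> E" and k: "k \<in> E" "k \<notin> J" and j: "j \<in> J"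
    and nz: "residue_coord J k j V \<noteq> 0"
  shows "V \<in> dom (insert k (J - {j}))" "adjacent V J (insert k (J - {j}))"
proof -
  let ?J' = "insert k (J - {j})"
  have dom: "W \<in> dom ?J'" if "W \<in> dom J" "residue_coord J k j W \<noteq> 0" for W
    using qbasis.exchange(1)[OF qbasis_dom[OF that(1) J] k j that(2)] that(1) unfolding dom_def by simp
  show "V \<in> dom ?J'" using dom V nz by blast
  have n: "near (dom J) (crd J) V (\<lambda>W. residue_coord J k j W \<noteq> 0)"
    by (rule near_nonzero[OF crd_gen nz]) (use k j in auto)
  have J': "?J' \<subseteq> E" using J k by auto
  have "frac_at (dom J) (crd J) V f" if "f \<in> crd ?J'" for f
  proof -
    obtain i l where il: "i \<in> E" "l \<in> ?J'" "f = residue_coord ?J' i l" using \<open>f \<in> crd ?J'\<close> unfolding crd_def by blast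
    define g where "g W = residue_coord J i l W + residue_coord J i j W / residue_coord J k j W *
        ((if l = k then 1 else 0) + (-1) * residue_coord J k l W)" for W
    have c: "frac_at (dom J) (crd J) V (\<lambda>_. c)" for c by (rule frac_at_subalgebra[OF subalgebra.const])
    have "frac_at (dom J) (crd J) V g"
      unfolding g_def
      by (intro frac_at_add frac_at_mult frac_at_divide frac_at_residue_coord c J il k V nz)
    then show ?thesis
    proof (rule frac_at_cong)
      show "near (dom J) (crd J) V (\<lambda>W. g W = f W)"
        by (rule near_mono[OF n])
           (use qbasis.exchange(2)[OF qbasis_dom[OF _ J] k j _ il(1)] il in \<open>simp add: g_def\<close>)
    qed
  qed
  moreover have "near (dom J) (crd J) V (\<lambda>W. W \<in> dom ?J')"
    by (rule near_mono[OF n]) (use dom in blast)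
  ultimately show "adjacent V J ?J'" unfolding adjacent_def by blast
qed

lemma adjacent_refl: "adjacent V J J"
  unfolding adjacent_def by (auto intro: near_always frac_at_subalgebra subalgebra.gen)

text \<open>Each exchange brings one element of \<open>K\<close> into \<open>J\<close> and removes
  none of \<open>K\<close>, so \<open>card (K - J)\<close> drops until the sets agree.\<close>

lemma adjacent_any:
  assumes "V \<in> dom J" "J \<subseteq> E" "V \<in> dom K" "K \<subseteq> E"
  shows "adjacent V J K"
  using assms(1,2)
proof (induction "card (K - J)" arbitrary: J rule: less_induct)
  case less
  interpret qbasis E J V by (rule qbasis_dom) fact+
  have K: "qbasis E K V" "finite K" using qbasis_dom assms finV unfolding dom_def by blast+
  show ?case
  proof (cases "K = J")
    case False
    then obtain k j where kj: "k \<in> K - J" "j \<in> J - K" "residue_coord J k j V \<noteq> 0"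
      using exchange_exists[OF K] by blast
    have k: "k \<in> E" "k \<notin> J" and j: "j \<in> J" using kj assms(4) by auto
    note ex = adjacent_exchange[OF less.prems k j kj(3)]
    have "K - insert k (J - {j}) \<subset> K - J" using kj by blast
    then have "card (K - insert k (J - {j})) < card (K - J)" by (rule psubset_card_mono[rotated]) (use K in simp)
    then have "adjacent V (insert k (J - {j})) K"
      by (rule less.hyps) (use ex less.prems k in auto)
    then show ?thesis using adjacent_trans[OF ex(2) _ less.prems(1)] by blast
  qed (simp add: adjacent_refl)
qed

lemma compatible_moduli: "compatible (moduli_atlas E \<V>)"
  unfolding compatible_def atlas using adjacent_any unfolding adjacent_def by fastforce

lemma pts_moduli: "pts (chart_space (moduli_atlas E \<V>)) = (\<Union>J\<in>{J. J \<subseteq> E}. dom J)"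
  unfolding pts_chart_space atlas by (auto simp: image_iff) blast

lemma separated_moduli: "separated (moduli_atlas E \<V>)"
  unfolding separated_def
proof (intro ballI impI)
  \<comment> \<open>The difference is the coefficient at \<open>k\<close>, modulo \<open>W\<close>,
    of \<open>bvec i\<close> minus its normal form modulo \<open>V\<close>. If all of them vanish,
    the relations of \<open>V\<close> hold modulo \<open>W\<close>, and then
    \<open>V \<subseteq> W\<close>.\<close>
  have key: "\<exists>i\<in>E. \<exists>k\<in>K. residue_coord K i k W - (\<Sum>j\<in>J. residue_coord J i j V * residue_coord K j k W) \<noteq> 0"
    if V: "V \<in> dom J" "J \<subseteq> E" and W: "W \<in> dom K" "K \<subseteq> E" and v: "v \<in> V" "v \<notin> W" for V W J K v
  proof (rule ccontr)
    interpret V: qbasis E J V by (rule qbasis_dom[OF V])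
    interpret W: qbasis E K W by (rule qbasis_dom[OF W])
    assume "\<not> ?thesis"
    then have *: "residue_coord K i k W = (\<Sum>j\<in>J. residue_coord J i j V * residue_coord K j k W)" if "i \<in> E" "k \<in> K" for i k
      using that by auto
    have finJ: "finite J" using finV V unfolding dom_def by blast
    have vE: "v \<in> free_space E" using inV V(1) v unfolding dom_def by blast
    have "coord (res K W v) k = 0" for k
    proof (cases "k \<in> K")
      case True
      have "coord (res K W v) k = (\<Sum>i\<in>Poly_Mapping.keys v. coord v i * (\<Sum>j\<in>J. residue_coord J i j V * residue_coord K j k W))"
        unfolding W.coord_res[OF vE] lin_def
        by (rule sum.cong) (use * keys_free_space[OF vE] True in auto)
      also have "\<dots> = (\<Sum>j\<in>J. lin (\<lambda>i. residue_coord J i j V) v * residue_coord K j k W)"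
        unfolding lin_def sum_distrib_left sum_distrib_right by (subst sum.swap) (simp add: mult.assoc)
      also have "\<dots> = 0" using V.res_eq_0_iff[OF vE] v by (simp add: V.coord_res[OF vE, symmetric])
      finally show ?thesis .
    next
      case False then show ?thesis using W.res_mem[OF vE] by (simp add: free_space_iff)
    qed
    then have "res K W v = 0" by (intro poly_mapping_eqI) simp
    then show False using W.res_eq_0_iff[OF vE] v by simp
  qed
  have alg: "(\<lambda>z. residue_coord K i k (snd z) - (\<Sum>j\<in>J. residue_coord J i j (fst z) * residue_coord K j k (snd z)))
     \<in> subalgebra ((\<lambda>c. c \<circ> fst) ` crd J \<union> (\<lambda>d. d \<circ> snd) ` crd K)"
    "(\<lambda>z. residue_coord K i k (fst z) - (\<Sum>j\<in>J. residue_coord J i j (snd z) * residue_coord K j k (fst z)))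
     \<in> subalgebra ((\<lambda>c. c \<circ> fst) ` crd K \<union> (\<lambda>d. d \<circ> snd) ` crd J)"
    if ik: "i \<in> E" "k \<in> K" "J \<subseteq> E" for J K i k
  proof -
    have f: "(\<lambda>z. residue_coord J i j (fst z)) \<in> subalgebra ((\<lambda>c. c \<circ> fst) ` crd J \<union> D)"
      and g: "(\<lambda>z. residue_coord J i j (snd z)) \<in> subalgebra (C \<union> (\<lambda>c. c \<circ> snd) ` crd J)"
      if "i \<in> E" "j \<in> J" for i j J C D
      using that unfolding crd_def comp_def by (blast intro: subalgebra.gen)+
    show "(\<lambda>z. residue_coord K i k (snd z) - (\<Sum>j\<in>J. residue_coord J i j (fst z) * residue_coord K j k (snd z)))
     \<in> subalgebra ((\<lambda>c. c \<circ> fst) ` crd J \<union> (\<lambda>d. d \<circ> snd) ` crd K)"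
      by (intro subalgebra_diff subalgebra_sum subalgebra.mult f g) (use ik in auto)
    show "(\<lambda>z. residue_coord K i k (fst z) - (\<Sum>j\<in>J. residue_coord J i j (snd z) * residue_coord K j k (fst z)))
     \<in> subalgebra ((\<lambda>c. c \<circ> fst) ` crd K \<union> (\<lambda>d. d \<circ> snd) ` crd J)"
      by (intro subalgebra_diff subalgebra_sum subalgebra.mult f g) (use ik in auto)
  qed
  fix V W assume "V \<in> pts (chart_space (moduli_atlas E \<V>))" "W \<in> pts (chart_space (moduli_atlas E \<V>))" and ne: "V \<noteq> W"
  then obtain J K where J: "V \<in> dom J" "J \<subseteq> E" and K: "W \<in> dom K" "K \<subseteq> E" unfolding pts_moduli by blast
  have fin: "finite J" "finite K" using finV J K unfolding dom_def by blast+
  have van: "residue_coord K i k Z - (\<Sum>j\<in>J. residue_coord J i j Z * residue_coord K j k Z) = 0"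
    if "Z \<in> dom J" "Z \<in> dom K" "i \<in> E" "J \<subseteq> E" "K \<subseteq> E" "finite J" for J K Z i k
    using qbasis.residue_coord_change[OF qbasis_dom[OF that(1,4)] qbasis_dom[OF that(2,5)] that(6,3)] by simp
  show "\<exists>U C U' C' h. (U, C) \<in> moduli_atlas E \<V> \<and> (U', C') \<in> moduli_atlas E \<V> \<and> V \<in> U \<and> W \<in> U' \<and>
        h \<in> subalgebra ((\<lambda>c. c \<circ> fst) ` C \<union> (\<lambda>d. d \<circ> snd) ` C') \<and> h (V, W) \<noteq> 0 \<and>
        (\<forall>z\<in>U \<inter> U'. h (z, z) = 0)"
  proof (cases "V \<subseteq> W")
    case False
    then obtain i k where ik: "i \<in> E" "k \<in> K"
      "residue_coord K i k W - (\<Sum>j\<in>J. residue_coord J i j V * residue_coord K j k W) \<noteq> 0"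
      using key[OF J K] by blast
    show ?thesis
      by (rule exI[of _ "dom J"], rule exI[of _ "crd J"], rule exI[of _ "dom K"], rule exI[of _ "crd K"],
          rule exI[of _ "\<lambda>z. residue_coord K i k (snd z) - (\<Sum>j\<in>J. residue_coord J i j (fst z) * residue_coord K j k (snd z))"],
          intro conjI atlasI J K alg(1) ik ballI)
         (use ik van[OF _ _ ik(1) J(2) K(2) fin(1)] in auto)
  next
    \<comment> \<open>Now some element of \<open>W\<close> lies outside \<open>V\<close>, and the
      same function with the roles of \<open>V\<close> and \<open>W\<close> exchanged separates the
      two points.\<close>
    case True
    then obtain w where "w \<in> W" "w \<notin> V" using ne by blast
    then obtain i k where ik: "i \<in> E" "k \<in> J"
      "residue_coord J i k V - (\<Sum>j\<in>K. residue_coord K i j W * residue_coord J j k V) \<noteq> 0"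
      using key[OF K J] by blast
    show ?thesis
      by (rule exI[of _ "dom J"], rule exI[of _ "crd J"], rule exI[of _ "dom K"], rule exI[of _ "crd K"],
          rule exI[of _ "\<lambda>z. residue_coord J i k (fst z) - (\<Sum>j\<in>K. residue_coord K i j (snd z) * residue_coord J j k (fst z))"],
          intro conjI atlasI J K alg(2) ik ballI)
         (use ik van[OF _ _ ik(1) K(2) J(2) fin(2)] in auto)
  qed
qed

lemma dom_eqI:
  assumes V: "V \<in> dom J" and W: "W \<in> dom J" and JE: "J \<subseteq> E"
    and eq: "\<And>i j. i \<in> E \<Longrightarrow> j \<in> J \<Longrightarrow> residue_coord J i j V = residue_coord J i j W"
  shows "V = W"
proof -
  interpret V: qbasis E J V by (rule qbasis_dom[OF V JE])
  interpret W: qbasis E J W by (rule qbasis_dom[OF W JE])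
  have rc: "residue_coord J i j V = residue_coord J i j W" if "i \<in> E" for i j
    using that eq V.residue_coord_outside W.residue_coord_outside by (cases "j \<in> J") auto
  have "res J V v = res J W v" if v: "v \<in> free_space E" for v
    by (rule poly_mapping_eqI, unfold V.coord_res[OF v] W.coord_res[OF v] lin_def, rule sum.cong)
       (use rc keys_free_space[OF v] in auto)
  then have "v \<in> V \<longleftrightarrow> v \<in> W" if "v \<in> free_space E" for v
    using V.res_eq_0_iff[OF that] W.res_eq_0_iff[OF that] that by simp
  then show "V = W" using inV V W unfolding dom_def by blast
qed

text \<open>\<open>E\<close> may be infinite. A finite part \<open>E'\<close> carries all
  information as soon as the other residue coordinates vanish on the chart, as happens for monomials
  of degree at least \<open>d\<close>.\<close>

lemma affine_chart_dom:
  assumes J: "J \<subseteq> E'" "E' \<subseteq> E" "finite E'"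
    and van: "\<And>V i j. V \<in> dom J \<Longrightarrow> i \<in> E - E' \<Longrightarrow> j \<in> J \<Longrightarrow> residue_coord J i j V = 0"
    and real: "\<And>z. (\<And>P. P \<in> subalgebra ((\<lambda>k w. w k) ` (E' \<times> J)) \<Longrightarrow>
        (\<And>V. V \<in> dom J \<Longrightarrow> P (\<lambda>k. residue_coord J (fst k) (snd k) V) = 0) \<Longrightarrow> P (\<lambda>k. z (fst k) (snd k)) = 0) \<Longrightarrow>
        \<exists>V\<in>dom J. \<forall>i\<in>E'. \<forall>j\<in>J. residue_coord J i j V = z i j"
  shows "affine_chart (dom J) (crd J)"
proof (rule affine_chartI[where K="E' \<times> J" and F="\<lambda>k. residue_coord J (fst k) (snd k)"])
  show "finite (E' \<times> J)" using J finite_subset by blast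
  fix k assume "k \<in> E' \<times> J"
  then show "\<exists>p\<in>subalgebra (crd J). \<forall>V\<in>dom J. residue_coord J (fst k) (snd k) V = p V"
    using crd_gen J by (intro bexI[of _ "residue_coord J (fst k) (snd k)"]) auto
next
  fix c assume "c \<in> crd J"
  then obtain i j where ij: "i \<in> E" "j \<in> J" "c = residue_coord J i j" unfolding crd_def by blast
  let ?F = "(\<lambda>k. residue_coord J (fst k) (snd k)) ` (E' \<times> J)"
  show "\<exists>p\<in>subalgebra ?F. \<forall>V\<in>dom J. c V = p V"
  proof (cases "i \<in> E'")
    case True
    have "c \<in> ?F" by (rule image_eqI[of _ _ "(i, j)"]) (use True ij in auto)
    then show ?thesis by (intro bexI[of _ c] subalgebra.gen) auto
  next
    case False
    then show ?thesis using van ij by (intro bexI[of _ "\<lambda>_. 0"] subalgebra.const) auto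
  qed
next
  fix V W assume V: "V \<in> dom J" and W: "W \<in> dom J"
    and eq: "\<And>k. k \<in> E' \<times> J \<Longrightarrow> residue_coord J (fst k) (snd k) V = residue_coord J (fst k) (snd k) W"
  have JE: "J \<subseteq> E" using J by blast
  show "V = W"
  proof (rule dom_eqI[OF V W JE])
    fix i j assume "i \<in> E" "j \<in> J"
    then show "residue_coord J i j V = residue_coord J i j W"
      using eq[of "(i, j)"] van[OF V, of i j] van[OF W, of i j] by (cases "i \<in> E'") auto
  qed
next
  fix z :: "'i \<times> 'i \<Rightarrow> complex"
  assume z: "\<And>P. P \<in> subalgebra ((\<lambda>k z. z k) ` (E' \<times> J)) \<Longrightarrow>
     (\<And>V. V \<in> dom J \<Longrightarrow> P (\<lambda>k. residue_coord J (fst k) (snd k) V) = 0) \<Longrightarrow> P z = 0"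
  have "\<exists>V\<in>dom J. \<forall>i\<in>E'. \<forall>j\<in>J. residue_coord J i j V = z (i, j)"
    by (rule real) (use z in simp)
  then show "\<exists>V\<in>dom J. \<forall>k\<in>E' \<times> J. residue_coord J (fst k) (snd k) V = z k" by force
qed

end

lemma restrict_moduli_atlas: "restrict_atlas (moduli_atlas E \<V>) S = moduli_atlas E (\<V> \<inter> S)"
proof -
  have img: "moduli_atlas E \<V> = (\<lambda>J. ({V\<in>\<V>. quotient_basis E J V}, {residue_coord J i j |i j. i \<in> E \<and> j \<in> J})) ` Pow E"
    for \<V> unfolding moduli_atlas_def by (auto simp: image_iff)
  have "{V\<in>\<V>. quotient_basis E J V} \<inter> S = {V\<in>\<V> \<inter> S. quotient_basis E J V}" for J by blast
  then show ?thesis unfolding img restrict_atlas_def image_image by simp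
qed

section \<open>Greedy bases\<close>

text \<open>The indices at which the span of the first basis vectors grows modulo \<open>V\<close>;
  they form the lexicographically first basis of the quotient.\<close>

definition greedy :: "nat \<Rightarrow> (nat \<Rightarrow>\<^sub>0 complex) set \<Rightarrow> nat set" where
  "greedy n V = {j. j < n \<and> \<not> (\<exists>u\<in>free_space {..<j}. bvec j - u \<in> V)}"

text \<open>The bound by \<open>j\<close> is the zero pattern of an echelon form. It survives the
  induction because every earlier vector is reduced to vectors that are not later than
  itself.\<close>

lemma greedy_spans:
  assumes "free.subspace V" "j < n"
  shows "\<exists>u\<in>free_space (greedy n V \<inter> {..j}). bvec j - u \<in> V"
  using assms(2)
proof (induction j rule: less_induct)
  case (less j)
  show ?case
  proof (cases "j \<in> greedy n V")
    case True
    then show ?thesis using free.subspace_0[OF assms(1)] by (intro bexI[of _ "bvec j"]) auto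
  next
    case False
    then obtain u where u: "u \<in> free_space {..<j}" "bvec j - u \<in> V" using less.prems unfolding greedy_def by blast
    have "\<forall>i\<in>Poly_Mapping.keys u. \<exists>w\<in>free_space (greedy n V \<inter> {..j}). bvec i - w \<in> V"
    proof
      fix i assume "i \<in> Poly_Mapping.keys u"
      then have "i < j" using keys_free_space[OF u(1)] by blast
      then obtain w where w: "w \<in> free_space (greedy n V \<inter> {..i})" "bvec i - w \<in> V"
        using less.IH less.prems by (meson order_less_trans)
      have "free_space (greedy n V \<inter> {..i}) \<subseteq> free_space (greedy n V \<inter> {..j})"
        by (rule free_space_mono) (use \<open>i < j\<close> in auto)
      then show "\<exists>w\<in>free_space (greedy n V \<inter> {..j}). bvec i - w \<in> V" using w by blast
    qed
    then obtain w where w: "\<And>i. i \<in> Poly_Mapping.keys u \<Longrightarrow> w i \<in> free_space (greedy n V \<inter> {..j}) \<and> bvec i - w i \<in> V"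
      by metis
    have "ext w u \<in> free_space (greedy n V \<inter> {..j})"
      by (rule ext_mem[OF subspace_free_space]) (use w in blast)
    moreover have "ext (\<lambda>i. bvec i - w i) u \<in> V" by (rule ext_mem[OF assms(1)]) (use w in blast)
    then have "u - ext w u \<in> V"
      using ext_id[of u] by (simp add: ext_def free.scale_right_diff_distrib sum_subtractf)
    from free.subspace_add[OF assms(1) u(2) this] have "bvec j - ext w u \<in> V" by simp
    ultimately show ?thesis by blast
  qed
qed

text \<open>In a nontrivial relation the vector of largest index would be a combination of earlier
  ones modulo \<open>V\<close>, so it would not have been chosen.\<close>

lemma greedy_independent:
  assumes "free.subspace V" "u \<in> free_space (greedy n V)" "u \<in> V"
  shows "u = 0"
proof (rule ccontr)
  assume "u \<noteq> 0"
  then have ne: "Poly_Mapping.keys u \<noteq> {}" by simp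
  define j where "j = Max (Poly_Mapping.keys u)"
  have j: "j \<in> Poly_Mapping.keys u" "\<And>i. i \<in> Poly_Mapping.keys u \<Longrightarrow> i \<le> j"
    using ne unfolding j_def by auto
  have c: "coord u j \<noteq> 0" using j by (simp add: in_keys_iff)
  let ?v = "bvec j - scale (1 / coord u j) u"
  have "?v \<in> free_space {..<j}" unfolding free_space_iff
  proof (intro allI impI)
    fix i assume "i \<notin> {..<j}"
    then show "coord ?v i = 0"
      using j(2)[of i] c by (cases "i = j") (auto simp: lookup_minus lookup_single when_def in_keys_iff)
  qed
  moreover have "bvec j - ?v \<in> V" using free.subspace_scale[OF assms(1,3)] by simp
  ultimately have "j \<notin> greedy n V" unfolding greedy_def by blast
  then show False using keys_free_space[OF assms(2) j(1)] by blast
qed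

lemma greedy_quotient_basis:
  assumes "free.subspace V" shows "quotient_basis {..<n} (greedy n V) V"
proof (rule quotient_basisI[OF assms])
  fix v assume v: "v \<in> free_space {..<n}"
  have "\<forall>i\<in>Poly_Mapping.keys v. \<exists>w\<in>free_space (greedy n V). bvec i - w \<in> V"
    using greedy_spans[OF assms] keys_free_space[OF v] free_space_mono[of "greedy n V \<inter> {.._}" "greedy n V"] by blast
  then obtain w where w: "\<And>i. i \<in> Poly_Mapping.keys v \<Longrightarrow> w i \<in> free_space (greedy n V) \<and> bvec i - w i \<in> V"
    by metis
  have "ext w v \<in> free_space (greedy n V)" by (rule ext_mem[OF subspace_free_space]) (use w in blast)
  moreover have "ext (\<lambda>i. bvec i - w i) v \<in> V" by (rule ext_mem[OF assms]) (use w in blast)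
  then have "v - ext w v \<in> V"
    using ext_id[of v] by (simp add: ext_def free.scale_right_diff_distrib sum_subtractf)
  ultimately show "\<exists>u\<in>free_space (greedy n V). v - u \<in> V" by blast
qed (use greedy_independent[OF assms] in blast)

text \<open>Reads the complement of \<open>A\<close> as a binary number, so that the lexicographic order of sets,
  decided at the least element of the symmetric difference, becomes the order of numbers.\<close>

fun lex_key :: "nat \<Rightarrow> nat set \<Rightarrow> nat" where
  "lex_key 0 A = 0"
| "lex_key (Suc n) A = 2 * lex_key n A + (if n \<in> A then 0 else 1)"

lemma lex_key_cong: "(\<And>i. i < n \<Longrightarrow> i \<in> A \<longleftrightarrow> i \<in> B) \<Longrightarrow> lex_key n A = lex_key n B"
  by (induction n) auto

lemma lex_key_less:
  assumes "j < n" "j \<in> A" "j \<notin> B" "\<And>i. i < j \<Longrightarrow> i \<in> A \<longleftrightarrow> i \<in> B"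
  shows "lex_key n A < lex_key n B"
  using assms(1)
proof (induction n)
  case (Suc n)
  show ?case
  proof (cases "j = n")
    case True
    then show ?thesis using assms lex_key_cong[of n A B] by simp
  next
    case False
    then show ?thesis using Suc by auto
  qed
qed simp

text \<open>Below the least index of the symmetric difference the sets agree. If that index belonged
  to \<open>B\<close>, the reduction of its vector to earlier elements of \<open>A\<close> would be
  a relation within \<open>B\<close>.\<close>

lemma greedy_first:
  assumes A: "\<And>j. j < n \<Longrightarrow> j \<notin> A \<Longrightarrow> \<exists>u\<in>free_space (A \<inter> {..<j}). bvec j - u \<in> V"
    and B: "\<And>u. u \<in> free_space B \<Longrightarrow> u \<in> V \<Longrightarrow> u = 0"
    and sub: "A \<subseteq> {..<n}" "B \<subseteq> {..<n}" and ne: "A \<noteq> B"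
  shows "lex_key n A < lex_key n B"
proof -
  let ?D = "(A - B) \<union> (B - A)"
  define j where "j = Min ?D"
  have fin: "finite ?D" using sub finite_subset by blast
  have D: "?D \<noteq> {}" using ne by blast
  have j: "j \<in> ?D" "\<And>i. i < j \<Longrightarrow> i \<in> A \<longleftrightarrow> i \<in> B"
    using Min_in[OF fin D] Min_le[OF fin] unfolding j_def by (auto simp: not_le[symmetric])
  have "j \<notin> B - A"
  proof
    assume jB: "j \<in> B - A"
    then obtain u where u: "u \<in> free_space (A \<inter> {..<j})" "bvec j - u \<in> V" using A sub by blast
    have "A \<inter> {..<j} \<subseteq> B" using j(2) by blast
    then have "u \<in> free_space B" using u(1) free_space_mono by blast
    moreover have "bvec j \<in> free_space B" using jB by simp
    ultimately have "bvec j - u \<in> free_space B" using free.subspace_diff[OF subspace_free_space] by blast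
    then have "bvec j - u = 0" using B u(2) by blast
    then have "bvec j \<in> free_space (A \<inter> {..<j})" using u(1) by simp
    then show False using jB unfolding bvec_free_space by blast
  qed
  then show ?thesis using j sub lex_key_less[of j n A B] by blast
qed


section \<open>Classes of Grassmannians\<close>

text \<open>The free entries of a reduced echelon form with pivots \<open>A\<close>, so their number
  is the dimension of the Schubert cell.\<close>

definition inversions :: "nat \<Rightarrow> nat set \<Rightarrow> (nat \<times> nat) set" where
  "inversions n A = {(j, a). j < n \<and> j \<notin> A \<and> a \<in> A \<and> a < j}"

lemma finite_inversions: "finite (inversions n A)"
  by (rule finite_subset[of _ "{..<n} \<times> {..<n}"]) (auto simp: inversions_def)

text \<open>The vectors \<open>bvec i - res J V (bvec i)\<close> with \<open>i \<in> E - J\<close>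
  form a basis of \<open>V\<close>: their coefficients on \<open>E - J\<close> are the identity
  matrix.\<close>

lemma (in qbasis) dim_complement:
  assumes "finite E" "V \<subseteq> free_space E" shows "free.dim V = card (E - J)"
proof (rule free.dim_unique)
  let ?b = "\<lambda>i. bvec i - res J V (bvec i)"
  have coord_b: "coord (?b i) k = (if k = i then 1 else 0)" if "i \<in> E - J" "k \<in> E - J" for i k
    using that res_mem[of "bvec i"] by (auto simp: lookup_minus lookup_single when_def free_space_iff)
  have inj: "inj_on ?b (E - J)"
  proof (rule inj_onI)
    fix i k assume ik: "i \<in> E - J" "k \<in> E - J" and eq: "?b i = ?b k"
    have "coord (?b i) i = coord (?b k) i" by (simp only: eq)
    then show "i = k" using coord_b[OF ik(1,1)] coord_b[OF ik(2,1)] by (simp split: if_splits)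
  qed
  show "?b ` (E - J) \<subseteq> V" using res_diff by auto
  show "V \<subseteq> free.span (?b ` (E - J))"
  proof
    fix v assume v: "v \<in> V"
    then have vE: "v \<in> free_space E" using assms by blast
    have "v = v - res J V v" using res_eq_0_iff[OF vE] v by simp
    also have "\<dots> = ext ?b v"
      unfolding res_ext[OF vE] using ext_id[of v] by (simp add: ext_def free.scale_right_diff_distrib sum_subtractf)
    also have "\<dots> \<in> free.span (?b ` (E - J))"
    proof (rule ext_mem[OF free.subspace_span])
      fix i assume "i \<in> Poly_Mapping.keys v"
      then have "i \<in> E" using keys_free_space[OF vE] by blast
      show "?b i \<in> free.span (?b ` (E - J))"
      proof (cases "i \<in> J")
        case True then show ?thesis using res_free[of "bvec i"] free.span_zero by simp
      next
        case False then show ?thesis using \<open>i \<in> E\<close> by (intro free.span_base) blast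
      qed
    qed
    finally show "v \<in> free.span (?b ` (E - J))" .
  qed
  show "free.independent (?b ` (E - J))"
  proof (rule free.independent_if_scalars_zero)
    show "finite (?b ` (E - J))" using assms by simp
    fix f x assume s: "(\<Sum>x\<in>?b ` (E - J). scale (f x) x) = 0" and x: "x \<in> ?b ` (E - J)"
    then obtain k where k: "k \<in> E - J" "x = ?b k" by blast
    have "(\<Sum>x\<in>?b ` (E - J). scale (f x) x) = (\<Sum>i\<in>E - J. scale (f (?b i)) (?b i))"
      by (simp add: sum.reindex[OF inj])
    then have "0 = coord (\<Sum>i\<in>E - J. scale (f (?b i)) (?b i)) k" using s by simp
    also have "\<dots> = (\<Sum>i\<in>E - J. if i = k then f (?b i) else 0)"
      unfolding coord_sum by (rule sum.cong[OF refl]) (use coord_b k in auto)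
    also have "\<dots> = f x" using assms(1) k by simp
    finally show "f x = 0" by simp
  qed
  show "card (?b ` (E - J)) = card (E - J)" by (rule card_image[OF inj])
qed

text \<open>Stratification by the greedy basis of the quotient, hence by sets \<open>A\<close> of
  size \<open>n - k\<close>. Each stratum consists of the echelon matrices in the chart of
  \<open>A\<close>, an affine space with one coordinate for every inversion.\<close>

theorem cls_grassmannian:
  assumes kn: "k \<le> n"
  shows "cls (grassmannian k n) = (\<Sum>A | A \<subseteq> {..<n} \<and> card A = n - k. \<bbbL> ^ card (inversions n A))"
proof -
  let ?E = "{..<n}"
  define \<V> where "\<V> = {V. V \<subseteq> free_space ?E \<and> free.subspace V \<and> free.dim V = k}"
  interpret moduli ?E \<V> by standard (auto simp: \<V>_def intro: finite_subset)
  define I where "I = {A. A \<subseteq> ?E \<and> card A = n - k}"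
  define T where "T A = {V\<in>dom A. \<forall>(j, a)\<in>{..<n} \<times> A. j < a \<longrightarrow> residue_coord A j a V = 0}" for A
  have finI: "finite I" unfolding I_def by (rule finite_subset[of _ "Pow ?E"]) auto
  have IE: "A \<subseteq> ?E" if "A \<in> I" for A using that unfolding I_def by blast
  have card_eq: "card J = n - k" if "V \<in> \<V>" "qbasis ?E J V" for V J
  proof -
    have "free.dim V = card (?E - J)" by (rule qbasis.dim_complement[OF that(2)]) (use that in \<open>auto simp: \<V>_def\<close>)
    moreover have "J \<subseteq> ?E" using that(2) unfolding qbasis_def by blast
    then have "card (?E - J) = n - card J" "card J \<le> n"
      using card_Diff_subset[of J ?E] card_mono[of ?E J] finite_subset by auto
    moreover have "free.dim V = k" using that(1) by (simp add: \<V>_def)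
    ultimately show ?thesis by linarith
  qed
  have ker: "kernel ?E J z \<in> dom J" if "J \<in> I" "\<And>i j. i \<in> J \<Longrightarrow> j \<in> J \<Longrightarrow> z i j = (if i = j then 1 else 0)" for J z
  proof -
    have J: "finite J" "J \<subseteq> ?E" using IE[OF that(1)] finite_subset[OF IE[OF that(1)]] by auto
    note kn = kernel[OF J that(2)]
    have "free.dim (kernel ?E J z) = card (?E - J)" by (rule qbasis.dim_complement[OF kn(3) _ kn(2)]) auto
    also have "\<dots> = n - card J" using card_Diff_subset[OF J] by simp
    also have "\<dots> = k" using that(1) \<open>k \<le> n\<close> unfolding I_def by simp
    finally have "kernel ?E J z \<in> \<V>" using kn(1,2) unfolding \<V>_def by simp
    then show ?thesis using kn(3) unfolding dom_def qbasis_def by simp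
  qed
  have aff: "affine_chart (dom J) (crd J)" if J: "J \<in> I" for J
  proof (rule affine_chart_dom[OF IE[OF J]])
    fix z :: "nat \<Rightarrow> nat \<Rightarrow> complex"
    assume z: "\<And>P. P \<in> subalgebra ((\<lambda>k w. w k) ` (?E \<times> J)) \<Longrightarrow>
        (\<And>V. V \<in> dom J \<Longrightarrow> P (\<lambda>k. residue_coord J (fst k) (snd k) V) = 0) \<Longrightarrow> P (\<lambda>k. z (fst k) (snd k)) = 0"
    \<comment> \<open>The chart is the space of matrices that are the identity on the rows in
      \<open>J\<close>. These linear relations suffice to realise a tuple by
      \<open>kernel\<close>.\<close>
    have z1: "z i j = (if i = j then 1 else 0)" if ij: "i \<in> J" "j \<in> J" for i j
    proof -
      have "(\<lambda>w. w (i, j) - (if i = j then 1 else 0)) (\<lambda>k. z (fst k) (snd k)) = 0"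
      proof (rule z)
        have "i \<in> ?E" using ij IE[OF J] by blast
        then show "(\<lambda>w. w (i, j) - (if i = j then 1 else 0)) \<in> subalgebra ((\<lambda>k w. w k) ` (?E \<times> J))"
          using ij by (intro subalgebra_diff subalgebra.const subalgebra.gen) auto
      qed (use qbasis.residue_coord_basis[OF qbasis_dom[OF _ IE[OF J]] ij(1)] in simp)
      then show ?thesis by simp
    qed
    show "\<exists>V\<in>dom J. \<forall>i\<in>?E. \<forall>j\<in>J. residue_coord J i j V = z i j"
      using ker[OF J z1] kernel(4)[OF _ IE[OF J] z1] finite_subset[OF IE[OF J]] by blast
  qed auto
  have greedy: "greedy n V \<in> I \<and> V \<in> T (greedy n V)" if V: "V \<in> \<V>" for V
  proof -
    have sub: "free.subspace V" using subV V .
    have qb: "qbasis ?E (greedy n V) V"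
      unfolding qbasis_def using sub greedy_quotient_basis[OF sub, of n] by (auto simp: greedy_def)
    then have I: "greedy n V \<in> I" using card_eq[OF V qb] unfolding I_def qbasis_def by blast
    have "residue_coord (greedy n V) j a V = 0" if j: "j < n" "j < a" for j a
    proof -
      obtain u where u: "u \<in> free_space (greedy n V \<inter> {..j})" "bvec j - u \<in> V" using greedy_spans[OF sub j(1)] by blast
      have "res (greedy n V) V (bvec j) = u"
        by (rule qbasis.res_eqI[OF qb]) (use u j free_space_mono[of "greedy n V \<inter> {..j}" "greedy n V"] in auto)
      then show ?thesis using u(1) j by (simp add: residue_coord_res free_space_iff)
    qed
    then show ?thesis using I qb V unfolding T_def dom_def qbasis_def by auto
  qed
  have TU: "T A \<subseteq> dom A" for A unfolding T_def by blast
  \<comment> \<open>For a point of the cell of \<open>A\<close>, a basis \<open>B\<close> of the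
    quotient cannot precede the greedy basis \<open>A\<close>; so the chart of \<open>B\<close>
    meets, besides the cell of \<open>B\<close>, only cells of earlier sets.\<close>
  have ord: "lex_key n A < lex_key n B" if AB: "A \<in> I" "B \<in> I" "A \<noteq> B" and V: "V \<in> T A" "V \<in> dom B" for A B V
  proof -
    interpret A: qbasis ?E A V using qbasis_dom V(1) TU IE[OF AB(1)] by blast
    interpret B: qbasis ?E B V using qbasis_dom V(2) IE[OF AB(2)] by blast
    show ?thesis
    proof (rule greedy_first)
      fix j assume j: "j < n" "j \<notin> A"
      then have e: "bvec j \<in> free_space ?E" by simp
      have "res A V (bvec j) \<in> free_space (A \<inter> {..<j})"
        unfolding free_space_iff
      proof (intro allI impI)
        fix a assume "a \<notin> A \<inter> {..<j}"
        then consider "a \<notin> A" | "a \<in> A" "j < a" using j by (metis Int_iff lessThan_iff linorder_neqE_nat)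
        then show "coord (res A V (bvec j)) a = 0"
        proof cases
          case 1 then show ?thesis using A.res_mem[OF e] unfolding free_space_iff by blast
        next
          case 2 then show ?thesis using V(1) j unfolding T_def residue_coord_res by auto
        qed
      qed
      then show "\<exists>u\<in>free_space (A \<inter> {..<j}). bvec j - u \<in> V" using A.res_diff[OF e] by blast
    next
      show "u = 0" if "u \<in> free_space B" "u \<in> V" for u
        using B.res_free[OF that(1)] B.res_eq_0_iff[OF B.free_JE[OF that(1)]] that(2) by simp
      show "A \<subseteq> ?E" "B \<subseteq> ?E" by (fact IE[OF AB(1)], fact IE[OF AB(2)])
      show "A \<noteq> B" by (fact AB(3))

    qed
  qed
  have stratum: "cls (chart_space {(T A, crd A)}) = \<bbbL> ^ card (inversions n A)" if A: "A \<in> I" for A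
  proof -
    have AE: "A \<subseteq> ?E" and finA: "finite A" using IE[OF A] finite_subset by auto
    let ?u = "\<lambda>k. residue_coord A (fst k) (snd k)"
    have TD: "V \<in> T A \<Longrightarrow> V \<in> dom A" for V using TU by blast
    have rc: "residue_coord A j a V = (if j = a then 1 else 0)"
      if "V \<in> T A" "j < n" "a \<in> A" "(j, a) \<notin> inversions n A" for V j a
    proof -
      interpret qbasis ?E A V using qbasis_dom[OF TD AE] that by blast
      have "j \<in> A \<or> j < a" using that(2-4) by (auto simp: inversions_def not_less le_less)
      then consider "j \<in> A" | "j \<notin> A" "j < a" by blast
      then show ?thesis
      proof cases
        case 1 then show ?thesis using residue_coord_basis by simp
      next
        case 2 then show ?thesis using that unfolding T_def by auto
      qed
    qed
    have "cls (chart_space {(T A, crd A)}) = cls (chart_space {({()}, {})}) * \<bbbL> ^ card (inversions n A)"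
    proof (rule cls_trivial_bundle[OF affine_chart_point finite_inversions, where u="?u" and \<pi>="\<lambda>_. ()"])
      fix V W assume VW: "V \<in> T A" "W \<in> T A" and eq: "\<And>k. k \<in> inversions n A \<Longrightarrow> ?u k V = ?u k W"
      show "V = W"
      proof (rule dom_eqI[OF TD[OF VW(1)] TD[OF VW(2)] AE])
        show "residue_coord A i j V = residue_coord A i j W" if "i \<in> ?E" "j \<in> A" for i j
          using rc[OF VW(1)] rc[OF VW(2)] eq[of "(i, j)"] that by (cases "(i, j) \<in> inversions n A") auto
      qed
    next
      fix s :: unit and w :: "nat \<times> nat \<Rightarrow> complex"
      define z where "z i j = (if (i, j) \<in> inversions n A then w (i, j) else if i = j then 1 else 0)" for i j
      have z1: "z i j = (if i = j then 1 else 0)" if "i \<in> A" "j \<in> A" for i j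
        using that by (auto simp: z_def inversions_def)
      have rcz: "residue_coord A i j (kernel ?E A z) = z i j" if "i < n" "j \<in> A" for i j
        using kernel(4)[OF finA AE z1] that by blast
      have "kernel ?E A z \<in> T A"
      proof -
        have "residue_coord A j a (kernel ?E A z) = 0" if "j < n" "a \<in> A" "j < a" for j a
          using rcz[OF that(1,2)] that by (simp add: z_def inversions_def)
        then show ?thesis using ker[OF A z1] unfolding T_def by auto
      qed
      moreover have "?u k (kernel ?E A z) = w k" if "k \<in> inversions n A" for k
      proof -
        have "fst k < n" "snd k \<in> A" using that by (auto simp: inversions_def)
        then show ?thesis using rcz that by (simp add: z_def)
      qed
      ultimately show "\<exists>V\<in>T A. () = s \<and> (\<forall>k\<in>inversions n A. ?u k V = w k)" by fastforce
    next
      fix k assume "k \<in> inversions n A"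
      then show "\<exists>p\<in>subalgebra (crd A). \<forall>V\<in>T A. ?u k V = p V"
        using crd_gen[of "fst k" "snd k" A] by (intro bexI[of _ "?u k"]) (auto simp: inversions_def)
    next
      fix d assume "d \<in> crd A"
      then obtain i j where ij: "i < n" "j \<in> A" "d = residue_coord A i j" unfolding crd_def by blast
      show "\<exists>p\<in>subalgebra ((\<lambda>c. c \<circ> (\<lambda>_. ())) ` {} \<union> ?u ` inversions n A). \<forall>V\<in>T A. d V = p V"
      proof (cases "(i, j) \<in> inversions n A")
        case True
        have "d \<in> ?u ` inversions n A" by (rule image_eqI[OF _ True]) (simp add: ij)
        then show ?thesis by (intro bexI[of _ d] subalgebra.gen) auto
      next
        case False
        then show ?thesis using rc ij by (intro bexI[of _ "\<lambda>_. if i = j then 1 else 0"] subalgebra.const) auto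
      qed
    qed auto
    then show ?thesis by (simp add: cls_point)
  qed
  have pts: "pts (chart_space (moduli_atlas ?E \<V>)) = (\<Union>A\<in>I. T A)"
  proof
    show "pts (chart_space (moduli_atlas ?E \<V>)) \<subseteq> (\<Union>A\<in>I. T A)"
      unfolding pts_moduli using greedy unfolding dom_def by blast
    show "(\<Union>A\<in>I. T A) \<subseteq> pts (chart_space (moduli_atlas ?E \<V>))"
      unfolding pts_moduli using TU IE by blast
  qed
  have "variety_atlas (moduli_atlas ?E \<V>)"
    unfolding variety_atlas_def
  proof (intro conjI compatible_moduli separated_moduli exI[of _ "(\<lambda>A. (dom A, crd A)) ` I"])
    show "(\<lambda>A. (dom A, crd A)) ` I \<subseteq> moduli_atlas ?E \<V>" using atlasI IE by blast
    show "\<Union> (fst ` (\<lambda>A. (dom A, crd A)) ` I) = \<Union> (fst ` moduli_atlas ?E \<V>)"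
      using pts TU IE pts_moduli unfolding pts_chart_space by (auto simp: image_image) blast+
  qed (use finI aff in auto)
  then have "cls (chart_space (moduli_atlas ?E \<V>)) = (\<Sum>A\<in>I. cls (chart_space {(T A, crd A)}))"
  proof (rule cls_stratification[OF finI])
    show "wf (inv_image less_than (lex_key n))" by auto
    show "(A, B) \<in> inv_image less_than (lex_key n)" if "A \<in> I" "B \<in> I" "A \<noteq> B" "V \<in> T A" "V \<in> dom B" for A B V
      using ord[OF that] by simp
    show "T A \<inter> T B = {}" if "A \<in> I" "B \<in> I" "A \<noteq> B" for A B
      using ord[OF that] ord[of B A] that TU by (metis disjoint_iff less_asym subsetD)
  qed (use aff pts TU atlasI IE in auto)
  also have "\<dots> = (\<Sum>A\<in>I. \<bbbL> ^ card (inversions n A))" using stratum by simp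
  finally show ?thesis
    unfolding grassmannian_def subspace_moduli_atlas \<V>_def I_def by simp
qed

section \<open>Gaussian binomial coefficients\<close>

text \<open>Defined by a Pascal rule instead of quotients of factorials, over rings that may be zero
  and offer no cancellation, so that \<open>q\<close> may be a class in \<open>K0\<close>.\<close>

fun qbinom :: "'a :: {comm_ring, comm_monoid_mult} \<Rightarrow> nat \<Rightarrow> nat \<Rightarrow> 'a" where
  "qbinom q n 0 = 1"
| "qbinom q 0 (Suc k) = 0"
| "qbinom q (Suc n) (Suc k) = qbinom q n k + q ^ Suc k * qbinom q n (Suc k)"

text \<open>Split by whether \<open>n \<in> A\<close>. If not, the pairs \<open>(n, a)\<close> add
  \<open>card A\<close> inversions; if so, none is added. This is the Pascal rule.\<close>

lemma sum_inversions:
  "(\<Sum>A | A \<subseteq> {..<n} \<and> card A = k. q ^ card (inversions n A)) = qbinom q n k"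
proof (induction n arbitrary: k)
  case 0
  show ?case
  proof (cases k)
    case 0
    have "{A. A \<subseteq> {..<0::nat} \<and> card A = 0} = {{}}" by auto
    then show ?thesis using 0 by (simp add: inversions_def)
  next
    case (Suc k)
    have "{A. A \<subseteq> {..<0::nat} \<and> card A = Suc k} = {}" by auto
    then show ?thesis using Suc by (simp only: sum.empty qbinom.simps)
  qed
next
  case (Suc n)
  have fin: "finite A" if "A \<subseteq> {..<n}" for A using that finite_subset by blast
  show ?case
  proof (cases k)
    case 0
    have "{A. A \<subseteq> {..<Suc n} \<and> card A = 0} = {{}}" using finite_subset[of _ "{..<Suc n}"] by auto
    then show ?thesis using 0 by (simp add: inversions_def)
  next
    case k: (Suc k')
    let ?X = "{A. A \<subseteq> {..<n} \<and> card A = k}" and ?Y = "{A. A \<subseteq> {..<n} \<and> card A = k'}"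
    have split: "{A. A \<subseteq> {..<Suc n} \<and> card A = k} = ?X \<union> insert n ` ?Y"
    proof
      show "{A. A \<subseteq> {..<Suc n} \<and> card A = k} \<subseteq> ?X \<union> insert n ` ?Y"
      proof
        fix A assume A: "A \<in> {A. A \<subseteq> {..<Suc n} \<and> card A = k}"
        show "A \<in> ?X \<union> insert n ` ?Y"
        proof (cases "n \<in> A")
          case True
          then have "A = insert n (A - {n})" "A - {n} \<subseteq> {..<n}" using A by (auto simp: less_Suc_eq)
          moreover have "card (A - {n}) = k'" using A True k by simp
          ultimately show ?thesis by blast
        next
          case False
          then have "A \<subseteq> {..<n}" using A by (auto simp: less_Suc_eq)
          then show ?thesis using A by blast
        qed
      qed
      show "?X \<union> insert n ` ?Y \<subseteq> {A. A \<subseteq> {..<Suc n} \<and> card A = k}"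
      proof -
        have "insert n A \<subseteq> {..<Suc n} \<and> card (insert n A) = k" if "A \<in> ?Y" for A
        proof -
          have "n \<notin> A" "finite A" using that fin by auto
          then show ?thesis using that k by auto
        qed
        then show ?thesis by auto
      qed
    qed
    have inj: "inj_on (insert n) ?Y"
      by (rule inj_onI) (metis (no_types, lifting) insert_ident lessThan_iff mem_Collect_eq order_less_irrefl subsetD)
    have invX: "card (inversions (Suc n) A) = card (inversions n A) + k" if "A \<in> ?X" for A
    proof -
      have "inversions (Suc n) A = inversions n A \<union> {n} \<times> A"
        using that by (auto simp: inversions_def less_Suc_eq)
      moreover have "inversions n A \<inter> {n} \<times> A = {}" by (auto simp: inversions_def)
      ultimately show ?thesis using that fin[of A] card_Un_disjoint[OF finite_inversions, of "{n} \<times> A" n A]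
        by (simp add: card_cartesian_product)
    qed
    have invY: "inversions (Suc n) (insert n A) = inversions n A" if "A \<in> ?Y" for A
      using that by (auto simp: inversions_def less_Suc_eq)
    have finXY: "finite ?X" "finite ?Y" by (rule finite_subset[of _ "Pow {..<n}"]; auto)+
    have "(\<Sum>A | A \<subseteq> {..<Suc n} \<and> card A = k. q ^ card (inversions (Suc n) A)) =
        (\<Sum>A\<in>?X. q ^ card (inversions (Suc n) A)) + (\<Sum>A\<in>insert n ` ?Y. q ^ card (inversions (Suc n) A))"
      unfolding split by (rule sum.union_disjoint) (use finXY in auto)
    also have "(\<Sum>A\<in>?X. q ^ card (inversions (Suc n) A)) = q ^ k * (\<Sum>A\<in>?X. q ^ card (inversions n A))"
      by (simp add: invX power_add sum_distrib_left mult.commute)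
    also have "(\<Sum>A\<in>insert n ` ?Y. q ^ card (inversions (Suc n) A)) = (\<Sum>A\<in>?Y. q ^ card (inversions n A))"
      by (simp add: sum.reindex[OF inj] invY)
    finally show ?thesis using Suc.IH[of k] Suc.IH[of k'] k by (simp add: add.commute)
  qed
qed

lemma qbinom_eq_0: "n < k \<Longrightarrow> qbinom q n k = 0"
  by (induction q n k rule: qbinom.induct) auto

lemma qbinom_self [simp]: "qbinom q n n = 1"
  by (induction n) (simp_all add: qbinom_eq_0)

text \<open>The mirror Pascal rule, with the power of \<open>q\<close> on the other term. It is
  obtained by applying the induction hypothesis to both terms of the defining rule. Writing the
  indices as sums avoids truncated subtraction.\<close>

lemma qbinom_pascal: "qbinom q (Suc a + Suc b) (Suc a) =
    q ^ Suc b * qbinom q (a + Suc b) a + qbinom q (Suc a + b) (Suc a)"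
proof (induction "a + b" arbitrary: a b rule: less_induct)
  case less
  have step: "qbinom q (Suc a + Suc b) (Suc a) = qbinom q (a + Suc b) a + q ^ Suc a * qbinom q (Suc a + b) (Suc a)"
    by simp
  show ?case
  proof (cases a; cases b)
    assume "a = 0" "b = 0"
    then show ?thesis by (simp add: add.commute)
  next
    fix b' assume a: "a = 0" and b: "b = Suc b'"
    have IH: "qbinom q (Suc 0 + Suc b') (Suc 0) = q ^ Suc b' * qbinom q (0 + Suc b') 0 + qbinom q (Suc 0 + b') (Suc 0)"
      by (rule less) (use a b in simp)
    have "qbinom q (Suc 0 + Suc b) (Suc 0) = 1 + q * qbinom q (Suc 0 + Suc b') (Suc 0)" using b by simp
    also have "\<dots> = q ^ Suc b + (1 + q * qbinom q (Suc 0 + b') (Suc 0))"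
      unfolding IH b by (simp add: algebra_simps)
    also have "1 + q * qbinom q (Suc 0 + b') (Suc 0) = qbinom q (Suc 0 + b) (Suc 0)" using b by simp
    finally show ?thesis using a by simp
  next
    fix a' assume a: "a = Suc a'" and b: "b = 0"
    have IH: "qbinom q (Suc a' + Suc 0) (Suc a') = q ^ Suc 0 * qbinom q (a' + Suc 0) a' + qbinom q (Suc a' + 0) (Suc a')"
      by (rule less) (use a b in simp)
    have "qbinom q (Suc a + Suc 0) (Suc a) = qbinom q (Suc a' + Suc 0) (Suc a') + q ^ Suc a"
      using a by (simp add: qbinom_eq_0)
    also have "\<dots> = q * (qbinom q (a' + Suc 0) a' + q ^ Suc a' * 1) + 1"
      unfolding IH using a by (simp add: algebra_simps qbinom_eq_0)
    also have "qbinom q (a' + Suc 0) a' + q ^ Suc a' * 1 = qbinom q (a + Suc 0) a" using a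
      by (cases a') (simp_all add: qbinom_eq_0)
    finally show ?thesis using b by (simp add: qbinom_eq_0)
  next
    fix a' b' assume a: "a = Suc a'" and b: "b = Suc b'"
    have 1: "qbinom q (Suc a' + Suc b) (Suc a') = q ^ Suc b * qbinom q (a' + Suc b) a' + qbinom q (Suc a' + b) (Suc a')"
      by (rule less) (use a b in simp)
    have 2: "qbinom q (Suc a + Suc b') (Suc a) = q ^ Suc b' * qbinom q (a + Suc b') a + qbinom q (Suc a + b') (Suc a)"
      by (rule less) (use a b in simp)
    have 3: "qbinom q (a + Suc b) a = qbinom q (a' + Suc b) a' + q ^ a * qbinom q (a + b) a"
      using a by simp
    have 4: "qbinom q (Suc a + b) (Suc a) = qbinom q (a + b) a + q ^ Suc a * qbinom q (Suc a + b') (Suc a)"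
      using b by simp
    have "qbinom q (Suc a + Suc b) (Suc a) = (q ^ Suc b * qbinom q (a' + Suc b) a' + qbinom q (a + b) a) +
        q ^ Suc a * (q ^ b * qbinom q (a + b) a + qbinom q (Suc a + b') (Suc a))"
      unfolding step using 1 2 a b by simp
    also have "\<dots> = q ^ Suc b * qbinom q (a + Suc b) a + qbinom q (Suc a + b) (Suc a)"
      unfolding 3 4 by (simp add: algebra_simps)
    finally show ?thesis .
  qed
qed

lemma qbinom_symmetric_add: "qbinom q (a + b) a = qbinom q (a + b) b"
proof (induction "a + b" arbitrary: a b rule: less_induct)
  case less
  show ?case
  proof (cases a; cases b)
    fix a' b' assume ab: "a = Suc a'" "b = Suc b'"
    have "qbinom q (a + b) a = qbinom q (a' + b) a' + q ^ a * qbinom q (a + b') a" using ab by simp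
    also have "\<dots> = q ^ Suc a' * qbinom q (b' + Suc a') b' + qbinom q (Suc b' + a') (Suc b')"
      using less[of a' b] less[of a b'] ab by (simp add: add.commute)
    also have "\<dots> = qbinom q (Suc b' + Suc a') (Suc b')" by (rule qbinom_pascal[symmetric])
    finally show ?thesis using ab by (simp add: add.commute)
  qed auto
qed

lemma qbinom_symmetric: "k \<le> n \<Longrightarrow> qbinom q n (n - k) = qbinom q n k"
  using qbinom_symmetric_add[of q k "n - k"] by simp

text \<open>Eliminate \<open>qbinom q n (Suc k)\<close> between the two Pascal rules.\<close>

lemma qbinom_absorb: "(1 - q ^ Suc n) * qbinom q n k = (1 - q ^ Suc k) * qbinom q (Suc n) (Suc k)"
proof (cases "k < n")
  case True
  then obtain b where b: "n = k + Suc b" using less_iff_Suc_add by auto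
  have 1: "qbinom q (Suc n) (Suc k) = qbinom q n k + q ^ Suc k * qbinom q n (Suc k)" by simp
  have 2: "qbinom q (Suc n) (Suc k) = q ^ Suc b * qbinom q n k + qbinom q n (Suc k)"
    using qbinom_pascal[of q k b] b by simp
  have "(1 - q ^ Suc k) * qbinom q (Suc n) (Suc k) = qbinom q (Suc n) (Suc k) - q ^ Suc k * qbinom q (Suc n) (Suc k)"
    by (simp add: left_diff_distrib)
  also have "\<dots> = (qbinom q n k + q ^ Suc k * qbinom q n (Suc k)) - q ^ Suc k * (q ^ Suc b * qbinom q n k + qbinom q n (Suc k))"
    by (subst (2) 2, subst 1) simp
  also have "\<dots> = (1 - q ^ Suc n) * qbinom q n k"
    using b by (simp add: algebra_simps power_add)
  finally show ?thesis by simp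
next
  case False
  then show ?thesis by (cases "k = n") (simp_all add: qbinom_eq_0 del: qbinom.simps)
qed

text \<open>Both sides are the Gaussian trinomial coefficient with parts \<open>g\<close>,
  \<open>k\<close> and the rest of \<open>m\<close>. As factorials cannot be cancelled, the proof is
  an induction on \<open>m\<close> with the Pascal rule applied to both factors.\<close>

lemma qbinom_trinomial: "qbinom q m (g + k) * qbinom q (g + k) g = qbinom q m g * qbinom q (m - g) k"
proof (induction m arbitrary: g k)
  case 0
  show ?case by (cases g; cases k) simp_all
next
  case (Suc m)
  show ?case
  proof (cases g)
    case 0 then show ?thesis by simp
  next
    case g: (Suc g')
    show ?thesis
    proof (cases k)
      case 0 then show ?thesis by simp
    next
      case k: (Suc k')
      let ?\<gamma> = "g' + k"
      \<comment> \<open>For \<open>m < g\<close> the first factor vanishes; otherwise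
        \<open>m - g'\<close> is the successor of \<open>m - g\<close> and the Pascal rule
        applies.\<close>
      have sub: "qbinom q m g * qbinom q (m - g') k =
          qbinom q m g * (qbinom q (m - g) k' + q ^ k * qbinom q (m - g) k)"
      proof (cases "m < g")
        case True then show ?thesis by (simp add: qbinom_eq_0)
      next
        case False
        then have "m - g' = Suc (m - g)" using g by simp
        then show ?thesis using k by simp
      qed
      have "qbinom q (Suc m) (g + k) * qbinom q (g + k) g =
        qbinom q m ?\<gamma> * qbinom q (Suc ?\<gamma>) (Suc g') + q ^ Suc ?\<gamma> * (qbinom q m (g + k) * qbinom q (g + k) g)"
        using g by (simp add: algebra_simps)
      also have "qbinom q m ?\<gamma> * qbinom q (Suc ?\<gamma>) (Suc g') =
         qbinom q m (g' + k) * qbinom q (g' + k) g' + q ^ g * (qbinom q m (g + k') * qbinom q (g + k') g)"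
        using g k by (simp add: algebra_simps)
      also have "\<dots> + q ^ Suc ?\<gamma> * (qbinom q m (g + k) * qbinom q (g + k) g) =
          qbinom q m g' * qbinom q (m - g') k + q ^ g * (qbinom q m g * (qbinom q (m - g) k' + q ^ k * qbinom q (m - g) k))"
        unfolding Suc.IH using g by (simp add: algebra_simps power_add)
      also have "\<dots> = (qbinom q m g' + q ^ g * qbinom q m g) * qbinom q (m - g') k"
        unfolding sub[symmetric] by (simp add: algebra_simps)
      also have "\<dots> = qbinom q (Suc m) g * qbinom q (Suc m - g) k" using g by simp
      finally show ?thesis .
    qed
  qed
qed

lemma neg_one_power_add_even: "(- 1) ^ (n + 2 * k) = ((- 1) ^ n :: 'a :: {comm_ring, comm_monoid_mult})"
  by (induction k) simp_all

lemma choose_two_Suc: "Suc n choose 2 = (n choose 2) + n"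
  by (simp add: numeral_2_eq_2)

text \<open>The value at \<open>q ^ e\<close> of the product of the \<open>x - q ^ i\<close>, \<open>i < D\<close>, expanded by the
  \<open>q\<close>-binomial theorem.\<close>

lemma qbinom_alternating_sum:
  "e < D \<Longrightarrow> (\<Sum>k\<le>D. (- 1) ^ (D - k) * qbinom q D k * q ^ (((D - k) choose 2) + k * e)) = (0 :: 'a :: {comm_ring, comm_monoid_mult})"
proof (induction D)
  case (Suc D)
  define B where "B D = (\<Sum>k\<le>D. (- 1) ^ (D - k) * qbinom q D k * q ^ (((D - k) choose 2) + k * e))" for D
  let ?f = "\<lambda>k. (- 1) ^ (Suc D - k) * q ^ (((Suc D - k) choose 2) + k * e)"
  have "B (Suc D) = ?f 0 * qbinom q (Suc D) 0 + (\<Sum>k\<le>D. ?f (Suc k) * qbinom q (Suc D) (Suc k))"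
    unfolding B_def by (subst sum.atMost_Suc_shift) (simp add: ac_simps)
  also have "(\<Sum>k\<le>D. ?f (Suc k) * qbinom q (Suc D) (Suc k)) =
      (\<Sum>k\<le>D. ?f (Suc k) * qbinom q D k) + (\<Sum>k\<le>D. ?f (Suc k) * q ^ Suc k * qbinom q D (Suc k))"
    by (simp add: distrib_left sum.distrib mult.assoc)
  also have "(\<Sum>k\<le>D. ?f (Suc k) * qbinom q D k) = q ^ e * B D"
    unfolding B_def sum_distrib_left by (rule sum.cong[OF refl]) (simp add: power_add ac_simps)
  also have "?f 0 * qbinom q (Suc D) 0 + (q ^ e * B D + (\<Sum>k\<le>D. ?f (Suc k) * q ^ Suc k * qbinom q D (Suc k))) =
     q ^ e * B D + (\<Sum>k\<le>Suc D. ?f k * q ^ k * qbinom q D k)"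
    by (subst sum.atMost_Suc_shift) (simp add: ac_simps)
  also have "(\<Sum>k\<le>Suc D. ?f k * q ^ k * qbinom q D k) = (\<Sum>k\<le>D. ?f k * q ^ k * qbinom q D k)"
    by (simp add: qbinom_eq_0)
  also have "\<dots> = - (q ^ D * B D)"
    unfolding B_def sum_distrib_left sum_negf[symmetric]
  proof (rule sum.cong[OF refl])
    fix k assume "k \<in> {..D}"
    then have k: "Suc D - k = Suc (D - k)" "D = (D - k) + k" by auto
    have "q ^ (((Suc D - k) choose 2) + k * e) * q ^ k = q ^ D * q ^ (((D - k) choose 2) + k * e)"
      unfolding k(1) choose_two_Suc by (subst (3) k(2)) (simp add: power_add ac_simps)
    then show "?f k * q ^ k * qbinom q D k = - (q ^ D * ((- 1) ^ (D - k) * qbinom q D k * q ^ (((D - k) choose 2) + k * e)))"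
      unfolding k(1) by (simp add: mult.assoc) (simp add: ac_simps)
  qed
  \<comment> \<open>One more root multiplies the value at \<open>x = q ^ e\<close> by
    \<open>q ^ e - q ^ D\<close>. This factor is zero at \<open>D = e\<close>, and the sum stays
    zero from there on.\<close>
  finally have rec: "B (Suc D) = (q ^ e - q ^ D) * B D" by (simp add: left_diff_distrib)
  show ?case
  proof (cases "e = D")
    case True then show ?thesis using rec unfolding B_def by simp
  next
    case False
    then have "B D = 0" using Suc unfolding B_def by simp
    then show ?thesis using rec unfolding B_def by simp
  qed
qed simp

text \<open>Lagrange interpolation of \<open>x ^ e\<close> at the nodes \<open>q ^ 0, \<dots>, q ^ D\<close>, evaluated at \<open>q ^ M\<close>.\<close>

lemma qbinom_interpolation:
  fixes q :: "'a :: {comm_ring, comm_monoid_mult}"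
  assumes "D < M" "e \<le> D"
  shows "(\<Sum>k\<le>D. (- 1) ^ (D - k) * qbinom q M k * qbinom q (M - k - 1) (D - k) * q ^ (((D - k + 1) choose 2) + k * e)) = q ^ (M * e)"
  using assms(2)
proof (induction e)
  case 0
  \<comment> \<open>For \<open>e = 0\<close> the Lagrange coefficients have to sum to 1. In the
    induction on \<open>D\<close> the Pascal rule writes the sum for \<open>Suc D\<close> as the sum
    for \<open>D\<close> plus a multiple of the alternating sum for \<open>Suc D\<close> with
    exponent 0, which vanishes.\<close>
  have "(\<Sum>k\<le>D. (- 1) ^ (D - k) * qbinom q M k * qbinom q (M - k - 1) (D - k) * q ^ ((D - k + 1) choose 2)) = 1"
    using assms(1)
  proof (induction D)
    case (Suc D)
    let ?a = "\<lambda>k. (- 1) ^ (Suc D - k) * qbinom q M k * q ^ ((Suc D - k) choose 2)"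
    have "?a k * q ^ (Suc D - k) * qbinom q (M - k - 1) (Suc D - k) =
        ?a k * qbinom q (M - k) (Suc D - k) + (- 1) ^ (D - k) * qbinom q M k * qbinom q (M - k - 1) (D - k) * q ^ ((D - k + 1) choose 2)"
      if "k \<le> D" for k
    proof -
      have k: "Suc D - k = Suc (D - k)" "M - k = Suc (M - k - 1)" using that Suc.prems by auto
      have "qbinom q (M - k) (Suc (D - k)) =
          qbinom q (M - k - 1) (D - k) + q ^ Suc (D - k) * qbinom q (M - k - 1) (Suc (D - k))"
        by (subst (1) k(2)) (rule qbinom.simps(3))
      then show ?thesis unfolding k(1) by (simp add: algebra_simps)
    qed
    then have "(\<Sum>k\<le>D. ?a k * q ^ (Suc D - k) * qbinom q (M - k - 1) (Suc D - k)) = (\<Sum>k\<le>D. ?a k * qbinom q (M - k) (Suc D - k)) + 1"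
      using Suc by (simp add: sum.distrib)
    then have "(\<Sum>k\<le>Suc D. ?a k * q ^ (Suc D - k) * qbinom q (M - k - 1) (Suc D - k)) = (\<Sum>k\<le>Suc D. ?a k * qbinom q (M - k) (Suc D - k)) + 1"
      by (simp add: ac_simps)
    also have "(\<Sum>k\<le>Suc D. ?a k * qbinom q (M - k) (Suc D - k)) =
      (\<Sum>k\<le>Suc D. qbinom q M (Suc D) * ((- 1) ^ (Suc D - k) * qbinom q (Suc D) k * q ^ (((Suc D - k) choose 2) + k * 0)))"
    proof (rule sum.cong[OF refl])
      fix k assume "k \<in> {..Suc D}"
      then have tri: "qbinom q M k * qbinom q (M - k) (Suc D - k) = qbinom q M (Suc D) * qbinom q (Suc D) k"
        using qbinom_trinomial[of q M k "Suc D - k"] by simp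
      have "?a k * qbinom q (M - k) (Suc D - k) =
          (- 1) ^ (Suc D - k) * (qbinom q M k * qbinom q (M - k) (Suc D - k)) * q ^ ((Suc D - k) choose 2)"
        by (simp only: ac_simps)
      then show "?a k * qbinom q (M - k) (Suc D - k) =
          qbinom q M (Suc D) * ((- 1) ^ (Suc D - k) * qbinom q (Suc D) k * q ^ (((Suc D - k) choose 2) + k * 0))"
        unfolding tri by (simp only: mult_0_right add_0_right mult.assoc mult.left_commute)
    qed
    also have "\<dots> = qbinom q M (Suc D) * 0"
      unfolding sum_distrib_left[symmetric] by (subst qbinom_alternating_sum) simp_all
    finally have "(\<Sum>k\<le>Suc D. ?a k * q ^ (Suc D - k) * qbinom q (M - k - 1) (Suc D - k)) = 1" by simp
    moreover have "?a k * q ^ (Suc D - k) * qbinom q (M - k - 1) (Suc D - k) =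
        (- 1) ^ (Suc D - k) * qbinom q M k * qbinom q (M - k - 1) (Suc D - k) * q ^ ((Suc D - k + 1) choose 2)" for k
      using choose_two_Suc[of "Suc D - k"] by (simp add: power_add ac_simps)
    ultimately show ?case by (simp only:)
  qed (simp add: numeral_2_eq_2)
  then show ?case by simp
next
  case (Suc e)
  let ?S = "\<lambda>e. \<Sum>k\<le>D. (- 1) ^ (D - k) * qbinom q M k * qbinom q (M - k - 1) (D - k) * q ^ (((D - k + 1) choose 2) + k * e)"
  let ?c = "(1 - q ^ Suc D) * qbinom q M (Suc D) * q ^ D"
  \<comment> \<open>The factor \<open>q ^ k - q ^ M\<close> plays the part of the denominator of the
    Lagrange coefficient at the node \<open>q ^ k\<close>. After multiplication by it,
    \<open>k\<close> enters only through \<open>q ^ k * qbinom q D k\<close>.\<close>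
  have key: "(q ^ k - q ^ M) * (qbinom q M k * qbinom q (M - k - 1) (D - k)) =
      q ^ k * ((1 - q ^ Suc D) * (qbinom q M (Suc D) * qbinom q D k))" if k: "k \<le> D" for k
  proof -
    have M: "M = k + (M - k)" "M - k = Suc (M - k - 1)" "Suc D = k + Suc (D - k)" using k assms(1) by auto
    have 1: "(1 - q ^ (M - k)) * qbinom q (M - k - 1) (D - k) = (1 - q ^ Suc (D - k)) * qbinom q (M - k) (Suc (D - k))"
      using qbinom_absorb[of q "M - k - 1" "D - k"] unfolding M(2)[symmetric] .
    have 2: "qbinom q M k * qbinom q (M - k) (Suc (D - k)) = qbinom q M (Suc D) * qbinom q (Suc D) k"
      using qbinom_trinomial[of q M k "Suc (D - k)"] unfolding M(3)[symmetric] by (rule sym)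
    have 3: "(1 - q ^ Suc (D - k)) * qbinom q (Suc D) k = (1 - q ^ Suc D) * qbinom q D k"
    proof -
      have "Suc D - k = Suc (D - k)" using k by simp
      then have "qbinom q (Suc D) k = qbinom q (Suc D) (Suc (D - k))"
        using qbinom_symmetric[of k "Suc D" q] k by simp
      then show ?thesis using qbinom_absorb[of q D "D - k"] qbinom_symmetric[OF k, of q] by simp
    qed
    have "q ^ k - q ^ M = q ^ k * (1 - q ^ (M - k))"
      by (subst M(1)) (simp add: power_add right_diff_distrib)
    then have "(q ^ k - q ^ M) * (qbinom q M k * qbinom q (M - k - 1) (D - k)) =
        q ^ k * (qbinom q M k * ((1 - q ^ (M - k)) * qbinom q (M - k - 1) (D - k)))"
      by (simp only: ac_simps)
    also have "\<dots> = q ^ k * ((1 - q ^ Suc (D - k)) * (qbinom q M k * qbinom q (M - k) (Suc (D - k))))"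
      unfolding 1 by (simp only: ac_simps)
    also have "\<dots> = q ^ k * (qbinom q M (Suc D) * ((1 - q ^ Suc (D - k)) * qbinom q (Suc D) k))"
      unfolding 2 by (simp only: ac_simps)
    also have "\<dots> = q ^ k * ((1 - q ^ Suc D) * (qbinom q M (Suc D) * qbinom q D k))"
      unfolding 3 by (simp only: ac_simps)
    finally show ?thesis .
  qed
  \<comment> \<open>Replacing \<open>e\<close> by \<open>Suc e\<close> multiplies the
    \<open>k\<close>-th term by \<open>q ^ k\<close>. The defect from the expected factor
    \<open>q ^ M\<close> is a multiple of the alternating sum for \<open>D\<close> and
    \<open>e\<close>, zero because \<open>e < D\<close>.\<close>
  have "?S (Suc e) - q ^ M * ?S e =
      (\<Sum>k\<le>D. (- 1) ^ (D - k) * q ^ (((D - k + 1) choose 2) + k * e) * ((q ^ k - q ^ M) * (qbinom q M k * qbinom q (M - k - 1) (D - k))))"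
    unfolding sum_distrib_left sum_subtractf[symmetric]
    by (rule sum.cong[OF refl]) (simp add: power_add algebra_simps)
  also have "\<dots> = (\<Sum>k\<le>D. ?c * ((- 1) ^ (D - k) * qbinom q D k * q ^ (((D - k) choose 2) + k * e)))"
  proof (rule sum.cong[OF refl])
    fix k assume "k \<in> {..D}"
    then have k: "k \<le> D" "D = (D - k) + k" by auto
    have p: "q ^ (((D - k + 1) choose 2) + k * e) * q ^ k = q ^ D * q ^ (((D - k) choose 2) + k * e)"
    proof -
      have "q ^ D = q ^ (D - k) * q ^ k" by (subst (1) k(2)) (rule power_add)
      then show ?thesis using choose_two_Suc[of "D - k"] by (simp add: power_add ac_simps)
    qed
    have "(- 1) ^ (D - k) * q ^ (((D - k + 1) choose 2) + k * e) * ((q ^ k - q ^ M) * (qbinom q M k * qbinom q (M - k - 1) (D - k))) =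
       (- 1) ^ (D - k) * (q ^ (((D - k + 1) choose 2) + k * e) * q ^ k) * ((1 - q ^ Suc D) * (qbinom q M (Suc D) * qbinom q D k))"
      unfolding key[OF k(1)] by (simp only: ac_simps)
    then show "(- 1) ^ (D - k) * q ^ (((D - k + 1) choose 2) + k * e) * ((q ^ k - q ^ M) * (qbinom q M k * qbinom q (M - k - 1) (D - k))) =
        ?c * ((- 1) ^ (D - k) * qbinom q D k * q ^ (((D - k) choose 2) + k * e))"
      unfolding p by (simp only: ac_simps)
  qed
  also have "\<dots> = ?c * 0"
    unfolding sum_distrib_left[symmetric] using qbinom_alternating_sum[of e D q] Suc.prems by simp
  finally have "?S (Suc e) = q ^ M * ?S e" by simp
  then show ?case using Suc by (simp add: power_add)
qed

text \<open>Both sides are linear in the \<open>P g\<close>, so coefficients are compared. For fixed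
  \<open>g\<close> the trinomial identity extracts \<open>qbinom q m g\<close> and leaves the
  interpolation of \<open>x ^ D\<close> with \<open>D = d - 1 - g\<close>, the largest degree that
  \<open>D + 1\<close> nodes reproduce.\<close>

theorem qbinom_inversion:
  fixes q :: "'a :: {comm_ring, comm_monoid_mult}"
  assumes H: "\<And>n. H n = (\<Sum>g = 1..d - 1. qbinom q n g * q ^ ((n - g) * (d - 1 - g)) * P g)"
    and d: "d \<le> m"
  shows "H m = (\<Sum>\<gamma> = 1..d - 1. (- 1) ^ (d + \<gamma> + 1) * H \<gamma> * qbinom q (m - \<gamma> - 1) (m - d) * qbinom q m \<gamma> * q ^ ((d - \<gamma>) choose 2))"
proof -
  let ?f = "\<lambda>\<gamma>. (- 1) ^ (d + \<gamma> + 1) * qbinom q (m - \<gamma> - 1) (m - d) * qbinom q m \<gamma> * q ^ ((d - \<gamma>) choose 2)"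
  have g: "(\<Sum>\<gamma> = 1..d - 1. ?f \<gamma> * (qbinom q \<gamma> g * q ^ ((\<gamma> - g) * (d - 1 - g)))) = qbinom q m g * q ^ ((m - g) * (d - 1 - g))"
    if g: "g \<in> {1..d - 1}" for g
  proof -
    define D where "D = d - 1 - g"
    define M where "M = m - g"
    have DM: "D < M" "d = g + D + 1" "m = g + M" using g d unfolding D_def M_def by auto
    have "(\<Sum>\<gamma> = 1..d - 1. ?f \<gamma> * (qbinom q \<gamma> g * q ^ ((\<gamma> - g) * D))) = (\<Sum>\<gamma> = g..d - 1. ?f \<gamma> * (qbinom q \<gamma> g * q ^ ((\<gamma> - g) * D)))"
      by (rule sum.mono_neutral_right) (use g in \<open>auto simp: qbinom_eq_0 not_le\<close>)
    also have "\<dots> = (\<Sum>k\<le>D. ?f (g + k) * (qbinom q (g + k) g * q ^ (k * D)))"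
      by (rule sum.reindex_bij_witness[where i="\<lambda>k. g + k" and j="\<lambda>\<gamma>. \<gamma> - g"]) (use DM in auto)
    also have "\<dots> = (\<Sum>k\<le>D. qbinom q m g * ((- 1) ^ (D - k) * qbinom q M k * qbinom q (M - k - 1) (D - k) * q ^ (((D - k + 1) choose 2) + k * D)))"
    proof (rule sum.cong[OF refl])
      fix k assume "k \<in> {..D}"
      then have k: "k \<le> D" by simp
      \<comment> \<open>Up to an even number the exponent is \<open>D - k\<close>, which turns the
        sign of the relation into that of the interpolation formula.\<close>
      have "d + (g + k) + 1 = (D - k) + 2 * (g + k + 1)" using k DM by simp
      then have 1: "(- 1) ^ (d + (g + k) + 1) = ((- 1) ^ (D - k) :: 'a)" by (simp only: neg_one_power_add_even)
      have "m - (g + k) - 1 = M - k - 1" "m - d = (M - k - 1) - (D - k)" using k DM by auto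
      then have 2: "qbinom q (m - (g + k) - 1) (m - d) = qbinom q (M - k - 1) (D - k)"
        using qbinom_symmetric[of "D - k" "M - k - 1" q] k DM by simp
      have 3: "d - (g + k) = D - k + 1" using k DM by simp
      have 4: "qbinom q m (g + k) * qbinom q (g + k) g = qbinom q m g * qbinom q M k"
        using qbinom_trinomial[of q m g k] unfolding M_def .
      have "?f (g + k) * (qbinom q (g + k) g * q ^ (k * D)) =
        (- 1) ^ (D - k) * qbinom q (M - k - 1) (D - k) * (qbinom q m (g + k) * qbinom q (g + k) g) * (q ^ ((D - k + 1) choose 2) * q ^ (k * D))"
        unfolding 1 2 3 by (simp only: ac_simps)
      then show "?f (g + k) * (qbinom q (g + k) g * q ^ (k * D)) =
        qbinom q m g * ((- 1) ^ (D - k) * qbinom q M k * qbinom q (M - k - 1) (D - k) * q ^ (((D - k + 1) choose 2) + k * D))"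
        unfolding 4 power_add by (simp only: ac_simps)
    qed
    also have "\<dots> = qbinom q m g * q ^ (M * D)"
      unfolding sum_distrib_left[symmetric] using qbinom_interpolation[OF DM(1) order_refl, of q] by simp
    finally show ?thesis unfolding D_def M_def .
  qed
  have "(\<Sum>\<gamma> = 1..d - 1. (- 1) ^ (d + \<gamma> + 1) * H \<gamma> * qbinom q (m - \<gamma> - 1) (m - d) * qbinom q m \<gamma> * q ^ ((d - \<gamma>) choose 2)) =
      (\<Sum>\<gamma> = 1..d - 1. \<Sum>g = 1..d - 1. ?f \<gamma> * (qbinom q \<gamma> g * q ^ ((\<gamma> - g) * (d - 1 - g))) * P g)"
    unfolding H sum_distrib_left sum_distrib_right by (intro sum.cong refl) (simp only: ac_simps)
  also have "\<dots> = (\<Sum>g = 1..d - 1. (\<Sum>\<gamma> = 1..d - 1. ?f \<gamma> * (qbinom q \<gamma> g * q ^ ((\<gamma> - g) * (d - 1 - g)))) * P g)"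
    unfolding sum_distrib_right by (rule sum.swap)
  also have "\<dots> = H m" unfolding H[of m] by (intro sum.cong refl arg_cong2[where f="(*)"] g)
  finally show ?thesis by simp
qed

section \<open>Polynomials\<close>

definition var :: "nat \<Rightarrow> nat \<Rightarrow>\<^sub>0 nat" where
  "var i = Poly_Mapping.single i 1"

abbreviation X :: "nat \<Rightarrow> mpoly" where
  "X i \<equiv> bvec (var i)"

definition deg :: "(nat \<Rightarrow>\<^sub>0 nat) \<Rightarrow> nat" where
  "deg a = (\<Sum>i\<in>Poly_Mapping.keys a. Poly_Mapping.lookup a i)"

lemma deg_superset: "finite A \<Longrightarrow> Poly_Mapping.keys a \<subseteq> A \<Longrightarrow> deg a = (\<Sum>i\<in>A. Poly_Mapping.lookup a i)"
  unfolding deg_def by (rule sum.mono_neutral_left) (auto simp: in_keys_iff)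

lemma deg_add [simp]: "deg (a + b) = deg a + deg b"
proof -
  let ?A = "Poly_Mapping.keys a \<union> Poly_Mapping.keys b"
  have "deg (a + b) = (\<Sum>i\<in>?A. Poly_Mapping.lookup (a + b) i)"
    by (rule deg_superset) (auto simp: keys_add)
  then show ?thesis
    using deg_superset[of ?A a] deg_superset[of ?A b] by (simp add: lookup_add sum.distrib)
qed

lemma deg_zero [simp]: "deg 0 = 0"
  by (simp add: deg_def)

lemma deg_var [simp]: "deg (var i) = 1"
  by (simp add: deg_def var_def)

lemma deg_eq_0_iff: "deg a = 0 \<longleftrightarrow> a = 0"
  by (auto simp: deg_def in_keys_iff keys_eq_empty intro!: poly_mapping_eqI)

lemma zero_monomials [simp]: "0 \<in> monomials n"
  by (simp add: monomials_def)

lemma var_monomials [simp]: "var i \<in> monomials n \<longleftrightarrow> i < n"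
  by (simp add: monomials_def var_def)

lemma add_monomials: "a \<in> monomials n \<Longrightarrow> b \<in> monomials n \<Longrightarrow> a + b \<in> monomials n"
  unfolding monomials_def using keys_add[of a b] by auto

lemma monomial_split:
  assumes "a \<in> monomials n" "a \<noteq> 0"
  obtains i b where "i < n" "b \<in> monomials n" "a = var i + b"
proof -
  have "Poly_Mapping.keys a \<noteq> {}" using assms(2) by simp
  then obtain i where i: "i \<in> Poly_Mapping.keys a" by blast
  have eq: "a = var i + (a - var i)"
    by (rule poly_mapping_eqI) (use i in \<open>auto simp: lookup_add lookup_minus var_def lookup_single when_def in_keys_iff\<close>)
  have "Poly_Mapping.keys (a - var i) \<subseteq> Poly_Mapping.keys a"
    by (auto simp: in_keys_iff lookup_minus)
  then have "a - var i \<in> monomials n" "i < n" using assms(1) i unfolding monomials_def by auto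
  then show ?thesis using that eq by blast
qed

lemma monomial_induct [consumes 1, case_names zero step]:
  assumes "a \<in> monomials n" "P 0"
    "\<And>i b. i < n \<Longrightarrow> b \<in> monomials n \<Longrightarrow> P b \<Longrightarrow> P (var i + b)"
  shows "P a"
  using assms(1)
proof (induction "deg a" arbitrary: a)
  case 0
  then show ?case using assms(2) deg_eq_0_iff by metis
next
  case (Suc k)
  then have "a \<noteq> 0" by auto
  then obtain i b where ib: "i < n" "b \<in> monomials n" "a = var i + b" using monomial_split Suc.prems by blast
  then show ?case using assms(3) Suc by simp
qed

lemma finite_monomials_deg: "finite {a\<in>monomials n. deg a < d}"
proof (induction d)
  case (Suc d)
  have "{a\<in>monomials n. deg a < Suc d} \<subseteq> insert 0 ((\<lambda>(i, b). var i + b) ` ({..<n} \<times> {a\<in>monomials n. deg a < d}))"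
  proof
    fix a assume a: "a \<in> {a\<in>monomials n. deg a < Suc d}"
    show "a \<in> insert 0 ((\<lambda>(i, b). var i + b) ` ({..<n} \<times> {a\<in>monomials n. deg a < d}))"
    proof (cases "a = 0")
      case False
      then obtain i b where "i < n" "b \<in> monomials n" "a = var i + b" using monomial_split a by blast
      then show ?thesis using a by (intro insertI2 image_eqI[of _ _ "(i, b)"]) auto
    qed simp
  qed
  then show ?case using Suc by (meson finite_SigmaI finite_imageI finite_insert finite_lessThan finite_subset)
qed simp

lemma scale_eq_mult: "scale c v = Poly_Mapping.single 0 c * (v :: mpoly)"
  unfolding scale_def by (rule mult_map_scale_conv_mult)

lemma scale_mult_left: "scale c v * w = scale c (v * (w :: mpoly))"
  unfolding scale_eq_mult by (simp add: mult.assoc)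

lemma scale_mult_right: "v * scale c w = scale c (v * (w :: mpoly))"
  unfolding scale_eq_mult by (simp add: mult.left_commute)

lemma bvec_mult: "bvec a * bvec b = (bvec (a + b) :: mpoly)"
  by (simp add: mult_single)

lemma mult_eq_ext: "p * q = ext (\<lambda>a. bvec a * q) (p :: mpoly)"
  by (rule linear_eq_ext[where E=UNIV and f="\<lambda>p. p * q"])
     (auto simp: distrib_right scale_mult_left free_space_def)

lemma free_space_mult:
  assumes "p \<in> free_space A" "q \<in> free_space B" "\<And>a b. a \<in> A \<Longrightarrow> b \<in> B \<Longrightarrow> a + b \<in> C"
  shows "p * q \<in> (free_space C :: mpoly set)"
proof -
  have "Poly_Mapping.keys (p * q) \<subseteq> C"
    using keys_mult[of p q] assms unfolding free_space_def by blast
  then show ?thesis unfolding free_space_def by simp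
qed

lemma poly_ring_mult: "p \<in> poly_ring n \<Longrightarrow> q \<in> poly_ring n \<Longrightarrow> p * q \<in> poly_ring n"
  unfolding poly_ring_def using free_space_mult add_monomials by blast

lemma poly_ring_subspace: "free.subspace (poly_ring n)"
  unfolding poly_ring_def by (rule subspace_free_space)

lemma X_poly_ring [simp]: "X i \<in> poly_ring n \<longleftrightarrow> i < n"
  unfolding poly_ring_def by simp

lemma one_poly_ring [simp]: "1 \<in> poly_ring n"
  unfolding poly_ring_def using bvec_free_space[of 0 "monomials n"] by simp

text \<open>Monomials are products of variables, and polynomials are combinations of monomials.
  Closure under the single variables is the form in which ideals appear in the equations of the
  charts.\<close>

lemma subspace_ideal:
  assumes "free.subspace I" "\<And>i p. i < n \<Longrightarrow> p \<in> I \<Longrightarrow> X i * p \<in> I" "p \<in> poly_ring n" "q \<in> I"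
  shows "p * q \<in> I"
proof -
  have mon: "bvec a * q \<in> I" if "a \<in> monomials n" for a
    using that
  proof (induction a rule: monomial_induct)
    case zero then show ?case using assms(4) by simp
  next
    case (step i b)
    have "bvec (var i + b) * q = X i * (bvec b * q)" by (simp only: bvec_mult[symmetric] mult.assoc)
    then show ?case using assms(2)[OF step(1,3)] by (simp only:)
  qed
  show ?thesis
    unfolding mult_eq_ext[of p]
    by (rule ext_mem[OF assms(1)], rule mon, rule keys_free_space[OF assms(3)[unfolded poly_ring_def]])
qed

lemma poly_ideal_subspace:
  assumes "poly_ideal n I" shows "free.subspace I"
proof (rule free.subspaceI)
  show "scale c p \<in> I" if "p \<in> I" for c p
  proof -
    have "Poly_Mapping.single 0 c \<in> poly_ring n" by (auto simp: poly_ring_def free_space_def)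
    then show ?thesis using assms that unfolding scale_eq_mult poly_ideal_def by blast
  qed
qed (use assms in \<open>auto simp: poly_ideal_def\<close>)

section \<open>Dimension counts modulo a subspace\<close>

text \<open>Replace each \<open>s\<close> by a representative \<open>u s\<close> in the span of
  \<open>T\<close>. A linear relation between the \<open>u s\<close> puts the same combination of
  the \<open>s\<close> into \<open>I\<close>, where it vanishes. So \<open>u\<close> is injective on
  \<open>S\<close> with independent image, and the ordinary exchange bound applies.\<close>

lemma steinitz_mod:
  assumes I: "free.subspace I" and S: "free.independent S" "\<And>v. v \<in> free.span S \<Longrightarrow> v \<in> I \<Longrightarrow> v = 0"
    and T: "finite T" "\<And>s. s \<in> S \<Longrightarrow> \<exists>u\<in>free.span T. s - u \<in> I"
  shows "finite S \<and> card S \<le> card T"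
proof -
  obtain u where u: "\<And>s. s \<in> S \<Longrightarrow> u s \<in> free.span T \<and> s - u s \<in> I" using T(2) by metis
  have comb: "(\<Sum>s\<in>S0. scale (c s) s) = 0" if S0: "finite S0" "S0 \<subseteq> S" "(\<Sum>s\<in>S0. scale (c s) (u s)) = 0" for S0 c
  proof -
    have "(\<Sum>s\<in>S0. scale (c s) (s - u s)) \<in> I"
      by (rule free.subspace_sum[OF I]) (use u S0 in \<open>auto intro!: free.subspace_scale[OF I]\<close>)
    then have "(\<Sum>s\<in>S0. scale (c s) s) \<in> I"
      using S0(3) by (simp add: free.scale_right_diff_distrib sum_subtractf)
    moreover have "(\<Sum>s\<in>S0. scale (c s) s) \<in> free.span S"
      by (rule free.span_sum, rule free.span_scale, rule free.span_base) (use S0 in blast)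
    ultimately show ?thesis using S(2) by blast
  qed
  have indep0: "c s = 0" if S0: "finite S0" "S0 \<subseteq> S" "(\<Sum>s\<in>S0. scale (c s) (u s)) = 0" "s \<in> S0" for S0 c s
    using comb[OF S0(1-3)] S(1) S0 unfolding free.dependent_explicit by blast
  have inj: "inj_on u S"
  proof (rule inj_onI, rule ccontr)
    fix s t assume st: "s \<in> S" "t \<in> S" "u s = u t" "s \<noteq> t"
    have "(\<Sum>x\<in>{s, t}. scale (if x = s then 1 else - 1) (u x)) = 0"
      using st by (simp add: uminus_scale[symmetric])
    from indep0[OF _ _ this, of s] show False using st by simp
  qed
  have "free.independent (u ` S)"
    unfolding free.dependent_explicit
  proof clarify
    fix t c v assume t: "finite t" "t \<subseteq> u ` S" "(\<Sum>v\<in>t. scale (c v) v) = 0" and v: "v \<in> t" "c v \<noteq> 0"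
    obtain S0 where S0: "S0 \<subseteq> S" "t = u ` S0" using t(2) subset_imageE by metis
    have inj0: "inj_on u S0" using inj S0(1) inj_on_subset by blast
    have "finite S0" using t(1) S0(2) inj0 finite_imageD by blast
    moreover have "(\<Sum>s\<in>S0. scale (c (u s)) (u s)) = 0" using t(3) S0(2) by (simp add: sum.reindex[OF inj0])
    ultimately show False using indep0[of S0 "\<lambda>s. c (u s)"] S0 v by blast
  qed
  moreover have "u ` S \<subseteq> free.span T" using u by blast
  ultimately have "finite (u ` S)" "card (u ` S) \<le> card T"
    using free.independent_span_bound[OF T(1)] by auto
  then show ?thesis using finite_imageD[OF _ inj] card_image[OF inj] by simp
qed

lemma span_bvec: "free.span (bvec ` J) = free_space J"
proof
  show "free.span (bvec ` J) \<subseteq> free_space J"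
    by (rule free.span_minimal[OF _ subspace_free_space]) auto
  show "free_space J \<subseteq> free.span (bvec ` J)"
  proof
    fix v assume "v \<in> free_space J"
    then have "ext bvec v \<in> free.span (bvec ` J)"
      by (intro ext_mem[OF free.subspace_span] free.span_base imageI) (rule keys_free_space)
    then show "v \<in> free.span (bvec ` J)" by (simp add: ext_id)
  qed
qed

lemma inj_bvec: "inj bvec"
  by (rule injI) (metis bvec_free_space insertI1 singletonD)

lemma independent_bvec: "free.independent (bvec ` J)"
  unfolding free.dependent_explicit
proof (intro notI, elim exE conjE bexE)
  fix t c x assume t: "finite t" "t \<subseteq> bvec ` J" "(\<Sum>v\<in>t. scale (c v) v) = 0" and x: "x \<in> t" "c x \<noteq> 0"
  then obtain j where v: "bvec j \<in> t" "c (bvec j) \<noteq> 0" by blast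
  have "0 = coord (\<Sum>v\<in>t. scale (c v) v) j" using t(3) by simp
  also have "\<dots> = (\<Sum>v\<in>t. if v = bvec j then c v else 0)"
    unfolding coord_sum
  proof (rule sum.cong[OF refl])
    fix w assume "w \<in> t"
    then obtain i where "w = bvec i" using t(2) by blast
    then show "coord (scale (c w) w) j = (if w = bvec j then c w else 0)"
      using injD[OF inj_bvec, of i j] by (auto simp: lookup_single when_def)
  qed
  also have "\<dots> = c (bvec j)" using t(1) v(1) by simp
  finally show False using v(2) by simp
qed

definition indep_mod :: "'i set \<Rightarrow> ('i \<Rightarrow>\<^sub>0 complex) set \<Rightarrow> bool" where
  "indep_mod J I \<longleftrightarrow> (\<forall>u\<in>free_space J. u \<in> I \<longrightarrow> u = 0)"

lemma indep_mod_card: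
  assumes "free.subspace I" "indep_mod J I" "finite K" "\<And>a. a \<in> J \<Longrightarrow> \<exists>u\<in>free_space K. bvec a - u \<in> I"
  shows "finite J \<and> card J \<le> card K"
proof -
  have "finite (bvec ` J) \<and> card (bvec ` J) \<le> card (bvec ` K)"
  proof (rule steinitz_mod[OF assms(1) independent_bvec], unfold span_bvec)
    show "v = 0" if "v \<in> free_space J" "v \<in> I" for v using assms(2) that unfolding indep_mod_def by blast
    show "finite (bvec ` K)" using assms(3) by simp
    show "\<exists>u\<in>free_space K. v - u \<in> I" if "v \<in> bvec ` J" for v using assms(4) that by (elim imageE) simp
  qed
  moreover have "inj_on bvec J" "inj_on bvec K" by (rule inj_on_subset[OF inj_bvec subset_UNIV])+
  ultimately show ?thesis using finite_imageD[of bvec J] by (simp add: card_image)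
qed

lemma indep_mod_insert:
  assumes I: "free.subspace I" and J: "indep_mod J I" and a: "\<not> indep_mod (insert a J) I"
  shows "\<exists>u\<in>free_space J. bvec a - u \<in> I"
proof -
  obtain v where v: "v \<in> free_space (insert a J)" "v \<in> I" "v \<noteq> 0" using a unfolding indep_mod_def by blast
  have "coord v a \<noteq> 0"
  proof
    assume "coord v a = 0"
    then have "v \<in> free_space J" using v(1) by (auto simp: free_space_iff)
    then show False using J v unfolding indep_mod_def by blast
  qed
  let ?u = "bvec a - scale (1 / coord v a) v"
  show ?thesis
  proof (cases "a \<in> J")
    case True then show ?thesis using free.subspace_0[OF I] by (intro bexI[of _ "bvec a"]) auto
  next
    case False
    have "?u \<in> free_space J"
      using v(1) \<open>coord v a \<noteq> 0\<close> by (auto simp: free_space_iff lookup_minus lookup_single when_def)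
    moreover have "bvec a - ?u \<in> I" using free.subspace_scale[OF I v(2)] by simp
    ultimately show ?thesis by blast
  qed
qed

text \<open>An independent subset of \<open>M\<close> of maximal cardinality cannot be enlarged, so
  it spans \<open>M\<close> modulo \<open>I\<close>.\<close>

lemma indep_mod_extend:
  assumes I: "free.subspace I" and bound: "\<And>J. J \<subseteq> M \<Longrightarrow> indep_mod J I \<Longrightarrow> finite J \<and> card J \<le> d"
  obtains J where "J \<subseteq> M" "indep_mod J I" "\<And>a. a \<in> M \<Longrightarrow> \<exists>u\<in>free_space J. bvec a - u \<in> I"
proof -
  let ?P = "\<lambda>J. J \<subseteq> M \<and> indep_mod J I"
  have P: "?P {}" "\<And>J. ?P J \<Longrightarrow> card J \<le> d" using bound by (auto simp: indep_mod_def free_space_def)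
  obtain J where J0: "?P J \<and> (\<forall>K. ?P K \<longrightarrow> card K \<le> card J)"
    using ex_has_greatest_nat[of ?P "{}" card "Suc d", OF P(1)] P(2) by (auto simp: less_Suc_eq_le)
  then have J: "?P J" "\<And>K. ?P K \<Longrightarrow> card K \<le> card J" by auto
  have "\<exists>u\<in>free_space J. bvec a - u \<in> I" if a: "a \<in> M" for a
  proof (cases "a \<in> J")
    case True then show ?thesis using free.subspace_0[OF I] by (intro bexI[of _ "bvec a"]) auto
  next
    case False
    have "\<not> indep_mod (insert a J) I"
    proof
      assume "indep_mod (insert a J) I"
      then have "card (insert a J) \<le> card J" using J a by simp
      moreover have "finite J" using bound J(1) by blast
      ultimately show False using False by simp
    qed
    then show ?thesis using indep_mod_insert[OF I] J(1) by blast
  qed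
  then show ?thesis using that J(1) by blast
qed

text \<open>If \<open>b\<close> were independent of \<open>J\<close>, adding it would give an
  independent set larger than the set \<open>K\<close> that spans it.\<close>

lemma indep_mod_equal_card:
  assumes I: "free.subspace I" and J: "indep_mod J I" and K: "finite K" "card K \<le> card J"
    and span: "\<And>a. a \<in> J \<Longrightarrow> \<exists>u\<in>free_space K. bvec a - u \<in> I" and b: "b \<in> K"
  shows "\<exists>u\<in>free_space J. bvec b - u \<in> I"
proof (cases "b \<in> J")
  case True then show ?thesis using free.subspace_0[OF I] by (intro bexI[of _ "bvec b"]) auto
next
  case False
  have "\<not> indep_mod (insert b J) I"
  proof
    assume "indep_mod (insert b J) I"
    then have "finite (insert b J) \<and> card (insert b J) \<le> card K"
    proof (rule indep_mod_card[OF I _ K(1)])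
      fix a assume "a \<in> insert b J"
      then show "\<exists>u\<in>free_space K. bvec a - u \<in> I"
        using span b free.subspace_0[OF I] by (cases "a = b") (auto intro!: bexI[of _ "bvec b"])
    qed
    then have "finite J" "card (insert b J) \<le> card J" using K(2) by auto
    then show False using False by simp
  qed
  then show ?thesis using indep_mod_insert[OF I J] by blast
qed

lemma extend_spanning:
  assumes I: "free.subspace I" and span: "\<And>a. a \<in> M \<Longrightarrow> \<exists>u\<in>free_space J. bvec a - u \<in> I" and v: "v \<in> free_space M"
  shows "\<exists>u\<in>free_space J. v - u \<in> I"
proof -
  have "\<forall>a\<in>Poly_Mapping.keys v. \<exists>u\<in>free_space J. bvec a - u \<in> I"
    using span keys_free_space[OF v] by blast
  then obtain w where w: "\<And>i. i \<in> Poly_Mapping.keys v \<Longrightarrow> w i \<in> free_space J \<and> bvec i - w i \<in> I" by metis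
  have "ext w v \<in> free_space J" by (rule ext_mem[OF subspace_free_space]) (use w in blast)
  moreover have "ext (\<lambda>i. bvec i - w i) v \<in> I" by (rule ext_mem[OF I]) (use w in blast)
  then have "v - ext w v \<in> I"
    using ext_id[of v] by (simp add: ext_def free.scale_right_diff_distrib sum_subtractf)
  ultimately show ?thesis by blast
qed

lemma (in qbasis) indep_mod_basis: "indep_mod J V"
  unfolding indep_mod_def using res_free res_eq_0_iff free_JE by metis

lemma (in qbasis) indep_mod_bound:
  assumes "finite J" "K \<subseteq> E" "indep_mod K V" shows "finite K \<and> card K \<le> card J"
proof (rule indep_mod_card[OF sub assms(3,1)])
  fix a assume "a \<in> K"
  then have "bvec a \<in> free_space E" using assms(2) by auto
  then show "\<exists>u\<in>free_space J. bvec a - u \<in> V" using res_mem res_diff by blast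
qed


section \<open>Punctual ideals\<close>

text \<open>Some power of every variable lies in an ideal of finite codimension that vanishes only at
  the origin: otherwise an ideal maximal among those avoiding the powers of a variable is prime,
  so it contains a linear factor of a polynomial in each variable, and thus belongs to a
  point of the zero locus.\<close>

definition upoly :: "nat \<Rightarrow> complex poly \<Rightarrow> mpoly" where
  "upoly i p = poly (map_poly (Poly_Mapping.single 0) p) (X i)"

lemma upoly_0 [simp]: "upoly i 0 = 0"
  by (simp add: upoly_def)

lemma upoly_pCons: "upoly i (pCons a p) = Poly_Mapping.single 0 a + X i * upoly i p"
  by (cases "p = 0 \<and> a = 0") (auto simp: upoly_def map_poly_pCons)

lemma upoly_add: "upoly i (p + q) = upoly i p + upoly i q"
  by (induction p q rule: poly_induct2) (simp_all add: upoly_pCons single_add algebra_simps)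

lemma upoly_smult: "upoly i (smult c p) = scale c (upoly i p)"
  by (induction p) (simp_all add: upoly_pCons scale_eq_mult algebra_simps mult_single)

lemma upoly_linear_factor: "upoly i ([:- c, 1:] * p) = (X i - Poly_Mapping.single 0 c) * upoly i p"
proof -
  have "[:- c, 1:] * p = smult (- c) p + pCons 0 p" by simp
  then have "upoly i ([:- c, 1:] * p) = scale (- c) (upoly i p) + X i * upoly i p"
    by (simp only: upoly_add upoly_smult upoly_pCons) simp
  then show ?thesis by (simp add: scale_eq_mult single_uminus algebra_simps)
qed

lemma single_zero_poly_ring [simp]: "Poly_Mapping.single 0 c \<in> poly_ring n"
  by (auto simp: poly_ring_def free_space_def)

lemma poly_ring_add: "p \<in> poly_ring n \<Longrightarrow> q \<in> poly_ring n \<Longrightarrow> p + q \<in> poly_ring n"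
  and poly_ring_diff: "p \<in> poly_ring n \<Longrightarrow> q \<in> poly_ring n \<Longrightarrow> p - q \<in> poly_ring n"
  using free.subspace_add[OF poly_ring_subspace] free.subspace_diff[OF poly_ring_subspace] by blast+

lemma upoly_poly_ring: "i < n \<Longrightarrow> upoly i p \<in> poly_ring n"
  by (induction p) (auto simp: upoly_pCons free.subspace_0[OF poly_ring_subspace] intro!: poly_ring_add poly_ring_mult)

lemma upoly_monom: "upoly i (Polynomial.monom c k) = scale c (X i ^ k)"
proof (induction k)
  case 0 then show ?case by (simp add: Polynomial.monom_0 upoly_pCons scale_eq_mult)
next
  case (Suc k) then show ?case by (simp add: Polynomial.monom_Suc upoly_pCons scale_mult_right)
qed

lemma X_power: "X i ^ k = bvec (Poly_Mapping.single i k)"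
proof (induction k)
  case 0 then show ?case by (simp del: One_nat_def)
next
  case (Suc k)
  have "Poly_Mapping.single i (Suc k) = var i + Poly_Mapping.single i k"
    by (simp add: var_def single_add[symmetric])
  then show ?case using Suc by (simp only: power_Suc bvec_mult)
qed

definition prime_ideal :: "nat \<Rightarrow> mpoly set \<Rightarrow> bool" where
  "prime_ideal n M \<longleftrightarrow> poly_ideal n M \<and> 1 \<notin> M \<and>
     (\<forall>p\<in>poly_ring n. \<forall>q\<in>poly_ring n. p * q \<in> M \<longrightarrow> p \<in> M \<or> q \<in> M)"

lemma prime_avoiding_powers:
  assumes I: "poly_ideal n I" and k: "k < n" and avoid: "\<And>N. X k ^ N \<notin> I"
  obtains M where "prime_ideal n M" "I \<subseteq> M" "X k \<notin> M"
proof -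
  let ?A = "{M. poly_ideal n M \<and> I \<subseteq> M \<and> (\<forall>N. X k ^ N \<notin> M)}"
  have "\<exists>M\<in>?A. \<forall>M'\<in>?A. M \<subseteq> M' \<longrightarrow> M' = M"
  proof (rule subset_Zorn_nonempty)
    show "?A \<noteq> {}" using I avoid by blast
    fix \<C> assume ne: "\<C> \<noteq> {}" and c: "subset.chain ?A \<C>"
    have mem: "\<And>M. M \<in> \<C> \<Longrightarrow> M \<in> ?A" and lin: "\<And>M M'. M \<in> \<C> \<Longrightarrow> M' \<in> \<C> \<Longrightarrow> M \<subseteq> M' \<or> M' \<subseteq> M"
      using c unfolding subset.chain_def by blast+
    obtain M0 where M0: "M0 \<in> \<C>" using ne by blast
    have "poly_ideal n (\<Union>\<C>)"
      unfolding poly_ideal_def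
    proof (intro conjI ballI)
      show "\<Union>\<C> \<subseteq> poly_ring n" using mem unfolding poly_ideal_def by blast
      show "0 \<in> \<Union>\<C>" using M0 mem unfolding poly_ideal_def by blast
      show "p * q \<in> \<Union>\<C>" if "p \<in> poly_ring n" "q \<in> \<Union>\<C>" for p q
        using that mem unfolding poly_ideal_def by blast
      fix p q assume "p \<in> \<Union>\<C>" "q \<in> \<Union>\<C>"
      then obtain M M' where M: "M \<in> \<C>" "M' \<in> \<C>" "p \<in> M" "q \<in> M'" by blast
      then obtain M2 where "M2 \<in> \<C>" "p \<in> M2" "q \<in> M2" using lin by blast
      then show "p + q \<in> \<Union>\<C>" using mem unfolding poly_ideal_def by blast
    qed
    moreover have "I \<subseteq> \<Union>\<C>" using M0 mem by blast
    moreover have "X k ^ N \<notin> \<Union>\<C>" for N using mem by blast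
    ultimately show "\<Union>\<C> \<in> ?A" by blast
  qed
  then obtain M where M1: "M \<in> ?A" "\<forall>M'\<in>?A. M \<subseteq> M' \<longrightarrow> M' = M" by (rule bexE)
  have M: "M \<in> ?A" "\<And>M'. M' \<in> ?A \<Longrightarrow> M \<subseteq> M' \<Longrightarrow> M' = M" by (rule M1(1)) (use M1(2) in simp)
  have Mi: "poly_ideal n M" and av: "\<And>N. X k ^ N \<notin> M" using M(1) by auto
  note sM = poly_ideal_subspace[OF Mi]
  have mul: "\<And>p q. p \<in> poly_ring n \<Longrightarrow> q \<in> M \<Longrightarrow> p * q \<in> M" and MR: "M \<subseteq> poly_ring n" using Mi unfolding poly_ideal_def by auto
  \<comment> \<open>If no power of \<open>X k\<close> lay in the ideal generated by \<open>M\<close>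
    and \<open>p\<close>, that ideal would be a strictly larger member of \<open>?A\<close>, against
    maximality.\<close>
  have ext: "\<exists>N m r. m \<in> M \<and> r \<in> poly_ring n \<and> X k ^ N = m + r * p" if p: "p \<in> poly_ring n" "p \<notin> M" for p
  proof (rule ccontr)
    assume no: "\<not> ?thesis"
    let ?M = "{m + r * p |m r. m \<in> M \<and> r \<in> poly_ring n}"
    have "poly_ideal n ?M"
      unfolding poly_ideal_def
    proof (intro conjI ballI subsetI)
      show "x \<in> poly_ring n" if "x \<in> ?M" for x
        using that MR p(1) by (auto intro!: poly_ring_add poly_ring_mult)
      show "0 \<in> ?M"
        using free.subspace_0[OF sM] free.subspace_0[OF poly_ring_subspace] by (intro CollectI exI[of _ 0]) auto
      fix x y assume "y \<in> ?M"
      then obtain m r where y: "y = m + r * p" "m \<in> M" "r \<in> poly_ring n" by blast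
      show "x * y \<in> ?M" if x: "x \<in> poly_ring n"
      proof (intro CollectI exI conjI)
        show "x * y = x * m + (x * r) * p" using y by (simp add: algebra_simps)
      qed (use mul poly_ring_mult x y in auto)
      show "x + y \<in> ?M" if x: "x \<in> ?M"
      proof -
        obtain m' r' where x: "x = m' + r' * p" "m' \<in> M" "r' \<in> poly_ring n" using x by blast
        show ?thesis
        proof (intro CollectI exI conjI)
          show "x + y = (m' + m) + (r' + r) * p" using x y by (simp add: algebra_simps)
        qed (use x y free.subspace_add[OF sM] poly_ring_add in auto)
      qed
    qed
    moreover have "M \<subseteq> ?M"
    proof
      fix m assume "m \<in> M"
      then show "m \<in> ?M" using free.subspace_0[OF poly_ring_subspace] by (intro CollectI exI[of _ m] exI[of _ 0]) auto
    qed
    moreover have "X k ^ N \<notin> ?M" for N using no by blast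
    ultimately have "?M = M" using M by blast
    moreover have "p \<in> ?M" using free.subspace_0[OF sM] by (intro CollectI exI[of _ 0] exI[of _ 1]) auto
    ultimately show False using p(2) by blast
  qed
  have "p \<in> M \<or> q \<in> M" if pq: "p \<in> poly_ring n" "q \<in> poly_ring n" "p * q \<in> M" for p q
  proof (rule ccontr)
    assume "\<not> ?thesis"
    then obtain N m r N' m' r' where *: "m \<in> M" "r \<in> poly_ring n" "X k ^ N = m + r * p"
      "m' \<in> M" "r' \<in> poly_ring n" "X k ^ N' = m' + r' * q" using ext pq by metis
    \<comment> \<open>In the product of the two representations every term has a factor in
      \<open>M\<close> or the factor \<open>p * q\<close>.\<close>
    have "X k ^ (N + N') = (m' + r' * q) * m + (r * p) * m' + (r * r') * (p * q)"
      unfolding power_add *(3,6) by (simp add: algebra_simps)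
    also have "\<dots> \<in> M"
    proof (intro free.subspace_add[OF sM])
      have "m' \<in> poly_ring n" using * MR by blast
      then show "(m' + r' * q) * m \<in> M" by (intro mul poly_ring_add poly_ring_mult * pq)
      show "(r * p) * m' \<in> M" by (rule mul[OF poly_ring_mult[OF *(2) pq(1)] *(4)])
      show "(r * r') * (p * q) \<in> M" by (rule mul[OF poly_ring_mult[OF *(2,5)] pq(3)])
    qed
    finally show False using av by blast
  qed
  moreover have "1 \<notin> M" using av[of 0] by simp
  ultimately have "prime_ideal n M" unfolding prime_ideal_def using Mi by blast
  moreover have "X k \<notin> M" using av[of 1] by simp
  ultimately show ?thesis using that M(1) by blast
qed

text \<open>Induction on the degree, splitting off a complex root. Primality selects the linear
  factor or the cofactor, and a nonzero constant is excluded by \<open>1 \<notin> M\<close>.\<close>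

lemma prime_contains_linear_factor:
  assumes M: "prime_ideal n M" and i: "i < n" and p: "upoly i p \<in> M" "p \<noteq> 0"
  shows "\<exists>c. X i - Poly_Mapping.single 0 c \<in> M"
  using p
proof (induction "Polynomial.degree p" arbitrary: p)
  case 0
  then obtain c where c: "p = [:c:]" "c \<noteq> 0" by (metis degree_eq_zeroE pCons_0_0)
  then have "Poly_Mapping.single 0 c \<in> M" using 0 by (simp add: upoly_pCons)
  then have "scale (1 / c) (Poly_Mapping.single 0 c) \<in> M"
    using M poly_ideal_subspace free.subspace_scale unfolding prime_ideal_def by blast
  moreover have "scale (1 / c) (Poly_Mapping.single 0 c) = (1 :: mpoly)"
    unfolding scale_eq_mult using c by (simp add: mult_single)
  ultimately show ?case using M unfolding prime_ideal_def by simp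
next
  case (Suc k)
  then have "\<not> constant (poly p)" by (simp add: constant_degree)
  then obtain c where "poly p c = 0" using fundamental_theorem_of_algebra by blast
  then obtain q where q: "p = [:- c, 1:] * q" using poly_eq_0_iff_dvd by blast
  then have "q \<noteq> 0" using Suc.prems by auto
  then have "Polynomial.degree p = Suc (Polynomial.degree q)"
    unfolding q by (subst degree_mult_eq) auto
  moreover have "(X i - Poly_Mapping.single 0 c) * upoly i q \<in> M" using Suc.prems(1) q upoly_linear_factor by metis
  then have "X i - Poly_Mapping.single 0 c \<in> M \<or> upoly i q \<in> M"
    using M i upoly_poly_ring[OF i] poly_ring_diff[of "X i" n "Poly_Mapping.single 0 c"] unfolding prime_ideal_def by simp
  ultimately show ?case using Suc.hyps \<open>q \<noteq> 0\<close> by auto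
qed

lemma eval_mpoly_lin: "eval_mpoly x p = lin (\<lambda>a. \<Prod>i\<in>Poly_Mapping.keys a. x i ^ Poly_Mapping.lookup a i) p"
  unfolding eval_mpoly_def lin_def ..

lemma eval_monomial_superset:
  "finite A \<Longrightarrow> Poly_Mapping.keys a \<subseteq> A \<Longrightarrow>
    (\<Prod>i\<in>Poly_Mapping.keys a. x i ^ Poly_Mapping.lookup a i) = (\<Prod>i\<in>A. x i ^ Poly_Mapping.lookup a i :: complex)"
  by (rule prod.mono_neutral_left) (auto simp: in_keys_iff)

lemma eval_monomial_add: "eval_mpoly x (bvec (a + b)) = eval_mpoly x (bvec a) * eval_mpoly x (bvec b)"
proof -
  let ?A = "Poly_Mapping.keys a \<union> Poly_Mapping.keys b"
  have "(\<Prod>i\<in>Poly_Mapping.keys (a + b). x i ^ Poly_Mapping.lookup (a + b) i) = (\<Prod>i\<in>?A. x i ^ Poly_Mapping.lookup (a + b) i)"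
    by (rule eval_monomial_superset) (auto simp: keys_add)
  then show ?thesis
    using eval_monomial_superset[of ?A a x] eval_monomial_superset[of ?A b x]
    by (simp add: eval_mpoly_lin lookup_add power_add prod.distrib)
qed

lemma eval_X: "eval_mpoly x (X i) = x i"
  by (simp add: eval_mpoly_lin var_def)

lemma eval_one: "eval_mpoly x 1 = 1"
  using lin_bvec[of _ "0 :: nat \<Rightarrow>\<^sub>0 nat"] unfolding eval_mpoly_lin by simp

text \<open>Modulo \<open>M\<close> each variable is congruent to the constant \<open>x i\<close>,
  hence \<open>f\<close> to its value at \<open>x\<close>. A nonzero constant in \<open>M\<close>
  would force \<open>1 \<in> M\<close>.\<close>

lemma prime_ideal_point:
  assumes M: "prime_ideal n M" and x: "\<And>i. i < n \<Longrightarrow> X i - Poly_Mapping.single 0 (x i) \<in> M" and f: "f \<in> M"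
  shows "eval_mpoly x f = 0"
proof -
  have Mi: "poly_ideal n M" using M unfolding prime_ideal_def by blast
  note sM = poly_ideal_subspace[OF Mi]
  have mul: "\<And>p q. p \<in> poly_ring n \<Longrightarrow> q \<in> M \<Longrightarrow> p * q \<in> M" and MR: "M \<subseteq> poly_ring n" using Mi unfolding poly_ideal_def by auto
  have mon: "bvec a - scale (eval_mpoly x (bvec a)) 1 \<in> M" if "a \<in> monomials n" for a
    using that
  proof (induction a rule: monomial_induct)
    case zero then show ?case using free.subspace_0[OF sM] by (simp add: eval_one)
  next
    case (step i b)
    have "bvec (var i + b) - scale (eval_mpoly x (bvec (var i + b))) 1 =
      bvec b * (X i - Poly_Mapping.single 0 (x i)) + Poly_Mapping.single 0 (x i) * (bvec b - scale (eval_mpoly x (bvec b)) 1)"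
      by (simp add: eval_monomial_add eval_X scale_eq_mult mult_single bvec_mult algebra_simps)
    also have "\<dots> \<in> M"
      by (intro free.subspace_add[OF sM] mul x step) (use step in \<open>auto simp: poly_ring_def[symmetric]\<close>,
          auto simp: poly_ring_def step)
    finally show ?case .
  qed
  have "ext (\<lambda>a. bvec a - scale (eval_mpoly x (bvec a)) 1) f \<in> M"
  proof (rule ext_mem[OF sM], rule mon)
    have fR: "f \<in> free_space (monomials n)" using MR f unfolding poly_ring_def by blast
    show "a \<in> monomials n" if "a \<in> Poly_Mapping.keys f" for a using keys_free_space[OF fR that] .
  qed
  moreover have "ext (\<lambda>a. bvec a - scale (eval_mpoly x (bvec a)) 1) f = f - scale (eval_mpoly x f) 1"
  proof -
    have "ext (\<lambda>a. bvec a - scale (eval_mpoly x (bvec a)) 1) f =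
        f - (\<Sum>a\<in>Poly_Mapping.keys f. scale (coord f a * eval_mpoly x (bvec a)) 1)"
      using ext_id[of f] by (simp add: ext_def free.scale_right_diff_distrib sum_subtractf)
    also have "(\<Sum>a\<in>Poly_Mapping.keys f. scale (coord f a * eval_mpoly x (bvec a)) 1) = scale (eval_mpoly x f) (1 :: mpoly)"
      by (simp add: free.scale_sum_left[symmetric] eval_mpoly_lin lin_def[of _ f])
    finally show ?thesis .
  qed
  ultimately have "f - scale (eval_mpoly x f) 1 \<in> M" by simp
  from free.subspace_diff[OF sM f this] have 1: "scale (eval_mpoly x f) 1 \<in> M" by simp
  show ?thesis
  proof (rule ccontr)
    assume "eval_mpoly x f \<noteq> 0"
    then show False using free.subspace_scale[OF sM 1, of "1 / eval_mpoly x f"] M unfolding prime_ideal_def by simp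
  qed
qed


section \<open>Powers of the maximal ideal in a punctual ideal\<close>

lemma deg_single [simp]: "deg (Poly_Mapping.single i k) = k"
  by (cases "k = 0") (simp_all add: deg_def)

lemma single_monomials: "i < n \<Longrightarrow> Poly_Mapping.single i k \<in> monomials n"
  by (simp add: monomials_def)

lemma upoly_sum_monom:
  "finite A \<Longrightarrow> upoly i (\<Sum>j\<in>A. Polynomial.monom (c j) j) = (\<Sum>j\<in>A. scale (c j) (X i ^ j))"
  by (induction A rule: finite_induct) (simp_all add: upoly_add upoly_monom)

lemma univariate_relation:
  assumes i: "i < n" and bound: "\<And>J. J \<subseteq> monomials n \<Longrightarrow> indep_mod J I \<Longrightarrow> finite J \<and> card J \<le> d"
  shows "\<exists>p. p \<noteq> 0 \<and> upoly i p \<in> I"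
proof -
  let ?s = "\<lambda>j::nat. Poly_Mapping.single i j"
  \<comment> \<open>The \<open>d + 1\<close> powers of the variable up to exponent \<open>d\<close>
    exceed the bound \<open>d\<close> on independent monomials, so there is a relation between
    them.\<close>
  let ?J = "?s ` {..d}"
  have inj: "inj_on ?s {..d}" by (rule inj_onI) (metis deg_single)
  have "\<not> indep_mod ?J I"
  proof
    assume "indep_mod ?J I"
    then have "card ?J \<le> d" using bound[of ?J] single_monomials[OF i] by blast
    then show False using card_image[OF inj] by simp
  qed
  then obtain u where u: "u \<in> free_space ?J" "u \<in> I" "u \<noteq> 0" unfolding indep_mod_def by blast
  define p where "p = (\<Sum>j\<le>d. Polynomial.monom (coord u (?s j)) j)"
  have "upoly i p = (\<Sum>j\<le>d. scale (coord u (?s j)) (bvec (?s j)))"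
    unfolding p_def by (subst upoly_sum_monom) (simp_all only: X_power finite_atMost)
  also have "\<dots> = (\<Sum>a\<in>?J. scale (coord u a) (bvec a))" by (simp only: sum.reindex[OF inj] comp_def)
  also have "\<dots> = (\<Sum>a\<in>Poly_Mapping.keys u. scale (coord u a) (bvec a))"
    by (rule sum.mono_neutral_right) (use u(1) in \<open>auto simp: free_space_def in_keys_iff\<close>)
  also have "\<dots> = u" using ext_id[of u] by (simp only: ext_def)
  finally have eq: "upoly i p = u" .
  then have "p \<noteq> 0" using u(3) by auto
  then show ?thesis using eq u(2) by blast
qed

lemma power_in_punctual_ideal:
  assumes I: "poly_ideal n I" and zl: "zero_locus n I \<subseteq> {\<lambda>_. 0}" and k: "k < n"
    and bound: "\<And>J. J \<subseteq> monomials n \<Longrightarrow> indep_mod J I \<Longrightarrow> finite J \<and> card J \<le> d"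
  shows "\<exists>N. X k ^ N \<in> I"
proof (rule ccontr)
  assume "\<not> ?thesis"
  then obtain M where M: "prime_ideal n M" "I \<subseteq> M" "X k \<notin> M" using prime_avoiding_powers[OF I k] by blast
  have "\<forall>i\<in>{..<n}. \<exists>c. X i - Poly_Mapping.single 0 c \<in> M"
  proof
    fix i assume "i \<in> {..<n}"
    then have i: "i < n" by simp
    obtain p where "p \<noteq> 0" "upoly i p \<in> I" using univariate_relation[OF i bound] by blast
    then show "\<exists>c. X i - Poly_Mapping.single 0 c \<in> M" using prime_contains_linear_factor[OF M(1) i] M(2) by blast
  qed
  then obtain c where c: "\<And>i. i < n \<Longrightarrow> X i - Poly_Mapping.single 0 (c i) \<in> M" by (metis lessThan_iff)
  define x where "x i = (if i < n then c i else 0)" for i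
  have "eval_mpoly x f = 0" if "f \<in> I" for f
    by (rule prime_ideal_point[OF M(1)]) (use c M(2) that in \<open>auto simp: x_def\<close>)
  then have "x \<in> zero_locus n I"
    unfolding zero_locus_def by (simp add: compatible_affine_space pts_chart_space x_def)
  then have "x k = 0" using zl by auto
  then have "c k = 0" using k by (simp add: x_def)
  then show False using c[OF k] M(3) by simp
qed

text \<open>Pigeonhole: a monomial whose degree exceeds the sum of the exponents \<open>N i\<close>
  is divisible by some \<open>X i ^ N i\<close>.\<close>

lemma monomials_in_punctual_ideal:
  assumes I: "poly_ideal n I" and zl: "zero_locus n I \<subseteq> {\<lambda>_. 0}"
    and bound: "\<And>J. J \<subseteq> monomials n \<Longrightarrow> indep_mod J I \<Longrightarrow> finite J \<and> card J \<le> d"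
  shows "\<exists>N. \<forall>a\<in>monomials n. N \<le> deg a \<longrightarrow> bvec a \<in> I"
proof -
  have "\<exists>N. \<forall>k<n. X k ^ N k \<in> I" using power_in_punctual_ideal[OF I zl _ bound] by metis
  then obtain N where N: "\<And>k. k < n \<Longrightarrow> X k ^ N k \<in> I" by blast
  have "bvec a \<in> I" if a: "a \<in> monomials n" "Suc (\<Sum>i<n. N i) \<le> deg a" for a
  proof -
    have "deg a = (\<Sum>i<n. Poly_Mapping.lookup a i)"
      by (rule deg_superset) (use a in \<open>auto simp: monomials_def\<close>)
    then have "\<not> (\<forall>i<n. Poly_Mapping.lookup a i \<le> N i)"
      using sum_mono[of "{..<n}" "Poly_Mapping.lookup a" N] a(2) by force
    then obtain i where i: "i < n" "N i \<le> Poly_Mapping.lookup a i" by force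
    let ?b = "a - Poly_Mapping.single i (N i)"
    have eq: "a = ?b + Poly_Mapping.single i (N i)"
      by (rule poly_mapping_eqI) (use i in \<open>auto simp: lookup_add lookup_minus lookup_single when_def\<close>)
    have "Poly_Mapping.keys ?b \<subseteq> Poly_Mapping.keys a" by (auto simp: in_keys_iff lookup_minus)
    then have "bvec ?b \<in> poly_ring n" using a(1) by (auto simp: poly_ring_def monomials_def)
    then have "bvec ?b * X i ^ N i \<in> I" using I N[OF i(1)] unfolding poly_ideal_def by blast
    also have "bvec ?b * X i ^ N i = bvec a" unfolding X_power bvec_mult eq[symmetric] ..
    finally show ?thesis .
  qed
  then show ?thesis by blast
qed

text \<open>The chain of the ideals generated by \<open>I\<close> and the powers of the maximal ideal decreases
  strictly until it reaches \<open>I\<close>, so it takes at most \<open>d\<close> steps.\<close>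

lemma nilpotency_bound:
  assumes I: "free.subspace I" "\<And>i p. i < n \<Longrightarrow> p \<in> I \<Longrightarrow> X i * p \<in> I"
    and bound: "\<And>J. J \<subseteq> monomials n \<Longrightarrow> indep_mod J I \<Longrightarrow> finite J \<and> card J \<le> d"
    and N: "\<And>a. a \<in> monomials n \<Longrightarrow> N \<le> deg a \<Longrightarrow> bvec a \<in> I"
  shows "a \<in> monomials n \<Longrightarrow> d \<le> deg a \<Longrightarrow> bvec a \<in> I"
proof -
  let ?P = "\<lambda>N. \<forall>a\<in>monomials n. N \<le> deg a \<longrightarrow> bvec a \<in> I"
  let ?W = "\<lambda>i. free_space {a\<in>monomials n. i < deg a}"
  define m where "m = (LEAST N. ?P N)"
  have m: "?P m" unfolding m_def by (rule LeastI[of ?P N]) (use N in blast)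
  have min: "\<not> ?P i" if "i < m" for i using that not_less_Least unfolding m_def by blast
  \<comment> \<open>If every monomial of degree \<open>i\<close> were congruent to higher terms,
    multiplication by variables would give the same in all degrees above \<open>i\<close>.
    Descending from degree \<open>m\<close>, all monomials of degree at least \<open>i\<close> would
    lie in \<open>I\<close>, against the minimality of \<open>m\<close>.\<close>
  have "\<exists>b\<in>monomials n. deg b = i \<and> \<not> (\<exists>u\<in>?W i. bvec b - u \<in> I)" if i: "i < m" for i
  proof (rule ccontr)
    assume "\<not> ?thesis"
    then have b: "\<exists>u\<in>?W i. bvec b - u \<in> I" if "b \<in> monomials n" "deg b = i" for b using that by blast
    have step: "\<exists>u\<in>?W j. bvec b - u \<in> I" if "b \<in> monomials n" "deg b = j" "i \<le> j" for b j
      using that(3,1,2)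
    proof (induction j arbitrary: b rule: dec_induct)
      case base then show ?case using b by blast
    next
      case (step j)
      then have "b \<noteq> 0" by auto
      then obtain k c where kc: "k < n" "c \<in> monomials n" "b = var k + c" using monomial_split step.prems by blast
      then have "deg c = j" using step.prems by simp
      then obtain u where u: "u \<in> ?W j" "bvec c - u \<in> I" using step.IH kc by blast
      have "X k * u \<in> ?W (Suc j)"
        by (rule free_space_mult[of _ "{var k}" _ "{a\<in>monomials n. j < deg a}"]) (use u kc in \<open>auto intro: add_monomials\<close>)
      moreover have "bvec b - X k * u \<in> I"
        using I(2)[OF kc(1) u(2)] unfolding kc(3) bvec_mult[symmetric] by (simp add: right_diff_distrib)
      ultimately show ?case by blast
    qed
    have "bvec b \<in> I" if "b \<in> monomials n" "i \<le> deg b" for b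
      using that
    proof (induction "m - deg b" arbitrary: b rule: less_induct)
      case less
      show ?case
      proof (cases "m \<le> deg b")
        case True then show ?thesis using m less.prems by blast
      next
        case False
        obtain u where u: "u \<in> ?W (deg b)" "bvec b - u \<in> I" using step[OF less.prems(1) refl less.prems(2)] by blast
        have "ext bvec u \<in> I"
        proof (rule ext_mem[OF I(1)])
          fix c assume "c \<in> Poly_Mapping.keys u"
          then have c: "c \<in> monomials n" "deg b < deg c" using keys_free_space[OF u(1)] by auto
          show "bvec c \<in> I" by (rule less.hyps) (use c False less.prems in auto)
        qed
        then have "u \<in> I" by (simp add: ext_id)
        from free.subspace_add[OF I(1) u(2) this] show ?thesis by simp
      qed
    qed
    then show False using min[OF i] by blast
  qed
  then have "\<forall>i\<in>{..<m}. \<exists>b. b \<in> monomials n \<and> deg b = i \<and> \<not> (\<exists>u\<in>?W i. bvec b - u \<in> I)" by blast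
  from bchoice[OF this] obtain b
    where b: "\<And>i. i < m \<Longrightarrow> b i \<in> monomials n \<and> deg (b i) = i \<and> \<not> (\<exists>u\<in>?W i. bvec (b i) - u \<in> I)"
    by blast
  have inj: "inj_on b {..<m}" by (rule inj_onI) (metis b lessThan_iff)
  \<comment> \<open>The term of least degree in a relation would be congruent to terms of higher
    degree, which the choice of \<open>b\<close> excludes.\<close>
  have "indep_mod (b ` {..<m}) I"
    unfolding indep_mod_def
  proof (intro ballI impI, rule ccontr)
    fix u assume u: "u \<in> free_space (b ` {..<m})" "u \<in> I" "u \<noteq> 0"
    then have ne: "deg ` Poly_Mapping.keys u \<noteq> {}" by simp
    define i where "i = Min (deg ` Poly_Mapping.keys u)"
    have "i \<in> deg ` Poly_Mapping.keys u" unfolding i_def by (rule Min_in) (use ne in auto)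
    then obtain a where a: "a \<in> Poly_Mapping.keys u" "deg a = i" by blast
    then obtain i' where "i' < m" "a = b i'" using keys_free_space[OF u(1)] by blast
    then have ai: "i < m" "a = b i" using b a(2) by auto
    have c: "coord u a \<noteq> 0" using a by (simp add: in_keys_iff)
    let ?v = "bvec a - scale (1 / coord u a) u"
    have "?v \<in> ?W i" unfolding free_space_iff
    proof (intro allI impI)
      fix a' assume a': "a' \<notin> {a \<in> monomials n. i < deg a}"
      show "coord ?v a' = 0"
      proof (cases "a' = a")
        case True then show ?thesis using c by (simp add: lookup_minus)
      next
        case False
        have "coord u a' = 0"
        proof (rule ccontr)
          assume "coord u a' \<noteq> 0"
          then have k: "a' \<in> Poly_Mapping.keys u" by (simp add: in_keys_iff)
          then obtain i' where i': "i' < m" "a' = b i'" using keys_free_space[OF u(1)] by blast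
          have "i \<le> deg a'" unfolding i_def by (rule Min_le) (use k in auto)
          then show False using a' b[OF i'(1)] i' False ai by auto
        qed
        then show ?thesis using False by (simp add: lookup_minus lookup_single when_def)
      qed
    qed
    moreover have "bvec a - ?v \<in> I" using free.subspace_scale[OF I(1) u(2)] by simp
    ultimately show False using b[OF ai(1)] ai(2) by blast
  qed
  then have "card (b ` {..<m}) \<le> d" using bound[of "b ` {..<m}"] b by blast
  then have "m \<le> d" using card_image[OF inj] by simp
  then show "bvec a \<in> I" if "a \<in> monomials n" "d \<le> deg a" using m that by auto
qed

text \<open>A description adapted to monomial coordinates: nilpotency at the uniform degree
  \<open>d\<close> replaces the zero locus, and a monomial basis replaces an arbitrary complement.
  The equivalence is \<open>punctual_ideal_iff\<close>; the uniform degree leaves only finitely many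
  monomials outside all these ideals.\<close>

definition punctual_ideal :: "nat \<Rightarrow> nat \<Rightarrow> mpoly set \<Rightarrow> bool" where
  "punctual_ideal d n I \<longleftrightarrow> free.subspace I \<and> I \<subseteq> poly_ring n \<and> (\<forall>i<n. \<forall>p\<in>I. X i * p \<in> I) \<and>
     (\<forall>a\<in>monomials n. d \<le> deg a \<longrightarrow> bvec a \<in> I) \<and>
     (\<exists>J\<subseteq>monomials n. finite J \<and> card J = d \<and> quotient_basis (monomials n) J I)"

lemma poly_ideal_X: "poly_ideal n I \<Longrightarrow> i < n \<Longrightarrow> p \<in> I \<Longrightarrow> X i * p \<in> I"
  unfolding poly_ideal_def by simp

lemma punctual_idealI:
  assumes I: "poly_ideal n I" and col: "colength n I d" and zl: "zero_locus n I \<subseteq> {\<lambda>_. 0}"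
  shows "punctual_ideal d n I"
proof -
  note sI = poly_ideal_subspace[OF I]
  obtain B where B: "B \<subseteq> poly_ring n" "finite B" "card B = d" "free.independent B"
    "free.span B \<inter> I = {0}" "\<And>p. p \<in> poly_ring n \<Longrightarrow> \<exists>u\<in>free.span B. p - u \<in> I"
    using col unfolding colength_def by metis
  have bound: "finite J \<and> card J \<le> d" if J: "J \<subseteq> monomials n" "indep_mod J I" for J
  proof -
    have "finite (bvec ` J) \<and> card (bvec ` J) \<le> card B"
    proof (rule steinitz_mod[OF sI independent_bvec _ B(2)], unfold span_bvec)
      show "v = 0" if "v \<in> free_space J" "v \<in> I" for v using J(2) that unfolding indep_mod_def by blast
      show "\<exists>u\<in>free.span B. v - u \<in> I" if "v \<in> bvec ` J" for v
        using that J(1) by (intro B(6)) (auto simp: poly_ring_def)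
    qed
    moreover have "inj_on bvec J" by (rule inj_on_subset[OF inj_bvec subset_UNIV])
    ultimately show ?thesis using finite_imageD[of bvec J] B(3) by (simp add: card_image)
  qed
  obtain J where J: "J \<subseteq> monomials n" "indep_mod J I" "\<And>a. a \<in> monomials n \<Longrightarrow> \<exists>u\<in>free_space J. bvec a - u \<in> I"
    using indep_mod_extend[OF sI bound] by blast
  have qb: "quotient_basis (monomials n) J I"
    by (rule quotient_basisI[OF sI extend_spanning[OF sI J(3)]]) (use J(2) in \<open>auto simp: indep_mod_def\<close>)
  have "card B \<le> card (bvec ` J)"
  proof (rule conjunct2[OF steinitz_mod[OF sI B(4)]], unfold span_bvec)
    show "v = 0" if "v \<in> free.span B" "v \<in> I" for v using B(5) that by blast
    show "finite (bvec ` J)" using bound[OF J(1,2)] by simp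
    show "\<exists>u\<in>free_space J. v - u \<in> I" if "v \<in> B" for v
      by (rule extend_spanning[OF sI J(3)]) (use that B(1) in \<open>auto simp: poly_ring_def\<close>)
  qed
  then have "card J = d" using bound[OF J(1,2)] B(3) card_image_le[of J bvec] by simp
  moreover have "\<forall>a\<in>monomials n. d \<le> deg a \<longrightarrow> bvec a \<in> I"
    using monomials_in_punctual_ideal[OF I zl bound] nilpotency_bound[OF sI poly_ideal_X[OF I] bound] by metis
  ultimately show ?thesis
    unfolding punctual_ideal_def using sI I poly_ideal_X[OF I] qb J(1) bound[OF J(1,2)] unfolding poly_ideal_def by blast
qed

lemma punctual_ideal_poly_ideal:
  assumes "punctual_ideal d n I" shows "poly_ideal n I"
  using assms subspace_ideal[of I n] unfolding punctual_ideal_def poly_ideal_def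
  by (auto intro: free.subspace_0 free.subspace_add)

lemma punctual_idealD:
  assumes I: "punctual_ideal d n I"
  shows "colength n I d" "zero_locus n I \<subseteq> {\<lambda>_. 0}"
proof -
  have sI: "free.subspace I" using I unfolding punctual_ideal_def by blast
  obtain J where J: "J \<subseteq> monomials n" "finite J" "card J = d" "quotient_basis (monomials n) J I"
    using I unfolding punctual_ideal_def by blast
  interpret qbasis "monomials n" J I by standard (use sI J in auto)
  have "inj_on bvec J" by (rule inj_on_subset[OF inj_bvec subset_UNIV])
  moreover have "bvec ` J \<subseteq> poly_ring n" using J(1) by (auto simp: poly_ring_def)
  moreover have "free_space J \<inter> I = {0}"
    using indep_mod_basis free.subspace_0[OF sI] free.subspace_0[OF subspace_free_space]
    unfolding indep_mod_def by blast
  moreover have "\<forall>p\<in>poly_ring n. \<exists>u\<in>free_space J. p - u \<in> I"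
    using res_mem res_diff unfolding poly_ring_def by blast
  ultimately show "colength n I d"
    unfolding colength_def using J independent_bvec
    by (intro exI[of _ "bvec ` J"]) (simp add: span_bvec card_image)
  show "zero_locus n I \<subseteq> {\<lambda>_. 0}"
  proof
    fix x assume x: "x \<in> zero_locus n I"
    have "x i = 0" for i
    proof (cases "i < n")
      case True
      have "bvec (Poly_Mapping.single i d) \<in> I"
        using I single_monomials[OF True] unfolding punctual_ideal_def by simp
      then have "eval_mpoly x (bvec (Poly_Mapping.single i d)) = 0" using x unfolding zero_locus_def by blast
      moreover have "eval_mpoly x (bvec (Poly_Mapping.single i d)) = x i ^ d"
        by (cases "d = 0") (simp_all add: eval_mpoly_lin eval_one[unfolded eval_mpoly_lin])
      ultimately show ?thesis by simp
    next
      case False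
      then show ?thesis using x by (simp add: zero_locus_def compatible_affine_space pts_chart_space)
    qed
    then show "x \<in> {\<lambda>_. 0}" by auto
  qed
qed

lemma punctual_ideal_iff:
  "punctual_ideal d n I \<longleftrightarrow> poly_ideal n I \<and> colength n I d \<and> zero_locus n I \<subseteq> {\<lambda>_. 0}"
  using punctual_idealI punctual_idealD punctual_ideal_poly_ideal by blast

section \<open>The punctual Hilbert scheme as a variety\<close>

lemma lin_ext: "lin g (ext \<phi> v) = lin (\<lambda>i. lin g (\<phi> i)) v"
proof -
  have sum: "lin g (\<Sum>i\<in>A. scale (coord v i) (\<phi> i)) = (\<Sum>i\<in>A. coord v i * lin g (\<phi> i))" for A
    by (induction A rule: infinite_finite_induct) (simp_all add: lin_add lin_scale)
  show ?thesis unfolding ext_def sum lin_def[of _ v] ..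
qed

lemma X_mult_ext: "X k * p = ext (\<lambda>a. bvec (var k + a)) p"
proof -
  have "X k * p = p * X k" by (rule mult.commute)
  also have "\<dots> = ext (\<lambda>a. bvec a * X k) p" by (rule mult_eq_ext)
  also have "\<dots> = ext (\<lambda>a. bvec (var k + a)) p" by (simp only: bvec_mult add.commute)
  finally show ?thesis .
qed

definition punctual_ideals :: "nat \<Rightarrow> nat \<Rightarrow> mpoly set set" where
  "punctual_ideals d n = {I. punctual_ideal d n I}"

lemma punctual_ideal_subspace: "punctual_ideal d n I \<Longrightarrow> free.subspace I"
  and punctual_ideal_ring: "punctual_ideal d n I \<Longrightarrow> I \<subseteq> free_space (monomials n)"
  and punctual_ideal_X: "punctual_ideal d n I \<Longrightarrow> i < n \<Longrightarrow> p \<in> I \<Longrightarrow> X i * p \<in> I"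
  and punctual_ideal_deg: "punctual_ideal d n I \<Longrightarrow> a \<in> monomials n \<Longrightarrow> d \<le> deg a \<Longrightarrow> bvec a \<in> I"
  unfolding punctual_ideal_def poly_ring_def by auto

lemma punctual_ideal_mult: "punctual_ideal d n I \<Longrightarrow> p \<in> poly_ring n \<Longrightarrow> q \<in> I \<Longrightarrow> p * q \<in> I"
  using subspace_ideal[of I n p q] punctual_ideal_subspace punctual_ideal_X by blast

lemma punctual_ideal_bound:
  assumes "punctual_ideal d n I" "J \<subseteq> monomials n" "indep_mod J I"
  shows "finite J \<and> card J \<le> d"
proof -
  obtain K where K: "K \<subseteq> monomials n" "finite K" "card K = d" "quotient_basis (monomials n) K I"
    using assms(1) unfolding punctual_ideal_def by blast
  have "qbasis (monomials n) K I"
    unfolding qbasis_def using punctual_ideal_subspace[OF assms(1)] K by blast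
  from qbasis.indep_mod_bound[OF this K(2) assms(2,3)] show ?thesis using K(3) by simp
qed

lemma punctual_ideal_basis:
  assumes "punctual_ideal d n I" "J \<subseteq> monomials n" "quotient_basis (monomials n) J I"
  shows "finite J" "card J = d"
proof -
  have q: "qbasis (monomials n) J I"
    unfolding qbasis_def using punctual_ideal_subspace[OF assms(1)] assms by blast
  note b = punctual_ideal_bound[OF assms(1,2) qbasis.indep_mod_basis[OF q]]
  then show "finite J" by blast
  obtain K where K: "K \<subseteq> monomials n" "finite K" "card K = d" "quotient_basis (monomials n) K I"
    using assms(1) unfolding punctual_ideal_def by blast
  have "qbasis (monomials n) K I"
    unfolding qbasis_def using punctual_ideal_subspace[OF assms(1)] K by blast
  from qbasis.indep_mod_bound[OF q _ K(1) qbasis.indep_mod_basis[OF this]] show "card J = d" using b K(3) by simp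
qed

lemma punctual_ideal_basis_deg:
  assumes "punctual_ideal d n I" "J \<subseteq> monomials n" "quotient_basis (monomials n) J I" "a \<in> J"
  shows "deg a < d"
proof (rule ccontr)
  assume "\<not> deg a < d"
  then have "bvec a \<in> I" using punctual_ideal_deg[OF assms(1)] assms by auto
  moreover have "qbasis (monomials n) J I"
    unfolding qbasis_def using punctual_ideal_subspace[OF assms(1)] assms by blast
  ultimately have "bvec a = 0" using qbasis.indep_mod_basis assms(4) unfolding indep_mod_def by fastforce
  then have "bvec a \<in> free_space {}" by (simp add: free_space_iff)
  then show False by simp
qed

interpretation hilb: moduli "monomials n" "punctual_ideals d n" for n d
  by standard (auto simp: punctual_ideals_def punctual_ideal_subspace punctual_ideal_basis(1)
      dest: punctual_ideal_ring)

abbreviation "hdom d n J \<equiv> hilb.dom n d J"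
abbreviation "hcrd n J \<equiv> hilb.crd n J"

lemma hdom_iff: "I \<in> hdom d n J \<longleftrightarrow> punctual_ideal d n I \<and> quotient_basis (monomials n) J I"
  unfolding hilb.dom_def by (simp add: punctual_ideals_def)

text \<open>Restricting a moduli atlas amounts to restricting the set of subspaces, so the results
  on \<open>moduli\<close> apply to the punctual ideals directly.\<close>

lemma punctual_hilb_atlas: "punctual_hilb d n \<cong>\<^sub>V chart_space (moduli_atlas (monomials n) (punctual_ideals d n))"
proof -
  let ?V = "{I. poly_ideal n I \<and> colength n I d}"
  interpret m: moduli "monomials n" ?V
  proof
    show "free.subspace I" if "I \<in> ?V" for I using that poly_ideal_subspace by blast
    show "I \<subseteq> free_space (monomials n)" if "I \<in> ?V" for I
      using that unfolding poly_ideal_def poly_ring_def by blast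
    fix I J assume I: "I \<in> ?V" and J: "J \<subseteq> monomials n" "quotient_basis (monomials n) J I"
    have sI: "free.subspace I" using I poly_ideal_subspace by blast
    obtain B where B: "finite B" "\<And>p. p \<in> poly_ring n \<Longrightarrow> \<exists>u\<in>free.span B. p - u \<in> I"
      using I unfolding colength_def by blast
    have q: "qbasis (monomials n) J I" unfolding qbasis_def using sI J by blast
    have "finite (bvec ` J) \<and> card (bvec ` J) \<le> card B"
    proof (rule steinitz_mod[OF sI independent_bvec _ B(1)], unfold span_bvec)
      show "v = 0" if "v \<in> free_space J" "v \<in> I" for v
        using qbasis.indep_mod_basis[OF q] that unfolding indep_mod_def by blast
      show "\<exists>u\<in>free.span B. v - u \<in> I" if "v \<in> bvec ` J" for v
        using that J(1) by (intro B(2)) (auto simp: poly_ring_def)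
    qed
    then show "finite J" using finite_imageD[of bvec J] inj_on_subset[OF inj_bvec subset_UNIV] by blast
  qed
  have eq: "?V \<inter> {I. zero_locus n I \<subseteq> {\<lambda>_. 0}} = punctual_ideals d n"
    unfolding punctual_ideals_def punctual_ideal_iff by blast
  show ?thesis
    unfolding punctual_hilb_def hilb_def subspace_moduli_atlas eq[symmetric] restrict_moduli_atlas[symmetric]
    by (rule induced_chart_space[OF m.compatible_moduli])
qed

text \<open>Since \<open>I\<close> is stable under \<open>X k\<close>, the product of
  \<open>X k\<close> with a monomial can be reduced by first reducing the monomial. These quadratic
  identities are the equations of the chart.\<close>

lemma residue_coord_X:
  assumes I: "punctual_ideal d n I" and J: "J \<subseteq> monomials n" "quotient_basis (monomials n) J I"
    and a: "a \<in> monomials n" and k: "k < n"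
  shows "residue_coord J (var k + a) j I = (\<Sum>b\<in>J. residue_coord J a b I * residue_coord J (var k + b) j I)"
proof -
  interpret qbasis "monomials n" J I unfolding qbasis_def using punctual_ideal_subspace[OF I] J by blast
  have finJ: "finite J" by (rule punctual_ideal_basis(1)[OF I J])
  let ?r = "res J I (bvec a)"
  have e: "bvec a \<in> free_space (monomials n)" using a by simp
  note rE = free_JE[OF res_mem[OF e]]
  have ring: "X k * p \<in> free_space (monomials n)" if "p \<in> free_space (monomials n)" for p
    using poly_ring_mult[of "X k" n p] k that unfolding poly_ring_def by simp
  have "X k * (bvec a - ?r) \<in> I" by (rule punctual_ideal_X[OF I k res_diff[OF e]])
  then have "X k * bvec a - X k * ?r \<in> I" by (simp only: right_diff_distrib)
  then have "res J I (X k * bvec a) = res J I (X k * ?r)"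
    using res_diff_distrib[OF ring[OF e] ring[OF rE]] res_eq_0_iff[OF free.subspace_diff[OF subspace_free_space ring[OF e] ring[OF rE]]]
    by simp
  then have "residue_coord J (var k + a) j I = coord (res J I (X k * ?r)) j"
    unfolding residue_coord_res bvec_mult by simp
  also have "\<dots> = lin (\<lambda>b. residue_coord J (var k + b) j I) ?r"
    unfolding coord_res[OF ring[OF rE]] unfolding X_mult_ext lin_ext by simp
  also have "\<dots> = (\<Sum>b\<in>J. coord ?r b * residue_coord J (var k + b) j I)"
    by (rule lin_superset[OF finJ]) (use res_mem[OF e] in \<open>simp add: free_space_def\<close>)
  finally show ?thesis unfolding residue_coord_res .
qed

text \<open>The relations are normalisation on \<open>J\<close>, vanishing in degrees at least
  \<open>d\<close>, and \<open>residue_coord_X\<close>. Conversely, the kernel of a table that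
  satisfies them is stable under the variables, so it is a punctual ideal with these
  coordinates.\<close>

lemma affine_hdom:
  assumes J: "J \<subseteq> monomials n" "\<And>a. a \<in> J \<Longrightarrow> deg a < d" "card J = d"
  shows "affine_chart (hdom d n J) (hcrd n J)"
proof (rule hilb.affine_chart_dom)
  let ?E = "{a\<in>monomials n. deg a < d}"
  show JE: "J \<subseteq> ?E" using J by blast
  show "?E \<subseteq> monomials n" by blast
  show "finite ?E" by (rule finite_monomials_deg)
  have finJ: "finite J" using JE finite_monomials_deg finite_subset by blast
  have van: "residue_coord J a b I = 0" if I: "I \<in> hdom d n J" and a: "a \<in> monomials n - ?E" for I a b
  proof -
    interpret qbasis "monomials n" J I by (rule hilb.qbasis_dom[OF I J(1)])
    have "bvec a \<in> I" using punctual_ideal_deg I a unfolding hdom_iff by auto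
    then have "res J I (bvec a) = 0" using res_eq_0_iff[of "bvec a"] a by simp
    then show ?thesis by (simp add: residue_coord_res)
  qed
  show "residue_coord J a b I = 0" if "I \<in> hdom d n J" "a \<in> monomials n - ?E" for I a b
    by (rule van[OF that])
  fix z :: "(nat \<Rightarrow>\<^sub>0 nat) \<Rightarrow> (nat \<Rightarrow>\<^sub>0 nat) \<Rightarrow> complex"
  assume z: "\<And>P. P \<in> subalgebra ((\<lambda>k w. w k) ` (?E \<times> J)) \<Longrightarrow>
        (\<And>I. I \<in> hdom d n J \<Longrightarrow> P (\<lambda>k. residue_coord J (fst k) (snd k) I) = 0) \<Longrightarrow> P (\<lambda>k. z (fst k) (snd k)) = 0"
  \<comment> \<open>\<open>y\<close> extends the finite table by zero to degrees at least
    \<open>d\<close>. \<open>Y\<close> is the same entry as a polynomial function of the table, so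
    that the hypothesis on polynomial relations can be applied to it.\<close>
  define y where "y a b = (if a \<in> ?E then z a b else 0)" for a b
  define Y where "Y a b = (\<lambda>w. if a \<in> ?E then w (a, b) else (0::complex))" for a b :: "nat \<Rightarrow>\<^sub>0 nat"
  have Y: "Y a b \<in> subalgebra ((\<lambda>k w. w k) ` (?E \<times> J))" if "b \<in> J" for a b
    by (cases "a \<in> ?E") (use that in \<open>auto simp: Y_def intro: subalgebra.const subalgebra.gen\<close>)
  have Yy: "Y a b (\<lambda>k. z (fst k) (snd k)) = y a b" for a b by (simp add: Y_def y_def)
  have Yr: "Y a b (\<lambda>k. residue_coord J (fst k) (snd k) I) = residue_coord J a b I"
    if "I \<in> hdom d n J" "a \<in> monomials n" for a b I
    using van[OF that(1), of a b] that(2) by (auto simp: Y_def)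
  have y1: "y a b = (if a = b then 1 else 0)" if ab: "a \<in> J" "b \<in> J" for a b
  proof -
    have "(\<lambda>w. Y a b w - (if a = b then 1 else 0)) (\<lambda>k. z (fst k) (snd k)) = 0"
    proof (rule z)
      show "(\<lambda>w. Y a b w - (if a = b then 1 else 0)) \<in> subalgebra ((\<lambda>k w. w k) ` (?E \<times> J))"
        by (intro subalgebra_diff subalgebra.const Y ab)
      show "Y a b (\<lambda>k. residue_coord J (fst k) (snd k) I) - (if a = b then 1 else 0) = 0" if "I \<in> hdom d n J" for I
        using Yr[OF that, of a b] qbasis.residue_coord_basis[OF hilb.qbasis_dom[OF that J(1)] ab(1)] ab J(1) by auto
    qed
    then show ?thesis by (simp add: Yy)
  qed
  have y2: "y (var k + a) c = (\<Sum>b\<in>J. y a b * y (var k + b) c)" if a: "a \<in> monomials n" "k < n" "c \<in> J" for a k c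
  proof -
    have "(\<lambda>w. Y (var k + a) c w - (\<Sum>b\<in>J. Y a b w * Y (var k + b) c w)) (\<lambda>k. z (fst k) (snd k)) = 0"
    proof (rule z)
      show "(\<lambda>w. Y (var k + a) c w - (\<Sum>b\<in>J. Y a b w * Y (var k + b) c w)) \<in> subalgebra ((\<lambda>k w. w k) ` (?E \<times> J))"
        by (intro subalgebra_diff subalgebra_sum subalgebra.mult Y a)
      fix I assume I: "I \<in> hdom d n J"
      have "(\<Sum>b\<in>J. Y a b (\<lambda>k. residue_coord J (fst k) (snd k) I) * Y (var k + b) c (\<lambda>k. residue_coord J (fst k) (snd k) I)) =
          (\<Sum>b\<in>J. residue_coord J a b I * residue_coord J (var k + b) c I)"
        by (intro sum.cong refl arg_cong2[where f="(*)"] Yr[OF I] add_monomials) (use a J(1) in auto)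
      then show "Y (var k + a) c (\<lambda>k. residue_coord J (fst k) (snd k) I) -
          (\<Sum>b\<in>J. Y a b (\<lambda>k. residue_coord J (fst k) (snd k) I) * Y (var k + b) c (\<lambda>k. residue_coord J (fst k) (snd k) I)) = 0"
        using Yr[OF I, of "var k + a" c] residue_coord_X[OF _ J(1) _ a(1,2), of d I c] I a
        by (simp add: hdom_iff add_monomials)
    qed
    then show ?thesis by (simp add: Yy)
  qed
  let ?I = "kernel (monomials n) J y"
  note ker = kernel[OF finJ J(1) y1]
  have "punctual_ideal d n ?I"
    unfolding punctual_ideal_def
  proof (intro conjI allI impI ballI)
    show "free.subspace ?I" "?I \<subseteq> poly_ring n" using ker(1,2) by (auto simp: poly_ring_def)
    show "\<exists>J\<subseteq>monomials n. finite J \<and> card J = d \<and> quotient_basis (monomials n) J ?I"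
      using J finJ ker(3) unfolding qbasis_def by blast
    show "bvec a \<in> ?I" if "a \<in> monomials n" "d \<le> deg a" for a
      using that by (simp add: kernel_def y_def)
    fix k p assume k: "k < n" and p: "p \<in> ?I"
    have pE: "p \<in> free_space (monomials n)" using p by (simp add: kernel_def)
    have "lin (\<lambda>a. y a c) (X k * p) = 0" if c: "c \<in> J" for c
    proof -
      have "lin (\<lambda>a. y a c) (X k * p) = lin (\<lambda>a. y (var k + a) c) p" by (simp add: X_mult_ext lin_ext)
      also have "\<dots> = (\<Sum>a\<in>Poly_Mapping.keys p. coord p a * (\<Sum>b\<in>J. y a b * y (var k + b) c))"
        unfolding lin_def by (rule sum.cong) (use y2[OF _ k c] keys_free_space[OF pE] in auto)
      also have "\<dots> = (\<Sum>b\<in>J. lin (\<lambda>a. y a b) p * y (var k + b) c)"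
        unfolding lin_def sum_distrib_left sum_distrib_right by (subst sum.swap) (simp add: mult.assoc)
      also have "\<dots> = 0" using p by (simp add: kernel_def)
      finally show ?thesis .
    qed
    moreover have "X k * p \<in> free_space (monomials n)"
      using poly_ring_mult[of "X k" n p] k pE unfolding poly_ring_def by simp
    ultimately show "X k * p \<in> ?I" by (simp add: kernel_def)
  qed
  then have "?I \<in> hdom d n J" using ker(3) unfolding hdom_iff qbasis_def by blast
  moreover have "residue_coord J a b ?I = z a b" if "a \<in> ?E" "b \<in> J" for a b
  proof -
    have "residue_coord J a b ?I = y a b" by (rule ker(4)) (use that in auto)
    then show ?thesis using that unfolding y_def[of a b] by simp
  qed
  ultimately show "\<exists>I\<in>hdom d n J. \<forall>a\<in>?E. \<forall>b\<in>J. residue_coord J a b I = z a b" by blast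
qed

section \<open>Substitutions\<close>

definition mono :: "(nat \<Rightarrow> mpoly) \<Rightarrow> (nat \<Rightarrow>\<^sub>0 nat) \<Rightarrow> mpoly" where
  "mono h a = (\<Prod>i\<in>Poly_Mapping.keys a. h i ^ Poly_Mapping.lookup a i)"

lemma mono_superset:
  "finite A \<Longrightarrow> Poly_Mapping.keys a \<subseteq> A \<Longrightarrow> mono h a = (\<Prod>i\<in>A. h i ^ Poly_Mapping.lookup a i)"
  unfolding mono_def by (rule prod.mono_neutral_left) (auto simp: in_keys_iff)

lemma mono_add: "mono h (a + b) = mono h a * mono h b"
proof -
  let ?A = "Poly_Mapping.keys a \<union> Poly_Mapping.keys b"
  have "mono h (a + b) = (\<Prod>i\<in>?A. h i ^ Poly_Mapping.lookup (a + b) i)"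
    by (rule mono_superset) (auto simp: keys_add)
  then show ?thesis
    using mono_superset[of ?A a h] mono_superset[of ?A b h] by (simp add: lookup_add power_add prod.distrib)
qed

lemma mono_zero [simp]: "mono h 0 = 1"
  by (simp add: mono_def)

lemma mono_var [simp]: "mono h (var i) = h i"
  by (simp add: mono_def var_def)

definition subst :: "(nat \<Rightarrow> mpoly) \<Rightarrow> mpoly \<Rightarrow> mpoly" where
  "subst h = ext (mono h)"

lemma subst_add: "subst h (p + q) = subst h p + subst h q"
  and subst_diff: "subst h (p - q) = subst h p - subst h q"
  and subst_scale: "subst h (scale c p) = scale c (subst h p)"
  and subst_bvec: "subst h (bvec a) = mono h a"
  and subst_zero [simp]: "subst h 0 = 0"
  by (simp_all add: subst_def ext_add ext_diff ext_scale)

lemma linear_eqI: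
  assumes "\<And>v w. f (v + w) = f v + f w" "\<And>c v. f (scale c v) = scale c (f v)"
    "\<And>v w. f' (v + w) = f' v + f' w" "\<And>c v. f' (scale c v) = scale c (f' v)"
    "\<And>i. f (bvec i) = f' (bvec i)"
  shows "f v = f' v"
  using linear_eq_ext[where E=UNIV and f=f and v=v] linear_eq_ext[where E=UNIV and f=f' and v=v] assms
  by (simp add: free_space_def)

lemma subst_mult: "subst h (p * q) = subst h p * subst h q"
proof (rule linear_eqI[where f="\<lambda>p. subst h (p * q)" and f'="\<lambda>p. subst h p * subst h q"])
  show "subst h (bvec a * q) = subst h (bvec a) * subst h q" for a
  proof (rule linear_eqI[where f="\<lambda>q. subst h (bvec a * q)" and f'="\<lambda>q. subst h (bvec a) * subst h q"])
    show "subst h (bvec a * bvec b) = subst h (bvec a) * subst h (bvec b)" for b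
      by (simp only: bvec_mult subst_bvec mono_add)
  qed (simp_all add: distrib_left subst_add subst_scale scale_mult_right)
qed (simp_all add: distrib_right subst_add subst_scale scale_mult_left)

lemma subst_X: "subst h (X i) = h i"
  by (simp only: subst_bvec mono_var)

text \<open>A substitution without constant terms does not lower degrees. Hence an ideal pulled back
  along it still contains all monomials of degree at least \<open>d\<close>.\<close>

lemma mono_graded:
  assumes "\<And>i. i < n \<Longrightarrow> h i \<in> free_space {b\<in>monomials g. 1 \<le> deg b}" "a \<in> monomials n"
  shows "mono h a \<in> free_space {b\<in>monomials g. deg a \<le> deg b}"
  using assms(2)
proof (induction a rule: monomial_induct)
  case zero
  then show ?case using bvec_free_space[of 0 "{b\<in>monomials g. 0 \<le> deg b}"] by simp
next
  case (step i b)
  show ?case unfolding mono_add mono_var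
    by (rule free_space_mult[OF assms(1)[OF step(1)] step(3)]) (auto intro: add_monomials)
qed

lemma mono_poly_ring:
  assumes "\<And>i. i < n \<Longrightarrow> h i \<in> poly_ring g" "a \<in> monomials n" shows "mono h a \<in> poly_ring g"
  using assms(2) by (induction a rule: monomial_induct) (auto simp: mono_add intro: poly_ring_mult assms(1))

lemma subst_poly_ring:
  assumes "\<And>i. i < n \<Longrightarrow> h i \<in> poly_ring g" "p \<in> poly_ring n" shows "subst h p \<in> poly_ring g"
proof -
  have "p \<in> free_space (monomials n)" using assms(2) by (simp add: poly_ring_def)
  then show ?thesis
    unfolding subst_def by (intro ext_mem[OF poly_ring_subspace] mono_poly_ring assms(1)) (auto dest: keys_free_space)
qed

lemma ext_ext: "ext \<psi> (ext \<phi> v) = ext (\<lambda>i. ext \<psi> (\<phi> i)) v"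
  by (rule poly_mapping_eqI) (simp add: coord_ext lin_ext)

section \<open>Renaming of variables and contraction of ideals\<close>

definition ren :: "(nat \<Rightarrow> nat) \<Rightarrow> (nat \<Rightarrow>\<^sub>0 nat) \<Rightarrow> (nat \<Rightarrow>\<^sub>0 nat)" where
  "ren \<sigma> a = (\<Sum>i\<in>Poly_Mapping.keys a. Poly_Mapping.single (\<sigma> i) (Poly_Mapping.lookup a i))"

lemma ren_superset:
  "finite A \<Longrightarrow> Poly_Mapping.keys a \<subseteq> A \<Longrightarrow> ren \<sigma> a = (\<Sum>i\<in>A. Poly_Mapping.single (\<sigma> i) (Poly_Mapping.lookup a i))"
  unfolding ren_def by (rule sum.mono_neutral_left) (auto simp: in_keys_iff)

lemma ren_add: "ren \<sigma> (a + b) = ren \<sigma> a + ren \<sigma> b"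
proof -
  let ?A = "Poly_Mapping.keys a \<union> Poly_Mapping.keys b"
  have "ren \<sigma> (a + b) = (\<Sum>i\<in>?A. Poly_Mapping.single (\<sigma> i) (Poly_Mapping.lookup (a + b) i))"
    by (rule ren_superset) (auto simp: keys_add)
  then show ?thesis
    using ren_superset[of ?A a \<sigma>] ren_superset[of ?A b \<sigma>] by (simp add: lookup_add single_add sum.distrib)
qed

lemma ren_zero [simp]: "ren \<sigma> 0 = 0"
  by (simp add: ren_def)

lemma ren_var [simp]: "ren \<sigma> (var i) = var (\<sigma> i)"
  by (simp add: ren_def var_def)

text \<open>The polynomial ring in \<open>g\<close> variables as a subring of the one in \<open>n\<close> variables,
  by means of the variables numbered by \<open>A\<close>.\<close>

locale renaming =
  fixes n g :: nat and A :: "nat set" and \<sigma> :: "nat \<Rightarrow> nat"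
  assumes bij: "bij_betw \<sigma> {..<g} A" and An: "A \<subseteq> {..<n}"
begin

abbreviation "\<rho> \<equiv> ren \<sigma>"

definition Ren :: "mpoly \<Rightarrow> mpoly" where
  "Ren = subst (\<lambda>i. X (\<sigma> i))"

lemma sigma: "i < g \<Longrightarrow> \<sigma> i \<in> A" "i < g \<Longrightarrow> \<sigma> i < n"
  using bij An unfolding bij_betw_def by auto

lemma sigma_surj: "a \<in> A \<Longrightarrow> \<exists>i<g. a = \<sigma> i"
  using bij unfolding bij_betw_def by auto

lemma ren_monomials: "a \<in> monomials g \<Longrightarrow> \<rho> a \<in> monomials n"
  by (induction a rule: monomial_induct) (auto simp: ren_add sigma intro: add_monomials)

lemma deg_ren: "a \<in> monomials g \<Longrightarrow> deg (\<rho> a) = deg a"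
  by (induction a rule: monomial_induct) (auto simp: ren_add)

lemma ren_inj: "inj_on \<rho> (monomials g)"
proof (rule inj_on_inverseI[where g="ren (inv_into {..<g} \<sigma>)"])
  fix a assume "a \<in> monomials g"
  then show "ren (inv_into {..<g} \<sigma>) (\<rho> a) = a"
  proof (induction a rule: monomial_induct)
    case (step i b)
    have "inv_into {..<g} \<sigma> (\<sigma> i) = i"
      by (rule inv_into_f_f) (use bij step in \<open>auto simp: bij_betw_def\<close>)
    then show ?case using step by (simp add: ren_add)
  qed simp
qed

lemma Ren_bvec: "a \<in> monomials g \<Longrightarrow> Ren (bvec a) = bvec (\<rho> a)"
proof (induction a rule: monomial_induct)
  case zero then show ?case unfolding Ren_def subst_bvec by simp
next
  case (step i b)
  have "Ren (bvec (var i + b)) = Ren (X i) * Ren (bvec b)"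
    unfolding Ren_def by (simp only: bvec_mult[symmetric] subst_mult)
  also have "Ren (X i) = X (\<sigma> i)" unfolding Ren_def subst_X ..
  also have "X (\<sigma> i) * Ren (bvec b) = bvec (\<rho> (var i + b))" by (simp only: step bvec_mult ren_add ren_var)
  finally show ?case .
qed

lemma Ren_add: "Ren (p + q) = Ren p + Ren q"
  and Ren_diff: "Ren (p - q) = Ren p - Ren q"
  and Ren_scale: "Ren (scale c p) = scale c (Ren p)"
  and Ren_mult: "Ren (p * q) = Ren p * Ren q"
  and Ren_X: "Ren (X i) = X (\<sigma> i)"
  and Ren_zero: "Ren 0 = 0"
  unfolding Ren_def by (simp_all add: subst_add subst_diff subst_scale subst_mult subst_X)

lemma Ren_poly_ring: "p \<in> poly_ring g \<Longrightarrow> Ren p \<in> poly_ring n"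
  unfolding Ren_def by (rule subst_poly_ring) (auto simp: sigma)

lemma Ren_ext: "p \<in> poly_ring g \<Longrightarrow> Ren p = ext (\<lambda>a. bvec (\<rho> a)) p"
  unfolding Ren_def subst_def
proof (rule ext_cong)
  fix a assume "p \<in> poly_ring g" "a \<in> Poly_Mapping.keys p"
  then have "a \<in> monomials g" unfolding poly_ring_def by (rule keys_free_space)
  from Ren_bvec[OF this] show "mono (\<lambda>i. X (\<sigma> i)) a = bvec (\<rho> a)" unfolding Ren_def subst_bvec .
qed

lemma coord_Ren: "p \<in> poly_ring g \<Longrightarrow> b \<in> monomials g \<Longrightarrow> coord (Ren p) (\<rho> b) = coord p b"
proof -
  assume p: "p \<in> poly_ring g" and b: "b \<in> monomials g"
  have "coord (Ren p) (\<rho> b) = lin (\<lambda>a. coord (bvec (\<rho> a)) (\<rho> b)) p"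
    unfolding Ren_ext[OF p] coord_ext ..
  also have "\<dots> = lin (\<lambda>a. coord (bvec a) b) p"
    unfolding lin_def
  proof (rule sum.cong[OF refl])
    fix a assume "a \<in> Poly_Mapping.keys p"
    then have "a \<in> monomials g" by (rule keys_free_space[OF p[unfolded poly_ring_def]])
    then show "coord p a * coord (bvec (\<rho> a)) (\<rho> b) = coord p a * coord (bvec a) b"
      using inj_onD[OF ren_inj _ _ b, of a] by (auto simp: lookup_single when_def)
  qed
  also have "\<dots> = coord p b" using coord_ext[of bvec p b] by (simp add: ext_id)
  finally show ?thesis .
qed

lemma Ren_eq_0: "p \<in> poly_ring g \<Longrightarrow> Ren p = 0 \<Longrightarrow> p = 0"
proof (rule poly_mapping_eqI)
  fix b assume "p \<in> poly_ring g" "Ren p = 0"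
  then show "coord p b = coord 0 b"
    using coord_Ren[of p b] by (cases "b \<in> monomials g") (auto simp: poly_ring_def free_space_iff)
qed

lemma free_space_poly_ring: "B \<subseteq> monomials g \<Longrightarrow> p \<in> free_space B \<Longrightarrow> p \<in> poly_ring g"
  unfolding poly_ring_def using free_space_mono by blast

lemma Ren_free_space:
  assumes "B \<subseteq> monomials g" "p \<in> free_space B" shows "Ren p \<in> free_space (\<rho> ` B)"
  unfolding Ren_ext[OF free_space_poly_ring[OF assms]]
  by (rule ext_mem[OF subspace_free_space]) (use keys_free_space[OF assms(2)] in simp)

lemma free_space_Ren:
  assumes B: "B \<subseteq> monomials g" and u: "u \<in> free_space (\<rho> ` B)"
  obtains w where "w \<in> free_space B" "u = Ren w"
proof -
  let ?i = "inv_into B \<rho>"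
  define w where "w = ext (\<lambda>c. bvec (?i c)) u"
  have w: "w \<in> free_space B" unfolding w_def
    by (rule ext_mem[OF subspace_free_space]) (use keys_free_space[OF u] in \<open>simp add: inv_into_into\<close>)
  have "Ren w = ext (\<lambda>c. ext (\<lambda>a. bvec (\<rho> a)) (bvec (?i c))) u"
    unfolding Ren_ext[OF free_space_poly_ring[OF B w]] unfolding w_def ext_ext ..
  also have "\<dots> = ext bvec u"
    by (rule ext_cong) (use keys_free_space[OF u] in \<open>simp add: f_inv_into_f\<close>)
  finally show ?thesis using that[OF w] by (simp add: ext_id)
qed

definition contract :: "mpoly set \<Rightarrow> mpoly set" where
  "contract I = {p\<in>poly_ring g. Ren p \<in> I}"

lemma contract_subspace: "free.subspace I \<Longrightarrow> free.subspace (contract I)"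
  by (rule free.subspaceI)
     (auto simp: contract_def Ren_add Ren_scale Ren_zero intro: free.subspace_0 free.subspace_add free.subspace_scale poly_ring_subspace)

lemma indep_mod_ren: "B \<subseteq> monomials g \<Longrightarrow> indep_mod (\<rho> ` B) I \<longleftrightarrow> indep_mod B (contract I)"
proof
  assume B: "B \<subseteq> monomials g" and i: "indep_mod (\<rho> ` B) I"
  show "indep_mod B (contract I)"
    unfolding indep_mod_def
  proof (intro ballI impI)
    fix u assume u: "u \<in> free_space B" "u \<in> contract I"
    then have "Ren u = 0" using i Ren_free_space[OF B u(1)] unfolding indep_mod_def contract_def by blast
    then show "u = 0" using Ren_eq_0 u(2) unfolding contract_def by blast
  qed
next
  assume B: "B \<subseteq> monomials g" and i: "indep_mod B (contract I)"
  show "indep_mod (\<rho> ` B) I"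
    unfolding indep_mod_def
  proof (intro ballI impI)
    fix u assume u: "u \<in> free_space (\<rho> ` B)" "u \<in> I"
    obtain w where w: "w \<in> free_space B" "u = Ren w" using free_space_Ren[OF B u(1)] .
    then have "w \<in> contract I" using u(2) free_space_poly_ring[OF B] unfolding contract_def by blast
    then have "w = 0" using i w(1) unfolding indep_mod_def by blast
    then show "u = 0" using w(2) Ren_zero by simp
  qed
qed

lemma quotient_basis_contract:
  assumes I: "free.subspace I" and B: "B \<subseteq> monomials g" "quotient_basis (monomials n) (\<rho> ` B) I"
  shows "quotient_basis (monomials g) B (contract I)"
proof (rule quotient_basisI[OF contract_subspace[OF I]])
  have rB: "\<rho> ` B \<subseteq> monomials n" using B ren_monomials by blast
  interpret q: qbasis "monomials n" "\<rho> ` B" I unfolding qbasis_def using I rB B by blast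
  show "u = 0" if "u \<in> free_space B" "u \<in> contract I" for u
    using q.indep_mod_basis indep_mod_ren[OF B(1)] that unfolding indep_mod_def by blast
  fix p assume p: "p \<in> free_space (monomials g)"
  then have pg: "p \<in> poly_ring g" by (simp add: poly_ring_def)
  then have e: "Ren p \<in> free_space (monomials n)" using Ren_poly_ring by (simp add: poly_ring_def)
  obtain w where w: "w \<in> free_space B" "res (\<rho> ` B) I (Ren p) = Ren w" using free_space_Ren[OF B(1) q.res_mem[OF e]] .
  have "p - w \<in> contract I"
    using q.res_diff[OF e] w poly_ring_diff[OF pg free_space_poly_ring[OF B(1) w(1)]]
    by (simp add: contract_def Ren_diff)
  then show "\<exists>u\<in>free_space B. p - u \<in> contract I" using w(1) by blast
qed

text \<open>The basis \<open>B0\<close> of renamed monomials shows that the small polynomial ring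
  maps onto the quotient by \<open>I\<close>. So the two quotient rings agree, and every monomial
  basis modulo the contraction gives one modulo \<open>I\<close>.\<close>

lemma quotient_basis_expand:
  assumes I: "free.subspace I" and B0: "B0 \<subseteq> monomials g" "quotient_basis (monomials n) (\<rho> ` B0) I"
    and B: "B \<subseteq> monomials g" "quotient_basis (monomials g) B (contract I)"
  shows "quotient_basis (monomials n) (\<rho> ` B) I"
proof (rule quotient_basisI[OF I])
  interpret c: qbasis "monomials g" B "contract I" unfolding qbasis_def using contract_subspace[OF I] B by blast
  have rB: "\<rho> ` B0 \<subseteq> monomials n" using B0 ren_monomials by blast
  interpret q: qbasis "monomials n" "\<rho> ` B0" I unfolding qbasis_def using I rB B0 by blast
  show "u = 0" if "u \<in> free_space (\<rho> ` B)" "u \<in> I" for u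
    using c.indep_mod_basis indep_mod_ren[OF B(1)] that unfolding indep_mod_def by blast
  fix p assume e: "p \<in> free_space (monomials n)"
  obtain w where w: "w \<in> free_space B0" "res (\<rho> ` B0) I p = Ren w" using free_space_Ren[OF B0(1) q.res_mem[OF e]] .
  have wg: "w \<in> free_space (monomials g)" using free_space_mono[OF B0(1)] w(1) by blast
  let ?w = "res B (contract I) w"
  have "Ren (w - ?w) \<in> I" using c.res_diff[OF wg] unfolding contract_def by blast
  from free.subspace_add[OF I q.res_diff[OF e] this] have "p - Ren ?w \<in> I" using w(2) by (simp add: Ren_diff)
  then show "\<exists>u\<in>free_space (\<rho> ` B). p - u \<in> I" using Ren_free_space[OF B(1) c.res_mem[OF wg]] by blast
qed

lemma residue_coord_contract:
  assumes I: "free.subspace I" and B: "B \<subseteq> monomials g" "quotient_basis (monomials n) (\<rho> ` B) I"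
    and a: "a \<in> monomials g" and b: "b \<in> monomials g"
  shows "residue_coord (\<rho> ` B) (\<rho> a) (\<rho> b) I = residue_coord B a b (contract I)"
proof -
  interpret c: qbasis "monomials g" B "contract I"
    unfolding qbasis_def using contract_subspace[OF I] quotient_basis_contract[OF I B] B by blast
  have rB: "\<rho> ` B \<subseteq> monomials n" using B ren_monomials by blast
  interpret q: qbasis "monomials n" "\<rho> ` B" I unfolding qbasis_def using I rB B by blast
  have e: "bvec a \<in> free_space (monomials g)" using a by simp
  let ?w = "res B (contract I) (bvec a)"
  have "Ren (bvec a - ?w) \<in> I" using c.res_diff[OF e] unfolding contract_def by blast
  then have "res (\<rho> ` B) I (bvec (\<rho> a)) = Ren ?w"
    using Ren_free_space[OF B(1) c.res_mem[OF e]] ren_monomials[OF a]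
    by (intro q.res_eqI) (auto simp: Ren_diff Ren_bvec[OF a])
  then show ?thesis
    unfolding residue_coord_res using coord_Ren[OF free_space_poly_ring[OF B(1) c.res_mem[OF e]] b] by simp
qed

lemma punctual_ideal_contract:
  assumes I: "punctual_ideal d n I" and B: "B \<subseteq> monomials g" "quotient_basis (monomials n) (\<rho> ` B) I"
  shows "punctual_ideal d g (contract I)"
  unfolding punctual_ideal_def
proof (intro conjI allI ballI impI)
  note sI = punctual_ideal_subspace[OF I]
  show "free.subspace (contract I)" by (rule contract_subspace[OF sI])
  show "contract I \<subseteq> poly_ring g" unfolding contract_def by blast
  show "X i * p \<in> contract I" if "i < g" "p \<in> contract I" for i p
    using that punctual_ideal_X[OF I sigma(2)] poly_ring_mult unfolding contract_def by (auto simp: Ren_mult Ren_X)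
  show "bvec a \<in> contract I" if "a \<in> monomials g" "d \<le> deg a" for a
    using that punctual_ideal_deg[OF I ren_monomials] unfolding contract_def
    by (simp add: Ren_bvec deg_ren poly_ring_def)
  have rB: "\<rho> ` B \<subseteq> monomials n" using B ren_monomials by blast
  have inj: "inj_on \<rho> B" using inj_on_subset[OF ren_inj B(1)] .
  have "finite B" "card B = d"
    using punctual_ideal_basis[OF I rB B(2)] finite_imageD[OF _ inj] card_image[OF inj] by auto
  then show "\<exists>J\<subseteq>monomials g. finite J \<and> card J = d \<and> quotient_basis (monomials g) J (contract I)"
    using quotient_basis_contract[OF sI B] B(1) by blast
qed

end

text \<open>An epimorphism onto the smaller polynomial ring that splits \<open>Ren\<close>.\<close>

locale retraction = renaming +
  fixes h :: "nat \<Rightarrow> mpoly"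
  assumes h_sigma: "\<And>i. i < g \<Longrightarrow> h (\<sigma> i) = X i"
    and h_graded: "\<And>k. k < n \<Longrightarrow> h k \<in> free_space {b\<in>monomials g. 1 \<le> deg b}"
begin

lemma h_poly_ring: "k < n \<Longrightarrow> h k \<in> poly_ring g"
  using h_graded free_space_mono[of "{b\<in>monomials g. 1 \<le> deg b}" "monomials g"] unfolding poly_ring_def by blast

lemma subst_h_poly_ring: "p \<in> poly_ring n \<Longrightarrow> subst h p \<in> poly_ring g"
  by (rule subst_poly_ring[OF h_poly_ring])

lemma subst_Ren: "p \<in> poly_ring g \<Longrightarrow> subst h (Ren p) = p"
proof -
  assume p: "p \<in> poly_ring g"
  have mon: "mono h (\<rho> a) = bvec a" if "a \<in> monomials g" for a
    using that
  proof (induction a rule: monomial_induct)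
    case (step i b)
    then show ?case by (simp only: ren_add ren_var mono_add mono_var h_sigma bvec_mult)
  qed simp
  have "subst h (Ren p) = ext (\<lambda>a. mono h (\<rho> a)) p"
    unfolding Ren_ext[OF p] subst_def ext_ext by simp
  also have "\<dots> = ext bvec p"
    by (rule ext_cong, rule mon, rule keys_free_space[OF p[unfolded poly_ring_def]])
  finally show ?thesis by (simp add: ext_id)
qed

text \<open>Replacing variables by congruent polynomials does not change the class modulo
  \<open>I\<close>. For monomials this follows one factor at a time, by telescoping the difference
  of two products.\<close>

lemma diff_Ren_subst:
  assumes I: "punctual_ideal d n I" and hI: "\<And>k. k < n \<Longrightarrow> X k - Ren (h k) \<in> I" and p: "p \<in> poly_ring n"
  shows "p - Ren (subst h p) \<in> I"
proof -
  note sI = punctual_ideal_subspace[OF I]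
  have mon: "bvec a - Ren (mono h a) \<in> I" if "a \<in> monomials n" for a
    using that
  proof (induction a rule: monomial_induct)
    case zero
    have "Ren 1 = 1" using Ren_bvec[of 0] by simp
    then show ?case using free.subspace_0[OF sI] by simp
  next
    case (step k b)
    have R: "Ren (mono h b) \<in> poly_ring n" by (rule Ren_poly_ring[OF mono_poly_ring[OF h_poly_ring step(2)]])
    have "bvec (var k + b) - Ren (mono h (var k + b)) = X k * (bvec b - Ren (mono h b)) + Ren (mono h b) * (X k - Ren (h k))"
      by (simp add: mono_add Ren_mult bvec_mult[symmetric] algebra_simps)
    also have "\<dots> \<in> I"
      by (rule free.subspace_add[OF sI punctual_ideal_X[OF I step(1,3)] punctual_ideal_mult[OF I R hI[OF step(1)]]])
    finally show ?case .
  qed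
  have pf: "p \<in> free_space (monomials n)" using p by (simp add: poly_ring_def)
  have "ext (\<lambda>a. bvec a - Ren (mono h a)) p \<in> I"
    by (rule ext_mem[OF sI]) (use mon keys_free_space[OF pf] in blast)
  moreover have "ext (\<lambda>a. bvec a - Ren (mono h a)) p = p - Ren (subst h p)"
  proof -
    have "Ren (subst h p) = ext (\<lambda>a. Ren (mono h a)) p"
      unfolding Ren_def subst_def[of "\<lambda>i. X (\<sigma> i)"] subst_def[of h] ext_ext ..
    then show ?thesis using ext_id[of p] by (simp add: ext_def free.scale_right_diff_distrib sum_subtractf)
  qed
  ultimately show ?thesis by simp
qed

text \<open>This recovers \<open>I\<close> from \<open>h\<close> and the contraction, which makes
  the parametrisation of a cell injective.\<close>

lemma mem_iff_contract:
  assumes I: "punctual_ideal d n I" and hI: "\<And>k. k < n \<Longrightarrow> X k - Ren (h k) \<in> I" and p: "p \<in> poly_ring n"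
  shows "p \<in> I \<longleftrightarrow> subst h p \<in> contract I"
proof -
  note sI = punctual_ideal_subspace[OF I]
  note d = diff_Ren_subst[OF I hI p]
  have "p \<in> I \<longleftrightarrow> Ren (subst h p) \<in> I"
    using free.subspace_diff[OF sI _ d] free.subspace_add[OF sI d] by fastforce
  then show ?thesis using subst_h_poly_ring[OF p] unfolding contract_def by simp
qed

lemma res_Ren:
  assumes I: "punctual_ideal d n I" and hI: "\<And>k. k < n \<Longrightarrow> X k - Ren (h k) \<in> I" and p: "p \<in> poly_ring n"
    and B: "B \<subseteq> monomials g" "quotient_basis (monomials n) (\<rho> ` B) I"
  shows "res (\<rho> ` B) I p = Ren (res B (contract I) (subst h p))"
proof -
  note sI = punctual_ideal_subspace[OF I]
  interpret c: qbasis "monomials g" B "contract I"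
    unfolding qbasis_def using contract_subspace[OF sI] quotient_basis_contract[OF sI B] B by blast
  have rB: "\<rho> ` B \<subseteq> monomials n" using B ren_monomials by blast
  interpret q: qbasis "monomials n" "\<rho> ` B" I unfolding qbasis_def using sI rB B by blast
  have e: "subst h p \<in> free_space (monomials g)" using subst_h_poly_ring[OF p] by (simp add: poly_ring_def)
  show ?thesis
  proof (rule q.res_eqI)
    show "p \<in> free_space (monomials n)" using p by (simp add: poly_ring_def)
    show "Ren (res B (contract I) (subst h p)) \<in> free_space (\<rho> ` B)" by (rule Ren_free_space[OF B(1) c.res_mem[OF e]])
    have "Ren (subst h p - res B (contract I) (subst h p)) \<in> I" using c.res_diff[OF e] unfolding contract_def by blast
    from free.subspace_add[OF sI diff_Ren_subst[OF I hI p] this]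
    show "p - Ren (res B (contract I) (subst h p)) \<in> I" by (simp add: Ren_diff)
  qed
qed

text \<open>For fixed \<open>h\<close> this is the inverse construction to \<open>contract\<close>:
  it produces the ideal with prescribed \<open>h\<close> and prescribed contraction.\<close>

definition pullback :: "mpoly set \<Rightarrow> mpoly set" where
  "pullback I = {p\<in>poly_ring n. subst h p \<in> I}"

lemma pullback_subspace: "free.subspace I \<Longrightarrow> free.subspace (pullback I)"
  by (rule free.subspaceI)
     (auto simp: pullback_def subst_add subst_scale intro: free.subspace_0 free.subspace_add free.subspace_scale poly_ring_subspace)

lemma contract_pullback: "I \<subseteq> poly_ring g \<Longrightarrow> contract (pullback I) = I"
  unfolding contract_def pullback_def using subst_Ren Ren_poly_ring by auto

lemma pullback_h: "free.subspace I \<Longrightarrow> k < n \<Longrightarrow> X k - Ren (h k) \<in> pullback I"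
  unfolding pullback_def using Ren_poly_ring[OF h_poly_ring] subst_Ren[OF h_poly_ring]
  by (auto simp: subst_diff subst_X free.subspace_0 intro: poly_ring_diff)

lemma quotient_basis_pullback:
  assumes I: "free.subspace I" "I \<subseteq> poly_ring g" and B: "B \<subseteq> monomials g" "quotient_basis (monomials g) B I"
  shows "quotient_basis (monomials n) (\<rho> ` B) (pullback I)"
proof (rule quotient_basisI[OF pullback_subspace[OF I(1)]])
  interpret c: qbasis "monomials g" B I unfolding qbasis_def using I B by blast
  show "u = 0" if "u \<in> free_space (\<rho> ` B)" "u \<in> pullback I" for u
    using c.indep_mod_basis indep_mod_ren[OF B(1), of "pullback I"] that
    unfolding contract_pullback[OF I(2)] indep_mod_def by blast
  fix p assume "p \<in> free_space (monomials n)"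
  then have p: "p \<in> poly_ring n" by (simp add: poly_ring_def)
  have e: "subst h p \<in> free_space (monomials g)" using subst_h_poly_ring[OF p] by (simp add: poly_ring_def)
  let ?w = "res B I (subst h p)"
  have wg: "?w \<in> poly_ring g" by (rule free_space_poly_ring[OF B(1) c.res_mem[OF e]])
  have "p - Ren ?w \<in> pullback I"
    using c.res_diff[OF e] poly_ring_diff[OF p Ren_poly_ring[OF wg]] subst_Ren[OF wg]
    by (simp add: pullback_def subst_diff)
  then show "\<exists>u\<in>free_space (\<rho> ` B). p - u \<in> pullback I" using Ren_free_space[OF B(1) c.res_mem[OF e]] by blast
qed

lemma punctual_ideal_pullback:
  assumes I: "punctual_ideal d g I" and B: "B \<subseteq> monomials g" "quotient_basis (monomials g) B I"
  shows "punctual_ideal d n (pullback I)"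
  unfolding punctual_ideal_def
proof (intro conjI allI ballI impI)
  note sI = punctual_ideal_subspace[OF I]
  have IR: "I \<subseteq> poly_ring g" using I unfolding punctual_ideal_def by blast
  show "free.subspace (pullback I)" by (rule pullback_subspace[OF sI])
  show "pullback I \<subseteq> poly_ring n" unfolding pullback_def by blast
  show "X i * p \<in> pullback I" if "i < n" "p \<in> pullback I" for i p
    using that punctual_ideal_mult[OF I h_poly_ring] poly_ring_mult[of "X i" n p]
    unfolding pullback_def by (auto simp: subst_mult subst_X)
  show "bvec a \<in> pullback I" if a: "a \<in> monomials n" "d \<le> deg a" for a
  proof -
    have "ext bvec (mono h a) \<in> I"
    proof (rule ext_mem[OF sI])
      fix b assume "b \<in> Poly_Mapping.keys (mono h a)"
      then have "b \<in> monomials g" "deg a \<le> deg b" using keys_free_space[OF mono_graded[OF h_graded a(1)]] by auto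
      then show "bvec b \<in> I" using punctual_ideal_deg[OF I] a(2) by auto
    qed
    then show ?thesis using a(1) unfolding pullback_def by (simp add: ext_id subst_bvec poly_ring_def)
  qed
  have rB: "\<rho> ` B \<subseteq> monomials n" using B ren_monomials by blast
  have inj: "inj_on \<rho> B" using inj_on_subset[OF ren_inj B(1)] .
  show "\<exists>J\<subseteq>monomials n. finite J \<and> card J = d \<and> quotient_basis (monomials n) J (pullback I)"
    using quotient_basis_pullback[OF sI IR B] rB punctual_ideal_basis[OF I B] card_image[OF inj]
    by (intro exI[of _ "\<rho> ` B"]) auto
qed

end

section \<open>Strata of the punctual Hilbert scheme\<close>

text \<open>Adapted to the filtration of the local quotient ring: 1, a basis of the cotangent space,
  and a part in the square of the maximal ideal.\<close>

definition std_basis :: "nat \<Rightarrow> (nat \<Rightarrow>\<^sub>0 nat) set \<Rightarrow> (nat \<Rightarrow>\<^sub>0 nat) set" where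
  "std_basis g J = insert 0 (var ` {..<g} \<union> J)"

text \<open>The size makes \<open>std_basis g J\<close> have \<open>d\<close> elements. Degrees stay
  below \<open>d\<close> because higher monomials lie in every punctual ideal, and this leaves
  finitely many candidates.\<close>

definition candidates :: "nat \<Rightarrow> nat \<Rightarrow> (nat \<Rightarrow>\<^sub>0 nat) set set" where
  "candidates d g = {J. J \<subseteq> {b\<in>monomials g. 2 \<le> deg b \<and> deg b < d} \<and> card J + g + 1 = d}"

lemma finite_candidates: "finite (candidates d g)"
proof (rule finite_subset)
  show "candidates d g \<subseteq> Pow {b\<in>monomials g. deg b < d}" unfolding candidates_def by auto
qed (simp add: finite_monomials_deg)

text \<open>An arbitrary numbering. It singles out a first candidate among those that give a basis,
  which keeps strata with the same \<open>A\<close> disjoint.\<close>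

definition set_key :: "nat \<Rightarrow> nat \<Rightarrow> (nat \<Rightarrow>\<^sub>0 nat) set \<Rightarrow> nat" where
  "set_key d g = (SOME e. inj_on e (candidates d g))"

lemma inj_set_key: "inj_on (set_key d g) (candidates d g)"
  unfolding set_key_def using finite_imp_inj_to_nat_seg[OF finite_candidates] by (metis (mono_tags, lifting) someI_ex)

lemma var_inj: "var i = var j \<longleftrightarrow> i = j"
  by (metis monomials_def var_def keys_single one_neq_zero singleton_inject)

lemma var_nonzero [simp]: "var i \<noteq> 0"
proof
  assume "var i = 0"
  then have "deg (var i) = deg 0" by (rule arg_cong)
  then show False by simp
qed

lemma candidates_finite: "J \<in> candidates d g \<Longrightarrow> finite J"
  unfolding candidates_def by (auto intro: finite_subset[OF _ finite_monomials_deg[of g d]])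

lemma candidates_monomials: "J \<in> candidates d g \<Longrightarrow> b \<in> J \<Longrightarrow> b \<in> monomials g \<and> 2 \<le> deg b \<and> deg b < d"
  unfolding candidates_def by auto

lemma std_basis_monomials: "J \<in> candidates d g \<Longrightarrow> std_basis g J \<subseteq> monomials g"
  unfolding std_basis_def using candidates_monomials by auto

lemma card_std_basis_aux:
  assumes "finite J" "\<And>b. b \<in> J \<Longrightarrow> 2 \<le> deg b"
  shows "card (std_basis g J) = card J + g + 1"
proof -
  have "card (var ` {..<g}) = g" by (subst card_image) (auto simp: inj_on_def var_inj)
  moreover have "var ` {..<g} \<inter> J = {}" using assms(2) by fastforce
  ultimately have "card (var ` {..<g} \<union> J) = g + card J" using assms(1) by (subst card_Un_disjoint) auto
  moreover have "0 \<notin> var ` {..<g} \<union> J" using assms(2)[of 0] by (auto dest: sym)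
  ultimately show ?thesis unfolding std_basis_def using assms(1) by simp
qed

lemma card_std_basis: "J \<in> candidates d g \<Longrightarrow> card (std_basis g J) = d"
proof -
  assume J: "J \<in> candidates d g"
  have "card (std_basis g J) = card J + g + 1"
    by (rule card_std_basis_aux[OF candidates_finite[OF J]]) (use candidates_monomials[OF J] in blast)
  then show ?thesis using J unfolding candidates_def by simp
qed

lemma std_basis_deg: "J \<in> candidates d g \<Longrightarrow> b \<in> std_basis g J \<Longrightarrow> deg b < d"
proof -
  assume J: "J \<in> candidates d g" and "b \<in> std_basis g J"
  then consider "b = 0" | i where "i < g" "b = var i" | "b \<in> J" unfolding std_basis_def by blast
  moreover have "card J + g + 1 = d" using J unfolding candidates_def by blast
  ultimately show ?thesis using candidates_monomials[OF J, of b] by cases auto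
qed

lemma finite_std_basis: "J \<in> candidates d g \<Longrightarrow> finite (std_basis g J)"
  unfolding std_basis_def using candidates_finite by auto

text \<open>The residue class of a monomial of degree \<open>k\<close> involves no basis elements of degree below
  \<open>min k 2\<close>: thus \<open>J\<close> spans the square of the maximal ideal of the quotient ring, and the
  variables in the basis are a basis of the cotangent space.\<close>

definition graded_residues ::
  "nat \<Rightarrow> nat \<Rightarrow> ((nat \<Rightarrow>\<^sub>0 nat) \<Rightarrow> (nat \<Rightarrow>\<^sub>0 nat)) \<Rightarrow> (nat \<Rightarrow>\<^sub>0 nat) set \<Rightarrow> mpoly set \<Rightarrow> bool" where
  "graded_residues n g \<rho> J I \<longleftrightarrow> (\<forall>a\<in>monomials n. \<forall>b\<in>std_basis g J. deg b < 2 \<longrightarrow> deg b < deg a \<longrightarrow>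
     residue_coord (\<rho> ` std_basis g J) a (\<rho> b) I = 0)"

text \<open>The ideals whose cotangent space has the full dimension \<open>g\<close>.\<close>

definition core :: "nat \<Rightarrow> nat \<Rightarrow> (nat \<Rightarrow>\<^sub>0 nat) set \<Rightarrow> mpoly set set" where
  "core d g J = {I\<in>hdom d g (std_basis g J). graded_residues g g (\<lambda>a. a) J I \<and>
     (\<forall>J'\<in>candidates d g. set_key d g J' < set_key d g J \<longrightarrow> \<not> quotient_basis (monomials g) (std_basis g J') I)}"

text \<open>The ideals such that \<open>A\<close> is the greedy basis of the cotangent space and \<open>J\<close> the first
  candidate that completes it.\<close>

definition cell :: "nat \<Rightarrow> nat \<Rightarrow> nat \<Rightarrow> nat set \<Rightarrow> (nat \<Rightarrow> nat) \<Rightarrow> (nat \<Rightarrow>\<^sub>0 nat) set \<Rightarrow> mpoly set set" where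
  "cell d n g A \<sigma> J = {I\<in>hdom d n (ren \<sigma> ` std_basis g J). graded_residues n g (ren \<sigma>) J I \<and>
     (\<forall>j<n. j \<notin> A \<longrightarrow> (\<forall>i<g. j < \<sigma> i \<longrightarrow> residue_coord (ren \<sigma> ` std_basis g J) (var j) (var (\<sigma> i)) I = 0)) \<and>
     (\<forall>J'\<in>candidates d g. set_key d g J' < set_key d g J \<longrightarrow> \<not> quotient_basis (monomials n) (ren \<sigma> ` std_basis g J') I)}"

text \<open>The core is closed in its chart: outside it some residue coordinate is nonzero, or the
  ideal lies in the chart of an earlier candidate, and both conditions are open.\<close>

lemma affine_core:
  assumes J: "J \<in> candidates d g"
  shows "affine_chart (core d g J) (hcrd g (std_basis g J))"
proof -
  let ?B = "std_basis g J"
  have "affine_chart (hdom d g ?B \<inter> core d g J) (hcrd g ?B)"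
  proof (rule affine_chart_closed_subset[OF affine_hdom])
    show "?B \<subseteq> monomials g" "card ?B = d" using std_basis_monomials[OF J] card_std_basis[OF J] by auto
    show "deg b < d" if "b \<in> ?B" for b using std_basis_deg[OF J that] .
    fix I assume I: "I \<in> hdom d g ?B" "I \<notin> core d g J"
    then consider a b where "a \<in> monomials g" "b \<in> ?B" "deg b < 2" "deg b < deg a" "residue_coord ?B a b I \<noteq> 0"
      | J' where "J' \<in> candidates d g" "set_key d g J' < set_key d g J" "quotient_basis (monomials g) (std_basis g J') I"
      unfolding core_def graded_residues_def image_ident by blast
    then show "near (hdom d g ?B) (hcrd g ?B) I (\<lambda>y. y \<notin> core d g J)"
    proof cases
      case 1
      show ?thesis
        by (rule near_mono[OF near_nonzero[OF hilb.crd_gen[OF 1(1,2)] 1(5)]])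
           (use 1 in \<open>auto simp: core_def graded_residues_def image_ident\<close>)
    next
      case 2
      have "I \<in> hdom d g (std_basis g J')" using I(1) 2(3) unfolding hdom_iff by blast
      then have "hilb.adjacent g d I ?B (std_basis g J')"
        using hilb.adjacent_any[OF I(1) std_basis_monomials[OF J] _ std_basis_monomials[OF 2(1)]] by blast
      then have "near (hdom d g ?B) (hcrd g ?B) I (\<lambda>y. y \<in> hdom d g (std_basis g J'))"
        unfolding hilb.adjacent_def by blast
      then show ?thesis
        by (rule near_mono) (use 2 in \<open>auto simp: core_def hdom_iff\<close>)
    qed
  qed
  moreover have "hdom d g ?B \<inter> core d g J = core d g J" unfolding core_def by blast
  ultimately show ?thesis by simp
qed

text \<open>A family of polynomials with coefficients polynomial in \<open>G\<close>. The common
  finite support turns a linear functional applied to the family into a finite sum, uniformly in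
  \<open>t\<close>.\<close>

definition polyfun :: "nat \<Rightarrow> 'a set \<Rightarrow> ('a \<Rightarrow> complex) set \<Rightarrow> ('a \<Rightarrow> mpoly) \<Rightarrow> bool" where
  "polyfun g T G F \<longleftrightarrow> (\<exists>S. finite S \<and> S \<subseteq> monomials g \<and> (\<forall>t\<in>T. F t \<in> free_space S) \<and>
     (\<forall>m. \<exists>p\<in>subalgebra G. \<forall>t\<in>T. coord (F t) m = p t))"

lemma polyfun_const: "a \<in> monomials g \<Longrightarrow> polyfun g T G (\<lambda>_. bvec a)"
  unfolding polyfun_def by (rule exI[of _ "{a}"]) (auto intro: subalgebra.const)

lemma polyfun_mult:
  assumes "polyfun g T G F" "polyfun g T G F'" shows "polyfun g T G (\<lambda>t. F t * F' t)"
proof -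
  obtain S where S: "finite S" "S \<subseteq> monomials g" "\<And>t. t \<in> T \<Longrightarrow> F t \<in> free_space S"
    "\<And>m. \<exists>p\<in>subalgebra G. \<forall>t\<in>T. coord (F t) m = p t" using assms(1) unfolding polyfun_def by blast
  obtain S' where S': "finite S'" "S' \<subseteq> monomials g" "\<And>t. t \<in> T \<Longrightarrow> F' t \<in> free_space S'"
    "\<And>m. \<exists>p\<in>subalgebra G. \<forall>t\<in>T. coord (F' t) m = p t" using assms(2) unfolding polyfun_def by blast
  obtain p where p: "\<And>m. p m \<in> subalgebra G" "\<And>m t. t \<in> T \<Longrightarrow> coord (F t) m = p m t" using S(4) by metis
  obtain q where q: "\<And>m. q m \<in> subalgebra G" "\<And>m t. t \<in> T \<Longrightarrow> coord (F' t) m = q m t" using S'(4) by metis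
  let ?S = "(\<lambda>(s, s'). s + s') ` (S \<times> S')"
  have "coord (F t * F' t) m = (\<Sum>s\<in>S. p s t * (\<Sum>s'\<in>S'. q s' t * coord (bvec (s' + s)) m))" if t: "t \<in> T" for t m
  proof -
    have k: "Poly_Mapping.keys (F t) \<subseteq> S" "Poly_Mapping.keys (F' t) \<subseteq> S'"
      using S(3)[OF t] S'(3)[OF t] unfolding free_space_def by auto
    have "coord (bvec s * F' t) m = (\<Sum>s'\<in>S'. q s' t * coord (bvec (s' + s)) m)" for s
    proof -
      have "bvec s * F' t = ext (\<lambda>s'. bvec s' * bvec s) (F' t)" using mult_eq_ext[of "F' t" "bvec s"] by (simp only: mult.commute)
      then show ?thesis by (simp only: coord_ext lin_superset[OF S'(1) k(2)] bvec_mult q(2)[OF t])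
    qed
    then show ?thesis by (simp only: mult_eq_ext[of "F t"] coord_ext lin_superset[OF S(1) k(1)] p(2)[OF t])
  qed
  moreover have "(\<lambda>t. \<Sum>s\<in>S. p s t * (\<Sum>s'\<in>S'. q s' t * coord (bvec (s' + s)) m)) \<in> subalgebra G" for m
    by (intro subalgebra_sum subalgebra.mult subalgebra.const p q)
  ultimately have "\<exists>p\<in>subalgebra G. \<forall>t\<in>T. coord (F t * F' t) m = p t" for m
    by (intro bexI[of _ "\<lambda>t. \<Sum>s\<in>S. p s t * (\<Sum>s'\<in>S'. q s' t * coord (bvec (s' + s)) m)"]) simp_all
  moreover have "F t * F' t \<in> free_space ?S" if "t \<in> T" for t
    by (rule free_space_mult[OF S(3)[OF that] S'(3)[OF that]]) auto
  moreover have "finite ?S" "?S \<subseteq> monomials g" using S S' by (auto intro: add_monomials)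
  ultimately show ?thesis unfolding polyfun_def by blast
qed

section \<open>Cells as trivial bundles over cores\<close>

locale cell_chart = renaming +
  fixes d :: nat and J :: "(nat \<Rightarrow>\<^sub>0 nat) set"
  assumes J: "J \<in> candidates d g"
begin

abbreviation "B \<equiv> std_basis g J"
abbreviation "T \<equiv> cell d n g A \<sigma> J"

text \<open>The free coefficients of \<open>h\<close> at a variable outside \<open>A\<close>: all
  those along \<open>J\<close>, but along a variable of \<open>A\<close> only if it comes earlier,
  because \<open>A\<close> is greedy.\<close>

definition fiber :: "(nat \<times> (nat \<Rightarrow>\<^sub>0 nat)) set" where
  "fiber = {(k, b). k < n \<and> k \<notin> A \<and> (b \<in> J \<or> (\<exists>i<g. b = var i \<and> \<sigma> i < k))}"

text \<open>The retraction with coefficient table \<open>c\<close>. The basis element 1 is left out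
  since variables lie in the maximal ideal, and on \<open>A\<close> the renaming is undone.\<close>

definition hmap :: "(nat \<Rightarrow> (nat \<Rightarrow>\<^sub>0 nat) \<Rightarrow> complex) \<Rightarrow> nat \<Rightarrow> mpoly" where
  "hmap c k = (if k \<in> A then X (inv_into {..<g} \<sigma> k) else if k < n then \<Sum>b\<in>B - {0}. scale (c k b) (bvec b) else 0)"

lemma BM: "B \<subseteq> monomials g" and finB: "finite B"
  using std_basis_monomials[OF J] finite_std_basis[OF J] by auto

lemma rB: "\<rho> ` B \<subseteq> monomials n"
  using BM ren_monomials by blast

lemma hmap_sigma: "i < g \<Longrightarrow> hmap c (\<sigma> i) = X i"
  using sigma(1) inv_into_f_f[of \<sigma> "{..<g}" i] bij unfolding hmap_def bij_betw_def by simp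

lemma hmap_mem: "k < n \<Longrightarrow> hmap c k \<in> free_space (B - {0})"
proof -
  have X: "X (inv_into {..<g} \<sigma> k) \<in> free_space (B - {0})" if "k \<in> A"
  proof -
    have "inv_into {..<g} \<sigma> k \<in> {..<g}" using that bij inv_into_into unfolding bij_betw_def by metis
    moreover have "var i \<noteq> 0" for i using deg_var[of i] by (metis deg_zero one_neq_zero)
    ultimately show ?thesis by (simp add: std_basis_def)
  qed
  show ?thesis unfolding hmap_def
    using X free.subspace_0[OF subspace_free_space]
    by (auto intro!: free.subspace_sum[OF subspace_free_space] free.subspace_scale[OF subspace_free_space])
qed

lemma hmap_free_B: "k < n \<Longrightarrow> hmap c k \<in> free_space B"
  using hmap_mem free_space_mono[of "B - {0}" B] by blast

lemma coord_hmap: "k < n \<Longrightarrow> k \<notin> A \<Longrightarrow> coord (hmap c k) b = (if b \<in> B - {0} then c k b else 0)"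
  using finB by (simp add: hmap_def coord_sum lookup_single when_def if_distrib cong: if_cong)

lemma retraction_hmap: "retraction n g A \<sigma> (hmap c)"
proof
  show "hmap c (\<sigma> i) = X i" if "i < g" for i using hmap_sigma[OF that] .
  fix k assume "k < n"
  moreover have "B - {0} \<subseteq> {b\<in>monomials g. 1 \<le> deg b}"
    using BM deg_eq_0_iff by (auto simp: Suc_le_eq)
  ultimately show "hmap c k \<in> free_space {b\<in>monomials g. 1 \<le> deg b}"
    using hmap_mem free_space_mono by blast
qed

definition rc :: "mpoly set \<Rightarrow> nat \<Rightarrow> (nat \<Rightarrow>\<^sub>0 nat) \<Rightarrow> complex" where
  "rc I k b = residue_coord (\<rho> ` B) (var k) (\<rho> b) I"

lemma cellD:
  assumes "I \<in> T"
  shows "I \<in> hdom d n (\<rho> ` B)" "punctual_ideal d n I" "quotient_basis (monomials n) (\<rho> ` B) I" "graded_residues n g \<rho> J I"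
    "\<And>j i. j < n \<Longrightarrow> j \<notin> A \<Longrightarrow> i < g \<Longrightarrow> j < \<sigma> i \<Longrightarrow> rc I j (var i) = 0"
    "\<And>J'. J' \<in> candidates d g \<Longrightarrow> set_key d g J' < set_key d g J \<Longrightarrow> \<not> quotient_basis (monomials n) (\<rho> ` std_basis g J') I"
  using assms unfolding cell_def hdom_iff rc_def by auto

text \<open>The normal form of a variable comes from the small ring. Its constant term vanishes by
  \<open>graded_residues\<close>, so it has the shape of \<open>hmap\<close> with the residue
  coordinates as table.\<close>

lemma X_minus_hmap:
  assumes I: "I \<in> T" and k: "k < n" shows "X k - Ren (hmap (rc I) k) \<in> I"
proof -
  note sI = punctual_ideal_subspace[OF cellD(2)[OF I]]
  interpret q: qbasis "monomials n" "\<rho> ` B" I unfolding qbasis_def using sI rB cellD(3)[OF I] by blast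
  show ?thesis
  proof (cases "k \<in> A")
    case True
    then obtain i where "i < g" "k = \<sigma> i" using sigma_surj by blast
    then show ?thesis using free.subspace_0[OF sI] by (simp add: hmap_sigma Ren_X)
  next
    case False
    have e: "X k \<in> free_space (monomials n)" using k by simp
    obtain w where w: "w \<in> free_space B" "res (\<rho> ` B) I (X k) = Ren w" using free_space_Ren[OF BM q.res_mem[OF e]] .
    have wc: "coord w b = rc I k b" if "b \<in> B" for b
      using coord_Ren[OF free_space_poly_ring[OF BM w(1)], of b] that BM w(2) unfolding rc_def residue_coord_res by auto
    have "0 \<in> B" "rc I k 0 = 0"
      using cellD(4)[OF I] k unfolding graded_residues_def rc_def by (auto simp: std_basis_def)
    then have "w = hmap (rc I) k"
      using w(1) wc by (intro poly_mapping_eqI) (auto simp: coord_hmap[OF k False] free_space_iff)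
    then show ?thesis using q.res_diff[OF e] w(2) by simp
  qed
qed

lemma contract_core:
  assumes I: "I \<in> T" shows "contract I \<in> core d g J"
proof -
  note c = cellD[OF I]
  note sI = punctual_ideal_subspace[OF c(2)]
  have "graded_residues g g (\<lambda>a. a) J (contract I)"
    unfolding graded_residues_def image_ident
  proof (intro ballI impI)
    fix a b assume ab: "a \<in> monomials g" "b \<in> B" "deg b < 2" "deg b < deg a"
    then have "residue_coord (\<rho> ` B) (\<rho> a) (\<rho> b) I = 0"
      using c(4) ren_monomials[OF ab(1)] deg_ren[OF ab(1)] unfolding graded_residues_def by simp
    then show "residue_coord B a b (contract I) = 0"
      using residue_coord_contract[OF sI BM c(3) ab(1)] ab(2) BM by auto
  qed
  moreover have "\<not> quotient_basis (monomials g) (std_basis g J') (contract I)"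
    if "J' \<in> candidates d g" "set_key d g J' < set_key d g J" for J'
    using quotient_basis_expand[OF sI BM c(3) std_basis_monomials[OF that(1)]] c(6)[OF that] by blast
  ultimately show ?thesis
    unfolding core_def hdom_iff
    using punctual_ideal_contract[OF c(2) BM c(3)] quotient_basis_contract[OF sI BM c(3)] by blast
qed

text \<open>Off the fibre the coefficients of both ideals are zero, so they have the same
  retraction, and \<open>mem_iff_contract\<close> compares them through their contractions.\<close>

lemma cell_eqI:
  assumes I: "I \<in> T" "I' \<in> T" and eq: "contract I = contract I'"
    and rc: "\<And>k b. (k, b) \<in> fiber \<Longrightarrow> rc I k b = rc I' k b"
  shows "I = I'"
proof -
  have "rc I k b = rc I' k b" if k: "k < n" "k \<notin> A" "b \<in> B - {0}" for k b
  proof (cases "(k, b) \<in> fiber")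
    case True then show ?thesis by (rule rc)
  next
    case False
    then obtain i where i: "i < g" "b = var i" "\<not> \<sigma> i < k" using k unfolding fiber_def std_basis_def by auto
    then have "k < \<sigma> i" using sigma(1)[OF i(1)] k by (metis linorder_neqE_nat)
    then show ?thesis using cellD(5)[OF I(1) k(1,2) i(1)] cellD(5)[OF I(2) k(1,2) i(1)] i(2) by simp
  qed
  then have h: "hmap (rc I) = hmap (rc I')" by (auto simp: fun_eq_iff hmap_def)
  interpret r: retraction n g A \<sigma> "hmap (rc I)" by (rule retraction_hmap)
  have "p \<in> I \<longleftrightarrow> p \<in> I'" if "p \<in> poly_ring n" for p
    using r.mem_iff_contract[OF cellD(2)[OF I(1)] X_minus_hmap[OF I(1)] that]
      r.mem_iff_contract[OF cellD(2)[OF I(2)] X_minus_hmap[OF I(2), folded h] that] eq by simp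
  then show ?thesis
    using cellD(2)[OF I(1)] cellD(2)[OF I(2)] unfolding punctual_ideal_def by blast
qed

text \<open>Surjectivity of the parametrisation, with table entries off the fibre set to zero.
  Normal forms modulo the pullback are those of substituted monomials modulo \<open>I\<close>, so
  the conditions of a cell follow from those of the core and from the shape of
  \<open>h\<close>.\<close>

lemma core_pullback:
  fixes w :: "nat \<times> (nat \<Rightarrow>\<^sub>0 nat) \<Rightarrow> complex"
  assumes I: "I \<in> core d g J"
  defines "h \<equiv> hmap (\<lambda>k b. if (k, b) \<in> fiber then w (k, b) else 0)"
  shows "\<exists>I'\<in>T. contract I' = I \<and> (\<forall>(k, b)\<in>fiber. rc I' k b = w (k, b))"
proof -
  interpret r: retraction n g A \<sigma> h unfolding h_def by (rule retraction_hmap)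
  have pI: "punctual_ideal d g I" and qb: "quotient_basis (monomials g) B I" and gr: "graded_residues g g (\<lambda>a. a) J I"
    using I unfolding core_def hdom_iff by auto
  note sI = punctual_ideal_subspace[OF pI]
  have IR: "I \<subseteq> poly_ring g" using pI unfolding punctual_ideal_def by blast
  interpret c: qbasis "monomials g" B I unfolding qbasis_def using sI BM qb by blast
  let ?I = "r.pullback I"
  have ct: "contract ?I = I" by (rule r.contract_pullback[OF IR])
  have pI': "punctual_ideal d n ?I" by (rule r.punctual_ideal_pullback[OF pI BM qb])
  have qb': "quotient_basis (monomials n) (\<rho> ` B) ?I" by (rule r.quotient_basis_pullback[OF sI IR BM qb])
  have rc': "residue_coord (\<rho> ` B) a (\<rho> b) ?I = coord (res B I (mono h a)) b" if a: "a \<in> monomials n" and b: "b \<in> B" for a b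
  proof -
    have ar: "bvec a \<in> poly_ring n" using a by (simp add: poly_ring_def)
    have "res (\<rho> ` B) ?I (bvec a) = Ren (res B I (mono h a))"
      using r.res_Ren[OF pI' r.pullback_h[OF sI] ar BM qb'] unfolding ct subst_bvec .
    moreover have "mono h a \<in> free_space (monomials g)"
      using mono_poly_ring[OF r.h_poly_ring a] by (simp add: poly_ring_def)
    from free_space_poly_ring[OF BM c.res_mem[OF this]] have "res B I (mono h a) \<in> poly_ring g" .
    ultimately show ?thesis using coord_Ren[of "res B I (mono h a)" b] b BM unfolding residue_coord_res by auto
  qed
  have rch: "rc ?I k b = (if (k, b) \<in> fiber then w (k, b) else 0)" if k: "k < n" "k \<notin> A" "b \<in> B - {0}" for k b
  proof -
    have "rc ?I k b = coord (res B I (h k)) b" unfolding rc_def using rc'[of "var k" b] k by simp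
    \<comment> \<open>\<open>h k\<close> is already a combination of the basis, hence its own normal
      form; so the prescribed coefficients reappear as coordinates.\<close>
    also have "res B I (h k) = h k" by (rule c.res_free) (simp add: h_def hmap_free_B[OF k(1)])
    also have "coord (h k) b = (if (k, b) \<in> fiber then w (k, b) else 0)"
      unfolding h_def coord_hmap[OF k(1,2)] using k(3) by simp
    finally show ?thesis .
  qed
  have "graded_residues n g \<rho> J ?I"
    unfolding graded_residues_def
  proof (intro ballI impI)
    fix a b assume ab: "a \<in> monomials n" "b \<in> B" "deg b < 2" "deg b < deg a"
    have m: "mono h a \<in> free_space {b\<in>monomials g. deg a \<le> deg b}" by (rule mono_graded[OF r.h_graded ab(1)])
    have mg: "mono h a \<in> free_space (monomials g)" using free_space_mono[of "{b\<in>monomials g. deg a \<le> deg b}" "monomials g"] m by blast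
    have "coord (res B I (mono h a)) b = (\<Sum>c\<in>Poly_Mapping.keys (mono h a). coord (mono h a) c * residue_coord B c b I)"
      unfolding c.coord_res[OF mg] lin_def ..
    also have "\<dots> = 0"
    proof (rule sum.neutral, rule ballI)
      fix c assume "c \<in> Poly_Mapping.keys (mono h a)"
      then have "c \<in> monomials g" "deg a \<le> deg c" using keys_free_space[OF m] by auto
      then have "residue_coord B c b I = 0" using gr ab unfolding graded_residues_def image_ident by auto
      then show "coord (mono h a) c * residue_coord B c b I = 0" by simp
    qed
    finally show "residue_coord (\<rho> ` B) a (\<rho> b) ?I = 0" using rc'[OF ab(1,2)] by simp
  qed
  moreover have "residue_coord (\<rho> ` B) (var j) (var (\<sigma> i)) ?I = 0" if j: "j < n" "j \<notin> A" "i < g" "j < \<sigma> i" for j i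
  proof -
    have "var i \<in> B - {0}" using j(3) deg_var[of i] by (auto simp: std_basis_def simp del: deg_var)
    moreover have "(j, var i) \<notin> fiber"
      using j candidates_monomials[OF J, of "var i"] unfolding fiber_def by (auto simp: var_inj)
    ultimately have "rc ?I j (var i) = 0" using rch[OF j(1,2)] by simp
    then show ?thesis unfolding rc_def by simp
  qed
  moreover have "\<not> quotient_basis (monomials n) (\<rho> ` std_basis g J') ?I"
    if J': "J' \<in> candidates d g" "set_key d g J' < set_key d g J" for J'
  proof
    assume "quotient_basis (monomials n) (\<rho> ` std_basis g J') ?I"
    from quotient_basis_contract[OF punctual_ideal_subspace[OF pI'] std_basis_monomials[OF J'(1)] this]
    show False using I J' unfolding ct core_def by blast
  qed
  ultimately have "?I \<in> T" unfolding cell_def hdom_iff using pI' qb' by blast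
  moreover have "rc ?I k b = w (k, b)" if f: "(k, b) \<in> fiber" for k b
  proof -
    have "b \<in> B - {0}"
      using f candidates_monomials[OF J, of b] deg_var by (auto simp: fiber_def std_basis_def) 
    then show ?thesis using rch[of k b] f unfolding fiber_def by auto
  qed
  ultimately show ?thesis using ct by blast
qed

lemma finite_fiber: "finite fiber"
proof (rule finite_subset)
  show "fiber \<subseteq> {..<n} \<times> (J \<union> var ` {..<g})" unfolding fiber_def by auto
qed (use candidates_finite[OF J] in simp)

text \<open>There are \<open>n - g\<close> variables with \<open>card J = d - 1 - g\<close>
  coefficients each, and one more coefficient for each inversion of \<open>A\<close>.\<close>

lemma card_fiber: "card fiber = card (inversions n A) + (n - g) * (d - 1 - g)"
proof -
  let ?K1 = "({..<n} - A) \<times> J" and ?f = "\<lambda>(k, a). (k, var (inv_into {..<g} \<sigma> a))"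
  have inv: "inv_into {..<g} \<sigma> a < g \<and> \<sigma> (inv_into {..<g} \<sigma> a) = a" if "a \<in> A" for a
    using that bij inv_into_into[of a \<sigma> "{..<g}"] f_inv_into_f[of a \<sigma> "{..<g}"] unfolding bij_betw_def by auto
  have split: "fiber = ?K1 \<union> ?f ` inversions n A"
  proof
    show "fiber \<subseteq> ?K1 \<union> ?f ` inversions n A"
    proof (rule subrelI)
      fix k b assume kb: "(k, b) \<in> fiber"
      show "(k, b) \<in> ?K1 \<union> ?f ` inversions n A"
      proof (cases "b \<in> J")
        case False
        then obtain i where i: "i < g" "b = var i" "\<sigma> i < k" using kb unfolding fiber_def by blast
        have "inv_into {..<g} \<sigma> (\<sigma> i) = i" using i(1) bij by (simp add: bij_betw_def)
        then have "(k, b) = ?f (k, \<sigma> i)" using i by simp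
        moreover have "(k, \<sigma> i) \<in> inversions n A" using kb i sigma(1) unfolding fiber_def inversions_def by auto
        ultimately show ?thesis by blast
      qed (use kb in \<open>auto simp: fiber_def\<close>)
    qed
    have "?f z \<in> fiber" if "z \<in> inversions n A" for z
      using that inv[of "snd z"] unfolding inversions_def fiber_def by (auto simp: var_inj)
    then show "?K1 \<union> ?f ` inversions n A \<subseteq> fiber" by (auto simp: fiber_def)
  qed
  have inj: "inj_on ?f (inversions n A)"
    by (rule inj_onI) (use inv in \<open>auto simp: inversions_def var_inj, metis\<close>)
  have dis: "?K1 \<inter> ?f ` inversions n A = {}"
    using candidates_monomials[OF J] by fastforce
  have finA: "finite A" using An finite_subset by blast
  have gA: "card A = g" using bij_betw_same_card[OF bij] by simp
  have "card fiber = card ?K1 + card (?f ` inversions n A)"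
    unfolding split by (rule card_Un_disjoint[OF _ _ dis]) (use candidates_finite[OF J] finite_inversions in auto)
  also have "card (?f ` inversions n A) = card (inversions n A)" by (rule card_image[OF inj])
  also have "card ?K1 = (n - g) * (d - 1 - g)"
    using J card_Diff_subset[OF finA An] gA unfolding candidates_def by (auto simp: card_cartesian_product)
  finally show ?thesis by simp
qed

lemma hmap_polyfun:
  assumes k: "k < n"
  shows "polyfun g T ((\<lambda>c. c \<circ> contract) ` hcrd g B \<union> (\<lambda>(k, b) I. rc I k b) ` fiber) (\<lambda>I. hmap (rc I) k)"
    (is "polyfun g T ?G _")
proof (cases "k \<in> A")
  case True
  then obtain i where i: "i < g" "k = \<sigma> i" using sigma_surj by blast
  then show ?thesis using polyfun_const[of "var i" g T ?G] by (simp add: hmap_sigma)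
next
  case False
  have "\<exists>p\<in>subalgebra ?G. \<forall>I\<in>T. coord (hmap (rc I) k) b = p I" for b
  proof (cases "(k, b) \<in> fiber")
    case True
    have "b \<in> B - {0}"
      using True candidates_monomials[OF J, of b] deg_var by (auto simp: fiber_def std_basis_def) 
    moreover have "(\<lambda>I. rc I k b) \<in> ?G" using image_eqI[OF _ True, of "\<lambda>I. rc I k b" "\<lambda>(k, b) I. rc I k b"] by simp
    ultimately show ?thesis
      using subalgebra.gen[of "\<lambda>I. rc I k b" ?G] by (intro bexI[of _ "\<lambda>I. rc I k b"]) (simp_all add: coord_hmap[OF k False])
  next
    case nf: False
    have "coord (hmap (rc I) k) b = 0" if I: "I \<in> T" for I
    proof (cases "b \<in> B - {0}")
      case True
      then obtain i where i: "i < g" "b = var i" "\<not> \<sigma> i < k" using nf k False unfolding fiber_def std_basis_def by auto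
      then have "k < \<sigma> i" using sigma(1)[OF i(1)] False by (metis linorder_neqE_nat)
      then show ?thesis using cellD(5)[OF I k False i(1)] i(2) by (simp add: coord_hmap[OF k False])
    next
      case nb: False
      then show ?thesis by (auto simp: coord_hmap[OF k False])
    qed
    then show ?thesis by (intro bexI[of _ "\<lambda>_. 0"] subalgebra.const) auto
  qed
  moreover have "hmap (rc I) k \<in> free_space B" for I by (rule hmap_free_B[OF k])
  ultimately show ?thesis unfolding polyfun_def using BM finB by blast
qed

text \<open>A monomial is reduced by substituting \<open>h\<close> and then reducing modulo the
  contraction. The coefficients after substitution are polynomials in the fibre coordinates, and the
  second reduction is linear with coordinates of the core as coefficients.\<close>

lemma residue_coord_polynomial:
  assumes a: "a \<in> monomials n" and b: "b \<in> B"
  shows "\<exists>p\<in>subalgebra ((\<lambda>c. c \<circ> contract) ` hcrd g B \<union> (\<lambda>(k, b) I. rc I k b) ` fiber).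
    \<forall>I\<in>T. residue_coord (\<rho> ` B) a (\<rho> b) I = p I" (is "\<exists>p\<in>subalgebra ?G. _")
proof -
  have "polyfun g T ?G (\<lambda>I. mono (hmap (rc I)) a)"
    using a
  proof (induction a rule: monomial_induct)
    case zero
    have "polyfun g T ?G (\<lambda>I. bvec 0)" by (rule polyfun_const) simp
    then show ?case by (simp only: mono_zero single_one)
  next
    case (step k c)
    show ?case unfolding mono_add mono_var by (rule polyfun_mult[OF hmap_polyfun[OF step(1)] step(3)])
  qed
  then obtain S where S: "finite S" "S \<subseteq> monomials g" "\<And>I. I \<in> T \<Longrightarrow> mono (hmap (rc I)) a \<in> free_space S"
    "\<And>m. \<exists>p\<in>subalgebra ?G. \<forall>I\<in>T. coord (mono (hmap (rc I)) a) m = p I" unfolding polyfun_def by blast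
  obtain p where p: "\<And>m. p m \<in> subalgebra ?G" "\<And>m I. I \<in> T \<Longrightarrow> coord (mono (hmap (rc I)) a) m = p m I" using S(4) by metis
  have "residue_coord (\<rho> ` B) a (\<rho> b) I = (\<Sum>m\<in>S. p m I * residue_coord B m b (contract I))" if I: "I \<in> T" for I
  proof -
    interpret r: retraction n g A \<sigma> "hmap (rc I)" by (rule retraction_hmap)
    note c = cellD[OF I]
    note sI = punctual_ideal_subspace[OF c(2)]
    interpret c: qbasis "monomials g" B "contract I"
      unfolding qbasis_def using contract_subspace[OF sI] quotient_basis_contract[OF sI BM c(3)] BM by blast
    have ar: "bvec a \<in> poly_ring n" using a by (simp add: poly_ring_def)
    have mg: "mono (hmap (rc I)) a \<in> free_space (monomials g)" using S(3)[OF I] free_space_mono[OF S(2)] by blast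
    have "res (\<rho> ` B) I (bvec a) = Ren (res B (contract I) (mono (hmap (rc I)) a))"
      using r.res_Ren[OF c(2) X_minus_hmap[OF I] ar BM c(3)] unfolding subst_bvec .
    then have "residue_coord (\<rho> ` B) a (\<rho> b) I = coord (res B (contract I) (mono (hmap (rc I)) a)) b"
      using coord_Ren[OF free_space_poly_ring[OF BM c.res_mem[OF mg]], of b] b BM unfolding residue_coord_res by auto
    also have "\<dots> = lin (\<lambda>m. residue_coord B m b (contract I)) (mono (hmap (rc I)) a)" by (rule c.coord_res[OF mg])
    also have "\<dots> = (\<Sum>m\<in>S. p m I * residue_coord B m b (contract I))"
      using lin_superset[OF S(1), of "mono (hmap (rc I)) a"] S(3)[OF I] unfolding free_space_def by (simp add: p(2)[OF I])
    finally show ?thesis .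
  qed
  moreover have "(\<lambda>I. \<Sum>m\<in>S. p m I * residue_coord B m b (contract I)) \<in> subalgebra ?G"
  proof (intro subalgebra_sum subalgebra.mult p)
    fix m assume "m \<in> S"
    then have "residue_coord B m b \<in> hcrd g B" using S(2) b unfolding hilb.crd_def by blast
    then show "(\<lambda>I. residue_coord B m b (contract I)) \<in> subalgebra ?G"
      by (intro subalgebra.gen UnI1 image_eqI[of _ _ "residue_coord B m b"]) (simp_all add: comp_def)
  qed
  ultimately show ?thesis by (intro bexI[of _ "\<lambda>I. \<Sum>m\<in>S. p m I * residue_coord B m b (contract I)"]) auto
qed

theorem cls_cell:
  "cls (chart_space {(T, hcrd n (\<rho> ` B))}) =
     cls (chart_space {(core d g J, hcrd g B)}) * \<bbbL> ^ (card (inversions n A) + (n - g) * (d - 1 - g))"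
  unfolding card_fiber[symmetric]
proof (rule cls_trivial_bundle[OF affine_core[OF J] finite_fiber, where \<pi>=contract and u="\<lambda>(k, b) I. rc I k b"])
  show "contract I \<in> core d g J" if "I \<in> T" for I using contract_core[OF that] .
  show "I = I'" if "I \<in> T" "I' \<in> T" "contract I = contract I'"
    "\<And>k. k \<in> fiber \<Longrightarrow> (case k of (k, b) \<Rightarrow> \<lambda>I. rc I k b) I = (case k of (k, b) \<Rightarrow> \<lambda>I. rc I k b) I'" for I I'
    by (rule cell_eqI[OF that(1-3)]) (use that(4) in fastforce)
  show "\<exists>I\<in>T. contract I = s \<and> (\<forall>k\<in>fiber. (case k of (k, b) \<Rightarrow> \<lambda>I. rc I k b) I = w k)" if "s \<in> core d g J" for s w
    using core_pullback[OF that, of w] by fastforce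
  show "\<exists>p\<in>subalgebra (hcrd n (\<rho> ` B)). \<forall>I\<in>T. c (contract I) = p I" if "c \<in> hcrd g B" for c
  proof -
    obtain a b where ab: "a \<in> monomials g" "b \<in> B" "c = residue_coord B a b" using \<open>c \<in> hcrd g B\<close> unfolding hilb.crd_def by blast
    have "c (contract I) = residue_coord (\<rho> ` B) (\<rho> a) (\<rho> b) I" if "I \<in> T" for I
      using residue_coord_contract[OF punctual_ideal_subspace[OF cellD(2)[OF that]] BM cellD(3)[OF that] ab(1)] ab BM by auto
    then show ?thesis
      using hilb.crd_gen[OF ren_monomials[OF ab(1)], of "\<rho> b" "\<rho> ` B"] ab(2)
      by (intro bexI[of _ "residue_coord (\<rho> ` B) (\<rho> a) (\<rho> b)"]) auto
  qed
  show "\<exists>p\<in>subalgebra (hcrd n (\<rho> ` B)). \<forall>I\<in>T. (case k of (k, b) \<Rightarrow> \<lambda>I. rc I k b) I = p I" if "k \<in> fiber" for k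
  proof -
    obtain j b where jb: "k = (j, b)" "j < n" "b \<in> B" using \<open>k \<in> fiber\<close> unfolding fiber_def std_basis_def by auto
    then show ?thesis
      using hilb.crd_gen[of "var j" n "\<rho> b" "\<rho> ` B"] by (intro bexI[of _ "residue_coord (\<rho> ` B) (var j) (\<rho> b)"]) (auto simp: rc_def)
  qed
  show "\<exists>p\<in>subalgebra ((\<lambda>c. c \<circ> contract) ` hcrd g B \<union> (\<lambda>(k, b) I. rc I k b) ` fiber). \<forall>I\<in>T. c I = p I"
    if "c \<in> hcrd n (\<rho> ` B)" for c
  proof -
    obtain a b where "a \<in> monomials n" "b \<in> B" "c = residue_coord (\<rho> ` B) a (\<rho> b)" using \<open>c \<in> hcrd n (\<rho> ` B)\<close> unfolding hilb.crd_def by blast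
    then show ?thesis using residue_coord_polynomial by simp
  qed
qed

end

section \<open>Cotangent spaces and the order of the cells\<close>

lemma free_space_split:
  assumes "r \<in> free_space (P \<union> Q)"
  obtains u where "u \<in> free_space P" "r - u \<in> free_space Q"
proof -
  define u where "u = ext (\<lambda>c. if c \<in> P then bvec c else 0) r"
  have c: "coord u c = (if c \<in> P then coord r c else 0)" for c
  proof -
    have "coord u c = (\<Sum>a\<in>Poly_Mapping.keys r. if a = c \<and> c \<in> P then coord r a else 0)"
      unfolding u_def coord_ext lin_def by (rule sum.cong) (auto simp: lookup_single when_def)
    then show ?thesis by (auto simp: in_keys_iff)
  qed
  show ?thesis by (rule that[of u]) (use assms in \<open>auto simp: free_space_iff c lookup_minus\<close>)
qed

lemma free_space_image:
  assumes "u \<in> free_space (f ` S)"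
  obtains w where "w \<in> free_space S" "u = ext (\<lambda>j. bvec (f j)) w"
proof -
  define w where "w = ext (\<lambda>c. bvec (inv_into S f c)) u"
  have "w \<in> free_space S" unfolding w_def
    by (rule ext_mem[OF subspace_free_space]) (use keys_free_space[OF assms] in \<open>simp add: inv_into_into\<close>)
  moreover have "ext (\<lambda>j. bvec (f j)) w = ext bvec u"
    unfolding w_def ext_ext by (rule ext_cong) (use keys_free_space[OF assms] in \<open>simp add: f_inv_into_f\<close>)
  ultimately show ?thesis using that by (simp add: ext_id)
qed

lemma ext_image_free_space: "w \<in> free_space S \<Longrightarrow> ext (\<lambda>j. bvec (f j)) w \<in> free_space (f ` S)"
  by (rule ext_mem[OF subspace_free_space]) (auto dest: keys_free_space)

definition linear_form :: "(nat \<Rightarrow>\<^sub>0 complex) \<Rightarrow> mpoly" where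
  "linear_form = ext (\<lambda>j. X j)"

lemma coord_linear_form: "coord (linear_form v) (var a) = coord v a"
proof -
  have "coord (linear_form v) (var a) = (\<Sum>j\<in>Poly_Mapping.keys v. if j = a then coord v j else 0)"
    unfolding linear_form_def coord_ext lin_def by (rule sum.cong) (auto simp: lookup_single when_def var_inj)
  then show ?thesis by (simp add: in_keys_iff)
qed

lemma linear_form_add: "linear_form (v + w) = linear_form v + linear_form w"
  and linear_form_diff: "linear_form (v - w) = linear_form v - linear_form w"
  and linear_form_scale: "linear_form (scale c v) = scale c (linear_form v)"
  and linear_form_bvec: "linear_form (bvec j) = X j"
  by (simp_all add: linear_form_def ext_add ext_diff ext_scale)

definition deg_ge :: "nat \<Rightarrow> nat \<Rightarrow> (nat \<Rightarrow>\<^sub>0 nat) set" where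
  "deg_ge n k = {a\<in>monomials n. k \<le> deg a}"

text \<open>The kernel of the map from linear forms to the cotangent space.\<close>

definition cotangent_relations :: "nat \<Rightarrow> mpoly set \<Rightarrow> (nat \<Rightarrow>\<^sub>0 complex) set" where
  "cotangent_relations n I = {v\<in>free_space {..<n}. \<exists>r\<in>free_space (deg_ge n 2). linear_form v - r \<in> I}"

lemma cotangent_relations_subspace:
  assumes I: "free.subspace I" shows "free.subspace (cotangent_relations n I)"
proof (rule free.subspaceI)
  note sub = free.subspace_0[OF subspace_free_space] free.subspace_add[OF subspace_free_space]
    free.subspace_scale[OF subspace_free_space]
  show "0 \<in> cotangent_relations n I"
    unfolding cotangent_relations_def using sub(1)[of "{..<n}"] sub(1)[of "deg_ge n 2"] free.subspace_0[OF I]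
    by (auto intro!: bexI[of _ 0] simp: linear_form_def)
  show "v + w \<in> cotangent_relations n I" if vw: "v \<in> cotangent_relations n I" "w \<in> cotangent_relations n I" for v w
  proof -
    obtain r s where r: "v \<in> free_space {..<n}" "w \<in> free_space {..<n}" "r \<in> free_space (deg_ge n 2)" "linear_form v - r \<in> I"
      "s \<in> free_space (deg_ge n 2)" "linear_form w - s \<in> I" using vw unfolding cotangent_relations_def by blast
    have "linear_form (v + w) - (r + s) \<in> I"
      using free.subspace_add[OF I r(4,6)] by (simp add: linear_form_add algebra_simps)
    then show ?thesis unfolding cotangent_relations_def using sub(2)[OF r(1,2)] sub(2)[OF r(3,5)] by blast
  qed
  show "scale c v \<in> cotangent_relations n I" if v: "v \<in> cotangent_relations n I" for c v
  proof -
    obtain r where r: "v \<in> free_space {..<n}" "r \<in> free_space (deg_ge n 2)" "linear_form v - r \<in> I"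
      using v unfolding cotangent_relations_def by blast
    have "linear_form (scale c v) - scale c r \<in> I"
      using free.subspace_scale[OF I r(3)] by (simp add: linear_form_scale free.scale_right_diff_distrib)
    then show ?thesis unfolding cotangent_relations_def using sub(3)[OF r(1)] sub(3)[OF r(2)] by blast
  qed
qed

lemma (in qbasis) indep_mod_subset: "K \<subseteq> J \<Longrightarrow> indep_mod K V"
  using indep_mod_basis free_space_mono unfolding indep_mod_def by blast

context cell_chart
begin

lemma ren_std_basis: "\<rho> ` B = insert 0 (var ` A \<union> \<rho> ` J)"
proof -
  have "\<rho> ` var ` {..<g} = var ` A" using bij unfolding bij_betw_def by (auto simp: image_image)
  then show ?thesis unfolding std_basis_def by (simp add: image_Un)
qed

lemma deg_ren_J: "c \<in> \<rho> ` J \<Longrightarrow> c \<in> monomials n \<and> 2 \<le> deg c"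
  using candidates_monomials[OF J] deg_ren ren_monomials by auto

lemma card_ren_J: "finite (\<rho> ` J)" "card (\<rho> ` J) + g + 1 = d"
proof -
  have "J \<subseteq> monomials g" using candidates_monomials[OF J] by blast
  then have "card (\<rho> ` J) = card J" using card_image inj_on_subset[OF ren_inj] by blast
  then show "card (\<rho> ` J) + g + 1 = d" using J unfolding candidates_def by simp
  show "finite (\<rho> ` J)" using candidates_finite[OF J] by simp
qed

lemma ren_B_cases:
  assumes "c \<in> \<rho> ` B" "c \<notin> \<rho> ` J"
  obtains b where "b \<in> B" "deg b < 2" "c = \<rho> b" "c = 0 \<or> (\<exists>i<g. b = var i \<and> c = var (\<sigma> i))"
proof -
  obtain b where b: "b \<in> B" "c = \<rho> b" using assms(1) by blast
  then consider "b = 0" | i where "i < g" "b = var i" using assms(2) unfolding std_basis_def by auto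
  then show ?thesis
  proof cases
    case 1 then show ?thesis using that[OF b(1) _ b(2)] b(2) by simp
  next
    case (2 i)
    then have "c = 0 \<or> (\<exists>i<g. b = var i \<and> c = var (\<sigma> i))" using b(2) by auto
    then show ?thesis using that[OF b(1) _ b(2)] 2 by simp
  qed
qed

text \<open>By \<open>graded_residues\<close> the normal form of a monomial of degree at least 2 has
  no component along 1 or along the variables.\<close>

lemma cell_deg2:
  assumes I: "I \<in> T" and a: "a \<in> monomials n" "2 \<le> deg a"
  shows "\<exists>u\<in>free_space (\<rho> ` J). bvec a - u \<in> I"
proof -
  interpret q: qbasis "monomials n" "\<rho> ` B" I
    unfolding qbasis_def using punctual_ideal_subspace[OF cellD(2)[OF I]] rB cellD(3)[OF I] by blast
  have e: "bvec a \<in> free_space (monomials n)" using a by simp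
  have "res (\<rho> ` B) I (bvec a) \<in> free_space (\<rho> ` J)"
    unfolding free_space_iff
  proof (intro allI impI)
    fix c assume c: "c \<notin> \<rho> ` J"
    show "coord (res (\<rho> ` B) I (bvec a)) c = 0"
    proof (cases "c \<in> \<rho> ` B")
      case True
      then obtain b where "b \<in> B" "deg b < 2" "c = \<rho> b" using ren_B_cases c by blast
      then show ?thesis using cellD(4)[OF I] a unfolding graded_residues_def residue_coord_res by auto
    next
      case False then show ?thesis using q.res_mem[OF e] unfolding free_space_iff by blast
    qed
  qed
  then show ?thesis using q.res_diff[OF e] by blast
qed

text \<open>Reduce \<open>X j\<close> and discard the part along \<open>J\<close>, which has degree
  at least 2; what remains are earlier variables of \<open>A\<close>. This is the greedy property of
  \<open>A\<close> for the cotangent space.\<close>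

lemma cell_linear:
  assumes I: "I \<in> T" and j: "j < n" "j \<notin> A"
  shows "\<exists>u\<in>free_space (A \<inter> {..<j}). bvec j - u \<in> cotangent_relations n I"
proof -
  interpret q: qbasis "monomials n" "\<rho> ` B" I
    unfolding qbasis_def using punctual_ideal_subspace[OF cellD(2)[OF I]] rB cellD(3)[OF I] by blast
  have e: "X j \<in> free_space (monomials n)" using j by simp
  let ?r = "res (\<rho> ` B) I (X j)"
  have "?r \<in> free_space (var ` (A \<inter> {..<j}) \<union> \<rho> ` J)"
    unfolding free_space_iff
  proof (intro allI impI)
    fix c assume c: "c \<notin> var ` (A \<inter> {..<j}) \<union> \<rho> ` J"
    show "coord ?r c = 0"
    proof (cases "c \<in> \<rho> ` B")
      case True
      then obtain b where b: "b \<in> B" "deg b < 2" "c = \<rho> b" "c = 0 \<or> (\<exists>i<g. b = var i \<and> c = var (\<sigma> i))"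
        using ren_B_cases c by blast
      show ?thesis
      proof (cases "c = 0")
        case True
        have "(0::nat \<Rightarrow>\<^sub>0 nat) \<in> B" by (simp add: std_basis_def)
        moreover have "var j \<in> monomials n" using j by simp
        ultimately have "residue_coord (\<rho> ` B) (var j) (\<rho> 0) I = 0"
          using cellD(4)[OF I, unfolded graded_residues_def, rule_format, of "var j" 0] \<open>0 \<in> B\<close> by simp
        then show ?thesis using True unfolding residue_coord_res by simp
      next
        case False
        then obtain i where i: "i < g" "b = var i" "c = var (\<sigma> i)" using b by blast
        then have "\<not> \<sigma> i < j" "\<sigma> i \<noteq> j" using c sigma(1) j by auto
        then have "rc I j (var i) = 0" using cellD(5)[OF I j i(1)] by simp
        then show ?thesis using i unfolding rc_def residue_coord_res by simp
      qed
    next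
      case False then show ?thesis using q.res_mem[OF e] unfolding free_space_iff by blast
    qed
  qed
  then obtain u where u: "u \<in> free_space (var ` (A \<inter> {..<j}))" "?r - u \<in> free_space (\<rho> ` J)" using free_space_split by blast
  obtain w where w: "w \<in> free_space (A \<inter> {..<j})" "u = linear_form w"
    using free_space_image[OF u(1)] unfolding linear_form_def by blast
  have "?r - u \<in> free_space (deg_ge n 2)"
    using u(2) free_space_mono[of "\<rho> ` J" "deg_ge n 2"] deg_ren_J unfolding deg_ge_def by blast
  moreover have "linear_form (bvec j - w) - (?r - u) \<in> I"
    using q.res_diff[OF e] w(2) by (simp add: linear_form_diff linear_form_bvec)
  moreover have "bvec j - w \<in> free_space {..<n}"
    using j w(1) free_space_mono[of "A \<inter> {..<j}" "{..<n}"] An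
    by (intro free.subspace_diff[OF subspace_free_space]) auto
  ultimately show ?thesis using w(1) unfolding cotangent_relations_def by blast
qed

text \<open>A linear form in the variables of \<open>A\<close> that is congruent to higher terms is
  congruent to a combination of \<open>J\<close>, a relation within the basis. Membership in a cell
  is not assumed, so that this applies to the chart of another index.\<close>

lemma cotangent_indep:
  assumes I: "punctual_ideal d n I" and qb: "quotient_basis (monomials n) (\<rho> ` B) I"
    and span: "\<And>a. a \<in> monomials n \<Longrightarrow> 2 \<le> deg a \<Longrightarrow> \<exists>u\<in>free_space (\<rho> ` J). bvec a - u \<in> I"
    and u: "u \<in> free_space A" "u \<in> cotangent_relations n I"
  shows "u = 0"
proof -
  note sI = punctual_ideal_subspace[OF I]
  interpret q: qbasis "monomials n" "\<rho> ` B" I unfolding qbasis_def using sI rB qb by blast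
  obtain r where r: "r \<in> free_space (deg_ge n 2)" "linear_form u - r \<in> I" using u(2) unfolding cotangent_relations_def by blast
  obtain s where s: "s \<in> free_space (\<rho> ` J)" "r - s \<in> I"
    using extend_spanning[OF sI span, of "deg_ge n 2" r] r(1) unfolding deg_ge_def by blast
  have uv: "linear_form u \<in> free_space (var ` A)"
    unfolding linear_form_def by (rule ext_image_free_space[OF u(1)])
  have "linear_form u - s \<in> I" using free.subspace_add[OF sI r(2) s(2)] by simp
  moreover have "linear_form u - s \<in> free_space (\<rho> ` B)"
    using uv s(1) free_space_mono[of "var ` A" "\<rho> ` B"] free_space_mono[of "\<rho> ` J" "\<rho> ` B"] ren_std_basis
    by (intro free.subspace_diff[OF subspace_free_space]) auto
  ultimately have "linear_form u = s" using q.indep_mod_basis unfolding indep_mod_def by fastforce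
  then have "coord u a = 0" for a
    using coord_linear_form[of u a] s(1) deg_ren_J[of "var a"] by (cases "var a \<in> \<rho> ` J") (simp_all add: free_space_iff)
  then show ?thesis by (intro poly_mapping_eqI) simp
qed

end

definition enum :: "nat set \<Rightarrow> nat \<Rightarrow> nat" where
  "enum A = (SOME \<sigma>. bij_betw \<sigma> {..<card A} A)"

lemma enum: "finite A \<Longrightarrow> bij_betw (enum A) {..<card A} A"
  unfolding enum_def using ex_bij_betw_nat_finite[of A] unfolding atLeast0LessThan by (rule someI_ex)

lemma renaming_enum: "A \<subseteq> {..<n} \<Longrightarrow> renaming n (card A) A (enum A)"
  unfolding renaming_def using enum finite_subset by blast

lemma cell_chart_enum: "A \<subseteq> {..<n} \<Longrightarrow> J \<in> candidates d (card A) \<Longrightarrow> cell_chart n (card A) A (enum A) d J"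
  unfolding cell_chart_def cell_chart_axioms_def using renaming_enum by blast

abbreviation cell_basis :: "nat set \<Rightarrow> (nat \<Rightarrow>\<^sub>0 nat) set \<Rightarrow> (nat \<Rightarrow>\<^sub>0 nat) set" where
  "cell_basis A J \<equiv> ren (enum A) ` std_basis (card A) J"

definition cell_order :: "nat \<Rightarrow> nat \<Rightarrow> ((nat set \<times> (nat \<Rightarrow>\<^sub>0 nat) set) \<times> (nat set \<times> (nat \<Rightarrow>\<^sub>0 nat) set)) set" where
  "cell_order d n = inv_image (less_than <*lex*> less_than <*lex*> less_than)
     (\<lambda>(A, J). (card A, lex_key n A, set_key d (card A) J))"

lemma wf_cell_order: "wf (cell_order d n)"
  unfolding cell_order_def by auto

text \<open>\<open>J'\<close> is independent modulo \<open>I\<close> and lies in the square of the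
  maximal ideal, which \<open>J\<close> spans. So \<open>J'\<close> is no larger than
  \<open>J\<close>, which means \<open>card A \<le> card A'\<close>. In case of equality
  \<open>J'\<close> spans as well, so \<open>A'\<close> is independent in the cotangent space and
  \<open>greedy_first\<close> compares \<open>A\<close> with \<open>A'\<close>. If these agree, the
  choice of the first candidate decides.\<close>

lemma cell_before:
  assumes A: "A \<subseteq> {..<n}" "J \<in> candidates d (card A)" and A': "A' \<subseteq> {..<n}" "J' \<in> candidates d (card A')"
    and ne: "(A, J) \<noteq> (A', J')" and I: "I \<in> cell d n (card A) A (enum A) J" "I \<in> hdom d n (cell_basis A' J')"
  shows "((A, J), (A', J')) \<in> cell_order d n"
proof -
  interpret c: cell_chart n "card A" A "enum A" d J by (rule cell_chart_enum[OF A])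
  interpret c': cell_chart n "card A'" A' "enum A'" d J' by (rule cell_chart_enum[OF A'])
  have pI: "punctual_ideal d n I" and qb': "quotient_basis (monomials n) (cell_basis A' J') I"
    using I(2) unfolding hdom_iff by auto
  note sI = punctual_ideal_subspace[OF pI]
  interpret q': qbasis "monomials n" "cell_basis A' J'" I unfolding qbasis_def using sI c'.rB qb' by blast
  let ?K = "ren (enum A) ` J" and ?K' = "ren (enum A') ` J'"
  have ind: "indep_mod ?K' I" by (rule q'.indep_mod_subset) (auto simp: std_basis_def)
  have sp: "\<exists>u\<in>free_space ?K. bvec a - u \<in> I" if "a \<in> ?K'" for a
    using c.cell_deg2[OF I(1)] c'.deg_ren_J[OF that] by blast
  have card_le: "card ?K' \<le> card ?K" using indep_mod_card[OF sI ind c.card_ren_J(1) sp] by blast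
  then have gle: "card A \<le> card A'" using c.card_ren_J(2) c'.card_ren_J(2) by linarith
  show ?thesis
  proof (cases "card A = card A'")
    case False
    then show ?thesis using gle by (simp add: cell_order_def)
  next
    case eq: True
    have "card ?K \<le> card ?K'" using eq c.card_ren_J(2) c'.card_ren_J(2) by linarith
    then have spJ: "\<exists>u\<in>free_space ?K'. bvec a - u \<in> I" if "a \<in> ?K" for a
      using indep_mod_equal_card[OF sI ind c.card_ren_J(1) _ sp that] by blast
    have span': "\<exists>u\<in>free_space ?K'. bvec a - u \<in> I" if a: "a \<in> monomials n" "2 \<le> deg a" for a
    proof -
      obtain u where u: "u \<in> free_space ?K" "bvec a - u \<in> I" using c.cell_deg2[OF I(1) a] by blast
      obtain w where w: "w \<in> free_space ?K'" "u - w \<in> I" using extend_spanning[OF sI spJ u(1)] by blast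
      have "bvec a - w \<in> I" using free.subspace_add[OF sI u(2) w(2)] by simp
      then show ?thesis using w(1) by blast
    qed
    show ?thesis
    proof (cases "A = A'")
      case True
      then have "J \<noteq> J'" using ne by blast
      then have "set_key d (card A) J \<noteq> set_key d (card A) J'"
        using inj_onD[OF inj_set_key _ A(2), of J'] A'(2) True by metis
      moreover have "\<not> set_key d (card A) J' < set_key d (card A) J"
        using c.cellD(6)[OF I(1), of J'] A'(2) True qb' by blast
      ultimately show ?thesis using True by (simp add: cell_order_def)
    next
      case False
      have "lex_key n A < lex_key n A'"
      proof (rule greedy_first[OF _ _ A(1) A'(1) False])
        show "\<exists>u\<in>free_space (A \<inter> {..<j}). bvec j - u \<in> cotangent_relations n I" if "j < n" "j \<notin> A" for j
          by (rule c.cell_linear[OF I(1) that])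
        show "u = 0" if "u \<in> free_space A'" "u \<in> cotangent_relations n I" for u
          by (rule c'.cotangent_indep[OF pI qb' span' that])
      qed
      then show ?thesis using eq by (simp add: cell_order_def)
    qed
  qed
qed

text \<open>A form of Nakayama's lemma. If 1 were congruent to terms of positive degree, every
  monomial would be congruent to terms of higher degree. Descending from degree \<open>d\<close>,
  all of them would lie in \<open>I\<close>, leaving no basis with \<open>d \<ge> 1\<close>
  elements.\<close>

lemma one_not_in_maximal_ideal:
  assumes I: "punctual_ideal d n I" and d: "1 \<le> d" and r: "r \<in> free_space (deg_ge n 1)"
  shows "1 - r \<notin> I"
proof
  assume one: "1 - r \<in> I"
  note sI = punctual_ideal_subspace[OF I]
  have "bvec a \<in> I" if "a \<in> monomials n" for a
    using that
  proof (induction "d - deg a" arbitrary: a rule: less_induct)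
    case less
    show ?case
    proof (cases "d \<le> deg a")
      case True then show ?thesis using punctual_ideal_deg[OF I less.prems] by blast
    next
      case False
      have ar: "bvec a \<in> poly_ring n" using less.prems by (simp add: poly_ring_def)
      have m: "bvec a * r \<in> free_space (deg_ge n (Suc (deg a)))"
        by (rule free_space_mult[of _ "{a}", OF _ r]) (use less.prems in \<open>auto simp: deg_ge_def intro: add_monomials\<close>)
      have "ext bvec (bvec a * r) \<in> I"
      proof (rule ext_mem[OF sI])
        fix c assume "c \<in> Poly_Mapping.keys (bvec a * r)"
        then have c: "c \<in> monomials n" "Suc (deg a) \<le> deg c" using keys_free_space[OF m] unfolding deg_ge_def by auto
        show "bvec c \<in> I" by (rule less.hyps) (use c False in auto)
      qed
      then have "bvec a * r \<in> I" by (simp add: ext_id)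
      from free.subspace_add[OF sI punctual_ideal_mult[OF I ar one] this] show ?thesis
        by (simp add: right_diff_distrib)
    qed
  qed
  moreover obtain J where J: "J \<subseteq> monomials n" "card J = d" "quotient_basis (monomials n) J I"
    using I unfolding punctual_ideal_def by blast
  moreover obtain b where "b \<in> J" using J(2) d by (metis card.empty ex_in_conv not_one_le_zero)
  ultimately have "bvec b \<in> I" "indep_mod J I"
    using qbasis.indep_mod_basis[of "monomials n" J I] sI unfolding qbasis_def by auto
  then have "bvec b = 0" using \<open>b \<in> J\<close> unfolding indep_mod_def by simp
  then have "bvec b \<in> free_space {}" by (simp add: free_space_iff)
  then show False by simp
qed

text \<open>Since the maximal ideal is nilpotent modulo \<open>I\<close>, variables that span the
  cotangent space generate the quotient ring. With \<open>A\<close> greedy, the monomials in its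
  variables therefore span, and \<open>J\<close> can be sought among them.\<close>

lemma cell_exists:
  assumes I: "punctual_ideal d n I" and d: "1 \<le> d"
  shows "\<exists>A\<subseteq>{..<n}. \<exists>J\<in>candidates d (card A). I \<in> cell d n (card A) A (enum A) J"
proof -
  note sI = punctual_ideal_subspace[OF I]
  let ?V = "cotangent_relations n I"
  note sV = cotangent_relations_subspace[OF sI, of n]
  define A where "A = greedy n ?V"
  have An: "A \<subseteq> {..<n}" unfolding A_def greedy_def by blast
  let ?g = "card A" and ?\<sigma> = "enum A"
  interpret renaming n ?g A ?\<sigma> by (rule renaming_enum[OF An])
  have varA: "\<rho> ` var ` {..<?g} = var ` A" using bij_betw_imp_surj_on[OF bij] by (simp add: image_image flip: image_image[of var ?\<sigma>])
  have linear: "\<exists>u\<in>free_space (A \<inter> {..j}). \<exists>r\<in>free_space (deg_ge n 2). X j - linear_form u - r \<in> I" if j: "j < n" for j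
  proof -
    obtain u where u: "u \<in> free_space (A \<inter> {..j})" "bvec j - u \<in> ?V" using greedy_spans[OF sV j] unfolding A_def by blast
    then obtain r where "r \<in> free_space (deg_ge n 2)" "linear_form (bvec j - u) - r \<in> I" unfolding cotangent_relations_def by blast
    then show ?thesis using u(1) by (auto simp: linear_form_diff linear_form_bvec)
  qed
  \<comment> \<open>Up to terms of higher degree a monomial can be rewritten in the variables of
    \<open>A\<close>, one factor at a time.\<close>
  have step: "\<exists>w\<in>free_space (deg_ge ?g (deg a)). \<exists>r\<in>free_space (deg_ge n (Suc (deg a))). bvec a - Ren w - r \<in> I"
    if "a \<in> monomials n" for a
    using that
  proof (induction a rule: monomial_induct)
    case zero
    have "bvec 0 \<in> free_space (deg_ge ?g (deg 0))" by (simp only: bvec_free_space) (simp add: deg_ge_def)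
    moreover have "bvec 0 - Ren (bvec 0) - 0 \<in> I" using Ren_bvec[of 0] free.subspace_0[OF sI] by simp
    ultimately show ?case using free.subspace_0[OF subspace_free_space] by blast
  next
    case (step j b)
    obtain w r where w: "w \<in> free_space (deg_ge ?g (deg b))" and r: "r \<in> free_space (deg_ge n (Suc (deg b)))"
      and i1: "bvec b - Ren w - r \<in> I" using step.IH by blast
    obtain u r1 where u: "u \<in> free_space (A \<inter> {..j})" and r1: "r1 \<in> free_space (deg_ge n 2)" and i2: "X j - linear_form u - r1 \<in> I"
      using linear[OF step(1)] by blast
    have "linear_form u \<in> free_space (\<rho> ` var ` {..<?g})"
      unfolding varA linear_form_def using ext_image_free_space[OF u, of var] free_space_mono[of "var ` (A \<inter> {..j})" "var ` A"] by blast
    then obtain w1 where w1: "w1 \<in> free_space (var ` {..<?g})" "linear_form u = Ren w1"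
      by (rule free_space_Ren[rotated]) auto
    have wg: "w \<in> poly_ring ?g" by (rule free_space_poly_ring[OF _ w]) (auto simp: deg_ge_def)
    have "Ren w \<in> free_space (\<rho> ` deg_ge ?g (deg b))" by (rule Ren_free_space[OF _ w]) (auto simp: deg_ge_def)
    moreover have "\<rho> ` deg_ge ?g (deg b) \<subseteq> deg_ge n (deg b)" using deg_ren ren_monomials unfolding deg_ge_def by auto
    ultimately have Rw: "Ren w \<in> free_space (deg_ge n (deg b))" using free_space_mono by blast
    \<comment> \<open>The product of the two congruences, telescoped so that each summand is a
      multiple of an element of \<open>I\<close>.\<close>
    have "X j * (bvec b - Ren w - r) + Ren w * (X j - linear_form u - r1) =
        bvec (var j + b) - Ren (w1 * w) - (X j * r + r1 * Ren w)"
      unfolding w1(2) by (simp add: Ren_mult bvec_mult[symmetric] algebra_simps)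
    moreover have "X j * (bvec b - Ren w - r) + Ren w * (X j - linear_form u - r1) \<in> I"
      by (rule free.subspace_add[OF sI punctual_ideal_X[OF I step(1) i1] punctual_ideal_mult[OF I Ren_poly_ring[OF wg] i2]])
    ultimately have "bvec (var j + b) - Ren (w1 * w) - (X j * r + r1 * Ren w) \<in> I" by simp
    moreover have "w1 * w \<in> free_space (deg_ge ?g (deg (var j + b)))"
      by (rule free_space_mult[OF w1(1) w]) (auto simp: deg_ge_def intro: add_monomials)
    moreover have "X j * r \<in> free_space (deg_ge n (Suc (deg (var j + b))))"
      by (rule free_space_mult[of _ "{var j}", OF _ r]) (use step(1) in \<open>auto simp: deg_ge_def intro: add_monomials\<close>)
    moreover have "r1 * Ren w \<in> free_space (deg_ge n (Suc (deg (var j + b))))"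
      by (rule free_space_mult[OF r1 Rw]) (auto simp: deg_ge_def intro: add_monomials)
    ultimately show ?case using free.subspace_add[OF subspace_free_space] by blast
  qed
  \<comment> \<open>Iterating \<open>step\<close> pushes the remainder into degrees at least
    \<open>d\<close>, where it lies in \<open>I\<close>.\<close>
  have span: "\<exists>u\<in>free_space (\<rho> ` deg_ge ?g (deg a)). bvec a - u \<in> I" if "a \<in> monomials n" for a
    using that
  proof (induction "d - deg a" arbitrary: a rule: less_induct)
    case less
    show ?case
    proof (cases "d \<le> deg a")
      case True
      then show ?thesis using punctual_ideal_deg[OF I less.prems] free.subspace_0[OF subspace_free_space] by (intro bexI[of _ 0]) auto
    next
      case False
      obtain w r where w: "w \<in> free_space (deg_ge ?g (deg a))" and r: "r \<in> free_space (deg_ge n (Suc (deg a)))"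
        and i: "bvec a - Ren w - r \<in> I" using step[OF less.prems] by blast
      have "\<exists>u\<in>free_space (\<rho> ` deg_ge ?g (deg a)). r - u \<in> I"
      proof (rule extend_spanning[OF sI _ r])
        fix c assume c: "c \<in> deg_ge n (Suc (deg a))"
        then obtain u where u: "u \<in> free_space (\<rho> ` deg_ge ?g (deg c))" "bvec c - u \<in> I"
          using less.hyps[of c, OF diff_less_mono2] False unfolding deg_ge_def by auto
        have "\<rho> ` deg_ge ?g (deg c) \<subseteq> \<rho> ` deg_ge ?g (deg a)" using c unfolding deg_ge_def by auto
        then show "\<exists>u\<in>free_space (\<rho> ` deg_ge ?g (deg a)). bvec c - u \<in> I" using u free_space_mono by blast
      qed
      then obtain u where u: "u \<in> free_space (\<rho> ` deg_ge ?g (deg a))" "r - u \<in> I" by blast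
      have "Ren w \<in> free_space (\<rho> ` deg_ge ?g (deg a))" by (rule Ren_free_space[OF _ w]) (auto simp: deg_ge_def)
      from free.subspace_add[OF subspace_free_space this u(1)] have "Ren w + u \<in> free_space (\<rho> ` deg_ge ?g (deg a))" .
      moreover have "bvec a - (Ren w + u) \<in> I" using free.subspace_add[OF sI i u(2)] by (simp add: algebra_simps)
      ultimately show ?thesis by blast
    qed
  qed
  have bound: "finite J \<and> card J \<le> d" if J: "J \<subseteq> deg_ge ?g 2" "indep_mod J (contract I)" for J
  proof -
    have Jg: "J \<subseteq> monomials ?g" using J(1) unfolding deg_ge_def by blast
    have "indep_mod (\<rho> ` J) I" using J(2) indep_mod_ren[OF Jg] by blast
    moreover have "\<rho> ` J \<subseteq> monomials n" using Jg ren_monomials by blast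
    ultimately have "finite (\<rho> ` J) \<and> card (\<rho> ` J) \<le> d" using punctual_ideal_bound[OF I] by blast
    then show ?thesis using finite_imageD[OF _ inj_on_subset[OF ren_inj Jg]] card_image[OF inj_on_subset[OF ren_inj Jg]] by simp
  qed
  \<comment> \<open>Not yet the set of the cell: any monomial basis of the square of the maximal
    ideal, which shows that some candidate gives a basis.\<close>
  obtain J0 where J0: "J0 \<subseteq> deg_ge ?g 2" "indep_mod J0 (contract I)"
    "\<And>b. b \<in> deg_ge ?g 2 \<Longrightarrow> \<exists>u\<in>free_space J0. bvec b - u \<in> contract I"
    using indep_mod_extend[OF contract_subspace[OF sI] bound] by blast
  have J0g: "J0 \<subseteq> monomials ?g" using J0(1) unfolding deg_ge_def by blast
  have ind0: "indep_mod (\<rho> ` J0) I" using J0(2) indep_mod_ren[OF J0g] by blast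
  have span0: "\<exists>u\<in>free_space (\<rho> ` J0). bvec a - u \<in> I" if a: "a \<in> monomials n" "2 \<le> deg a" for a
  proof -
    obtain u where u: "u \<in> free_space (\<rho> ` deg_ge ?g (deg a))" "bvec a - u \<in> I" using span[OF a(1)] by blast
    have "\<exists>w\<in>free_space (\<rho> ` J0). u - w \<in> I"
    proof (rule extend_spanning[OF sI _ u(1)])
      fix c assume "c \<in> \<rho> ` deg_ge ?g (deg a)"
      then obtain b where "b \<in> deg_ge ?g (deg a)" and c: "c = \<rho> b" by blast
      then have b: "b \<in> deg_ge ?g 2" using a(2) unfolding deg_ge_def by simp
      then obtain w where w: "w \<in> free_space J0" "bvec b - w \<in> contract I" using J0(3) by blast
      have "bvec c - Ren w \<in> I" using w(2) b c unfolding contract_def deg_ge_def by (simp add: Ren_diff Ren_bvec)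
      then show "\<exists>w\<in>free_space (\<rho> ` J0). bvec c - w \<in> I" using Ren_free_space[OF J0g w(1)] by blast
    qed
    then obtain w where w: "w \<in> free_space (\<rho> ` J0)" "u - w \<in> I" by blast
    have "bvec a - w \<in> I" using free.subspace_add[OF sI u(2) w(2)] by simp
    then show ?thesis using w(1) by blast
  qed
  let ?B0 = "std_basis ?g J0"
  have rB0: "\<rho> ` ?B0 = insert 0 (var ` A \<union> \<rho> ` J0)" unfolding std_basis_def using varA by (simp add: image_Un)
  have ren_deg: "c \<in> deg_ge n 2" if "c \<in> \<rho> ` J0" for c
    using that J0(1) deg_ren ren_monomials unfolding deg_ge_def by auto
  have linear_res: "\<exists>u\<in>free_space (A \<inter> {..j}). \<exists>w\<in>free_space (\<rho> ` J). X j - linear_form u - w \<in> I"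
    if j: "j < n" and sp: "\<And>a. a \<in> monomials n \<Longrightarrow> 2 \<le> deg a \<Longrightarrow> \<exists>u\<in>free_space (\<rho> ` J). bvec a - u \<in> I" for j J
  proof -
    obtain u r where u: "u \<in> free_space (A \<inter> {..j})" "r \<in> free_space (deg_ge n 2)" "X j - linear_form u - r \<in> I"
      using linear[OF j] by blast
    obtain w where w: "w \<in> free_space (\<rho> ` J)" "r - w \<in> I"
      using extend_spanning[OF sI sp, of "deg_ge n 2" r] u(2) unfolding deg_ge_def by blast
    have "X j - linear_form u - w \<in> I" using free.subspace_add[OF sI u(3) w(2)] by (simp add: algebra_simps)
    then show ?thesis using u(1) w(1) by blast
  qed
  have qb0: "quotient_basis (monomials n) (\<rho> ` ?B0) I"
  proof (rule quotient_basisI[OF sI])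
    show "\<exists>u\<in>free_space (\<rho> ` ?B0). v - u \<in> I" if "v \<in> free_space (monomials n)" for v
    proof (rule extend_spanning[OF sI _ that])
      fix a assume a: "a \<in> monomials n"
      show "\<exists>u\<in>free_space (\<rho> ` ?B0). bvec a - u \<in> I"
      proof (cases "2 \<le> deg a")
        case True
        then show ?thesis using span0[OF a] free_space_mono[of "\<rho> ` J0" "\<rho> ` ?B0"] rB0 by blast
      next
        case small: False
        show ?thesis
        proof (cases "a = 0")
          case True
          then show ?thesis using rB0 free.subspace_0[OF sI] by (intro bexI[of _ "bvec 0"]) (simp_all del: single_one)
        next
          case False
          then obtain j b where jb: "j < n" "b \<in> monomials n" "a = var j + b" using monomial_split[OF a] by blast
          then have "a = var j" using small deg_eq_0_iff[of b] by simp
          moreover obtain u w where u: "u \<in> free_space (A \<inter> {..j})" "w \<in> free_space (\<rho> ` J0)" "X j - linear_form u - w \<in> I"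
            using linear_res[OF jb(1) span0] by blast
          have "linear_form u + w \<in> free_space (\<rho> ` ?B0)"
            using ext_image_free_space[OF u(1), of var] free_space_mono[of "var ` (A \<inter> {..j})" "\<rho> ` ?B0"] free_space_mono[of "\<rho> ` J0" "\<rho> ` ?B0"] u(2) rB0
            by (intro free.subspace_add[OF subspace_free_space]) (auto simp: linear_form_def)
          ultimately show ?thesis using u(3) by (intro bexI[of _ "linear_form u + w"]) (simp_all add: diff_diff_eq)
        qed
      qed
    qed
    fix u assume u: "u \<in> free_space (\<rho> ` ?B0)" "u \<in> I"
    \<comment> \<open>Otherwise \<open>u\<close> could be scaled to \<open>1 - r\<close> with
      \<open>r\<close> of positive degree.\<close>
    have "coord u 0 = 0"
    proof (rule ccontr)
      assume c: "coord u 0 \<noteq> 0"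
      let ?r = "1 - scale (1 / coord u 0) u"
      have "?r \<in> free_space (deg_ge n 1)"
        unfolding free_space_iff
      proof (intro allI impI)
        fix a assume a: "a \<notin> deg_ge n 1"
        show "coord ?r a = 0"
        proof (cases "a = 0")
          case True then show ?thesis using c by (simp add: lookup_minus lookup_one)
        next
          case False
          have "a \<notin> \<rho> ` ?B0"
          proof
            assume "a \<in> \<rho> ` ?B0"
            then have "a \<in> var ` A \<or> a \<in> \<rho> ` J0" using rB0 False by auto
            then show False using a An ren_deg[of a] unfolding deg_ge_def by auto
          qed
          then have "coord u a = 0" using u(1) unfolding free_space_iff by blast
          then show ?thesis using False by (simp add: lookup_minus lookup_one)
        qed
      qed
      from one_not_in_maximal_ideal[OF I d this] show False
        using free.subspace_scale[OF sI u(2), of "1 / coord u 0"] by simp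
    qed
    moreover have "coord u c = 0" if "c \<noteq> 0" "c \<notin> var ` A \<union> \<rho> ` J0" for c
      using u(1) that unfolding rB0 free_space_iff by simp
    ultimately have "u \<in> free_space (var ` A \<union> \<rho> ` J0)" unfolding free_space_iff by metis
    then obtain u1 where u1: "u1 \<in> free_space (var ` A)" "u - u1 \<in> free_space (\<rho> ` J0)" using free_space_split by blast
    obtain v where v: "v \<in> free_space A" "u1 = linear_form v" using free_space_image[OF u1(1)] unfolding linear_form_def by blast
    have "- (u - u1) \<in> free_space (deg_ge n 2)"
      using free.subspace_neg[OF subspace_free_space] u1(2) free_space_mono[of "\<rho> ` J0" "deg_ge n 2"] ren_deg by blast
    moreover have "linear_form v - (- (u - u1)) \<in> I" using u(2) v(2) by simp
    ultimately have "v \<in> ?V" using v(1) free_space_mono[OF An] unfolding cotangent_relations_def by blast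
    then have "v = 0" using greedy_independent[OF sV] v(1) unfolding A_def by blast
    then have "u1 = 0" using v(2) by (simp add: linear_form_def)
    then show "u = 0" using u1(2) u(2) ind0 unfolding indep_mod_def by simp
  qed
  have J0c: "J0 \<in> candidates d ?g"
  proof -
    have B0g: "?B0 \<subseteq> monomials ?g" using J0g unfolding std_basis_def by auto
    have "\<rho> ` ?B0 \<subseteq> monomials n" using B0g ren_monomials by blast
    then have "card ?B0 = d" using punctual_ideal_basis(2)[OF I _ qb0] card_image[OF inj_on_subset[OF ren_inj B0g]] by simp
    moreover have "card ?B0 = card J0 + ?g + 1"
      by (rule card_std_basis_aux) (use bound[OF J0(1,2)] J0(1) in \<open>auto simp: deg_ge_def\<close>)
    moreover have "deg b < d" if b: "b \<in> J0" for b
    proof -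
      have "\<rho> b \<in> \<rho> ` ?B0" using b unfolding std_basis_def by blast
      then have "deg (\<rho> b) < d" using punctual_ideal_basis_deg[OF I _ qb0] \<open>\<rho> ` ?B0 \<subseteq> monomials n\<close> by blast
      then show ?thesis using deg_ren J0g b by auto
    qed
    ultimately show ?thesis using J0(1) unfolding candidates_def deg_ge_def by auto
  qed
  \<comment> \<open>The definition of \<open>cell\<close> demands the candidate of least number
    among those that give a basis. It has the size of \<open>J0\<close> and is spanned by it, so it
    spans the square of the maximal ideal too.\<close>
  let ?P = "\<lambda>J. J \<in> candidates d ?g \<and> quotient_basis (monomials n) (\<rho> ` std_basis ?g J) I"
  have "\<exists>J. ?P J \<and> (\<forall>J'. ?P J' \<longrightarrow> set_key d ?g J \<le> set_key d ?g J')"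
    by (rule ex_has_least_nat[of ?P J0]) (use J0c qb0 in simp)
  then obtain J where J: "J \<in> candidates d ?g" "quotient_basis (monomials n) (\<rho> ` std_basis ?g J) I"
    "\<And>J'. ?P J' \<Longrightarrow> set_key d ?g J \<le> set_key d ?g J'" by blast
  interpret c: cell_chart n ?g A ?\<sigma> d J by (rule cell_chart_enum[OF An J(1)])
  interpret c0: cell_chart n ?g A ?\<sigma> d J0 by (rule cell_chart_enum[OF An J0c])
  interpret q: qbasis "monomials n" "\<rho> ` c.B" I unfolding qbasis_def using sI c.rB J(2) by blast
  have ind: "indep_mod (\<rho> ` J) I" by (rule q.indep_mod_subset) (auto simp: std_basis_def)
  have card_eq: "card (\<rho> ` J0) \<le> card (\<rho> ` J)" using c.card_ren_J(2) c0.card_ren_J(2) by linarith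
  have spJ: "\<exists>u\<in>free_space (\<rho> ` J). bvec a - u \<in> I" if "a \<in> \<rho> ` J0" for a
  proof (rule indep_mod_equal_card[OF sI ind c0.card_ren_J(1) card_eq _ that])
    show "\<exists>u\<in>free_space (\<rho> ` J0). bvec a - u \<in> I" if "a \<in> \<rho> ` J" for a
      using span0 c.deg_ren_J[OF that] by blast
  qed
  have spanJ: "\<exists>u\<in>free_space (\<rho> ` J). bvec a - u \<in> I" if a: "a \<in> monomials n" "2 \<le> deg a" for a
  proof -
    obtain u where u: "u \<in> free_space (\<rho> ` J0)" "bvec a - u \<in> I" using span0[OF a] by blast
    obtain w where w: "w \<in> free_space (\<rho> ` J)" "u - w \<in> I" using extend_spanning[OF sI spJ u(1)] by blast
    have "bvec a - w \<in> I" using free.subspace_add[OF sI u(2) w(2)] by simp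
    then show ?thesis using w(1) by blast
  qed
  have res_X: "\<exists>u\<in>free_space (A \<inter> {..j}). \<exists>w\<in>free_space (\<rho> ` J). res (\<rho> ` c.B) I (X j) = linear_form u + w" if j: "j < n" for j
  proof -
    obtain u w where u: "u \<in> free_space (A \<inter> {..j})" "w \<in> free_space (\<rho> ` J)" "X j - linear_form u - w \<in> I"
      using linear_res[OF j spanJ] by blast
    have "linear_form u + w \<in> free_space (\<rho> ` c.B)"
      using ext_image_free_space[OF u(1), of var] free_space_mono[of "var ` (A \<inter> {..j})" "\<rho> ` c.B"] free_space_mono[of "\<rho> ` J" "\<rho> ` c.B"] u(2) c.ren_std_basis
      by (intro free.subspace_add[OF subspace_free_space]) (auto simp: linear_form_def)
    then have "res (\<rho> ` c.B) I (X j) = linear_form u + w"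
      by (intro q.res_eqI) (use j u(3) in \<open>simp_all add: diff_diff_eq\<close>)
    then show ?thesis using u by blast
  qed
  have notJ: "c \<notin> \<rho> ` J" if "deg c < 2" for c using c.deg_ren_J[of c] that by auto
  have graded: "graded_residues n ?g \<rho> J I"
    unfolding graded_residues_def
  proof (intro ballI impI)
    fix a b assume ab: "a \<in> monomials n" "b \<in> c.B" "deg b < 2" "deg b < deg a"
    have dr: "deg (\<rho> b) = deg b" using deg_ren ab(2) c.BM by blast
    show "residue_coord (\<rho> ` c.B) a (\<rho> b) I = 0"
    proof (cases "2 \<le> deg a")
      case True
      then obtain u where u: "u \<in> free_space (\<rho> ` J)" "bvec a - u \<in> I" using spanJ[OF ab(1)] by blast
      have "u \<in> free_space (\<rho> ` c.B)" using u(1) free_space_mono[of "\<rho> ` J" "\<rho> ` c.B"] c.ren_std_basis by blast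
      then have "res (\<rho> ` c.B) I (bvec a) = u" by (intro q.res_eqI) (use u ab in simp_all)
      then show ?thesis using u(1) notJ[of "\<rho> b"] ab(3) dr unfolding residue_coord_res free_space_iff by simp
    next
      case False
      \<comment> \<open>The remaining case is the constant coefficient of a variable, which vanishes
        because the normal form is a linear form plus a combination of \<open>J\<close>.\<close>
      then have b0: "b = 0" and a1: "deg a = 1" using ab(4) deg_eq_0_iff[of b] by auto
      then have "a \<noteq> 0" by auto
      then obtain j e where je: "j < n" "e \<in> monomials n" "a = var j + e" using monomial_split[OF ab(1)] by blast
      then have aj: "a = var j" using a1 deg_eq_0_iff[of e] by simp
      obtain u w where u: "u \<in> free_space (A \<inter> {..j})" "w \<in> free_space (\<rho> ` J)" "res (\<rho> ` c.B) I (X j) = linear_form u + w"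
        using res_X[OF je(1)] by blast
      have "coord (linear_form u) 0 = 0"
      proof -
        have "deg c = 1" if "c \<in> var ` (A \<inter> {..j})" for c using that by auto
        then have "0 \<notin> var ` (A \<inter> {..j})" by fastforce
        then show ?thesis using ext_image_free_space[OF u(1), of var] unfolding linear_form_def free_space_iff by blast
      qed
      moreover have "coord w 0 = 0" using u(2) notJ[of 0] unfolding free_space_iff by simp
      ultimately show ?thesis using u(3) unfolding residue_coord_res aj b0 by (simp add: lookup_add)
    qed
  qed
  have lower: "residue_coord (\<rho> ` c.B) (var j) (var (?\<sigma> i)) I = 0" if j: "j < n" "j \<notin> A" "i < ?g" "j < ?\<sigma> i" for i j
  proof -
    obtain u w where u: "u \<in> free_space (A \<inter> {..j})" "w \<in> free_space (\<rho> ` J)" "res (\<rho> ` c.B) I (X j) = linear_form u + w"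
      using res_X[OF j(1)] by blast
    have "coord u (?\<sigma> i) = 0" using u(1) j(4) unfolding free_space_iff by simp
    moreover have "coord w (var (?\<sigma> i)) = 0" using u(2) notJ[of "var (?\<sigma> i)"] unfolding free_space_iff by simp
    ultimately show ?thesis using u(3) unfolding residue_coord_res by (simp add: lookup_add coord_linear_form)
  qed
  have "\<not> quotient_basis (monomials n) (\<rho> ` std_basis ?g J') I"
    if "J' \<in> candidates d ?g" "set_key d ?g J' < set_key d ?g J" for J'
    using J(3)[of J'] that by auto
  then have "I \<in> cell d n ?g A ?\<sigma> J"
    unfolding cell_def hdom_iff using I J(2) graded lower by blast
  then show ?thesis using An J(1) by blast
qed

section \<open>The class of the punctual Hilbert scheme\<close>

definition core_class :: "nat \<Rightarrow> nat \<Rightarrow> K0" where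
  "core_class d g = (\<Sum>J\<in>candidates d g. cls (chart_space {(core d g J, hcrd g (std_basis g J))}))"

text \<open>The cores depend on \<open>A\<close> only through its size, because contraction moves
  them to the ring in \<open>card A\<close> variables. The sum over all \<open>A\<close> of size
  \<open>g\<close> therefore collapses to a Gaussian binomial times
  \<open>core_class d g\<close>.\<close>

theorem cls_punctual_hilb:
  assumes d: "1 < d"
  shows "cls (punctual_hilb d n) = (\<Sum>g = 1..d - 1. qbinom \<bbbL> n g * \<bbbL> ^ ((n - g) * (d - 1 - g)) * core_class d g)"
proof -
  define Idx where "Idx = Sigma {A. A \<subseteq> {..<n}} (\<lambda>A. candidates d (card A))"
  define T where "T = (\<lambda>(A, J). cell d n (card A) A (enum A) J)"
  define U where "U = (\<lambda>(A, J). hdom d n (cell_basis A J))"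
  define C where "C = (\<lambda>(A, J). hcrd n (cell_basis A J))"
  let ?\<A> = "moduli_atlas (monomials n) (punctual_ideals d n)"
  have finI: "finite Idx" unfolding Idx_def by (rule finite_SigmaI) (auto simp: finite_candidates)
  have Idx: "\<exists>A J. i = (A, J) \<and> A \<subseteq> {..<n} \<and> J \<in> candidates d (card A)" if "i \<in> Idx" for i
    using that unfolding Idx_def by blast
  have basis: "cell_basis A J \<subseteq> monomials n" "\<And>a. a \<in> cell_basis A J \<Longrightarrow> deg a < d" "card (cell_basis A J) = d"
    if "A \<subseteq> {..<n}" "J \<in> candidates d (card A)" for A J
  proof -
    interpret c: cell_chart n "card A" A "enum A" d J by (rule cell_chart_enum[OF that])
    show "cell_basis A J \<subseteq> monomials n" by (rule c.rB)
    show "deg a < d" if "a \<in> cell_basis A J" for a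
      using that c.deg_ren std_basis_deg[OF c.J] c.BM by auto
    show "card (cell_basis A J) = d"
      using card_image[OF inj_on_subset[OF c.ren_inj c.BM]] card_std_basis[OF c.J] by simp
  qed
  have aff: "affine_chart (U i) (C i)" if "i \<in> Idx" for i
    using Idx[OF that] affine_hdom basis unfolding U_def C_def by force
  have UA: "(U i, C i) \<in> ?\<A>" if "i \<in> Idx" for i
    using Idx[OF that] hilb.atlasI basis(1) unfolding U_def C_def by fastforce
  have TU: "T i \<subseteq> U i" for i unfolding T_def U_def cell_def by auto
  have ord: "(i, j) \<in> cell_order d n" if "i \<in> Idx" "j \<in> Idx" "i \<noteq> j" "I \<in> T i" "I \<in> U j" for i j I
  proof -
    note prems = that
    obtain A J A' J' where *: "i = (A, J)" "A \<subseteq> {..<n}" "J \<in> candidates d (card A)"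
      "j = (A', J')" "A' \<subseteq> {..<n}" "J' \<in> candidates d (card A')"
      using Idx[OF prems(1)] Idx[OF prems(2)] by blast
    show ?thesis
      unfolding *(1,4) by (rule cell_before[OF *(2,3,5,6)]) (use prems(3-5) in \<open>simp_all add: *(1,4) T_def U_def\<close>)
  qed
  have pts: "pts (chart_space ?\<A>) = (\<Union>i\<in>Idx. T i)"
  proof
    show "(\<Union>i\<in>Idx. T i) \<subseteq> pts (chart_space ?\<A>)"
      using TU UA unfolding pts_chart_space by fastforce
    show "pts (chart_space ?\<A>) \<subseteq> (\<Union>i\<in>Idx. T i)"
    proof
      fix I assume "I \<in> pts (chart_space ?\<A>)"
      then have pI: "punctual_ideal d n I" unfolding hilb.pts_moduli using hdom_iff by blast
      then obtain A J where AJ: "A \<subseteq> {..<n}" "J \<in> candidates d (card A)" "I \<in> cell d n (card A) A (enum A) J"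
        using cell_exists[OF pI less_imp_le[OF d]] by blast
      show "I \<in> (\<Union>i\<in>Idx. T i)"
        by (rule UN_I[of "(A, J)"]) (use AJ in \<open>auto simp: Idx_def T_def\<close>)
    qed
  qed
  have var: "variety_atlas ?\<A>"
    unfolding variety_atlas_def
  proof (intro conjI hilb.compatible_moduli hilb.separated_moduli exI[of _ "(\<lambda>i. (U i, C i)) ` Idx"])
    show "(\<lambda>i. (U i, C i)) ` Idx \<subseteq> ?\<A>" using UA by blast
    show "\<Union> (fst ` (\<lambda>i. (U i, C i)) ` Idx) = \<Union> (fst ` ?\<A>)"
    proof
      show "\<Union> (fst ` (\<lambda>i. (U i, C i)) ` Idx) \<subseteq> \<Union> (fst ` ?\<A>)" using UA by (force simp: image_image)
      show "\<Union> (fst ` ?\<A>) \<subseteq> \<Union> (fst ` (\<lambda>i. (U i, C i)) ` Idx)"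
        using pts TU unfolding pts_chart_space by (fastforce simp: image_image simp del: split_paired_All split_paired_Ex)
    qed
  qed (use finI aff in auto)
  have "cls (punctual_hilb d n) = cls (chart_space ?\<A>)" by (rule cls_iso[OF punctual_hilb_atlas])
  also have "\<dots> = (\<Sum>i\<in>Idx. cls (chart_space {(T i, C i)}))"
  proof (rule cls_stratification[OF finI var UA aff TU pts _ wf_cell_order])
    show "T i \<inter> T j = {}" if ij: "i \<in> Idx" "j \<in> Idx" "i \<noteq> j" for i j
    proof (rule ccontr)
      assume "T i \<inter> T j \<noteq> {}"
      then obtain I where "I \<in> T i" "I \<in> T j" by blast
      then have "(i, j) \<in> cell_order d n" "(j, i) \<in> cell_order d n" using ord ij TU by blast+
      then show False using wf_asym[OF wf_cell_order] by blast
    qed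
  qed (use ord in blast)+
  also have "\<dots> = (\<Sum>A | A \<subseteq> {..<n}. \<Sum>J\<in>candidates d (card A). cls (chart_space {(T (A, J), C (A, J))}))"
    unfolding Idx_def by (subst sum.Sigma) (auto simp: finite_candidates)
  also have "\<dots> = (\<Sum>A | A \<subseteq> {..<n}. \<bbbL> ^ (card (inversions n A) + (n - card A) * (d - 1 - card A)) * core_class d (card A))"
  proof (rule sum.cong[OF refl])
    fix A assume "A \<in> {A. A \<subseteq> {..<n}}"
    then have "cls (chart_space {(T (A, J), C (A, J))}) = \<bbbL> ^ (card (inversions n A) + (n - card A) * (d - 1 - card A)) *
        cls (chart_space {(core d (card A) J, hcrd (card A) (std_basis (card A) J))})" if "J \<in> candidates d (card A)" for J
      using cell_chart.cls_cell[OF cell_chart_enum[of A n J d]] that unfolding T_def C_def by (simp add: mult.commute)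
    then show "(\<Sum>J\<in>candidates d (card A). cls (chart_space {(T (A, J), C (A, J))})) =
        \<bbbL> ^ (card (inversions n A) + (n - card A) * (d - 1 - card A)) * core_class d (card A)"
      unfolding core_class_def sum_distrib_left by simp
  qed
  \<comment> \<open>Sizes 0 and at least \<open>d\<close> have no candidates:
    \<open>card J + g + 1 = d\<close> excludes \<open>g \<ge> d\<close>, and for
    \<open>g = 0\<close> it makes \<open>J\<close> nonempty since \<open>d > 1\<close>, while
    without variables there is no monomial of degree 2 or more.\<close>
  also have "\<dots> = (\<Sum>A\<in>{A\<in>{A. A \<subseteq> {..<n}}. card A \<in> {1..d - 1}}. \<bbbL> ^ (card (inversions n A) + (n - card A) * (d - 1 - card A)) * core_class d (card A))"
  proof (rule sum.mono_neutral_right)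
    show "\<forall>A\<in>{A. A \<subseteq> {..<n}} - {A\<in>{A. A \<subseteq> {..<n}}. card A \<in> {1..d - 1}}.
        \<bbbL> ^ (card (inversions n A) + (n - card A) * (d - 1 - card A)) * core_class d (card A) = 0"
    proof
      fix A assume "A \<in> {A. A \<subseteq> {..<n}} - {A\<in>{A. A \<subseteq> {..<n}}. card A \<in> {1..d - 1}}"
      then have "card A = 0 \<or> d \<le> card A" by auto
      moreover have "candidates d 0 = {}"
      proof -
        have "J = {}" if "J \<in> candidates d 0" for J
        proof (rule ccontr)
          assume "J \<noteq> {}"
          then obtain a where a: "a \<in> J" by blast
          then have "a \<in> monomials 0" "2 \<le> deg a" using candidates_monomials[OF that a] by auto
          moreover have "a \<noteq> 0" using \<open>2 \<le> deg a\<close> by auto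
          ultimately show False using monomial_split[of a 0] by blast
        qed
        moreover have "{} \<notin> candidates d 0" using d by (simp add: candidates_def)
        ultimately show ?thesis by blast
      qed
      moreover have "candidates d k = {}" if "d \<le> k" for k using that unfolding candidates_def by auto
      ultimately have "candidates d (card A) = {}" by metis
      then show "\<bbbL> ^ (card (inversions n A) + (n - card A) * (d - 1 - card A)) * core_class d (card A) = 0"
        by (simp add: core_class_def)
    qed
  qed auto
  also have "\<dots> = (\<Sum>g = 1..d - 1. \<Sum>A\<in>{A\<in>{A\<in>{A. A \<subseteq> {..<n}}. card A \<in> {1..d - 1}}. card A = g}.
      \<bbbL> ^ (card (inversions n A) + (n - card A) * (d - 1 - card A)) * core_class d (card A))"
    by (rule sum.group[symmetric]) auto
  also have "\<dots> = (\<Sum>g = 1..d - 1. qbinom \<bbbL> n g * \<bbbL> ^ ((n - g) * (d - 1 - g)) * core_class d g)"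
  proof (rule sum.cong[OF refl])
    fix g assume g: "g \<in> {1..d - 1}"
    have "{A\<in>{A\<in>{A. A \<subseteq> {..<n}}. card A \<in> {1..d - 1}}. card A = g} = {A. A \<subseteq> {..<n} \<and> card A = g}" using g by auto
    then show "(\<Sum>A\<in>{A\<in>{A\<in>{A. A \<subseteq> {..<n}}. card A \<in> {1..d - 1}}. card A = g}.
        \<bbbL> ^ (card (inversions n A) + (n - card A) * (d - 1 - card A)) * core_class d (card A)) =
        qbinom \<bbbL> n g * \<bbbL> ^ ((n - g) * (d - 1 - g)) * core_class d g"
      unfolding sum_inversions[symmetric] sum_distrib_right by (simp add: power_add)
  qed
  finally show ?thesis .
qed

lemma cls_grassmannian_qbinom: "k \<le> n \<Longrightarrow> cls (grassmannian k n) = qbinom \<bbbL> n k"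
  using cls_grassmannian[of k n] sum_inversions[where n=n and k="n - k" and q="\<bbbL>"] qbinom_symmetric[where n=n and k=k and q="\<bbbL>"] by simp

theorem corollary5p4:
  fixes m d :: nat
  assumes "m \<ge> d" and "d > 1"
  shows "cls (punctual_hilb d m) =
    (\<Sum>\<gamma> = 1..d - 1. (- 1) ^ (d + \<gamma> + 1) * cls (punctual_hilb d \<gamma>) *
       cls (grassmannian (m - d) (m - \<gamma> - 1)) * cls (grassmannian \<gamma> m) * \<bbbL> ^ ((d - \<gamma>) choose 2))"
proof -
  have "cls (punctual_hilb d m) = (\<Sum>\<gamma> = 1..d - 1. (- 1) ^ (d + \<gamma> + 1) * cls (punctual_hilb d \<gamma>) *
       qbinom \<bbbL> (m - \<gamma> - 1) (m - d) * qbinom \<bbbL> m \<gamma> * \<bbbL> ^ ((d - \<gamma>) choose 2))"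
    by (rule qbinom_inversion[where P="core_class d", OF cls_punctual_hilb[OF assms(2)] assms(1)])
  also have "\<dots> = (\<Sum>\<gamma> = 1..d - 1. (- 1) ^ (d + \<gamma> + 1) * cls (punctual_hilb d \<gamma>) *
       cls (grassmannian (m - d) (m - \<gamma> - 1)) * cls (grassmannian \<gamma> m) * \<bbbL> ^ ((d - \<gamma>) choose 2))"
  proof (rule sum.cong[OF refl])
    fix \<gamma> assume "\<gamma> \<in> {1..d - 1}"
    then have "m - d \<le> m - \<gamma> - 1" "\<gamma> \<le> m" using assms by auto
    then show "(- 1) ^ (d + \<gamma> + 1) * cls (punctual_hilb d \<gamma>) *
       qbinom \<bbbL> (m - \<gamma> - 1) (m - d) * qbinom \<bbbL> m \<gamma> * \<bbbL> ^ ((d - \<gamma>) choose 2) =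
      (- 1) ^ (d + \<gamma> + 1) * cls (punctual_hilb d \<gamma>) *
       cls (grassmannian (m - d) (m - \<gamma> - 1)) * cls (grassmannian \<gamma> m) * \<bbbL> ^ ((d - \<gamma>) choose 2)"
      by (simp add: cls_grassmannian_qbinom)
  qed
  finally show ?thesis .
qed

end
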